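(* Let $\beta,\lambda$ satisfy the coefficient assumptions (i)–(iii) of the context, let $y\in\mathbb R$, and let $\Xi_T\in L^2(\mathcal F_T)$ satisfy $\Lambda_\Xi:=\int_0^T\frac{d\,\mathbb E[\Xi_t^2]}{T-t}<\infty$. For every $0<\varepsilon\le T^2/4$, the explicit strategy $Q^\varepsilon\in\mathcal Q_{\rm ac}$ defined in the context satisfies $$0\le J_0(Q^\varepsilon)-J_0(Q^0)\le C_J\bigl(\widetilde C_{\rm tr}\sqrt\varepsilon+4\Lambda_\Xi\varepsilon\bigr),$$ $$0\le J_\varepsilon(Q^\varepsilon)-V(0)\le(1+C_J)\bigl(\widetilde C_{\rm tr}\sqrt\varepsilon+4\Lambda_\Xi\varepsilon\bigr).$$ As a consequence, the value functions satisfy $$0\le V(\varepsilon)-V(0)\le(1+C_J)\bigl(\widetilde C_{\rm tr}\sqrt\varepsilon+4\Lambda_\Xi\varepsilon\bigr),$$ and in particular $V(\varepsilon)-V(0)=O(\sqrt\varepsilon)$ as $\varepsilon\downarrow0$.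
   Context: Fix $T\in(0,\infty)$ and a filtered probability space $(\Omega,\mathcal F,(\mathcal F_t)_{t\in[0,T]},\mathbb P)$ satisfying the usual conditions; $\mathcal F_{0-}$ is the augmentation of the trivial $\sigma$-field. Let $\Xi_t=\mathbb E[\Xi_T\mid\mathcal F_t]$ (càdlàg), $\Xi_{0-}=\mathbb E[\Xi_T]$. $\Lambda_\Xi$ is a Stieltjes integral with respect to the nondecreasing function $t\mapsto\mathbb E[\Xi_t^2]$ on $[0,T]$, with the convention that an atom at $T$ contributes $+\infty$. Coefficient assumptions on the deterministic functions $\beta,\lambda:[0,T]\to(0,\infty)$: (i) $\beta$ is càdlàg and of finite variation. (ii) $\lambda$ is absolutely continuous and bounded away from zero, and its a.e. derivative admits a càdlàg version $\dot\lambda$ of finite variation; $\lambda_{0-}:=\lambda_0$, $\gamma_t:=\log\lambda_t$, $\dot\gamma_t:=\dot\lambda_t/\lambda_t$. (iii) There is $c>0$ with $2\beta_t+\dot\gamma_t>c$ for all $t\in[0,T]$. Set $\eta_t=\frac{\beta_t+\dot\gamma_t}{2\beta_t+\dot\gamma_t}$, $\dot\theta_t=\frac{(\beta_t+\dot\gamma_t)^2}{\lambda_t(2\beta_t+\dot\gamma_t)}$, $\theta_t=\int_0^t\dot\theta_s\,ds$. Strategies and costs. $\mathcal Q$ is the set of càdlàg semimartingales $Q$ with $\mathbb E[\sup_{t\le T}|Q_t|^2]<\infty$, $Q_{0-}=0$, $Q_T=\Xi_T$. For $Q\in\mathcal Q$, $Y^Q$ solves $dY_t=-\beta_tY_t\,dt+\lambda_t\,dQ_t$,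 $Y_{0-}=y$. Let $$\langle Y,Z\rangle_{\mathcal H}=\mathbb E\Big[\int_0^T\tfrac{2\beta_t+\dot\gamma_t}{2\lambda_t}Y_tZ_t\,dt+\tfrac1{2\lambda_T}Y_TZ_T\Big],\qquad J_0(Q)=\langle Y^Q,Y^Q\rangle_{\mathcal H}-\tfrac{y^2}{2\lambda_0}$$ ($J_0(Q)$ equals the execution cost $\mathbb E[\int_0^TY^Q_{t-}dQ_t+\frac12[Y^Q,Q]_T]$). $\mathcal Q_{\rm ac}\subset\mathcal Q$ consists of the $Q_t=\int_0^tu_s\,ds$ with $u$ progressively measurable, $\mathbb E\int_0^Tu_t^2\,dt<\infty$ and $Q_T=\Xi_T$. For $\varepsilon>0$ and $Q\in\mathcal Q_{\rm ac}$, $J_\varepsilon(Q)=J_0(Q)+\varepsilon\,\mathbb E\int_0^T\dot Q_t^2\,dt$; $V(0)=\inf_{Q\in\mathcal Q}J_0(Q)$ and $V(\varepsilon)=\inf_{Q\in\mathcal Q_{\rm ac}}J_\varepsilon(Q)$. The unregularized optimizer. $Q^0\in\mathcal Q$ is the unique minimizer of $J_0$ over $\mathcal Q$. Explicitly, with the square-integrable martingale $$M_t=\frac{\lambda_T}{1+\lambda_T\theta_T}\Big(\Xi_0+\frac y{\lambda_0}\Big)+\int_{(0,t]}\frac{\lambda_T}{1+\lambda_T(\theta_T-\theta_s)}\,d\Xi_s,\quad t\in[0,T],$$ one has $Q^0_t=\frac{\eta_t}{\lambda_t}M_t-\frac y{\lambda_0}+\int_0^t\dot\theta_sM_s\,ds$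 for $0\le t<T$ and $Q^0_T=\Xi_T$, $Q^0_{0-}=0$. The strategy $Q^\varepsilon$. Let $\bar Q^\varepsilon_t=\frac1{\sqrt\varepsilon}\int_0^te^{-(t-r)/\sqrt\varepsilon}Q^0_r\,dr$, $0\le t<T$. Then $Q^\varepsilon_t=\bar Q^\varepsilon_t$ for $0\le t\le T-\sqrt\varepsilon$; $Q^\varepsilon_t=\frac{T-t}{\sqrt\varepsilon}\bar Q^\varepsilon_{T-\sqrt\varepsilon}+(T-t)\int_{T-\sqrt\varepsilon}^t\frac{\Xi_r}{(T-r)^2}\,dr$ for $T-\sqrt\varepsilon<t<T$; and $Q^\varepsilon_T=\Xi_T$. Constants. $C_J=C_{\mathcal H}^2L_Y^2$ with $$C_{\mathcal H}^2=\tfrac12\max\Big\{\Big\|\tfrac{2\beta+\dot\gamma}{\lambda}\Big\|_{L^\infty(0,T)},\tfrac1{\lambda_T}\Big\},\qquad L_Y=\|\lambda\|_{L^\infty(0,T)}\sqrt{2+T(T+2)\|\beta+\dot\gamma\|^2_{L^\infty(0,T)}};$$ $$\widetilde C_{\rm tr}=2\bigl(C_0+2[Q^0]^2_{\rm tr}+8K_0+10\,\mathbb E[\Xi_T^2]\bigr),$$ where $C_0=2A_\alpha^2m_2+\frac{2y^2}{\lambda_0^2}$, $A_\alpha=\|\eta/\lambda\|_{L^\infty(0,T)}$, $m_2=\mathbb E[M_T^2]$, $K_0=\sup_{t\in[0,T)}\mathbb E|Q^0_t-\Xi_t|^2$, and $[Q^0]^2_{\rm tr}=\sup_{h>0}\frac1h\,\mathbb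 E\int_0^T|Q^0_t-Q^0_{(t-h)^+}|^2\,dt$ with $(t-h)^+=\max\{t-h,0\}$. *)

theory Defs
  imports "HOL-Probability.Probability" "HOL-Probability.Essential_Supremum"
    "HOL-Library.Landau_Symbols"
begin

section \<open>Functions on a compact time interval\<close>

text \<open>All time-dependent objects live on \<open>[0,T]\<close>; they are represented by functions on the
  reals whose values outside \<open>[0,T]\<close> are irrelevant.\<close>

definition is_partition :: "real \<Rightarrow> nat \<Rightarrow> (nat \<Rightarrow> real) \<Rightarrow> bool" where
  "is_partition t n p \<longleftrightarrow> p 0 = 0 \<and> p n = t \<and> (\<forall>i<n. p i \<le> p (Suc i))"

definition cadlag_on :: "real \<Rightarrow> (real \<Rightarrow> real) \<Rightarrow> bool" where
  "cadlag_on T f \<longleftrightarrow>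
     (\<forall>t\<in>{0..<T}. (f \<longlongrightarrow> f t) (at_right t)) \<and>
     (\<forall>t\<in>{0<..T}. \<exists>l. (f \<longlongrightarrow> l) (at_left t))"

definition finite_variation_on :: "real \<Rightarrow> (real \<Rightarrow> real) \<Rightarrow> bool" where
  "finite_variation_on T f \<longleftrightarrow>
     (\<exists>B. \<forall>n p. is_partition T n p \<longrightarrow> (\<Sum>i<n. \<bar>f (p (Suc i)) - f (p i)\<bar>) \<le> B)"

definition abs_continuous_on :: "real \<Rightarrow> (real \<Rightarrow> real) \<Rightarrow> bool" where
  "abs_continuous_on T f \<longleftrightarrow>
     (\<forall>e>0. \<exists>d>0. \<forall>(n::nat) a b.
        (\<forall>i<n. 0 \<le> a i \<and> a i \<le> b i \<and> b i \<le> T) \<and>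
        disjoint_family_on (\<lambda>i. {a i<..<b i}) {..<n} \<and>
        (\<Sum>i<n. b i - a i) < d \<longrightarrow>
        (\<Sum>i<n. \<bar>f (b i) - f (a i)\<bar>) < e)"

definition Linf_norm :: "real \<Rightarrow> (real \<Rightarrow> real) \<Rightarrow> real" where
  "Linf_norm T f =
     real_of_ereal (esssup (restrict_space lborel {0<..<T}) (\<lambda>t. ereal \<bar>f t\<bar>))"

section \<open>Processes on a filtered probability space\<close>

locale filtered_prob_space = prob_space M for M :: "'a measure" +
  fixes F :: "real \<Rightarrow> 'a measure" and T :: real
  assumes T_pos: "0 < T"
    and subalgebra_F: "\<And>t. t \<in> {0..T} \<Longrightarrow> subalgebra M (F t)"
    and F_mono: "\<And>s t. 0 \<le> s \<Longrightarrow> s \<le> t \<Longrightarrow> t \<le> T \<Longrightarrow> sets (F s) \<subseteq> sets (F t)"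
    and F_right_cont: "\<And>t. t \<in> {0..<T} \<Longrightarrow> sets (F t) = (\<Inter>s\<in>{t<..T}. sets (F s))"
    and M_complete: "\<And>A N. N \<in> null_sets M \<Longrightarrow> A \<subseteq> N \<Longrightarrow> A \<in> sets M"
    and null_sets_F0: "null_sets M \<subseteq> sets (F 0)"
begin

text \<open>A process is a function of time and outcome. Cadlag means that every path is cadlag;
  under the usual conditions an almost surely cadlag adapted process can be modified on a
  null set to have this property.\<close>

definition cadlag_adapted :: "(real \<Rightarrow> 'a \<Rightarrow> real) \<Rightarrow> bool" where
  "cadlag_adapted X \<longleftrightarrow>
     (\<forall>t\<in>{0..T}. X t \<in> borel_measurable (F t)) \<and>
     (\<forall>\<omega>\<in>space M. cadlag_on T (\<lambda>t. X t \<omega>))"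

definition progressive :: "(real \<Rightarrow> 'a \<Rightarrow> real) \<Rightarrow> bool" where
  "progressive u \<longleftrightarrow>
     (\<forall>t\<in>{0..T}. (\<lambda>(s, \<omega>). u s \<omega>) \<in> borel_measurable (restrict_space borel {0..t} \<Otimes>\<^sub>M F t))"

definition martingale :: "(real \<Rightarrow> 'a \<Rightarrow> real) \<Rightarrow> bool" where
  "martingale X \<longleftrightarrow>
     (\<forall>t\<in>{0..T}. X t \<in> borel_measurable (F t) \<and> integrable M (X t)) \<and>
     (\<forall>s t. 0 \<le> s \<and> s \<le> t \<and> t \<le> T \<longrightarrow> (AE \<omega> in M. real_cond_exp M (F s) (X t) \<omega> = X s \<omega>))"

text \<open>On the closed horizon a localizing sequence reaches \<open>T\<close> after finitely many steps, almost
  surely. Values of a stopping time above \<open>T\<close> play the role of infinity.\<close>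

definition local_martingale :: "(real \<Rightarrow> 'a \<Rightarrow> real) \<Rightarrow> bool" where
  "local_martingale X \<longleftrightarrow> cadlag_adapted X \<and>
     (\<exists>\<tau> :: nat \<Rightarrow> 'a \<Rightarrow> real.
        (\<forall>n. \<forall>\<omega>\<in>space M. 0 \<le> \<tau> n \<omega> \<and> \<tau> n \<omega> \<le> \<tau> (Suc n) \<omega>) \<and>
        (\<forall>n. \<forall>t\<in>{0..T}. {\<omega>\<in>space M. \<tau> n \<omega> \<le> t} \<in> sets (F t)) \<and>
        (AE \<omega> in M. \<forall>\<^sub>F n in sequentially. T \<le> \<tau> n \<omega>) \<and>
        (\<forall>n. martingale (\<lambda>t \<omega>. X (min t (\<tau> n \<omega>)) \<omega> - X 0 \<omega>)))"

definition semimartingale :: "(real \<Rightarrow> 'a \<Rightarrow> real) \<Rightarrow> bool" where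
  "semimartingale X \<longleftrightarrow> cadlag_adapted X \<and>
     (\<exists>N A. local_martingale N \<and> cadlag_adapted A \<and>
        (\<forall>\<omega>\<in>space M. finite_variation_on T (\<lambda>t. A t \<omega>)) \<and>
        (\<forall>t\<in>{0..T}. \<forall>\<omega>\<in>space M. X t \<omega> = N t \<omega> + A t \<omega>))"

text \<open>The stochastic integral of a deterministic continuous integrand \<open>f\<close> over \<open>(0,t]\<close>: the limit
  in probability of left-endpoint Riemann sums as the mesh of the partition of \<open>[0,t]\<close> tends
  to zero. This determines the cadlag process \<open>I\<close> up to indistinguishability, and
  \<open>stoch_int f X\<close> is some version of it. A jump of \<open>X\<close> at time zero is not included.\<close>

definition is_stoch_int ::
    "(real \<Rightarrow> real) \<Rightarrow> (real \<Rightarrow> 'a \<Rightarrow> real) \<Rightarrow> (real \<Rightarrow> 'a \<Rightarrow> real) \<Rightarrow> bool" where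
  "is_stoch_int f X I \<longleftrightarrow> cadlag_adapted I \<and>
     (\<forall>t\<in>{0..T}. \<forall>e>0. \<exists>d>0. \<forall>n p.
        is_partition t n p \<and> (\<forall>i<n. p (Suc i) - p i < d) \<longrightarrow>
        prob {\<omega>\<in>space M.
          \<bar>(\<Sum>i<n. f (p i) * (X (p (Suc i)) \<omega> - X (p i) \<omega>)) - I t \<omega>\<bar> > e} < e)"

definition stoch_int ::
    "(real \<Rightarrow> real) \<Rightarrow> (real \<Rightarrow> 'a \<Rightarrow> real) \<Rightarrow> real \<Rightarrow> 'a \<Rightarrow> real" where
  "stoch_int f X = (SOME I. is_stoch_int f X I)"

end

section \<open>The execution problem\<close>

text \<open>The parameters \<open>bet\<close>, \<open>lam\<close> and \<open>lamdot\<close> are the coefficients \<open>\<beta>\<close>, \<open>\<lambda>\<close> and the cadlag version of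
  the almost everywhere derivative of \<open>\<lambda>\<close>; \<open>y\<close> is the initial state; \<open>\<Xi>\<close> is the cadlag version of
  the martingale of conditional expectations of the terminal position \<open>\<Xi> T\<close>.\<close>

locale execution_problem = filtered_prob_space M F T
  for M :: "'a measure" and F :: "real \<Rightarrow> 'a measure" and T :: real +
  fixes bet lam lamdot :: "real \<Rightarrow> real" and y :: real and \<Xi> :: "real \<Rightarrow> 'a \<Rightarrow> real"
  assumes bet_pos: "\<And>t. t \<in> {0..T} \<Longrightarrow> 0 < bet t"
    and bet_cadlag: "cadlag_on T bet"
    and bet_fv: "finite_variation_on T bet"
    and lam_ac: "abs_continuous_on T lam"
    and lam_bounded_below: "\<exists>c>0. \<forall>t\<in>{0..T}. c \<le> lam t"
    and lam_deriv: "AE t in lborel. t \<in> {0<..<T} \<longrightarrow> (lam has_real_derivative lamdot t) (at t)"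
    and lamdot_cadlag: "cadlag_on T lamdot"
    and lamdot_fv: "finite_variation_on T lamdot"
    and coercive: "\<exists>c>0. \<forall>t\<in>{0..T}. c < 2 * bet t + lamdot t / lam t"
    and Xi_L2: "integrable M (\<lambda>\<omega>. (\<Xi> T \<omega>)\<^sup>2)"
    and Xi_cadlag_adapted: "cadlag_adapted \<Xi>"
    and Xi_cond_exp: "\<And>t. t \<in> {0..T} \<Longrightarrow> AE \<omega> in M. \<Xi> t \<omega> = real_cond_exp M (F t) (\<Xi> T) \<omega>"
begin

definition gamdot :: "real \<Rightarrow> real" where
  "gamdot t = lamdot t / lam t"

definition eta :: "real \<Rightarrow> real" where
  "eta t = (bet t + gamdot t) / (2 * bet t + gamdot t)"

definition thetadot :: "real \<Rightarrow> real" where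
  "thetadot t = (bet t + gamdot t)\<^sup>2 / (lam t * (2 * bet t + gamdot t))"

definition theta :: "real \<Rightarrow> real" where
  "theta t = (LINT s:{0..t}|lborel. thetadot s)"

text \<open>The interval measure of the extension of \<open>t \<mapsto> E[\<Xi>\<^sub>t\<^sup>2]\<close> that is constant outside
  \<open>[0,T]\<close> has no mass at zero. Since the inverse of zero is infinity in \<open>ennreal\<close>, an atom at
  \<open>T\<close> contributes infinity.\<close>

definition Xi_second_moment :: "real \<Rightarrow> real" where
  "Xi_second_moment t = expectation (\<lambda>\<omega>. (\<Xi> (max 0 (min t T)) \<omega>)\<^sup>2)"

definition Lambda_Xi :: ennreal where
  "Lambda_Xi = (\<integral>\<^sup>+ t\<in>{0..T}. inverse (ennreal (T - t)) \<partial>interval_measure Xi_second_moment)"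

subsection \<open>Strategies and costs\<close>

text \<open>The value at time \<open>0-\<close> of every strategy is zero and is not part of the representation, so
  \<open>Q 0\<close> is the size of the initial jump.\<close>

definition strategies :: "(real \<Rightarrow> 'a \<Rightarrow> real) set" where
  "strategies = {Q. semimartingale Q \<and>
     (\<integral>\<^sup>+ \<omega>. (SUP t\<in>{0..T}. ennreal ((Q t \<omega>)\<^sup>2)) \<partial>M) < \<infinity> \<and>
     (AE \<omega> in M. Q T \<omega> = \<Xi> T \<omega>)}"

text \<open>The equation \<open>dY = - \<beta> Y dt + \<lambda> dQ\<close>, \<open>Y(0-) = y\<close>, in integrated form; the summand
  \<open>\<lambda>(0) Q(0)\<close> is the contribution of the jump of \<open>Q\<close> at time zero.\<close>

definition is_state :: "(real \<Rightarrow> 'a \<Rightarrow> real) \<Rightarrow> (real \<Rightarrow> 'a \<Rightarrow> real) \<Rightarrow> bool" where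
  "is_state Q Y \<longleftrightarrow> cadlag_adapted Y \<and>
     (AE \<omega> in M. \<forall>t\<in>{0..T}.
        Y t \<omega> = y - (LINT s:{0..t}|lborel. bet s * Y s \<omega>) + lam 0 * Q 0 \<omega> + stoch_int lam Q t \<omega>)"

definition state :: "(real \<Rightarrow> 'a \<Rightarrow> real) \<Rightarrow> real \<Rightarrow> 'a \<Rightarrow> real" where
  "state Q = (SOME Y. is_state Q Y)"

definition inner_H :: "(real \<Rightarrow> 'a \<Rightarrow> real) \<Rightarrow> (real \<Rightarrow> 'a \<Rightarrow> real) \<Rightarrow> real" where
  "inner_H Y Z = expectation (\<lambda>\<omega>.
     (LINT t:{0..T}|lborel. (2 * bet t + gamdot t) / (2 * lam t) * Y t \<omega> * Z t \<omega>)
     + 1 / (2 * lam T) * Y T \<omega> * Z T \<omega>)"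

definition J0 :: "(real \<Rightarrow> 'a \<Rightarrow> real) \<Rightarrow> real" where
  "J0 Q = inner_H (state Q) (state Q) - y\<^sup>2 / (2 * lam 0)"

definition is_rate :: "(real \<Rightarrow> 'a \<Rightarrow> real) \<Rightarrow> (real \<Rightarrow> 'a \<Rightarrow> real) \<Rightarrow> bool" where
  "is_rate Q u \<longleftrightarrow> progressive u \<and>
     (\<integral>\<^sup>+ \<omega>. (\<integral>\<^sup>+ t\<in>{0..T}. ennreal ((u t \<omega>)\<^sup>2) \<partial>lborel) \<partial>M) < \<infinity> \<and>
     (AE \<omega> in M. \<forall>t\<in>{0..T}. Q t \<omega> = (LINT s:{0..t}|lborel. u s \<omega>))"

definition ac_strategies :: "(real \<Rightarrow> 'a \<Rightarrow> real) set" where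
  "ac_strategies = {Q \<in> strategies. \<exists>u. is_rate Q u}"

definition rate :: "(real \<Rightarrow> 'a \<Rightarrow> real) \<Rightarrow> real \<Rightarrow> 'a \<Rightarrow> real" where
  "rate Q = (SOME u. is_rate Q u)"

definition J :: "real \<Rightarrow> (real \<Rightarrow> 'a \<Rightarrow> real) \<Rightarrow> real" where
  "J \<epsilon> Q = J0 Q + \<epsilon> * expectation (\<lambda>\<omega>. LINT t:{0..T}|lborel. (rate Q t \<omega>)\<^sup>2)"

text \<open>Both infima are taken over sets of reals bounded below by \<open>- y\<^sup>2 / (2 \<lambda>(0))\<close>.\<close>

definition V0 :: real where
  "V0 = (INF Q\<in>strategies. J0 Q)"

definition V :: "real \<Rightarrow> real" where
  "V \<epsilon> = (INF Q\<in>ac_strategies. J \<epsilon> Q)"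

subsection \<open>The optimizer of the unregularized problem and its approximation\<close>

definition opt_mart :: "real \<Rightarrow> 'a \<Rightarrow> real" where
  "opt_mart t \<omega> = lam T / (1 + lam T * theta T) * (\<Xi> 0 \<omega> + y / lam 0)
     + stoch_int (\<lambda>s. lam T / (1 + lam T * (theta T - theta s))) \<Xi> t \<omega>"

definition Qopt :: "real \<Rightarrow> 'a \<Rightarrow> real" where
  "Qopt t \<omega> =
     (if t < T
      then eta t / lam t * opt_mart t \<omega> - y / lam 0
             + (LINT s:{0..t}|lborel. thetadot s * opt_mart s \<omega>)
      else \<Xi> T \<omega>)"

definition Qbar :: "real \<Rightarrow> real \<Rightarrow> 'a \<Rightarrow> real" where
  "Qbar \<epsilon> t \<omega> =
     1 / sqrt \<epsilon> * (LINT r:{0..t}|lborel. exp (- (t - r) / sqrt \<epsilon>) * Qopt r \<omega>)"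

definition Qeps :: "real \<Rightarrow> real \<Rightarrow> 'a \<Rightarrow> real" where
  "Qeps \<epsilon> t \<omega> =
     (if t \<le> T - sqrt \<epsilon> then Qbar \<epsilon> t \<omega>
      else if t < T
      then (T - t) / sqrt \<epsilon> * Qbar \<epsilon> (T - sqrt \<epsilon>) \<omega>
             + (T - t) * (LINT r:{T - sqrt \<epsilon>..t}|lborel. \<Xi> r \<omega> / (T - r)\<^sup>2)
      else \<Xi> T \<omega>)"

subsection \<open>Constants\<close>

definition C_H_sq :: real where
  "C_H_sq = 1 / 2 * max (Linf_norm T (\<lambda>t. (2 * bet t + gamdot t) / lam t)) (1 / lam T)"

definition L_Y :: real where
  "L_Y = Linf_norm T lam * sqrt (2 + T * (T + 2) * (Linf_norm T (\<lambda>t. bet t + gamdot t))\<^sup>2)"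

definition C_J :: real where
  "C_J = C_H_sq * L_Y\<^sup>2"

definition A_alpha :: real where
  "A_alpha = Linf_norm T (\<lambda>t. eta t / lam t)"

definition m2 :: real where
  "m2 = expectation (\<lambda>\<omega>. (opt_mart T \<omega>)\<^sup>2)"

definition C_0 :: real where
  "C_0 = 2 * A_alpha\<^sup>2 * m2 + 2 * y\<^sup>2 / (lam 0)\<^sup>2"

definition K_0 :: ennreal where
  "K_0 = (SUP t\<in>{0..<T}. \<integral>\<^sup>+ \<omega>. ennreal ((Qopt t \<omega> - \<Xi> t \<omega>)\<^sup>2) \<partial>M)"

definition Qopt_tr_sq :: ennreal where
  "Qopt_tr_sq = (SUP h\<in>{0<..}.
     (\<integral>\<^sup>+ \<omega>. (\<integral>\<^sup>+ t\<in>{0..T}. ennreal ((Qopt t \<omega> - Qopt (max (t - h) 0) \<omega>)\<^sup>2) \<partial>lborel) \<partial>M)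
     / ennreal h)"

text \<open>Both suprema are finite. (If one were infinite, \<open>enn2real\<close> would map it to zero, which
  would only lower the constant.)\<close>

definition C_tr :: real where
  "C_tr = 2 * (C_0 + 2 * enn2real Qopt_tr_sq + 8 * enn2real K_0
     + 10 * expectation (\<lambda>\<omega>. (\<Xi> T \<omega>)\<^sup>2))"

end

end

theory Submission
  imports Defs
begin

text \<open>
  For deterministic integrands with bounded derivative, stochastic integrals are given path by path
  by integration by parts, so the state \<open>Y\<^sup>Q\<close> solves a linear Volterra equation with an explicit
  solution. In particular \<open>Y\<close> belonging to \<open>Q\<^sup>0\<close> is \<open>\<eta> M\<close> before \<open>T\<close> and \<open>M\<^sub>T\<close> at \<open>T\<close>. Since \<open>M\<close> is
  a martingale, this state is orthogonal in \<open>H\<close> to every difference of states with the same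
  terminal inventory. Hence \<open>J\<^sub>0(Q) - J\<^sub>0(Q\<^sup>0)\<close> is the squared \<open>H\<close>-norm of \<open>Y\<^sup>Q - Y\<close>, which is at most
  \<open>C\<^sub>J\<close> times the squared \<open>L\<^sup>2\<close>-distance of \<open>Q\<close> and \<open>Q\<^sup>0\<close>.

  Up to \<open>a = T - sqrt \<epsilon>\<close> the regularized strategy averages \<open>Q\<^sup>0\<close> over exponentially distributed
  delays, and Jensen's inequality bounds both its distance to \<open>Q\<^sup>0\<close> and its rate by the translation
  modulus of \<open>Q\<^sup>0\<close>. After \<open>a\<close> the rate is a martingale: its value at \<open>a\<close> plus
  \<open>X\<^sub>t = \<integral>\<^bsub>(a,t]\<^esub> d\<Xi>\<^sub>r / (T - r)\<close>. With \<open>\<phi>(t) = \<integral>\<^bsub>(a,t]\<^esub> dE[\<Xi>\<^sub>r\<^sup>2] / (T - r)\<close> and \<open>\<psi>(t) = E[X\<^sub>t\<^sup>2]\<close>, the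
  identity \<open>\<integral>\<^sub>a\<^sup>t \<psi>(r) dr = \<phi>(t) - (T - t) \<psi>(t) \<le> \<Lambda>\<^sub>\<Xi>\<close> controls its energy.
\<close>

section \<open>Right-continuous bounded functions\<close>

text \<open>The two regimes balance at the width \<open>d = sqrt \<epsilon>\<close>. Before
  \<open>T - d\<close> the strategy solves \<open>d * Q' = Qopt - Q\<close>, so
  \<open>\<epsilon>\<close> times the squared rate equals the squared distance to
  \<open>Qopt\<close>: one estimate of order \<open>d\<close> serves both the cost gap and the
  regularization term. Afterwards the rate is \<open>(\<Xi> - Q) / (T - t)\<close>, which enforces
  the terminal position but is singular at \<open>T\<close>. The weight \<open>1 / (T - r)\<close>
  inside \<open>Lambda_Xi\<close> bounds its energy, and the absence of an atom at \<open>T\<close>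
  makes \<open>\<Xi>\<close> left-continuous there almost surely, so that the target is reached
  without a jump. The factor \<open>T - t \<le> d\<close> turns the late rate bound into a late
  distance bound. The obstacle throughout is that states, stochastic integrals and rates are chosen
  by \<open>SOME\<close>: each is first identified, up to null sets, with an explicit path formula.
  Suprema such as \<open>K_0\<close> pass through \<open>enn2real\<close>, which sends infinity to
  zero, so their finiteness has to be established before they bound anything.\<close>

text \<open>The coefficients are only right-continuous, so differential equations are stated below with right
  derivatives, and this class replaces the continuous functions as the class of admissible integrands.\<close>

definition rcb :: "real \<Rightarrow> (real \<Rightarrow> real) \<Rightarrow> bool" where
  "rcb T f \<longleftrightarrow> (\<forall>t\<in>{0..<T}. (f \<longlongrightarrow> f t) (at_right t)) \<and> (\<exists>B. \<forall>t\<in>{0..T}. \<bar>f t\<bar> \<le> B)"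

text \<open>One-sided limits bound the function near each point, the value at the point itself being
  added by hand; \<open>Bolzano\<close> bisection passes from these local bounds to the whole
  interval.\<close>

lemma cadlag_on_bounded:
  assumes "cadlag_on T f"
  shows "\<exists>B. \<forall>t\<in>{0..T}. \<bar>f t\<bar> \<le> B"
proof (cases "0 \<le> T")
  case True
  define P where "P a b \<longleftrightarrow> (\<exists>B. \<forall>t\<in>{a..b}\<inter>{0..T}. \<bar>f t\<bar> \<le> B)" for a b
  have "P 0 T" using True
  proof (induction rule: Bolzano)
    case (trans a b c)
    then obtain B1 B2 where B: "\<And>t. t\<in>{a..b}\<inter>{0..T} \<Longrightarrow> \<bar>f t\<bar> \<le> B1"
      "\<And>t. t\<in>{b..c}\<inter>{0..T} \<Longrightarrow> \<bar>f t\<bar> \<le> B2"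
      unfolding P_def by blast
    have "\<bar>f t\<bar> \<le> max B1 B2" if "t\<in>{a..c}\<inter>{0..T}" for t
      using that B(1)[of t] B(2)[of t] by (cases "t \<le> b") (auto simp: le_max_iff_disj)
    then show ?case unfolding P_def by blast
  next
    case (local x)
    have "\<exists>d>0. \<exists>B. \<forall>t. x < t \<and> t < x + d \<and> t \<in> {0..T} \<longrightarrow> \<bar>f t\<bar> \<le> B"
    proof (cases "x < T")
      case True
      then have "(f \<longlongrightarrow> f x) (at_right x)" using assms local by (auto simp: cadlag_on_def)
      then have "eventually (\<lambda>t. dist (f t) (f x) < 1) (at_right x)" by (rule tendstoD) simp
      then obtain d where "d > x" "\<And>t. x < t \<Longrightarrow> t < d \<Longrightarrow> dist (f t) (f x) < 1"
        by (auto simp: eventually_at_right_field)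
      then show ?thesis
        by (intro exI[of _ "d - x"] conjI exI[of _ "\<bar>f x\<bar> + 1"]) (force simp: dist_real_def)+
    next
      case False then show ?thesis by (intro exI[of _ 1]) auto
    qed
    then obtain d1 B1 where 1: "d1 > 0" "\<And>t. x < t \<Longrightarrow> t < x + d1 \<Longrightarrow> t \<in> {0..T} \<Longrightarrow> \<bar>f t\<bar> \<le> B1"
      by blast
    have "\<exists>d>0. \<exists>B. \<forall>t. t < x \<and> x - d < t \<and> t \<in> {0..T} \<longrightarrow> \<bar>f t\<bar> \<le> B"
    proof (cases "0 < x")
      case True
      then obtain l where "(f \<longlongrightarrow> l) (at_left x)"
        using assms local unfolding cadlag_on_def by (metis greaterThanAtMost_iff)
      then have "eventually (\<lambda>t. dist (f t) l < 1) (at_left x)" by (rule tendstoD) simp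
      then obtain d where "d < x" "\<And>t. d < t \<Longrightarrow> t < x \<Longrightarrow> dist (f t) l < 1"
        by (auto simp: eventually_at_left_field)
      then show ?thesis
        by (intro exI[of _ "x - d"] conjI exI[of _ "\<bar>l\<bar> + 1"]) (force simp: dist_real_def)+
    next
      case False then show ?thesis by (intro exI[of _ 1]) auto
    qed
    then obtain d2 B2 where 2: "d2 > 0" "\<And>t. t < x \<Longrightarrow> x - d2 < t \<Longrightarrow> t \<in> {0..T} \<Longrightarrow> \<bar>f t\<bar> \<le> B2"
      by blast
    have "P a b" if "a \<le> x \<and> x \<le> b \<and> b - a < min d1 d2" for a b
      unfolding P_def
    proof (intro exI ballI)
      fix t assume t: "t \<in> {a..b} \<inter> {0..T}"
      have "t < x \<or> t = x \<or> t > x" by auto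
      then show "\<bar>f t\<bar> \<le> max (max B1 B2) \<bar>f x\<bar>"
        using 1(2)[of t] 2(2)[of t] t that by (auto simp: le_max_iff_disj)
    qed
    then show ?case using 1(1) 2(1) by (intro exI[of _ "min d1 d2"]) auto
  qed
  then show ?thesis unfolding P_def by auto
qed auto

lemma cadlag_on_rcb: "cadlag_on T f \<Longrightarrow> rcb T f"
  using cadlag_on_bounded[of T f] by (auto simp: rcb_def cadlag_on_def)

lemma rcb_bound:
  assumes "rcb T f" obtains B where "0 \<le> B" "\<And>t. 0 \<le> t \<Longrightarrow> t \<le> T \<Longrightarrow> \<bar>f t\<bar> \<le> B"
proof -
  from assms obtain B where "\<forall>t\<in>{0..T}. \<bar>f t\<bar> \<le> B" by (auto simp: rcb_def)
  then have "0 \<le> max B 0" "\<And>t. 0 \<le> t \<Longrightarrow> t \<le> T \<Longrightarrow> \<bar>f t\<bar> \<le> max B 0"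
    by (auto simp: le_max_iff_disj)
  then show ?thesis using that by blast
qed

lemma rcb_tendsto: "rcb T f \<Longrightarrow> 0 \<le> t \<Longrightarrow> t < T \<Longrightarrow> (f \<longlongrightarrow> f t) (at_right t)"
  by (auto simp: rcb_def)

lemma rcb_const: "rcb T (\<lambda>_. c)"
  by (auto simp: rcb_def)

lemma rcb_add: assumes "rcb T f" "rcb T g" shows "rcb T (\<lambda>t. f t + g t)"
proof -
  obtain A B where "\<And>t. 0 \<le> t \<Longrightarrow> t \<le> T \<Longrightarrow> \<bar>f t\<bar> \<le> A" "\<And>t. 0 \<le> t \<Longrightarrow> t \<le> T \<Longrightarrow> \<bar>g t\<bar> \<le> B"
    using assms by (metis rcb_bound)
  then have "\<forall>t\<in>{0..T}. \<bar>f t + g t\<bar> \<le> A + B" by (fastforce intro: order_trans[OF abs_triangle_ineq] add_mono)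
  then show ?thesis using assms by (auto simp: rcb_def intro!: tendsto_intros)
qed

lemma rcb_mult: assumes "rcb T f" "rcb T g" shows "rcb T (\<lambda>t. f t * g t)"
proof -
  obtain A B where "\<And>t. 0 \<le> t \<Longrightarrow> t \<le> T \<Longrightarrow> \<bar>f t\<bar> \<le> A" "\<And>t. 0 \<le> t \<Longrightarrow> t \<le> T \<Longrightarrow> \<bar>g t\<bar> \<le> B" "0 \<le> A" "0 \<le> B"
    using assms by (metis rcb_bound)
  then have "\<forall>t\<in>{0..T}. \<bar>f t * g t\<bar> \<le> A * B" by (auto simp: abs_mult intro!: mult_mono)
  then show ?thesis using assms by (auto simp: rcb_def intro!: tendsto_intros)
qed

lemma rcb_minus: "rcb T f \<Longrightarrow> rcb T (\<lambda>t. - f t)"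
  using rcb_mult[OF rcb_const[of T "-1"], of f] by simp

lemma rcb_diff: "rcb T f \<Longrightarrow> rcb T g \<Longrightarrow> rcb T (\<lambda>t. f t - g t)"
  using rcb_add[of T f "\<lambda>t. - g t"] rcb_minus[of T g] by simp

lemma rcb_power: "rcb T f \<Longrightarrow> rcb T (\<lambda>t. f t ^ n)"
  by (induction n) (auto intro: rcb_const rcb_mult)

lemma rcb_divide:
  assumes "rcb T f" "rcb T g" and c: "c > 0" "\<And>t. 0 \<le> t \<Longrightarrow> t \<le> T \<Longrightarrow> c \<le> g t"
  shows "rcb T (\<lambda>t. f t / g t)"
proof -
  obtain A where A: "\<And>t. 0 \<le> t \<Longrightarrow> t \<le> T \<Longrightarrow> \<bar>f t\<bar> \<le> A" "0 \<le> A"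
    using assms(1) by (metis rcb_bound)
  have "\<forall>t\<in>{0..T}. \<bar>f t / g t\<bar> \<le> A / c"
  proof
    fix t assume t: "t \<in> {0..T}"
    then have "c \<le> g t" using c by auto
    then show "\<bar>f t / g t\<bar> \<le> A / c" using A(1)[of t] t c(1) A(2)
      by (auto simp: abs_divide intro!: frac_le)
  qed
  moreover have "\<forall>t\<in>{0..<T}. ((\<lambda>t. f t / g t) \<longlongrightarrow> f t / g t) (at_right t)"
  proof
    fix t assume "t \<in> {0..<T}"
    then have "g t \<noteq> 0" using c(1) c(2)[of t] by auto
    then show "((\<lambda>t. f t / g t) \<longlongrightarrow> f t / g t) (at_right t)"
      using assms(1,2) \<open>t \<in> {0..<T}\<close> by (auto simp: rcb_def intro!: tendsto_intros)
  qed
  ultimately show ?thesis by (auto simp: rcb_def)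
qed

lemma rcb_continuous:
  assumes "continuous_on {0..T} f" shows "rcb T f"
proof -
  have "(f \<longlongrightarrow> f t) (at_right t)" if "t \<in> {0..<T}" for t
  proof -
    have "(f \<longlongrightarrow> f t) (at t within {0..T})" using assms that by (auto simp: continuous_on_def)
    then have "(f \<longlongrightarrow> f t) (at t within {t<..<T})" by (rule tendsto_within_subset) (use that in auto)
    moreover have "at t within {t<..<T} = at_right t"
      using that by (intro at_within_nhd[of _ "{..<T}"]) auto
    ultimately show ?thesis by simp
  qed
  moreover have "bounded (f ` {0..T})" using assms by (intro compact_imp_bounded compact_continuous_image) auto
  ultimately show ?thesis by (auto simp: rcb_def bounded_iff)
qed

lemma rcb_mono: "rcb T f \<Longrightarrow> T' \<le> T \<Longrightarrow> rcb T' f"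
  by (fastforce simp: rcb_def)



section \<open>Calculus with right derivatives\<close>

lemma continuous_on_Icc_at_right:
  fixes f :: "real \<Rightarrow> real"
  assumes "continuous_on {0..T} f" "0 \<le> t" "t < T"
  shows "(f \<longlongrightarrow> f t) (at_right t)"
  using rcb_tendsto[OF rcb_continuous[OF assms(1)]] assms by auto

text \<open>The mean value theorem asks for two-sided derivatives. Instead, the infimum
  \<open>s\<close> of the times at which the bound fails is examined: continuity from the left keeps
  the bound at \<open>s\<close>, and the right derivative carries it a little beyond, which
  contradicts the choice of \<open>s\<close>.\<close>

lemma right_deriv_zero_bound:
  fixes f :: "real \<Rightarrow> real"
  assumes cont: "continuous_on {0..T} f"
    and der: "\<And>t. 0 \<le> t \<Longrightarrow> t < T \<Longrightarrow> (f has_real_derivative 0) (at_right t)"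
    and e: "e > 0" and t: "0 \<le> t" "t \<le> T"
  shows "\<bar>f t - f 0\<bar> \<le> e * t"
proof (rule ccontr)
  assume neg: "\<not> \<bar>f t - f 0\<bar> \<le> e * t"
  define S where "S = {r\<in>{0..t}. e * r < \<bar>f r - f 0\<bar>}"
  have "t \<in> S" using neg t by (auto simp: S_def)
  have bdd: "bdd_below S" by (auto simp: S_def bdd_below_def)
  define s where "s = Inf S"
  have s: "0 \<le> s" "s \<le> t"
    unfolding s_def using \<open>t \<in> S\<close> bdd by (auto intro!: cInf_greatest cInf_lower simp: S_def)
  have below: "\<bar>f r - f 0\<bar> \<le> e * r" if "0 \<le> r" "r < s" for r
  proof -
    have "r \<notin> S" using that cInf_lower[OF _ bdd, of r] by (auto simp: s_def)
    then show ?thesis using that s by (auto simp: S_def)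
  qed
  have at_s: "\<bar>f s - f 0\<bar> \<le> e * s"
  proof (cases "s = 0")
    case False
    then have s0: "0 < s" using s by auto
    have c: "(f \<longlongrightarrow> f s) (at s within {0..<s})"
      using cont s t by (auto simp: continuous_on_def intro: tendsto_within_subset[of _ _ _ "{0..T}"])
    have "((\<lambda>r. e * r - \<bar>f r - f 0\<bar>) \<longlongrightarrow> e * s - \<bar>f s - f 0\<bar>) (at s within {0..<s})"
      by (intro tendsto_intros c)
    moreover have "eventually (\<lambda>r. 0 \<le> e * r - \<bar>f r - f 0\<bar>) (at s within {0..<s})"
      unfolding eventually_at_filter using below by (intro always_eventually) auto
    moreover have "at s within {0..<s} \<noteq> bot"
    proof -
      have "at s within {0..<s} = at_left s" by (rule at_within_nhd[of _ "{0<..}"]) (use s0 in auto)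
      then show ?thesis by simp
    qed
    ultimately have "0 \<le> e * s - \<bar>f s - f 0\<bar>" by (rule tendsto_lowerbound)
    then show ?thesis by simp
  qed auto
  then have "s \<noteq> t" using neg by auto
  with s have "s < t" by auto
  then have "(f has_real_derivative 0) (at_right s)" using der s t by auto
  then have "((\<lambda>r. (f r - f s) / (r - s)) \<longlongrightarrow> 0) (at_right s)"
    by (simp add: has_field_derivative_iff)
  then have "eventually (\<lambda>r. dist ((f r - f s) / (r - s)) 0 < e) (at_right s)"
    using e by (rule tendstoD)
  then obtain b where b: "b > s" "\<And>r. s < r \<Longrightarrow> r < b \<Longrightarrow> \<bar>(f r - f s) / (r - s)\<bar> < e"
    by (auto simp: eventually_at_right_field)
  have "\<exists>r\<in>S. r < b" using b(1) \<open>t \<in> S\<close> bdd cInf_lessD[of S b] by (auto simp: s_def)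
  then obtain r where r: "r \<in> S" "r < b" by auto
  have "s \<le> r" using r bdd by (auto simp: s_def intro: cInf_lower)
  moreover have "r \<noteq> s" using r at_s by (auto simp: S_def)
  ultimately have "s < r" by auto
  then have "\<bar>f r - f s\<bar> \<le> e * (r - s)" using b(2)[of r] r(2) by (auto simp: abs_divide field_simps)
  then have "\<bar>f r - f 0\<bar> \<le> e * r" using at_s by (simp add: algebra_simps)
  then show False using r by (auto simp: S_def)
qed

lemma right_deriv_zero_const:
  fixes f :: "real \<Rightarrow> real"
  assumes cont: "continuous_on {0..T} f"
    and der: "\<And>t. 0 \<le> t \<Longrightarrow> t < T \<Longrightarrow> (f has_real_derivative 0) (at_right t)"
    and t: "0 \<le> t" "t \<le> T"
  shows "f t = f 0"
proof -
  have "\<bar>f t - f 0\<bar> \<le> e" if "e > 0" for e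
  proof -
    have "\<bar>f t - f 0\<bar> \<le> e / (t + 1) * t"
      using that t by (intro right_deriv_zero_bound[OF cont der]) auto
    also have "\<dots> \<le> e" using that t by (auto simp: field_simps)
    finally show ?thesis .
  qed
  then have "\<bar>f t - f 0\<bar> \<le> 0" by (rule field_le_epsilon) auto
  then show ?thesis by simp
qed

text \<open>The process is sampled at the next grid point to the right, which leaves countably many
  sampling times and hence joint measurability; right-continuity gives the limit. All sampled times
  stay in \<open>[0,t]\<close>, so \<open>N = F t\<close> yields progressive measurability.\<close>

lemma rc_pair_measurable:
  fixes X :: "real \<Rightarrow> 'a \<Rightarrow> real"
  assumes t: "0 \<le> t" and meas: "\<And>s. 0 \<le> s \<Longrightarrow> s \<le> t \<Longrightarrow> X s \<in> borel_measurable N"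
    and rc: "\<And>s \<omega>. 0 \<le> s \<Longrightarrow> s < t \<Longrightarrow> \<omega> \<in> space N \<Longrightarrow> ((\<lambda>s. X s \<omega>) \<longlongrightarrow> X s \<omega>) (at_right s)"
  shows "(\<lambda>(s, \<omega>). X s \<omega>) \<in> borel_measurable (restrict_space borel {0..t} \<Otimes>\<^sub>M N)"
proof -
  \<comment> \<open>The \<open>+ 1\<close> puts the sampled time strictly after \<open>s\<close>, as
    a right limit requires; the cap \<open>min t\<close> never looks beyond \<open>t\<close> and
    makes the approximation exact at \<open>s = t\<close>.\<close>
  define a where "a n s = min t ((real (nat \<lfloor>real n * s\<rfloor>) + 1) / real n)" for n :: nat and s :: real
  have meas_a: "(\<lambda>(s, \<omega>). X (a (Suc n) s) \<omega>) \<in> borel_measurable (restrict_space borel {0..t} \<Otimes>\<^sub>M N)" for n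
  proof -
    have "(\<lambda>z. (\<lambda>(k::nat) z. X (min t ((real k + 1) / real (Suc n))) (snd z)) (nat \<lfloor>real (Suc n) * fst z\<rfloor>) z)
      \<in> borel_measurable (restrict_space borel {0..t} \<Otimes>\<^sub>M N)"
    proof (rule measurable_compose_countable[where f = "\<lambda>(k::nat) z. X (min t ((real k + 1) / real (Suc n))) (snd z)"
          and g = "\<lambda>z. nat \<lfloor>real (Suc n) * fst z\<rfloor>"])
      fix k :: nat
      have [measurable]: "X (min t ((real k + 1) / real (Suc n))) \<in> borel_measurable N"
        using t by (intro meas) auto
      show "(\<lambda>z. X (min t ((real k + 1) / real (Suc n))) (snd z)) \<in> borel_measurable (restrict_space borel {0..t} \<Otimes>\<^sub>M N)"
        by measurable
    next
      have [measurable]: "(\<lambda>s. s) \<in> borel_measurable (restrict_space borel {0..t})"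
        by (rule measurable_restrict_space1) simp
      show "(\<lambda>z. nat \<lfloor>real (Suc n) * fst z\<rfloor>) \<in> measurable (restrict_space borel {0..t} \<Otimes>\<^sub>M N) (count_space UNIV)"
        by measurable
    qed
    then show ?thesis by (simp add: a_def case_prod_beta)
  qed
  show ?thesis
  proof (rule borel_measurable_LIMSEQ_metric[OF meas_a])
    fix z :: "real \<times> 'a" assume "z \<in> space (restrict_space borel {0..t} \<Otimes>\<^sub>M N)"
    then obtain s \<omega> where z: "z = (s, \<omega>)" "0 \<le> s" "s \<le> t" "\<omega> \<in> space N"
      by (auto simp: space_pair_measure space_restrict_space)
    have up: "s < (real (nat \<lfloor>real (Suc n) * s\<rfloor>) + 1) / real (Suc n)" for n
      using z by (simp add: field_simps del: of_nat_Suc) linarith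
    have lo: "(real (nat \<lfloor>real (Suc n) * s\<rfloor>) + 1) / real (Suc n) \<le> s + 1 / real (Suc n)" for n
      using z by (simp add: field_simps del: of_nat_Suc)
    have "(\<lambda>n. X (a (Suc n) s) \<omega>) \<longlonglongrightarrow> X s \<omega>"
    proof (cases "s < t")
      case True
      have gt: "s < a (Suc n) s" for n unfolding a_def using True up by auto
      have lim: "(\<lambda>n. a (Suc n) s) \<longlonglongrightarrow> s"
      proof (rule tendsto_sandwich[where f = "\<lambda>_. s" and h = "\<lambda>n. s + 1 / real (Suc n)"])
        show "(\<lambda>n. s + 1 / real (Suc n)) \<longlonglongrightarrow> s"
          using tendsto_add[OF tendsto_const LIMSEQ_inverse_real_of_nat, of s] by (simp add: inverse_eq_divide)
        show "eventually (\<lambda>n. s \<le> a (Suc n) s) sequentially" using gt by (auto intro!: always_eventually less_imp_le)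
        show "eventually (\<lambda>n. a (Suc n) s \<le> s + 1 / real (Suc n)) sequentially"
          using lo unfolding a_def by (intro always_eventually allI min.coboundedI2)
      qed auto
      have "filterlim (\<lambda>n. a (Suc n) s) (at_right s) sequentially"
        unfolding filterlim_at using gt lim by (simp add: less_imp_neq[THEN not_sym])
      then show ?thesis by (rule filterlim_compose[OF rc[OF z(2) True z(4)]])
    next
      case False
      then have "s = t" using z by simp
      have "a (Suc n) s = s" for n
        unfolding a_def using less_imp_le[OF up[of n]] unfolding \<open>s = t\<close> by (rule min_absorb1)
      then show ?thesis by simp
    qed
    then show "(\<lambda>n. case z of (s, \<omega>) \<Rightarrow> X (a (Suc n) s) \<omega>) \<longlonglongrightarrow> (case z of (s, \<omega>) \<Rightarrow> X s \<omega>)"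
      using z by simp
  qed
qed

text \<open>The process lemma, applied to a one-point sample space.\<close>

lemma rcb_measurable:
  assumes "rcb T f" "0 \<le> T"
  shows "f \<in> borel_measurable (restrict_space borel {0..T})"
proof -
  have 1: "(\<lambda>(s, \<omega>::unit). f s) \<in> borel_measurable (restrict_space borel {0..T} \<Otimes>\<^sub>M count_space UNIV)"
    using assms by (intro rc_pair_measurable) (auto simp: rcb_def)
  have 2: "(\<lambda>s. (s, ())) \<in> measurable (restrict_space borel {0..T}) (restrict_space borel {0..T} \<Otimes>\<^sub>M count_space UNIV)"
    by measurable
  show ?thesis using measurable_comp[OF 2 1] by (simp add: comp_def)
qed

lemma rcb_set_measurable:
  assumes "rcb T f" "0 \<le> T" "t \<le> T" "0 \<le> s"
  shows "set_borel_measurable lborel {s..t} f"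
proof -
  have "set_borel_measurable borel {0..T} f"
    using rcb_measurable[OF assms(1,2)]
    by (simp add: borel_measurable_restrict_space_iff set_borel_measurable_def mult.commute)
  then have "set_borel_measurable borel {s..t} f"
    by (rule set_borel_measurable_subset) (use assms in auto)
  then show ?thesis by (simp add: set_borel_measurable_def)
qed

lemma rcb_integrable:
  assumes f: "rcb T f" and "0 \<le> T" "t \<le> T" "0 \<le> s"
  shows "set_integrable lborel {s..t} f"
proof -
  obtain B where B: "\<And>t. 0 \<le> t \<Longrightarrow> t \<le> T \<Longrightarrow> \<bar>f t\<bar> \<le> B" "0 \<le> B" using rcb_bound[OF f] by metis
  have "set_integrable lborel {s..t} (\<lambda>_. B)"
    unfolding set_integrable_def by (intro integrable_scaleR_left) (auto simp: integrable_indicator_iff emeasure_lborel_Icc_eq)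
  then show ?thesis
    by (rule set_integrable_bound) (use B assms in \<open>auto simp: rcb_set_measurable[OF assms] intro!: AE_I2\<close>)
qed

section \<open>Integrals with variable endpoints and their right derivatives\<close>

lemma set_integral_Icc_split:
  fixes f :: "real \<Rightarrow> real"
  assumes "set_integrable lborel {0..t} f" "0 \<le> s" "s \<le> t"
  shows "(LINT r:{0..t}|lborel. f r) = (LINT r:{0..s}|lborel. f r) + (LINT r:{s<..t}|lborel. f r)"
proof -
  have "{0..t} = {0..s} \<union> {s<..t}" using assms by auto
  moreover have "set_integrable lborel {0..s} f" "set_integrable lborel {s<..t} f"
    using assms by (auto intro: set_integrable_subset[OF assms(1)])
  ultimately show ?thesis
    using set_integral_Un[of "{0..s}" "{s<..t}" lborel f] by (simp add: disjoint_iff)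
qed

lemma set_integral_Icc_diff:
  fixes f :: "real \<Rightarrow> real"
  assumes "set_integrable lborel {0..t} f" "0 \<le> s" "s \<le> t"
  shows "(LINT r:{s..t}|lborel. f r) = (LINT r:{0..t}|lborel. f r) - (LINT r:{0..s}|lborel. f r)"
proof -
  have "(LINT r:{s..t}|lborel. f r) = (LINT r:{s<..t}|lborel. f r)"
    unfolding set_lebesgue_integral_def
  proof (rule integral_cong_AE)
    have "set_borel_measurable lborel {0..t} f"
      using assms(1) unfolding set_integrable_def set_borel_measurable_def by auto
    then have m: "set_borel_measurable borel {0..t} f" by (simp add: set_borel_measurable_def)
    have "set_borel_measurable borel {s..t} f" "set_borel_measurable borel {s<..t} f"
      by (rule set_borel_measurable_subset[OF m]; use assms in auto)+
    then show "(\<lambda>x. indicat_real {s..t} x *\<^sub>R f x) \<in> borel_measurable lborel"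
      "(\<lambda>x. indicat_real {s<..t} x *\<^sub>R f x) \<in> borel_measurable lborel"
      by (auto simp: set_borel_measurable_def)
    show "AE x in lborel. indicat_real {s..t} x *\<^sub>R f x = indicat_real {s<..t} x *\<^sub>R f x"
      using AE_lborel_singleton[of s] by eventually_elim (auto simp: indicator_def)
  qed
  then show ?thesis using set_integral_Icc_split[OF assms] by simp
qed

lemma set_integral_Ioc_const: "s \<le> t \<Longrightarrow> (LINT r:{s<..t}|lborel. c) = c * (t - s :: real)"
  by (simp add: set_lebesgue_integral_def)

lemma set_integral_Ioc_bound:
  fixes f :: "real \<Rightarrow> real"
  assumes "set_integrable lborel {s<..t} f" "s \<le> t" "\<And>r. s < r \<Longrightarrow> r \<le> t \<Longrightarrow> \<bar>f r\<bar> \<le> B"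
  shows "\<bar>LINT r:{s<..t}|lborel. f r\<bar> \<le> B * (t - s)"
proof -
  have "\<bar>LINT r:{s<..t}|lborel. f r\<bar> \<le> (LINT r:{s<..t}|lborel. \<bar>f r\<bar>)"
    using set_integral_norm_bound[OF assms(1)] by simp
  also have "\<dots> \<le> (LINT r:{s<..t}|lborel. B)"
    using assms by (intro set_integral_mono set_integrable_abs)
      (auto simp: set_integrable_def intro!: integrable_scaleR_left)
  also have "\<dots> = B * (t - s)" using assms by (simp add: set_integral_Ioc_const)
  finally show ?thesis .
qed

lemma rcb_integral_diff_bound:
  assumes f: "rcb T f" and T: "0 \<le> T" and B: "\<And>t. 0 \<le> t \<Longrightarrow> t \<le> T \<Longrightarrow> \<bar>f t\<bar> \<le> B"
    and st: "0 \<le> s" "s \<le> t" "t \<le> T"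
  shows "\<bar>(LINT r:{0..t}|lborel. f r) - (LINT r:{0..s}|lborel. f r)\<bar> \<le> B * (t - s)"
proof -
  have i: "set_integrable lborel {0..t} f" using rcb_integrable f T st by auto
  have "set_integrable lborel {s<..t} f" by (rule set_integrable_subset[OF i]) (use st in auto)
  then have "\<bar>LINT r:{s<..t}|lborel. f r\<bar> \<le> B * (t - s)" 
    using st B by (intro set_integral_Ioc_bound) auto
  then show ?thesis using set_integral_Icc_split[OF i st(1,2)] by simp
qed

lemma rcb_integral_continuous:
  assumes f: "rcb T f" and T: "0 \<le> T"
  shows "continuous_on {0..T} (\<lambda>t. LINT r:{0..t}|lborel. f r)"
proof -
  obtain B where B: "\<And>t. 0 \<le> t \<Longrightarrow> t \<le> T \<Longrightarrow> \<bar>f t\<bar> \<le> B" "0 \<le> B" using rcb_bound[OF f] by metis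
  have "B-lipschitz_on {0..T} (\<lambda>t. LINT r:{0..t}|lborel. f r)"
  proof (rule lipschitz_onI)
    fix s t assume st: "s \<in> {0..T}" "t \<in> {0..T}"
    show "dist (LINT r:{0..s}|lborel. f r) (LINT r:{0..t}|lborel. f r) \<le> B * dist s t"
      using rcb_integral_diff_bound[OF f T B(1), of s t] rcb_integral_diff_bound[OF f T B(1), of t s] st
      by (cases "s \<le> t") (auto simp: dist_real_def abs_minus_commute)
  qed (use B in auto)
  then show ?thesis by (rule lipschitz_on_continuous_on)
qed

lemma rcb_integral: "rcb T f \<Longrightarrow> 0 \<le> T \<Longrightarrow> rcb T (\<lambda>t. LINT r:{0..t}|lborel. f r)"
  by (rule rcb_continuous, rule rcb_integral_continuous)

lemma rcb_integral_right_deriv: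
  assumes f: "rcb T f" and st: "0 \<le> s" "s < T"
  shows "((\<lambda>t. LINT r:{0..t}|lborel. f r) has_real_derivative f s) (at_right s)"
  unfolding has_field_derivative_iff
proof (rule tendstoI)
  fix e :: real assume e: "e > 0"
  have "eventually (\<lambda>t. dist (f t) (f s) < e / 2) (at_right s)"
    using e by (intro tendstoD[OF rcb_tendsto[OF f st]]) auto
  then obtain b where b: "b > s" "\<And>t. s < t \<Longrightarrow> t < b \<Longrightarrow> dist (f t) (f s) < e / 2"
    by (auto simp: eventually_at_right_field)
  have "dist (((LINT r:{0..t}|lborel. f r) - (LINT r:{0..s}|lborel. f r)) / (t - s)) (f s) < e"
    if t: "s < t" "t < min b T" for t
  proof -
    have i: "set_integrable lborel {0..t} f" using rcb_integrable f t st by auto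
    have i2: "set_integrable lborel {s<..t} f" by (rule set_integrable_subset[OF i]) (use st in auto)
    have c: "set_integrable lborel {s<..t} (\<lambda>_. f s)"
      unfolding set_integrable_def using t by (intro integrable_scaleR_left) auto
    have "\<bar>LINT r:{s<..t}|lborel. (f r - f s)\<bar> \<le> e / 2 * (t - s)"
      using b t by (intro set_integral_Ioc_bound set_integral_diff i2 c) (auto simp: dist_real_def less_imp_le)
    then have "\<bar>(LINT r:{0..t}|lborel. f r) - (LINT r:{0..s}|lborel. f r) - f s * (t - s)\<bar> \<le> e / 2 * (t - s)"
      using set_integral_Icc_split[OF i st(1), of] t i2 c by (simp add: set_integral_Ioc_const set_integral_diff)
    then have "\<bar>((LINT r:{0..t}|lborel. f r) - (LINT r:{0..s}|lborel. f r)) / (t - s) - f s\<bar> \<le> e / 2"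
      using t by (simp add: divide_diff_eq_iff abs_divide pos_divide_le_eq)
    then show ?thesis using e by (simp add: dist_real_def)
  qed
  then show "eventually (\<lambda>t. dist (((LINT r:{0..t}|lborel. f r) - (LINT r:{0..s}|lborel. f r)) / (t - s)) (f s) < e) (at_right s)"
    unfolding eventually_at_right_field using b st by (intro exI[of _ "min b T"]) auto
qed

lemma set_integral_Icc_self: "(LINT r:{a..a::real}|lborel. f r) = (0::real)"
proof -
  have "AE r in lborel. indicat_real {a..a} r *\<^sub>R f r = 0"
    using AE_lborel_singleton[of a] by eventually_elim (auto simp: indicator_def)
  then show ?thesis unfolding set_lebesgue_integral_def by (rule integral_eq_zero_AE)
qed

text \<open>\<open>F\<close> minus the integral of \<open>f\<close> has vanishing right derivative.
  This takes the place of the usual fundamental theorem for integrands that are only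
  right-continuous; the explicit solutions below are verified with it.\<close>

lemma right_deriv_FTC:
  assumes cont: "continuous_on {0..T} F" and f: "rcb T f"
    and der: "\<And>t. 0 \<le> t \<Longrightarrow> t < T \<Longrightarrow> (F has_real_derivative f t) (at_right t)"
    and t: "0 \<le> t" "t \<le> T"
  shows "F t = F 0 + (LINT r:{0..t}|lborel. f r)"
proof -
  have T: "0 \<le> T" using t by auto
  have "F t - (LINT r:{0..t}|lborel. f r) = F 0 - (LINT r:{0..0}|lborel. f r)"
  proof (rule right_deriv_zero_const[where T=T])
    show "continuous_on {0..T} (\<lambda>t. F t - (LINT r:{0..t}|lborel. f r))"
      by (intro continuous_intros cont rcb_integral_continuous f T)
    show "((\<lambda>t. F t - (LINT r:{0..t}|lborel. f r)) has_real_derivative 0) (at_right t)" if "0 \<le> t" "t < T" for t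
      using DERIV_diff[OF der[OF that] rcb_integral_right_deriv[OF f that]] by simp
  qed (use t in auto)
  then show ?thesis using set_integral_Icc_self[of 0 f] by simp
qed

section \<open>Absolutely continuous functions, finite variation and Riemann sums\<close>

text \<open>The derivative exists only off a null set. Absolute continuity controls the intervals of a tagged
  division whose tags lie in that null set, once the gauge confines them to an open set of small
  measure; this yields the Henstock--Kurzweil integral.\<close>

lemma abs_continuous_has_integral:
  assumes ac: "abs_continuous_on T f"
    and der: "AE t in lborel. t \<in> {0<..<T} \<longrightarrow> (f has_real_derivative f' t) (at t)"
    and B: "\<And>t. 0 \<le> t \<Longrightarrow> t \<le> T \<Longrightarrow> \<bar>f' t\<bar> \<le> B"
    and t: "0 \<le> t" "t \<le> T"
  shows "(f' has_integral (f t - f 0)) {0..t}"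
proof -
  have B0: "0 \<le> B" using B[of t] t by auto
  obtain N' where N'0: "{x \<in> space lborel. \<not> (x \<in> {0<..<T} \<longrightarrow> (f has_real_derivative f' x) (at x))} \<subseteq> N'"
    and N'1: "N' \<in> null_sets lborel"
    using der unfolding eventually_ae_filter by blast
  have N': "x \<in> {0<..<T} \<longrightarrow> (f has_real_derivative f' x) (at x)" if "x \<notin> N'" for x
    using N'0 that by auto
  \<comment> \<open>The derivative is assumed only inside \<open>(0,T)\<close>; adding the two
    endpoints to the exceptional set makes it available at every other tag.\<close>
  define N where "N = N' \<union> {0, t}"
  have N: "N \<in> null_sets lborel" unfolding N_def
    by (rule null_sets.Un[OF N'1 finite_imp_null_set_lborel]) simp
  have der': "(f has_real_derivative f' x) (at x)" if "x \<notin> N" "0 \<le> x" "x \<le> t" for x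
    using N'[of x] that t by (auto simp: N_def)
  show ?thesis unfolding has_integral[of f' "f t - f 0" 0 t, unfolded box_real]
  proof (intro allI impI)
    fix e0 :: real assume "e0 > 0"
    \<comment> \<open>The tags off \<open>N\<close> cost at most \<open>e * t\<close>, those in
      \<open>N\<close> at most \<open>B * e + e\<close>; one further \<open>e\<close> makes the
      final inequality strict.\<close>
    define e where "e = e0 / (t + B + 2)"
    have e: "e > 0" using \<open>e0 > 0\<close> B0 t by (auto simp: e_def)
    obtain d where d0: "d > 0" and d1: "\<And>(n::nat) a b. (\<forall>i<n. 0 \<le> a i \<and> a i \<le> b i \<and> b i \<le> T) \<and>
        disjoint_family_on (\<lambda>i. {a i<..<b i}) {..<n} \<and> (\<Sum>i<n. b i - a i) < d \<longrightarrow>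
        (\<Sum>i<n. \<bar>f (b i) - f (a i)\<bar>) < e"
      using ac[unfolded abs_continuous_on_def, rule_format, OF e] by (elim exE conjE) (rule that, assumption, elim allE)
    \<comment> \<open>The total length of the intervals tagged in \<open>N\<close> must stay below
      \<open>d\<close> for absolute continuity and below \<open>e\<close> to absorb the bounded
      derivative.\<close>
    define d' where "d' = min d e"
    have d': "d' > 0" "d' \<le> d" "d' \<le> e" using d0 e by (auto simp: d'_def)
    obtain U where U: "open U" "N \<subseteq> U" "emeasure lborel (U - N) < ennreal d'"
      by (rule outer_regular_lborel[of N d']) (use N d' in auto)
    have U': "emeasure lborel U < ennreal d'"
    proof -
      have "emeasure lborel U = emeasure lborel ((U - N) \<union> N)" using U by (auto intro!: arg_cong[of _ _ "emeasure lborel"])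
      also have "\<dots> = emeasure lborel (U - N)" using U N by (intro emeasure_Un_null_set) auto
      finally show ?thesis using U by simp
    qed
    \<comment> \<open>Straddle estimate: differentiability at a tag controls the increment over
      every small interval that contains the tag, not only over those that start at it.\<close>
    have "\<exists>\<delta>>0. \<forall>u v. u \<le> x \<and> x \<le> v \<and> u \<in> ball x \<delta> \<and> v \<in> ball x \<delta> \<longrightarrow> \<bar>f' x * (v - u) - (f v - f u)\<bar> \<le> e * (v - u)"
      if x: "x \<notin> N" "0 \<le> x" "x \<le> t" for x
    proof -
      have "(f has_derivative (*) (f' x)) (at x)" using der'[OF x] by (simp add: has_field_derivative_def)
      then obtain \<delta> where \<delta>: "\<delta> > 0" "\<And>y. \<bar>y - x\<bar> < \<delta> \<Longrightarrow> \<bar>f y - f x - f' x * (y - x)\<bar> \<le> e * \<bar>y - x\<bar>"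
        using e unfolding has_derivative_at_alt by (auto simp: real_norm_def)
      show ?thesis
      proof (intro exI[of _ \<delta>] conjI allI impI)
        fix u v assume uv: "u \<le> x \<and> x \<le> v \<and> u \<in> ball x \<delta> \<and> v \<in> ball x \<delta>"
        have "\<bar>f' x * (v - u) - (f v - f u)\<bar> = \<bar>(f u - f x - f' x * (u - x)) - (f v - f x - f' x * (v - x))\<bar>"
          by (simp add: algebra_simps)
        also have "\<dots> \<le> e * \<bar>u - x\<bar> + e * \<bar>v - x\<bar>"
          using uv by (intro order_trans[OF abs_triangle_ineq4 add_mono[OF \<delta>(2) \<delta>(2)]]) (auto simp: dist_real_def)
        also have "\<dots> = e * (v - u)" using uv by (auto simp: algebra_simps)
        finally show "\<bar>f' x * (v - u) - (f v - f u)\<bar> \<le> e * (v - u)" .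
      qed fact
    qed
    then obtain \<delta> where \<delta>: "\<And>x. x \<notin> N \<Longrightarrow> 0 \<le> x \<Longrightarrow> x \<le> t \<Longrightarrow> \<delta> x > 0 \<and>
        (\<forall>u v. u \<le> x \<and> x \<le> v \<and> u \<in> ball x (\<delta> x) \<and> v \<in> ball x (\<delta> x) \<longrightarrow> \<bar>f' x * (v - u) - (f v - f u)\<bar> \<le> e * (v - u))"
      by metis
    define g where "g x = (if x \<in> N then U else if 0 \<le> x \<and> x \<le> t then ball x (\<delta> x) else ball x 1)" for x
    have gauge: "gauge g"
      unfolding gauge_def g_def using U \<delta> by auto
    show "\<exists>\<gamma>. gauge \<gamma> \<and> (\<forall>\<D>. \<D> tagged_division_of {0..t} \<and> \<gamma> fine \<D> \<longrightarrow>
        norm ((\<Sum>(x, k)\<in>\<D>. measure lborel k *\<^sub>R f' x) - (f t - f 0)) < e0)"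
    proof (intro exI[of _ g] conjI allI impI)
      show "gauge g" by (rule gauge)
    next
      fix D assume D: "D tagged_division_of {0..t} \<and> g fine D"
      then have td: "D tagged_division_of {0..t}" and fine: "g fine D" by auto
      have fin: "finite D" using td by auto
      have kk: "\<exists>u v. k = {u..v} \<and> u \<le> x \<and> x \<le> v \<and> 0 \<le> u \<and> v \<le> t" if xk: "(x, k) \<in> D" for x k
      proof -
        obtain u v where k: "k = {u..v}" using tagged_division_ofD(4)[OF td xk] by auto
        moreover have "x \<in> k" "k \<subseteq> {0..t}" using tagged_division_ofD(2,3)[OF td xk] by auto
        ultimately show ?thesis by (intro exI[of _ u] exI[of _ v]) auto
      qed
      define \<phi> where "\<phi> = (\<lambda>(x::real, k::real set). measure lborel k *\<^sub>R f' x - (f (Sup k) - f (Inf k)))"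
      have sum_eq: "(\<Sum>(x, k)\<in>D. measure lborel k *\<^sub>R f' x) - (f t - f 0) = (\<Sum>z\<in>D. \<phi> z)"
        using additive_tagged_division_1[OF t(1) td, of f] by (simp add: \<phi>_def sum_subtractf case_prod_beta)
      define Db where "Db = {z \<in> D. fst z \<in> N}"
      have finb: "finite Db" using fin by (simp add: Db_def)
      have good: "\<bar>\<phi> z\<bar> \<le> e * measure lborel (snd z)" if z: "z \<in> D - Db" for z
      proof -
        obtain x k where zz: "z = (x, k)" by (cases z)
        then have x: "(x, k) \<in> D" "x \<notin> N" using z by (auto simp: Db_def)
        obtain u v where uv: "k = {u..v}" "u \<le> x" "x \<le> v" "0 \<le> u" "v \<le> t" using kk[OF x(1)] by blast
        have "k \<subseteq> g x" using fine x by (auto simp: fine_def)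
        then have "u \<in> ball x (\<delta> x)" "v \<in> ball x (\<delta> x)" 
          using uv x subsetD[of "{u..v}" "g x" u] subsetD[of "{u..v}" "g x" v] by (simp_all add: g_def)
        then have "\<bar>f' x * (v - u) - (f v - f u)\<bar> \<le> e * (v - u)" using \<delta>[of x] x uv by auto
        then show ?thesis using uv zz by (simp add: \<phi>_def mult.commute)
      qed
      have "(\<Sum>z\<in>D - Db. \<bar>\<phi> z\<bar>) \<le> (\<Sum>z\<in>D - Db. e * measure lborel (snd z))" using good by (intro sum_mono)
      also have "\<dots> \<le> (\<Sum>z\<in>D. e * measure lborel (snd z))" using fin e by (intro sum_mono2) auto
      also have "\<dots> = e * t"
        using additive_content_tagged_division[of D 0 t] td t by (simp add: sum_distrib_left[symmetric] case_prod_beta)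
      finally have goodsum: "(\<Sum>z\<in>D - Db. \<bar>\<phi> z\<bar>) \<le> e * t" .
      \<comment> \<open>\<open>abs_continuous_on\<close> speaks of intervals indexed by an initial
        segment of the naturals, so the tags in \<open>N\<close> are enumerated.\<close>
      obtain h where h: "bij_betw h {0..<card Db} Db" using ex_bij_betw_nat_finite[OF finb] by blast
      have hD: "h i \<in> Db" if "i < card Db" for i using h that by (auto simp: bij_betw_def)
      define a b where "a i = Inf (snd (h i))" and "b i = Sup (snd (h i))" for i
      have ab: "snd (h i) = {a i..b i} \<and> a i \<le> b i \<and> 0 \<le> a i \<and> b i \<le> t" "a i \<in> U \<and> {a i<..<b i} \<subseteq> U"
        if i: "i < card Db" for i
      proof -
        obtain x k where zz: "h i = (x, k)" by (cases "h i")
        have x: "(x, k) \<in> D" "x \<in> N" using hD[OF i] zz by (auto simp: Db_def)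
        obtain u v where uv: "k = {u..v}" "u \<le> x" "x \<le> v" "0 \<le> u" "v \<le> t" using kk[OF x(1)] by blast
        have "k \<subseteq> U" using fine[unfolded fine_def, rule_format, OF x(1)] x(2) by (simp add: g_def)
        then show "snd (h i) = {a i..b i} \<and> a i \<le> b i \<and> 0 \<le> a i \<and> b i \<le> t" "a i \<in> U \<and> {a i<..<b i} \<subseteq> U"
          using uv zz by (auto simp: a_def b_def)
      qed
      have disj: "disjoint_family_on (\<lambda>i. {a i<..<b i}) {..<card Db}"
        unfolding disjoint_family_on_def
      proof (intro ballI impI)
        fix i j assume ij: "i \<in> {..<card Db}" "j \<in> {..<card Db}" "i \<noteq> j"
        have "h i \<noteq> h j" using ij h by (auto simp: bij_betw_def inj_on_def)
        moreover have "h i \<in> D" "h j \<in> D" using hD ij by (auto simp: Db_def)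
        ultimately have "interior (snd (h i)) \<inter> interior (snd (h j)) = {}"
          using tagged_division_ofD(5)[OF td, of "fst (h i)" "snd (h i)" "fst (h j)" "snd (h j)"] by auto
        then show "{a i<..<b i} \<inter> {a j<..<b j} = {}" using ab ij by auto
      qed
      have "ennreal (\<Sum>i<card Db. b i - a i) = (\<Sum>i<card Db. emeasure lborel {a i<..<b i})"
        using ab by (subst sum_ennreal[symmetric]) (auto intro!: sum.cong)
      also have "\<dots> = emeasure lborel (\<Union>i<card Db. {a i<..<b i})"
        using disj by (intro sum_emeasure) auto
      also have "\<dots> \<le> emeasure lborel U" using ab U by (intro emeasure_mono) auto
      finally have "ennreal (\<Sum>i<card Db. b i - a i) < ennreal d'" using U' by (rule le_less_trans)
      then have len: "(\<Sum>i<card Db. b i - a i) < d'" using ab by (subst (asm) ennreal_less_iff) (auto intro!: sum_nonneg)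
      have fsum: "(\<Sum>i<card Db. \<bar>f (b i) - f (a i)\<bar>) < e"
      proof (rule d1[rule_format], intro conjI allI impI disj)
        show "(\<Sum>i<card Db. b i - a i) < d" using len d' by linarith
        fix i assume i: "i < card Db"
        then show "0 \<le> a i" "a i \<le> b i" "b i \<le> T" using ab[OF i] t by auto
      qed
      have "(\<Sum>z\<in>Db. \<bar>\<phi> z\<bar>) = (\<Sum>i<card Db. \<bar>\<phi> (h i)\<bar>)"
        using sum.reindex_bij_betw[OF h, of "\<lambda>z. \<bar>\<phi> z\<bar>"] by (simp add: atLeast0LessThan)
      also have "\<dots> \<le> (\<Sum>i<card Db. B * (b i - a i) + \<bar>f (b i) - f (a i)\<bar>)"
      proof (rule sum_mono)
        fix i assume i: "i \<in> {..<card Db}"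
        have hi: "h i \<in> D" using hD i by (auto simp: Db_def)
        then have "fst (h i) \<in> {0..t}" using tagged_division_ofD(2,3)[OF td, of "fst (h i)" "snd (h i)"] by auto
        then have "\<bar>f' (fst (h i))\<bar> \<le> B" using B t by auto
        moreover have c: "measure lborel (snd (h i)) = b i - a i" using ab i by auto
        ultimately have "\<bar>measure lborel (snd (h i)) * f' (fst (h i))\<bar> \<le> B * (b i - a i)"
          using ab(1)[of i] i by (auto simp: abs_mult mult.commute intro!: mult_right_mono)
        moreover have "\<phi> (h i) = measure lborel (snd (h i)) * f' (fst (h i)) - (f (b i) - f (a i))"
          by (simp add: \<phi>_def case_prod_beta a_def b_def)
        ultimately show "\<bar>\<phi> (h i)\<bar> \<le> B * (b i - a i) + \<bar>f (b i) - f (a i)\<bar>" by linarith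
      qed
      also have "\<dots> = B * (\<Sum>i<card Db. b i - a i) + (\<Sum>i<card Db. \<bar>f (b i) - f (a i)\<bar>)"
        by (simp add: sum.distrib sum_distrib_left)
      also have "\<dots> \<le> B * e + e"
        using len d' fsum B0 by (intro add_mono mult_left_mono) auto
      finally have badsum: "(\<Sum>z\<in>Db. \<bar>\<phi> z\<bar>) \<le> B * e + e" .
      have "\<bar>\<Sum>z\<in>D. \<phi> z\<bar> \<le> (\<Sum>z\<in>D. \<bar>\<phi> z\<bar>)" by (rule sum_abs)
      also have "\<dots> = (\<Sum>z\<in>D - Db. \<bar>\<phi> z\<bar>) + (\<Sum>z\<in>Db. \<bar>\<phi> z\<bar>)"
        using fin by (intro sum.subset_diff) (auto simp: Db_def)
      also have "\<dots> \<le> e * (t + B + 1)" using goodsum badsum by (simp add: algebra_simps)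
      also have "\<dots> < e * (t + B + 2)" using e by simp
      also have "\<dots> = e0" using t B0 by (simp add: e_def)
      finally show "norm ((\<Sum>(x, k)\<in>D. measure lborel k *\<^sub>R f' x) - (f t - f 0)) < e0"
        unfolding sum_eq by simp
    qed
  qed
qed

lemma abs_continuous_FTC:
  assumes ac: "abs_continuous_on T f" and f': "rcb T f'"
    and der: "AE t in lborel. t \<in> {0<..<T} \<longrightarrow> (f has_real_derivative f' t) (at t)"
    and t: "0 \<le> t" "t \<le> T"
  shows "f t = f 0 + (LINT r:{0..t}|lborel. f' r)"
proof -
  obtain B where B: "\<And>t. 0 \<le> t \<Longrightarrow> t \<le> T \<Longrightarrow> \<bar>f' t\<bar> \<le> B" using rcb_bound[OF f'] by metis
  have "(f' has_integral (f t - f 0)) {0..t}" by (rule abs_continuous_has_integral[OF ac der B t])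
  moreover have "set_integrable lborel {0..t} f'" using f' t by (intro rcb_integrable[where T=T]) auto
  then have "integral {0..t} f' = (LINT r:{0..t}|lborel. f' r)"
    using set_borel_integral_eq_integral(2) by metis
  ultimately show ?thesis by (auto dest: integral_unique)
qed

section \<open>Partitions, finite variation and translation in time\<close>

lemma is_partition_extend:
  assumes "is_partition s n p" "s \<le> t"
  shows "is_partition t (Suc n) (p(Suc n := t))"
  using assms by (auto simp: is_partition_def less_Suc_eq)

text \<open>\<open>V\<close> is the variation on \<open>[0,t]\<close>, a supremum of partition sums.
  Extending a partition of \<open>[0,s]\<close> by the single point \<open>t\<close> adds the term
  \<open>\<bar>f t - f s\<bar>\<close>, so the increments of \<open>V\<close> dominate; the same
  extension to \<open>T\<close> shows that all these suprema are finite.\<close>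

lemma finite_variation_on_dominated:
  assumes "finite_variation_on T f"
  obtains V where "\<And>s t. 0 \<le> s \<Longrightarrow> s \<le> t \<Longrightarrow> t \<le> T \<Longrightarrow> \<bar>f t - f s\<bar> \<le> V t - V s"
proof -
  obtain B where B: "\<And>n p. is_partition T n p \<Longrightarrow> (\<Sum>i<n. \<bar>f (p (Suc i)) - f (p i)\<bar>) \<le> B"
    using assms by (auto simp: finite_variation_on_def)
  define S where "S t = {(\<Sum>i<n. \<bar>f (p (Suc i)) - f (p i)\<bar>) |n p. is_partition t n p}" for t
  have ext: "x + \<bar>f t - f s\<bar> \<in> S t" if x: "x \<in> S s" and st: "s \<le> t" for s t x
  proof -
    obtain n p where p: "is_partition s n p" "x = (\<Sum>i<n. \<bar>f (p (Suc i)) - f (p i)\<bar>)"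
      using x by (auto simp: S_def)
    have "(\<Sum>i<Suc n. \<bar>f ((p(Suc n := t)) (Suc i)) - f ((p(Suc n := t)) i)\<bar>) = x + \<bar>f t - f s\<bar>"
      using p by (simp add: is_partition_def)
    then show ?thesis using is_partition_extend[OF p(1) st] unfolding S_def
      by (auto intro!: exI[of _ "Suc n"] exI[of _ "p(Suc n := t)"])
  qed
  have ne: "S t \<noteq> {}" if "0 \<le> t" for t
    using that unfolding S_def by (auto intro!: exI[of _ "1::nat"] exI[of _ "\<lambda>i. if i = 0 then 0 else t"] simp: is_partition_def)
  have bdd: "bdd_above (S t)" if "t \<le> T" for t
  proof (rule bdd_aboveI)
    fix x assume "x \<in> S t"
    from ext[OF this that] obtain n p where "is_partition T n p" "x + \<bar>f T - f t\<bar> = (\<Sum>i<n. \<bar>f (p (Suc i)) - f (p i)\<bar>)"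
      by (auto simp: S_def)
    then show "x \<le> B" using B[of n p] by linarith
  qed
  show ?thesis
  proof (rule that[of "\<lambda>t. Sup (S t)"])
    fix s t assume st: "0 \<le> s" "s \<le> t" "t \<le> T"
    have "Sup (S s) \<le> Sup (S t) - \<bar>f t - f s\<bar>"
    proof (rule cSup_least)
      fix x assume "x \<in> S s"
      from cSup_upper[OF ext[OF this st(2)] bdd[OF st(3)]] show "x \<le> Sup (S t) - \<bar>f t - f s\<bar>" by linarith
    qed (use ne st in auto)
    then show "\<bar>f t - f s\<bar> \<le> Sup (S t) - Sup (S s)" by linarith
  qed
qed

text \<open>Translating the second integral by \<open>h\<close> makes the two cancel except on the
  last window of length \<open>h\<close>, where \<open>W T - W 0\<close> bounds the integrand. The
  result is linear in \<open>h\<close>, as the translation seminorm of the optimizer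
  demands.\<close>

lemma nn_integral_increment_shift:
  fixes W :: "real \<Rightarrow> real"
  assumes mono: "\<And>s t. 0 \<le> s \<Longrightarrow> s \<le> t \<Longrightarrow> t \<le> T \<Longrightarrow> W s \<le> W t" and T: "0 \<le> T" and h: "0 < h"
  shows "(\<integral>\<^sup>+ t\<in>{0..T}. ennreal (W t - W (max (t - h) 0)) \<partial>lborel) \<le> ennreal (h * (W T - W 0))"
proof -
  \<comment> \<open>Freezing \<open>W\<close> outside \<open>[0,T]\<close> and subtracting
    \<open>W 0\<close> makes \<open>w\<close> vanish at negative times, so that
    \<open>w (t - h)\<close> reproduces the truncation \<open>max (t - h) 0\<close>.\<close>
  define w where "w t = W (max 0 (min t T)) - W 0" for t
  have w_mono: "mono w" unfolding w_def using T by (intro monoI diff_right_mono mono) auto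
  then have [measurable]: "w \<in> borel_measurable borel" by (rule borel_measurable_mono)
  have w: "0 \<le> w t" "w t \<le> W T - W 0" for t unfolding w_def using T mono by auto
  have ind: "integrable lborel (\<lambda>t. indicator {a..b} t * w (t - c))" for a b c :: real
  proof (rule Bochner_Integration.integrable_bound)
    show "integrable lborel (\<lambda>t. indicator {a..b} t * (W T - W 0))" by (intro integrable_mult_left) (auto simp: integrable_indicator_iff emeasure_lborel_Icc_eq)
    show "AE t in lborel. norm (indicator {a..b} t * w (t - c)) \<le> norm (indicator {a..b} t * (W T - W 0))"
      using w by (intro AE_I2) (auto simp: indicator_def intro: order_trans[OF _ abs_ge_self])
  qed measurable
  have shift: "(LINT t|lborel. indicator {0..T} t * w (t - h)) = (LINT t|lborel. indicator {-h..T-h} t * w t)"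
    by (subst lborel_integral_real_affine[of 1 "\<lambda>t. indicator {-h..T-h} t * w t" "-h"])
      (auto intro!: Bochner_Integration.integral_cong simp: indicator_def)
  have "(\<integral>\<^sup>+ t\<in>{0..T}. ennreal (W t - W (max (t - h) 0)) \<partial>lborel) = (\<integral>\<^sup>+ t. ennreal (indicator {0..T} t * w t - indicator {0..T} t * w (t - h)) \<partial>lborel)"
    using h by (intro nn_integral_cong) (auto simp: w_def indicator_def min_def max_def)
  also have "\<dots> = ennreal (LINT t|lborel. indicator {0..T} t * w t - indicator {0..T} t * w (t - h))"
    using ind[of 0 T 0] ind[of 0 T h] h w_mono
    by (intro nn_integral_eq_integral) (auto simp: indicator_def intro!: AE_I2 monoD[of w])
  also have "(LINT t|lborel. indicator {0..T} t * w t - indicator {0..T} t * w (t - h))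
    = (LINT t|lborel. indicator {0..T} t * w t - indicator {-h..T-h} t * w t)"
    using ind[of 0 T 0] ind[of 0 T h] ind[of "-h" "T-h" 0] shift by simp
  also have "\<dots> \<le> (LINT t|lborel. indicator {T-h..T} t * (W T - W 0))"
  proof (rule integral_mono)
    show "integrable lborel (\<lambda>t. indicator {0..T} t * w t - indicator {-h..T-h} t * w t)"
      using ind[of 0 T 0] ind[of "-h" "T-h" 0] by auto
    show "integrable lborel (\<lambda>t. indicator {T-h..T} t * (W T - W 0))"
      by (intro integrable_mult_left) (auto simp: integrable_indicator_iff emeasure_lborel_Icc_eq)
    show "indicator {0..T} t * w t - indicator {-h..T-h} t * w t \<le> indicator {T-h..T} t * (W T - W 0)" for t
      using w[of t] h by (auto simp: indicator_def)
  qed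
  also have "\<dots> = h * (W T - W 0)" using h by simp
  finally show ?thesis by (simp add: ennreal_leI)
qed

lemma is_partition_le:
  assumes "is_partition t n p" "i \<le> j" "j \<le> n"
  shows "p i \<le> p j"
  using assms(2,3)
proof (induction j rule: dec_induct)
  case (step k)
  then have "p k \<le> p (Suc k)" using assms(1) by (auto simp: is_partition_def)
  then show ?case using step by auto
qed simp

lemma integral_finite_variation:
  assumes i: "set_integrable lborel {0..T} f" and eq: "\<And>t. 0 \<le> t \<Longrightarrow> t \<le> T \<Longrightarrow> q t = (LINT s:{0..t}|lborel. f s :: real)"
  shows "finite_variation_on T q"
  unfolding finite_variation_on_def
proof (intro exI allI impI)
  fix n p assume p: "is_partition T n p"
  have pin: "0 \<le> p i" "p i \<le> T" if "i \<le> n" for i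
    using is_partition_le[OF p, of 0 i] is_partition_le[OF p, of i n] p that by (auto simp: is_partition_def)
  define A where "A t = (LINT s:{0..t}|lborel. \<bar>f s\<bar>)" for t
  have ia: "set_integrable lborel {0..T} (\<lambda>s. \<bar>f s\<bar>)" by (rule set_integrable_abs[OF i])
  have "\<bar>q (p (Suc k)) - q (p k)\<bar> \<le> A (p (Suc k)) - A (p k)" if k: "k < n" for k
  proof -
    have le: "p k \<le> p (Suc k)" using p k by (auto simp: is_partition_def)
    have s: "set_integrable lborel {0..p (Suc k)} f" "set_integrable lborel {0..p (Suc k)} (\<lambda>s. \<bar>f s\<bar>)"
      by (rule set_integrable_subset[OF i] set_integrable_subset[OF ia]; use pin[of "Suc k"] k in auto)+
    have s2: "set_integrable lborel {p k<..p (Suc k)} f" by (rule set_integrable_subset[OF s(1)]) (use pin[of k] k in auto)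
    have "q (p (Suc k)) - q (p k) = (LINT s:{p k<..p (Suc k)}|lborel. f s)"
      using set_integral_Icc_split[OF s(1) pin(1) le] eq[of "p k"] eq[of "p (Suc k)"] pin[of k] pin[of "Suc k"] k by auto
    moreover have "A (p (Suc k)) - A (p k) = (LINT s:{p k<..p (Suc k)}|lborel. \<bar>f s\<bar>)"
      using set_integral_Icc_split[OF s(2) pin(1) le] k by (simp add: A_def)
    ultimately show ?thesis using set_integral_norm_bound[OF s2] by simp
  qed
  then have "(\<Sum>k<n. \<bar>q (p (Suc k)) - q (p k)\<bar>) \<le> (\<Sum>k<n. A (p (Suc k)) - A (p k))" by (intro sum_mono) auto
  also have "\<dots> = A T - A 0"
    using sum_lessThan_telescope[of "\<lambda>i. A (p i)" n] p by (simp add: is_partition_def)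
  finally show "(\<Sum>k<n. \<bar>q (p (Suc k)) - q (p k)\<bar>) \<le> A T - A 0" .
qed

lemma is_partition_cell:
  assumes p: "is_partition t n p" and s: "0 < s" "s \<le> t"
  obtains j where "j < n" "p j < s" "s \<le> p (Suc j)"
proof -
  define k where "k = (LEAST k. s \<le> p k)"
  have pn: "s \<le> p n" "p 0 = 0" using p s by (auto simp: is_partition_def)
  have k: "s \<le> p k" "k \<le> n" unfolding k_def using pn by (auto intro: LeastI Least_le)
  then have "k \<noteq> 0" using pn s by (cases k) auto
  then obtain j where j: "k = Suc j" by (cases k) auto
  have "\<not> s \<le> p j" using not_less_Least[of j "\<lambda>k. s \<le> p k"] j by (simp add: k_def)
  then show ?thesis using that[of j] j k by auto
qed

lemma is_partition_step_fun:
  fixes x :: "nat \<Rightarrow> real"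
  assumes p: "is_partition t n p" and j: "j < n" "p j < s" "s \<le> p (Suc j)"
  shows "(\<Sum>i<n. x i * indicator {p i<..p (Suc i)} s) = x j"
proof -
  have "x i * indicator {p i<..p (Suc i)} s = (if i = j then x j else 0)" if i: "i < n" for i
  proof -
    have "s \<le> p i" if "j < i" using j is_partition_le[OF p, of "Suc j" i] that i by auto
    moreover have "p (Suc i) < s" if "i < j" using j is_partition_le[OF p, of "Suc i" j] that i by auto
    ultimately show ?thesis using j by (auto simp: indicator_def not_le)
      (metis linorder_neqE_nat not_le)+
  qed
  then have "(\<Sum>i<n. x i * indicator {p i<..p (Suc i)} s) = (\<Sum>i<n. if i = j then x j else 0)"
    by (intro sum.cong) auto
  then show ?thesis using j by simp
qed

text \<open>Summation by parts moves the increments from \<open>X\<close> to \<open>f\<close>. What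
  remains is the integral of \<open>f'\<close> against the step function of right-endpoint values of
  \<open>X\<close>, which converges to \<open>X\<close> by right-continuity, under a constant bound.
  Hence the sums converge on each path even when \<open>X\<close> has infinite variation.\<close>

lemma Riemann_sums_by_parts:
  fixes f f' X :: "real \<Rightarrow> real"
  assumes f: "\<And>s. 0 \<le> s \<Longrightarrow> s \<le> T \<Longrightarrow> f s = f 0 + (LINT r:{0..s}|lborel. f' r)" and f': "rcb T f'"
    and X: "rcb T X" and t: "0 \<le> t" "t \<le> T"
    and part: "\<And>k::nat. is_partition t (n k) (p k)"
    and mesh: "\<And>k i. i < n k \<Longrightarrow> p k (Suc i) - p k i < 1 / real (Suc k)"
  shows "(\<lambda>k. \<Sum>i<n k. f (p k i) * (X (p k (Suc i)) - X (p k i))) \<longlonglongrightarrow>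
    f t * X t - f 0 * X 0 - (LINT r:{0..t}|lborel. f' r * X r)"
proof -
  have T: "0 \<le> T" using t by auto
  obtain B where B: "\<And>t. 0 \<le> t \<Longrightarrow> t \<le> T \<Longrightarrow> \<bar>X t\<bar> \<le> B" "0 \<le> B" using rcb_bound[OF X] by metis
  have int: "set_integrable lborel {0..t} f'" using rcb_integrable f' T t by auto
  define st where "st k s = (\<Sum>i<n k. X (p k (Suc i)) * indicator {p k i<..p k (Suc i)} s)" for k s
  have pin: "0 \<le> p k i" "p k i \<le> t" if "i \<le> n k" for k i
    using is_partition_le[OF part, of 0 i k] is_partition_le[OF part, of i "n k" k] part[of k] that
    by (auto simp: is_partition_def)
  have sum_eq: "(\<Sum>i<n k. f (p k i) * (X (p k (Suc i)) - X (p k i))) =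
     f t * X t - f 0 * X 0 - (LINT s|lborel. indicator {0..t} s * f' s * st k s)" for k
  proof -
    have df: "f (p k (Suc i)) - f (p k i) = (LINT s:{p k i<..p k (Suc i)}|lborel. f' s)" if i: "i < n k" for i
    proof -
      have le: "p k i \<le> p k (Suc i)" using i part[of k] by (auto simp: is_partition_def)
      have "set_integrable lborel {0..p k (Suc i)} f'"
        by (rule set_integrable_subset[OF int]) (use pin[of "Suc i" k] i in auto)
      from set_integral_Icc_split[OF this pin(1) le] show ?thesis
        using f[of "p k i"] f[of "p k (Suc i)"] pin[of i k] pin[of "Suc i" k] i t by auto
    qed
    have "(\<Sum>i<n k. f (p k i) * (X (p k (Suc i)) - X (p k i))) =
      (\<Sum>i<n k. (f (p k (Suc i)) * X (p k (Suc i)) - f (p k i) * X (p k i)) - X (p k (Suc i)) * (f (p k (Suc i)) - f (p k i)))"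
      by (intro sum.cong) (auto simp: algebra_simps)
    also have "\<dots> = f t * X t - f 0 * X 0 - (\<Sum>i<n k. X (p k (Suc i)) * (LINT s:{p k i<..p k (Suc i)}|lborel. f' s))"
      using sum_lessThan_telescope[of "\<lambda>i. f (p k i) * X (p k i)" "n k"] part[of k]
      by (simp add: sum_subtractf is_partition_def df)
    also have "(\<Sum>i<n k. X (p k (Suc i)) * (LINT s:{p k i<..p k (Suc i)}|lborel. f' s)) =
      (\<Sum>i<n k. LINT s|lborel. indicator {0..t} s * f' s * (X (p k (Suc i)) * indicator {p k i<..p k (Suc i)} s))"
    proof (intro sum.cong refl)
      fix i assume i: "i \<in> {..<n k}"
      show "X (p k (Suc i)) * (LINT s:{p k i<..p k (Suc i)}|lborel. f' s) =
        (LINT s|lborel. indicator {0..t} s * f' s * (X (p k (Suc i)) * indicator {p k i<..p k (Suc i)} s))"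
        unfolding set_lebesgue_integral_def integral_mult_right_zero[symmetric]
        using pin[of i k] pin[of "Suc i" k] i
        by (intro Bochner_Integration.integral_cong) (auto simp: indicator_def)
    qed
    also have "\<dots> = (LINT s|lborel. (\<Sum>i<n k. indicator {0..t} s * f' s * (X (p k (Suc i)) * indicator {p k i<..p k (Suc i)} s)))"
    proof (intro Bochner_Integration.integral_sum[symmetric])
      fix i assume i: "i \<in> {..<n k}"
      have "set_integrable lborel {p k i<..p k (Suc i)} f'"
        by (rule set_integrable_subset[OF int]) (use pin[of "Suc i" k] pin[of i k] i in auto)
      then have "integrable lborel (\<lambda>s. X (p k (Suc i)) * (indicator {p k i<..p k (Suc i)} s *\<^sub>R f' s))"
        unfolding set_integrable_def by (rule integrable_mult_right)
      also have "(\<lambda>s. X (p k (Suc i)) * (indicator {p k i<..p k (Suc i)} s *\<^sub>R f' s)) =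
        (\<lambda>s. indicator {0..t} s * f' s * (X (p k (Suc i)) * indicator {p k i<..p k (Suc i)} s))"
        using pin[of "Suc i" k] pin[of i k] i by (intro ext) (auto simp: indicator_def)
      finally show "integrable lborel \<dots>" .
    qed
    finally show ?thesis unfolding st_def sum_distrib_left .
  qed
  have st_val: "\<exists>j. j < n k \<and> s \<le> p k (Suc j) \<and> p k (Suc j) < s + 1 / real (Suc k) \<and> st k s = X (p k (Suc j))"
    if s: "0 < s" "s \<le> t" for k s
  proof -
    obtain j where j: "j < n k" "p k j < s" "s \<le> p k (Suc j)" using is_partition_cell[OF part s] by blast
    have "st k s = X (p k (Suc j))"
      unfolding st_def by (rule is_partition_step_fun[OF part j, of "\<lambda>i. X (p k (Suc i))"])
    then show ?thesis using j mesh[OF j(1)] by (intro exI[of _ j]) auto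
  qed
  have "(\<lambda>k. LINT s|lborel. indicator {0..t} s * f' s * st k s) \<longlonglongrightarrow> (LINT s|lborel. indicator {0..t} s * f' s * X s)"
  proof (rule integral_dominated_convergence[where w = "\<lambda>s. B * \<bar>indicator {0..t} s * f' s\<bar>"])
    have m1: "(\<lambda>s. indicator {0..t} s * f' s) \<in> borel_measurable lborel"
      using rcb_set_measurable[OF f' T t(2), of 0] by (simp add: set_borel_measurable_def)
    have m2: "(\<lambda>s. indicator {0..t} s * X s) \<in> borel_measurable lborel"
      using rcb_set_measurable[OF X T t(2), of 0] by (simp add: set_borel_measurable_def)
    have "(\<lambda>s. indicator {0..t} s * f' s * X s) = (\<lambda>s. (indicator {0..t} s * f' s) * (indicator {0..t} s * X s))"
      by (auto simp: indicator_def)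
    then show "(\<lambda>s. indicator {0..t} s * f' s * X s) \<in> borel_measurable lborel" using m1 m2 by simp
    show "(\<lambda>s. indicator {0..t} s * f' s * st k s) \<in> borel_measurable lborel" for k
      unfolding st_def using m1 by measurable
    show "integrable lborel (\<lambda>s. B * \<bar>indicator {0..t} s * f' s\<bar>)"
      using int by (intro integrable_mult_right integrable_abs) (simp add: set_integrable_def)
    show "AE s in lborel. (\<lambda>k. indicator {0..t} s * f' s * st k s) \<longlonglongrightarrow> indicator {0..t} s * f' s * X s"
      using AE_lborel_singleton[of 0]
    proof eventually_elim
      case (elim s)
      show ?case
      proof (cases "s \<in> {0..t}")
        case True
        then have s: "0 < s" "s \<le> t" using elim by auto
        have "(\<lambda>k. st k s) \<longlonglongrightarrow> X s"
        proof (cases "s = t")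
          case True
          have "st k s = X s" for k
          proof -
            obtain j where j: "j < n k" "s \<le> p k (Suc j)" "st k s = X (p k (Suc j))"
              using st_val[OF s, of k] by blast
            have "p k (Suc j) = s" using pin(2)[of "Suc j" k] j True by auto
            then show ?thesis using j by simp
          qed
          then show ?thesis by simp
        next
          case False
          then have lim: "(X \<longlongrightarrow> X s) (at_right s)" using X s t by (intro rcb_tendsto) auto
          show ?thesis
          proof (rule tendstoI)
            fix e :: real assume e: "e > 0"
            obtain b where b: "b > s" "\<And>r. s < r \<Longrightarrow> r < b \<Longrightarrow> dist (X r) (X s) < e"
              using tendstoD[OF lim e] by (auto simp: eventually_at_right_field)
            have "eventually (\<lambda>k. 1 / real (Suc k) < b - s) sequentially"
              using order_tendstoD(2)[OF LIMSEQ_inverse_real_of_nat, of "b - s"] b(1) by (simp add: inverse_eq_divide)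
            then show "eventually (\<lambda>k. dist (st k s) (X s) < e) sequentially"
            proof eventually_elim
              case (elim k)
              obtain j where j: "s \<le> p k (Suc j)" "p k (Suc j) < s + 1 / real (Suc k)" "st k s = X (p k (Suc j))"
                using st_val[OF s, of k] by blast
              show ?case using b(2)[of "p k (Suc j)"] j elim e by (cases "p k (Suc j) = s") auto
            qed
          qed
        qed
        then show ?thesis by (intro tendsto_intros)
      qed simp
    qed
    show "AE s in lborel. norm (indicator {0..t} s * f' s * st k s) \<le> B * \<bar>indicator {0..t} s * f' s\<bar>" for k
      using AE_lborel_singleton[of 0]
    proof eventually_elim
      case (elim s)
      show ?case
      proof (cases "s \<in> {0..t}")
        case True
        then have s: "0 < s" "s \<le> t" using elim by auto
        obtain j where j: "j < n k" "st k s = X (p k (Suc j))" using st_val[OF s, of k] by blast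
        have "\<bar>st k s\<bar> \<le> B" using j pin[of "Suc j" k] B(1) t by auto
        then have "\<bar>f' s\<bar> * \<bar>st k s\<bar> \<le> \<bar>f' s\<bar> * B" by (intro mult_left_mono) auto
        then show ?thesis using True by (simp add: abs_mult mult.commute)
      qed simp
    qed
  qed
  then show ?thesis unfolding sum_eq by (intro tendsto_diff tendsto_const) (simp add: set_lebesgue_integral_def mult.assoc)
qed

section \<open>Cadlag functions, Volterra equations and norms\<close>

lemma cadlag_on_continuous:
  assumes "continuous_on {0..T} f" shows "cadlag_on T f"
  unfolding cadlag_on_def
proof (intro conjI ballI)
  show "(f \<longlongrightarrow> f t) (at_right t)" if "t \<in> {0..<T}" for t
    using continuous_on_Icc_at_right[OF assms] that by auto
  fix t assume t: "t \<in> {0<..T}"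
  have "(f \<longlongrightarrow> f t) (at t within {0..T})" using assms t by (auto simp: continuous_on_def)
  then have "(f \<longlongrightarrow> f t) (at t within {0<..<t})" by (rule tendsto_within_subset) (use t in auto)
  moreover have "at t within {0<..<t} = at_left t"
    by (rule at_within_nhd[of _ "{0<..}"]) (use t in auto)
  ultimately show "\<exists>l. (f \<longlongrightarrow> l) (at_left t)" by auto
qed

lemma cadlag_on_const: "cadlag_on T (\<lambda>_. c)"
  by (intro cadlag_on_continuous continuous_intros)

lemma cadlag_on_add:
  assumes "cadlag_on T f" "cadlag_on T g" shows "cadlag_on T (\<lambda>t. f t + g t)"
  unfolding cadlag_on_def
proof (intro conjI ballI)
  show "((\<lambda>t. f t + g t) \<longlongrightarrow> f t + g t) (at_right t)" if "t \<in> {0..<T}" for t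
    using assms that by (auto simp: cadlag_on_def intro!: tendsto_add)
  fix t assume "t \<in> {0<..T}"
  then obtain a b where "(f \<longlongrightarrow> a) (at_left t)" "(g \<longlongrightarrow> b) (at_left t)"
    using assms unfolding cadlag_on_def by metis
  then show "\<exists>l. ((\<lambda>t. f t + g t) \<longlongrightarrow> l) (at_left t)" by (blast intro: tendsto_add)
qed

lemma cadlag_on_mult:
  assumes "cadlag_on T f" "cadlag_on T g" shows "cadlag_on T (\<lambda>t. f t * g t :: real)"
  unfolding cadlag_on_def
proof (intro conjI ballI)
  show "((\<lambda>t. f t * g t) \<longlongrightarrow> f t * g t) (at_right t)" if "t \<in> {0..<T}" for t
    using assms that by (auto simp: cadlag_on_def intro!: tendsto_mult)
  fix t assume "t \<in> {0<..T}"
  then obtain a b where "(f \<longlongrightarrow> a) (at_left t)" "(g \<longlongrightarrow> b) (at_left t)"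
    using assms unfolding cadlag_on_def by metis
  then show "\<exists>l. ((\<lambda>t. f t * g t) \<longlongrightarrow> l) (at_left t)" by (blast intro: tendsto_mult)
qed

lemma cadlag_on_diff: "cadlag_on T f \<Longrightarrow> cadlag_on T g \<Longrightarrow> cadlag_on T (\<lambda>t. f t - g t :: real)"
  using cadlag_on_add[of T f "\<lambda>t. (-1) * g t"] cadlag_on_mult[OF cadlag_on_const[of T "-1"], of g] by simp

lemma cadlag_on_divide:
  assumes f: "cadlag_on T f" and g: "cadlag_on T g" and c: "0 < c" "\<And>t. 0 \<le> t \<Longrightarrow> t \<le> T \<Longrightarrow> c \<le> g t"
  shows "cadlag_on T (\<lambda>t. f t / g t)"
  unfolding cadlag_on_def
proof (intro conjI ballI)
  show "((\<lambda>t. f t / g t) \<longlongrightarrow> f t / g t) (at_right t)" if "t \<in> {0..<T}" for t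
    using f g that c(1) c(2)[of t] by (auto simp: cadlag_on_def intro!: tendsto_divide)
  fix t assume t: "t \<in> {0<..T}"
  then obtain a b where ab: "(f \<longlongrightarrow> a) (at_left t)" "(g \<longlongrightarrow> b) (at_left t)"
    using assms unfolding cadlag_on_def by metis
  have "eventually (\<lambda>s. c \<le> g s) (at_left t)"
    unfolding eventually_at_left_field using c t by (intro exI[of _ 0]) auto
  then have "c \<le> b" using ab(2) by (intro tendsto_lowerbound[OF ab(2)]) auto
  then have "((\<lambda>t. f t / g t) \<longlongrightarrow> a / b) (at_left t)" using ab c by (intro tendsto_divide) auto
  then show "\<exists>l. ((\<lambda>t. f t / g t) \<longlongrightarrow> l) (at_left t)" by blast
qed

lemma has_real_derivative_at_right_cong:
  fixes f g :: "real \<Rightarrow> real"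
  assumes "(g has_real_derivative D) (at_right s)" "s < T" "\<And>t. s \<le> t \<Longrightarrow> t < T \<Longrightarrow> f t = g t"
  shows "(f has_real_derivative D) (at_right s)"
proof -
  have "eventually (\<lambda>t. (g t - g s) / (t - s) = (f t - f s) / (t - s)) (at_right s)"
    unfolding eventually_at_right_field using assms by (intro exI[of _ T]) auto
  then show ?thesis using assms(1) unfolding has_field_derivative_iff by (rule Lim_transform_eventually[rotated])
qed

text \<open>The equation itself improves right-continuity of \<open>w\<close> to continuity; the
  integrating factor \<open>exp (A t)\<close> then gives a function with zero right derivative that
  starts at zero.\<close>

lemma Volterra_zero:
  assumes a: "rcb T a" and w: "rcb T w"
    and eq: "\<And>t. 0 \<le> t \<Longrightarrow> t \<le> T \<Longrightarrow> w t = - (LINT s:{0..t}|lborel. a s * w s)"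
    and t: "0 \<le> t" "t \<le> T"
  shows "w t = 0"
proof -
  have T: "0 \<le> T" using t by auto
  define A where "A t = (LINT s:{0..t}|lborel. a s)" for t
  have aw: "rcb T (\<lambda>s. a s * w s)" by (rule rcb_mult[OF a w])
  have "continuous_on {0..T} (\<lambda>t. - (LINT s:{0..t}|lborel. a s * w s))"
    by (intro continuous_intros rcb_integral_continuous aw T)
  then have w_cont: "continuous_on {0..T} w" by (rule continuous_on_cong[THEN iffD1, rotated 2]) (use eq in auto)
  have "exp (A t) * w t = exp (A 0) * w 0"
  proof (rule right_deriv_zero_const[where T=T and f="\<lambda>t. exp (A t) * w t"])
    show "continuous_on {0..T} (\<lambda>t. exp (A t) * w t)"
      unfolding A_def by (intro continuous_intros w_cont rcb_integral_continuous a T)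
    fix s assume s: "0 \<le> s" "s < T"
    have A': "(A has_real_derivative a s) (at_right s)"
      unfolding A_def by (rule rcb_integral_right_deriv[OF a s])
    have "((\<lambda>t. - (LINT s:{0..t}|lborel. a s * w s)) has_real_derivative - (a s * w s)) (at_right s)"
      by (rule DERIV_minus[OF rcb_integral_right_deriv[OF aw s]])
    then have w': "(w has_real_derivative - (a s * w s)) (at_right s)"
      by (rule has_real_derivative_at_right_cong[OF _ s(2)]) (use eq s in auto)
    show "((\<lambda>t. exp (A t) * w t) has_real_derivative 0) (at_right s)"
      by (rule derivative_eq_intros A' w' refl | simp add: algebra_simps)+
  qed (use t in auto)
  moreover have "w 0 = 0" using eq[of 0] T set_integral_Icc_self[of 0] by simp
  ultimately show ?thesis by simp
qed

section \<open>Square-integrable functions and essential bounds\<close>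

lemma square_integrable_mult:
  fixes f g :: "'a \<Rightarrow> real"
  assumes [measurable]: "f \<in> borel_measurable N" "g \<in> borel_measurable N"
    and "integrable N (\<lambda>x. (f x)\<^sup>2)" "integrable N (\<lambda>x. (g x)\<^sup>2)"
  shows "integrable N (\<lambda>x. f x * g x)"
proof (rule Bochner_Integration.integrable_bound)
  show "integrable N (\<lambda>x. (f x)\<^sup>2 + (g x)\<^sup>2)" using assms by auto
  have "\<bar>a * b\<bar> \<le> a\<^sup>2 + b\<^sup>2" for a b :: real
  proof -
    have "0 \<le> (\<bar>a\<bar> - \<bar>b\<bar>)\<^sup>2" by simp
    then have "2 * (\<bar>a\<bar> * \<bar>b\<bar>) \<le> a\<^sup>2 + b\<^sup>2" by (simp add: power2_diff)
    moreover have "0 \<le> \<bar>a\<bar> * \<bar>b\<bar>" by simp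
    ultimately show ?thesis unfolding abs_mult by linarith
  qed
  then show "AE x in N. norm (f x * g x) \<le> norm ((f x)\<^sup>2 + (g x)\<^sup>2)" by simp
qed simp

lemma Cauchy_Schwarz_integral:
  fixes f g :: "'a \<Rightarrow> real"
  assumes [measurable]: "f \<in> borel_measurable N" "g \<in> borel_measurable N"
    and f: "integrable N (\<lambda>x. (f x)\<^sup>2)" and g: "integrable N (\<lambda>x. (g x)\<^sup>2)"
  shows "(LINT x|N. f x * g x)\<^sup>2 \<le> (LINT x|N. (f x)\<^sup>2) * (LINT x|N. (g x)\<^sup>2)"
proof -
  define A B C where "A = (LINT x|N. (f x)\<^sup>2)" and "B = (LINT x|N. f x * g x)" and "C = (LINT x|N. (g x)\<^sup>2)"
  have fg: "integrable N (\<lambda>x. f x * g x)" by (rule square_integrable_mult[OF assms])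
  have quad: "0 \<le> A - 2 * c * B + c\<^sup>2 * C" for c
  proof -
    have "0 \<le> (LINT x|N. (f x - c * g x)\<^sup>2)" by simp
    also have "(LINT x|N. (f x - c * g x)\<^sup>2) = (LINT x|N. (f x)\<^sup>2 - 2 * c * (f x * g x) + c\<^sup>2 * (g x)\<^sup>2)"
      by (intro Bochner_Integration.integral_cong) (auto simp: power2_eq_square algebra_simps)
    also have "\<dots> = A - 2 * c * B + c\<^sup>2 * C"
      using f g fg by (simp add: A_def B_def C_def)
    finally show ?thesis .
  qed
  have "B\<^sup>2 \<le> A * C"
  proof (cases "C = 0")
    case True
    have "B = 0"
    proof (rule ccontr)
      assume "B \<noteq> 0"
      \<comment> \<open>For \<open>C = 0\<close> the quadratic form is affine in \<open>c\<close>,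
        and this \<open>c\<close> gives it the value \<open>-1\<close>.\<close>
      then have "A - 2 * ((A + 1) / (2 * B)) * B = - 1" by (simp add: field_simps)
      then show False using quad[of "(A + 1) / (2 * B)"] True by simp
    qed
    then show ?thesis using True by simp
  next
    case False
    moreover have "0 \<le> C" by (simp add: C_def)
    ultimately have C: "0 < C" by simp
    have "0 \<le> A - B\<^sup>2 / C" using quad[of "B / C"] C by (simp add: power2_eq_square field_simps)
    then show ?thesis using C by (simp add: field_simps)
  qed
  then show ?thesis by (simp add: A_def B_def C_def)
qed

lemma set_integral_abs_square_le:
  fixes f :: "real \<Rightarrow> real"
  assumes m: "set_borel_measurable lborel {s..t} f" and f: "set_integrable lborel {s..t} (\<lambda>r. (f r)\<^sup>2)" and st: "s \<le> t"
  shows "(LINT r:{s..t}|lborel. \<bar>f r\<bar>)\<^sup>2 \<le> (t - s) * (LINT r:{s..t}|lborel. (f r)\<^sup>2)"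
proof -
  have [measurable]: "(\<lambda>r. indicat_real {s..t} r * f r) \<in> borel_measurable lborel"
    using m by (simp add: set_borel_measurable_def)
  have sq: "(indicat_real {s..t} r * f r)\<^sup>2 = indicat_real {s..t} r *\<^sub>R (f r)\<^sup>2"
     "(indicat_real {s..t} r)\<^sup>2 = indicat_real {s..t} r"
     "(\<bar>indicat_real {s..t} r * f r\<bar>)\<^sup>2 = indicat_real {s..t} r *\<^sub>R (f r)\<^sup>2"
     "indicat_real {s..t} r *\<^sub>R \<bar>f r\<bar> = indicat_real {s..t} r * \<bar>indicat_real {s..t} r * f r\<bar>" for r
    by (auto simp: indicator_def)
  have "(LINT r|lborel. indicat_real {s..t} r * \<bar>indicat_real {s..t} r * f r\<bar>)\<^sup>2
    \<le> (LINT r|lborel. (indicat_real {s..t} r)\<^sup>2) * (LINT r|lborel. (\<bar>indicat_real {s..t} r * f r\<bar>)\<^sup>2)"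
    by (rule Cauchy_Schwarz_integral) (use f in \<open>auto simp: sq set_integrable_def integrable_indicator_iff emeasure_lborel_Icc_eq simp del: power2_abs\<close>)
  then show ?thesis unfolding set_lebesgue_integral_def sq(2,3,4) using st by simp
qed

lemma AE_restrict_Ioo_iff:
  "(AE t in restrict_space lborel {0<..<T::real}. P t) \<longleftrightarrow> (AE t in lborel. t \<in> {0<..<T} \<longrightarrow> P t)"
  by (subst AE_restrict_space_iff) auto

text \<open>A violation at \<open>t\<close> would persist on a right neighbourhood, which has
  positive measure; so an almost everywhere bound holds at every point of right-continuity.\<close>

lemma AE_Ioo_right_limit_le:
  fixes f :: "real \<Rightarrow> real"
  assumes f: "(f \<longlongrightarrow> f t) (at_right t)" and t: "0 \<le> t" "t < T"
    and ae: "AE s in lborel. s \<in> {0<..<T} \<longrightarrow> f s \<le> c"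
  shows "f t \<le> c"
proof (rule ccontr)
  assume "\<not> f t \<le> c"
  then have "eventually (\<lambda>s. c < f s) (at_right t)" using f by (intro order_tendstoD) auto
  then obtain b where b: "b > t" "\<And>s. t < s \<Longrightarrow> s < b \<Longrightarrow> c < f s"
    by (auto simp: eventually_at_right_field)
  have "AE s in lborel. s \<notin> {t<..<min b T}" using ae by eventually_elim (use b t in force)
  then have "emeasure lborel {t<..<min b T} = 0"
    by (subst (asm) AE_iff_measurable[of "{t<..<min b T}"]) auto
  then show False using b t by (simp add: min_def split: if_splits)
qed

lemma rcb_restrict_measurable:
  assumes "rcb T f" shows "f \<in> borel_measurable (restrict_space lborel {0<..<T})"
proof (cases "0 \<le> T")
  case True
  have "set_borel_measurable borel {0..T} f"
    using rcb_set_measurable[OF assms True order_refl, of 0] by (simp add: set_borel_measurable_def)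
  then have "set_borel_measurable borel {0<..<T} f"
    by (rule set_borel_measurable_subset) auto
  then show ?thesis
    by (subst borel_measurable_restrict_space_iff) (auto simp: set_borel_measurable_def mult.commute)
next
  case False
  then have "space (restrict_space lborel {0<..<T}) = {}" by (auto simp: space_restrict_space)
  then show ?thesis by (auto simp: measurable_def)
qed

lemma rcb_le_Linf_norm:
  assumes f: "rcb T f" and t: "0 \<le> t" "t < T"
  shows "\<bar>f t\<bar> \<le> Linf_norm T f"
proof -
  let ?N = "restrict_space lborel {0<..<T}"
  obtain B where B: "\<And>t. 0 \<le> t \<Longrightarrow> t \<le> T \<Longrightarrow> \<bar>f t\<bar> \<le> B" using rcb_bound[OF f] by metis
  have [measurable]: "f \<in> borel_measurable ?N" by (rule rcb_restrict_measurable[OF f])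
  have up: "esssup ?N (\<lambda>t. ereal \<bar>f t\<bar>) \<le> ereal B"
    by (rule esssup_I) (auto intro!: AE_I2 B simp: space_restrict_space)
  have ae: "AE s in ?N. ereal \<bar>f s\<bar> \<le> esssup ?N (\<lambda>t. ereal \<bar>f t\<bar>)" by (rule esssup_AE)
  \<comment> \<open>\<open>real_of_ereal\<close> sends both infinities to zero, so the essential
    supremum must be shown finite before its real value can serve as a bound.\<close>
  have "esssup ?N (\<lambda>t. ereal \<bar>f t\<bar>) \<noteq> -\<infinity>"
  proof
    assume "esssup ?N (\<lambda>t. ereal \<bar>f t\<bar>) = -\<infinity>"
    then have "AE s in lborel. s \<notin> {0<..<T}" using ae by (simp add: AE_restrict_Ioo_iff)
    then have "emeasure lborel {0<..<T} = 0" by (subst (asm) AE_iff_measurable[of "{0<..<T}"]) auto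
    then show False using t by simp
  qed
  with up have eq: "esssup ?N (\<lambda>t. ereal \<bar>f t\<bar>) = ereal (Linf_norm T f)"
    unfolding Linf_norm_def by (cases "esssup ?N (\<lambda>t. ereal \<bar>f t\<bar>)") auto
  have "AE s in lborel. s \<in> {0<..<T} \<longrightarrow> \<bar>f s\<bar> \<le> Linf_norm T f"
    using ae unfolding eq by (simp add: AE_restrict_Ioo_iff)
  then show ?thesis
    using t by (intro AE_Ioo_right_limit_le[of "\<lambda>s. \<bar>f s\<bar>"] tendsto_rabs rcb_tendsto[OF f]) auto
qed

section \<open>Stochastic integrals of deterministic integrands\<close>

abbreviation leb :: "real \<Rightarrow> real measure" where
  "leb t \<equiv> restrict_space lborel {0..t}"

lemma finite_measure_leb: "finite_measure (leb t)"
  by (intro finite_measure_restrict_space finite_measureI) (auto simp: emeasure_restrict_space emeasure_lborel_Icc_eq)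

lemma integral_leb:
  fixes f :: "real \<Rightarrow> real"
  shows "(\<integral>s. f s \<partial>leb t) = (LINT s:{0..t}|lborel. f s)"
  by (simp add: integral_restrict_space set_lebesgue_integral_def)

lemma sets_leb: "sets (leb t) = sets (restrict_space borel {0..t})"
  by (intro sets_restrict_space_cong) simp

lemma integral_process_measurable:
  fixes X :: "real \<Rightarrow> 'a \<Rightarrow> real"
  assumes t: "0 \<le> t" and "\<And>s. 0 \<le> s \<Longrightarrow> s \<le> t \<Longrightarrow> X s \<in> borel_measurable N"
    and "\<And>s \<omega>. 0 \<le> s \<Longrightarrow> s < t \<Longrightarrow> \<omega> \<in> space N \<Longrightarrow> ((\<lambda>s. X s \<omega>) \<longlongrightarrow> X s \<omega>) (at_right s)"
  shows "(\<lambda>\<omega>. LINT s:{0..t}|lborel. X s \<omega>) \<in> borel_measurable N"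
proof -
  interpret L: finite_measure "leb t" by (rule finite_measure_leb)
  have "(\<lambda>(s, \<omega>). X s \<omega>) \<in> borel_measurable (restrict_space borel {0..t} \<Otimes>\<^sub>M N)"
    by (rule rc_pair_measurable[OF assms])
  then have "(\<lambda>(s, \<omega>). X s \<omega>) \<in> borel_measurable (leb t \<Otimes>\<^sub>M N)"
    by (simp cong: measurable_cong_sets add: sets_pair_measure_cong[OF sets_leb refl])
  then have "(\<lambda>(\<omega>, s). X s \<omega>) \<in> borel_measurable (N \<Otimes>\<^sub>M leb t)"
    by (subst measurable_pair_swap_iff) (simp add: case_prod_beta)
  then have "(\<lambda>\<omega>. \<integral>s. X s \<omega> \<partial>leb t) \<in> borel_measurable N"
    by (rule L.borel_measurable_lebesgue_integral)
  then show ?thesis by (simp add: integral_leb)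
qed

context filtered_prob_space
begin

lemma space_F: "t \<in> {0..T} \<Longrightarrow> space (F t) = space M"
  using subalgebra_F[of t] by (simp add: subalgebra_def)

lemma measurable_F_M: "X \<in> borel_measurable (F t) \<Longrightarrow> t \<in> {0..T} \<Longrightarrow> X \<in> borel_measurable M"
  using measurable_from_subalg[OF subalgebra_F] by blast

lemma subalgebra_F_F: "0 \<le> s \<Longrightarrow> s \<le> t \<Longrightarrow> t \<le> T \<Longrightarrow> subalgebra (F t) (F s)"
  using space_F[of s] space_F[of t] F_mono[of s t] by (auto simp: subalgebra_def)

lemma measurable_F_mono:
  assumes "X \<in> borel_measurable (F s)" "0 \<le> s" "s \<le> t" "t \<le> T"
  shows "X \<in> borel_measurable (F t)"
  using measurable_from_subalg[OF subalgebra_F_F[OF assms(2-4)] assms(1)] .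

lemma cadlag_adaptedD:
  assumes "cadlag_adapted X"
  shows "0 \<le> t \<Longrightarrow> t \<le> T \<Longrightarrow> X t \<in> borel_measurable (F t)"
    and "0 \<le> t \<Longrightarrow> t \<le> T \<Longrightarrow> X t \<in> borel_measurable M"
    and "\<omega> \<in> space M \<Longrightarrow> cadlag_on T (\<lambda>t. X t \<omega>)"
    and "\<omega> \<in> space M \<Longrightarrow> rcb T (\<lambda>t. X t \<omega>)"
  using assms measurable_F_M[of "X t" t] cadlag_on_rcb unfolding cadlag_adapted_def by auto

lemma weighted_integral_measurable:
  assumes X: "\<And>s. 0 \<le> s \<Longrightarrow> s \<le> t \<Longrightarrow> X s \<in> borel_measurable (F s)"
    "\<And>\<omega>. \<omega> \<in> space M \<Longrightarrow> rcb T (\<lambda>t. X t \<omega>)"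
    and f: "rcb T f" and t: "0 \<le> t" "t \<le> T"
  shows "(\<lambda>\<omega>. LINT s:{0..t}|lborel. f s * X s \<omega>) \<in> borel_measurable (F t)"
proof (rule integral_process_measurable)
  show "(\<lambda>\<omega>. f s * X s \<omega>) \<in> borel_measurable (F t)" if "0 \<le> s" "s \<le> t" for s
    using measurable_F_mono[OF X(1)] that t by (intro borel_measurable_times borel_measurable_const) auto
  show "((\<lambda>s. f s * X s \<omega>) \<longlongrightarrow> f s * X s \<omega>) (at_right s)" if "0 \<le> s" "s < t" "\<omega> \<in> space (F t)" for s \<omega>
    using that t space_F[of t] by (intro rcb_tendsto[OF rcb_mult[OF f X(2)]]) auto
qed (rule t)

text \<open>All integrands of the problem have a bounded derivative \<open>f'\<close>, so integration by parts gives the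
  stochastic integral path by path and no general integration theory is needed.\<close>

definition ibp :: "(real \<Rightarrow> real) \<Rightarrow> (real \<Rightarrow> real) \<Rightarrow> (real \<Rightarrow> 'a \<Rightarrow> real) \<Rightarrow> real \<Rightarrow> 'a \<Rightarrow> real" where
  "ibp f f' X t \<omega> = f t * X t \<omega> - f 0 * X 0 \<omega> - (LINT s:{0..t}|lborel. f' s * X s \<omega>)"

lemma ibp_cadlag_adapted:
  assumes X: "cadlag_adapted X" and f: "continuous_on {0..T} f" and f': "rcb T f'"
  shows "cadlag_adapted (ibp f f' X)"
  unfolding cadlag_adapted_def
proof (intro conjI ballI)
  fix t assume t: "t \<in> {0..T}"
  have [measurable]: "X t \<in> borel_measurable (F t)" "X 0 \<in> borel_measurable (F t)"
    "(\<lambda>\<omega>. LINT s:{0..t}|lborel. f' s * X s \<omega>) \<in> borel_measurable (F t)"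
    using t f' cadlag_adaptedD(1)[OF X, of t] measurable_F_mono[OF cadlag_adaptedD(1)[OF X, of 0], of t]
    by (auto intro!: weighted_integral_measurable cadlag_adaptedD[OF X])
  show "ibp f f' X t \<in> borel_measurable (F t)"
    unfolding ibp_def[abs_def] by measurable
next
  fix \<omega> assume \<omega>: "\<omega> \<in> space M"
  have "rcb T (\<lambda>s. f' s * X s \<omega>)" by (rule rcb_mult[OF f' cadlag_adaptedD(4)[OF X \<omega>]])
  then show "cadlag_on T (\<lambda>t. ibp f f' X t \<omega>)"
    unfolding ibp_def using T_pos
    by (intro cadlag_on_diff cadlag_on_mult cadlag_on_const cadlag_on_continuous f cadlag_adaptedD(3)[OF X \<omega>]
        rcb_integral_continuous) auto
qed

lemma prob_gt_tendsto_zero: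
  fixes E :: "nat \<Rightarrow> 'a \<Rightarrow> real"
  assumes [measurable]: "\<And>k. E k \<in> borel_measurable M"
    and lim: "\<And>\<omega>. \<omega> \<in> space M \<Longrightarrow> (\<lambda>k. E k \<omega>) \<longlonglongrightarrow> 0" and e: "e > 0"
  shows "(\<lambda>k. prob {\<omega>\<in>space M. e < \<bar>E k \<omega>\<bar>}) \<longlonglongrightarrow> 0"
proof -
  have "(\<lambda>k. LINT \<omega>|M. indicat_real {\<omega>\<in>space M. e < \<bar>E k \<omega>\<bar>} \<omega>) \<longlonglongrightarrow> (LINT \<omega>|M. 0)"
  proof (rule integral_dominated_convergence[where w = "\<lambda>_. 1"])
    show "AE \<omega> in M. (\<lambda>k. indicat_real {\<omega>\<in>space M. e < \<bar>E k \<omega>\<bar>} \<omega>) \<longlonglongrightarrow> 0"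
    proof (rule AE_I2)
      fix \<omega> assume "\<omega> \<in> space M"
      from tendsto_rabs[OF lim[OF this]] have "eventually (\<lambda>k. \<bar>E k \<omega>\<bar> < e) sequentially"
        using e by (intro order_tendstoD) auto
      then have "eventually (\<lambda>k. indicat_real {\<omega>\<in>space M. e < \<bar>E k \<omega>\<bar>} \<omega> = 0) sequentially"
        by eventually_elim auto
      then show "(\<lambda>k. indicat_real {\<omega>\<in>space M. e < \<bar>E k \<omega>\<bar>} \<omega>) \<longlonglongrightarrow> 0" by (rule tendsto_eventually)
    qed
    show "AE \<omega> in M. norm (indicat_real {\<omega>\<in>space M. e < \<bar>E k \<omega>\<bar>} \<omega>) \<le> 1" for k
      by (intro AE_I2) (auto simp: indicator_def)
  qed auto
  then show ?thesis by simp
qed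

text \<open>\<open>is_stoch_int\<close> asks for one mesh size that is good for all partitions. If
  none existed, there would be a bad partition of mesh below \<open>1 / (k + 1)\<close> for every
  \<open>k\<close>; yet along this sequence the sums converge on every path, hence in
  probability.\<close>

lemma is_stoch_int_ibp:
  assumes X: "cadlag_adapted X" and f': "rcb T f'"
    and f: "\<And>s. 0 \<le> s \<Longrightarrow> s \<le> T \<Longrightarrow> f s = f 0 + (LINT r:{0..s}|lborel. f' r)"
  shows "is_stoch_int f X (ibp f f' X)"
proof -
  have "continuous_on {0..T} (\<lambda>s. f 0 + (LINT r:{0..s}|lborel. f' r))"
    using T_pos by (intro continuous_intros rcb_integral_continuous f') auto
  then have f_cont: "continuous_on {0..T} f"
    by (rule continuous_on_eq) (rule f[symmetric], auto)
  have I: "cadlag_adapted (ibp f f' X)" by (rule ibp_cadlag_adapted[OF X f_cont f'])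
  show ?thesis unfolding is_stoch_int_def
  proof (intro conjI I ballI allI impI)
    fix t e :: real assume t: "t \<in> {0..T}" and e: "e > 0"
    define E where "E n p \<omega> = (\<Sum>i<n. f (p i) * (X (p (Suc i)) \<omega> - X (p i) \<omega>)) - ibp f f' X t \<omega>"
      for n :: nat and p :: "nat \<Rightarrow> real" and \<omega>
    define P where "P d n p \<longleftrightarrow> is_partition t n p \<and> (\<forall>i<n. p (Suc i) - p i < d)" for d n p
    have "\<exists>d>0. \<forall>n p. P d n p \<longrightarrow> prob {\<omega>\<in>space M. e < \<bar>E n p \<omega>\<bar>} < e"
    proof (rule ccontr)
      assume neg: "\<not> ?thesis"
      have "\<exists>n p. P (1 / real (Suc k)) n p \<and> e \<le> prob {\<omega>\<in>space M. e < \<bar>E n p \<omega>\<bar>}" for k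
      proof -
        have "0 < 1 / real (Suc k)" by simp
        with neg have "\<not> (\<forall>n p. P (1 / real (Suc k)) n p \<longrightarrow> prob {\<omega>\<in>space M. e < \<bar>E n p \<omega>\<bar>} < e)" by blast
        then show ?thesis by (auto simp: not_less)
      qed
      then obtain n p where np: "\<And>k. P (1 / real (Suc k)) (n k) (p k)"
        "\<And>k. e \<le> prob {\<omega>\<in>space M. e < \<bar>E (n k) (p k) \<omega>\<bar>}" by metis
      have part: "is_partition t (n k) (p k)" for k using np(1)[of k] by (simp add: P_def)
      have mesh: "p k (Suc i) - p k i < 1 / real (Suc k)" if "i < n k" for k i using np(1)[of k] that by (simp add: P_def)
      have "(\<lambda>k. prob {\<omega>\<in>space M. e < \<bar>E (n k) (p k) \<omega>\<bar>}) \<longlonglongrightarrow> 0"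
      proof (rule prob_gt_tendsto_zero[OF _ _ e])
        fix k
        have "X (p k i) \<in> borel_measurable M" if "i \<le> n k" for i
          using is_partition_le[OF part, of 0 i k] is_partition_le[OF part, of i "n k" k] part[of k] that t
          by (intro cadlag_adaptedD(2)[OF X]) (auto simp: is_partition_def)
        moreover have "ibp f f' X t \<in> borel_measurable M" using cadlag_adaptedD(2)[OF I] t by auto
        ultimately show "E (n k) (p k) \<in> borel_measurable M"
          unfolding E_def[abs_def]
          by (intro borel_measurable_diff borel_measurable_sum borel_measurable_times borel_measurable_const) auto
      next
        fix \<omega> assume \<omega>: "\<omega> \<in> space M"
        have "(\<lambda>k. \<Sum>i<n k. f (p k i) * (X (p k (Suc i)) \<omega> - X (p k i) \<omega>)) \<longlonglongrightarrow> ibp f f' X t \<omega>"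
          unfolding ibp_def using t
          by (intro Riemann_sums_by_parts[where T=T] f f' cadlag_adaptedD(4)[OF X \<omega>] part mesh) auto
        then show "(\<lambda>k. E (n k) (p k) \<omega>) \<longlonglongrightarrow> 0"
          unfolding E_def by (rule LIM_zero)
      qed
      then have "e \<le> 0" by (rule LIMSEQ_le_const) (use np in auto)
      with e show False by simp
    qed
    then show "\<exists>d>0. \<forall>n p. is_partition t n p \<and> (\<forall>i<n. p (Suc i) - p i < d) \<longrightarrow>
      prob {\<omega>\<in>space M. e < \<bar>(\<Sum>i<n. f (p i) * (X (p (Suc i)) \<omega> - X (p i) \<omega>)) - ibp f f' X t \<omega>\<bar>} < e"
      unfolding P_def E_def .
  qed
qed

section \<open>Identification of the chosen stochastic integral\<close>

lemma ex_partition_mesh: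
  assumes "0 \<le> t" "0 < (d::real)"
  shows "\<exists>n p. is_partition t n p \<and> (\<forall>i<n. p (Suc i) - p i < d)"
proof -
  obtain n :: nat where n: "t / d < real n" using reals_Archimedean2 by blast
  then have n0: "0 < real n" using assms by (meson divide_nonneg_pos le_less_trans)
  have "t / real n < d" using n n0 assms by (simp add: field_simps)
  then show ?thesis using n0 assms
    by (intro exI[of _ n] exI[of _ "\<lambda>i. real i * t / real n"]) (auto simp: is_partition_def field_simps)
qed

text \<open>Both candidates are close, with high probability, to the Riemann sum of one common
  partition that is fine enough for both.\<close>

lemma is_stoch_int_unique:
  assumes X: "cadlag_adapted X" and I: "is_stoch_int f X I" and I': "is_stoch_int f X I'" and t: "t \<in> {0..T}"
  shows "AE \<omega> in M. I t \<omega> = I' t \<omega>"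
proof -
  have [measurable]: "I t \<in> borel_measurable M" "I' t \<in> borel_measurable M"
    using cadlag_adaptedD(2) I I' t by (auto simp: is_stoch_int_def)
  have le: "prob {\<omega>\<in>space M. c < \<bar>I t \<omega> - I' t \<omega>\<bar>} \<le> 2 * e" if e: "0 < e" "2 * e \<le> c" for e c
  proof -
    define S where "S n p \<omega> = (\<Sum>i<n. f (p i) * (X (p (Suc i)) \<omega> - X (p i) \<omega>))"
      for n :: nat and p :: "nat \<Rightarrow> real" and \<omega>
    obtain d where d: "d > 0" "\<And>n p. is_partition t n p \<Longrightarrow> (\<forall>i<n. p (Suc i) - p i < d) \<Longrightarrow>
        prob {\<omega>\<in>space M. \<bar>S n p \<omega> - I t \<omega>\<bar> > e} < e"
      using I e t unfolding is_stoch_int_def S_def by blast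
    obtain d' where d': "d' > 0" "\<And>n p. is_partition t n p \<Longrightarrow> (\<forall>i<n. p (Suc i) - p i < d') \<Longrightarrow>
        prob {\<omega>\<in>space M. \<bar>S n p \<omega> - I' t \<omega>\<bar> > e} < e"
      using I' e t unfolding is_stoch_int_def S_def by blast
    obtain n p where np: "is_partition t n p" "\<forall>i<n. p (Suc i) - p i < min d d'"
      using ex_partition_mesh[of t "min d d'"] d d' t by auto
    have 1: "prob {\<omega>\<in>space M. \<bar>S n p \<omega> - I t \<omega>\<bar> > e} < e" "prob {\<omega>\<in>space M. \<bar>S n p \<omega> - I' t \<omega>\<bar> > e} < e"
      using d(2)[OF np(1)] d'(2)[OF np(1)] np(2) by auto
    have "X (p i) \<in> borel_measurable M" if "i \<le> n" for i
      using is_partition_le[OF np(1), of 0 i] is_partition_le[OF np(1), of i n] np(1) that t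
      by (intro cadlag_adaptedD(2)[OF X]) (auto simp: is_partition_def)
    then have [measurable]: "S n p \<in> borel_measurable M"
      unfolding S_def[abs_def]
      by (intro borel_measurable_diff borel_measurable_sum borel_measurable_times borel_measurable_const) auto
    have "prob {\<omega>\<in>space M. c < \<bar>I t \<omega> - I' t \<omega>\<bar>}
      \<le> prob ({\<omega>\<in>space M. \<bar>S n p \<omega> - I t \<omega>\<bar> > e} \<union> {\<omega>\<in>space M. \<bar>S n p \<omega> - I' t \<omega>\<bar> > e})"
      using e by (intro finite_measure_mono) auto
    also have "\<dots> \<le> prob {\<omega>\<in>space M. \<bar>S n p \<omega> - I t \<omega>\<bar> > e} + prob {\<omega>\<in>space M. \<bar>S n p \<omega> - I' t \<omega>\<bar> > e}"
      by (rule measure_Un_le) auto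
    finally show ?thesis using 1 by simp
  qed
  have zero: "prob {\<omega>\<in>space M. c < \<bar>I t \<omega> - I' t \<omega>\<bar>} = 0" if "c > 0" for c
  proof (rule ccontr)
    define q where "q = prob {\<omega>\<in>space M. c < \<bar>I t \<omega> - I' t \<omega>\<bar>}"
    assume "\<not> ?thesis"
    then have q: "q > 0" by (simp add: q_def zero_less_measure_iff)
    \<comment> \<open>The first entry meets the constraint \<open>2 * e \<le> c\<close>, the second
      forces \<open>q \<le> q / 2\<close>.\<close>
    have "q \<le> 2 * min (c / 2) (q / 4)" unfolding q_def by (rule le) (use that q in \<open>auto simp: q_def[symmetric]\<close>)
    then show False using q by (simp add: min_def split: if_splits)
  qed
  have "AE \<omega> in M. \<bar>I t \<omega> - I' t \<omega>\<bar> \<le> 1 / real (Suc k)" for k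
    using zero[of "1 / real (Suc k)"] by (subst AE_iff_measurable[OF _ refl]) (auto simp: emeasure_eq_measure not_le)
  then have "AE \<omega> in M. \<forall>k. \<bar>I t \<omega> - I' t \<omega>\<bar> \<le> 1 / real (Suc k)" by (simp add: AE_all_countable)
  then show ?thesis
  proof eventually_elim
    case (elim \<omega>)
    have "(\<lambda>k. 1 / real (Suc k)) \<longlonglongrightarrow> 0" using LIMSEQ_inverse_real_of_nat by (simp add: inverse_eq_divide)
    then have "\<bar>I t \<omega> - I' t \<omega>\<bar> \<le> 0" by (rule LIMSEQ_le_const) (use elim in auto)
    then show ?case by simp
  qed
qed

lemma cadlag_indistinguishable:
  assumes X: "\<And>\<omega>. \<omega> \<in> space M \<Longrightarrow> rcb T (\<lambda>t. X t \<omega>)" and Y: "\<And>\<omega>. \<omega> \<in> space M \<Longrightarrow> rcb T (\<lambda>t. Y t \<omega>)"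
    and eq: "\<And>t. t \<in> {0..T} \<Longrightarrow> AE \<omega> in M. X t \<omega> = Y t \<omega>"
  shows "AE \<omega> in M. \<forall>t\<in>{0..T}. X t \<omega> = Y t \<omega>"
proof -
  \<comment> \<open>\<open>T\<close> is added because it cannot be approached from the right inside
    the interval.\<close>
  define S where "S = insert T (\<rat> \<inter> {0..T})"
  have "countable S" unfolding S_def by (auto intro!: countable_Int1 countable_rat)
  then have "AE \<omega> in M. \<forall>t\<in>S. X t \<omega> = Y t \<omega>"
    using eq T_pos by (subst AE_ball_countable) (auto simp: S_def)
  then show ?thesis using AE_space
  proof eventually_elim
    case (elim \<omega>)
    show ?case
    proof
      fix t assume t: "t \<in> {0..T}"
      show "X t \<omega> = Y t \<omega>"
      proof (cases "t = T")
        case True then show ?thesis using elim by (auto simp: S_def)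
      next
        case False
        then have t': "0 \<le> t" "t < T" using t by auto
        have "((\<lambda>s. X s \<omega> - Y s \<omega>) \<longlongrightarrow> X t \<omega> - Y t \<omega>) (at_right t)"
          using elim t' by (intro tendsto_diff rcb_tendsto[where T=T] X Y) auto
        then show ?thesis
        proof (rule contrapos_pp)
          assume ne: "X t \<omega> \<noteq> Y t \<omega>"
          show "\<not> ((\<lambda>s. X s \<omega> - Y s \<omega>) \<longlongrightarrow> X t \<omega> - Y t \<omega>) (at_right t)"
          proof
            assume "((\<lambda>s. X s \<omega> - Y s \<omega>) \<longlongrightarrow> X t \<omega> - Y t \<omega>) (at_right t)"
            from tendsto_imp_eventually_ne[OF this, of 0] ne
            have "eventually (\<lambda>s. X s \<omega> - Y s \<omega> \<noteq> 0) (at_right t)" by simp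
            then obtain b where b: "b > t" "\<And>s. t < s \<Longrightarrow> s < b \<Longrightarrow> X s \<omega> \<noteq> Y s \<omega>"
              by (auto simp: eventually_at_right_field)
            obtain q where "q \<in> \<rat>" "t < q" "q < min b T" using Rats_dense_in_real[of t "min b T"] b t' by auto
            then show False using b(2)[of q] elim t' by (auto simp: S_def)
          qed
        qed
      qed
    qed
  qed
qed

text \<open>The integration-by-parts process witnesses the choice; uniqueness then identifies
  whatever version \<open>SOME\<close> returns with it, and right-continuity does so at all times
  simultaneously.\<close>

lemma stoch_int_eq:
  assumes X: "cadlag_adapted X" and f': "rcb T f'"
    and f: "\<And>s. 0 \<le> s \<Longrightarrow> s \<le> T \<Longrightarrow> f s = f 0 + (LINT r:{0..s}|lborel. f' r)"
  shows "cadlag_adapted (stoch_int f X)"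
    and "AE \<omega> in M. \<forall>t\<in>{0..T}. stoch_int f X t \<omega> = ibp f f' X t \<omega>"
proof -
  have I: "is_stoch_int f X (ibp f f' X)" by (rule is_stoch_int_ibp[OF assms])
  then have S: "is_stoch_int f X (stoch_int f X)" unfolding stoch_int_def by (rule someI[of "is_stoch_int f X"])
  then show "cadlag_adapted (stoch_int f X)" by (simp add: is_stoch_int_def)
  then show "AE \<omega> in M. \<forall>t\<in>{0..T}. stoch_int f X t \<omega> = ibp f f' X t \<omega>"
    using I by (intro cadlag_indistinguishable is_stoch_int_unique[OF X S I])
      (auto simp: is_stoch_int_def intro: cadlag_adaptedD(4))
qed

end

section \<open>The state equation\<close>

text \<open>\<open>cadlag_on\<close> demands no continuity at \<open>T\<close>, so the value there
  is free. This covers the optimizer and its state, which follow a formula before \<open>T\<close>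
  and may jump at \<open>T\<close>.\<close>

lemma cadlag_on_eq_before:
  assumes f: "cadlag_on T f" and eq: "\<And>t. 0 \<le> t \<Longrightarrow> t < T \<Longrightarrow> g t = f t"
  shows "cadlag_on T g"
  unfolding cadlag_on_def
proof (intro conjI ballI)
  fix t assume t: "t \<in> {0..<T}"
  have "eventually (\<lambda>s. f s = g s) (at_right t)"
    unfolding eventually_at_right_field using eq t by (intro exI[of _ T]) auto
  moreover have "(f \<longlongrightarrow> g t) (at_right t)" using f t eq by (auto simp: cadlag_on_def)
  ultimately show "(g \<longlongrightarrow> g t) (at_right t)" by (rule Lim_transform_eventually[rotated])
next
  fix t assume t: "t \<in> {0<..T}"
  then obtain l where l: "(f \<longlongrightarrow> l) (at_left t)" using f unfolding cadlag_on_def by metis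
  have "eventually (\<lambda>s. f s = g s) (at_left t)"
    unfolding eventually_at_left_field using eq t by (intro exI[of _ 0]) auto
  from Lim_transform_eventually[OF l this] show "\<exists>l. (g \<longlongrightarrow> l) (at_left t)" by blast
qed

lemma set_integral_uminus:
  fixes f :: "'a \<Rightarrow> real"
  shows "(LINT x:A|N. - f x) = - (LINT x:A|N. f x)"
  by (simp add: set_lebesgue_integral_def)

context execution_problem
begin

lemma T_ge0: "0 \<le> T" using T_pos by simp

lemma lam_lower: obtains c where "0 < c" "\<And>t. 0 \<le> t \<Longrightarrow> t \<le> T \<Longrightarrow> c \<le> lam t"
  using lam_bounded_below by auto

lemma lam_pos: "0 \<le> t \<Longrightarrow> t \<le> T \<Longrightarrow> 0 < lam t"
  by (rule lam_lower) (auto intro: less_le_trans)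

lemma lamdot_rcb: "rcb T lamdot" and bet_rcb: "rcb T bet"
  using lamdot_cadlag bet_cadlag by (auto intro: cadlag_on_rcb)

lemma lam_FTC: "0 \<le> t \<Longrightarrow> t \<le> T \<Longrightarrow> lam t = lam 0 + (LINT r:{0..t}|lborel. lamdot r)"
  by (rule abs_continuous_FTC[OF lam_ac lamdot_rcb lam_deriv])

lemma lam_cont: "continuous_on {0..T} lam"
proof -
  have "continuous_on {0..T} (\<lambda>t. lam 0 + (LINT r:{0..t}|lborel. lamdot r))"
    using T_ge0 by (intro continuous_intros rcb_integral_continuous lamdot_rcb) auto
  then show ?thesis by (rule continuous_on_eq) (rule lam_FTC[symmetric], auto)
qed

lemma lam_rcb: "rcb T lam" and lam_cadlag: "cadlag_on T lam"
  using lam_cont by (auto intro: rcb_continuous cadlag_on_continuous)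

lemma lam_right_deriv:
  assumes "0 \<le> t" "t < T" shows "(lam has_real_derivative lamdot t) (at_right t)"
proof (rule has_real_derivative_at_right_cong[OF _ assms(2)])
  show "((\<lambda>t. lam 0 + (LINT r:{0..t}|lborel. lamdot r)) has_real_derivative lamdot t) (at_right t)"
    using DERIV_add[OF DERIV_const rcb_integral_right_deriv[OF lamdot_rcb assms]] by simp
qed (use assms in \<open>auto intro: lam_FTC\<close>)

lemma coercive': obtains c where "0 < c" "\<And>t. 0 \<le> t \<Longrightarrow> t \<le> T \<Longrightarrow> c \<le> 2 * bet t + gamdot t"
proof -
  from coercive obtain c where c: "0 < c" "\<And>t. t \<in> {0..T} \<Longrightarrow> c < 2 * bet t + lamdot t / lam t" by auto
  show ?thesis by (rule that[OF c(1)]) (use c(2) in \<open>auto simp: gamdot_def intro: less_imp_le\<close>)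
qed

lemma coercive_pos: "0 \<le> t \<Longrightarrow> t \<le> T \<Longrightarrow> 0 < 2 * bet t + gamdot t"
  by (rule coercive') (auto intro: less_le_trans)

text \<open>Coefficient with which the past state enters the inventory: from
  \<open>dQ = (dY + bet * Y dt) / lam\<close> and the product rule for \<open>Y / lam\<close>, the
  inventory is \<open>Y / lam\<close> plus the integral of \<open>rho * Y\<close>, up to a
  constant.\<close>

definition rho :: "real \<Rightarrow> real" where "rho t = (bet t + gamdot t) / lam t"

lemma gamdot_cadlag: "cadlag_on T gamdot"
  unfolding gamdot_def[abs_def]
  by (rule lam_lower, rule cadlag_on_divide[OF lamdot_cadlag lam_cadlag]) auto

lemma rho_cadlag: "cadlag_on T rho"
  unfolding rho_def[abs_def]
  by (rule lam_lower, rule cadlag_on_divide[OF cadlag_on_add[OF bet_cadlag gamdot_cadlag] lam_cadlag]) auto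

lemma eta_cadlag: "cadlag_on T eta"
  unfolding eta_def[abs_def]
  by (rule coercive', rule cadlag_on_divide[OF cadlag_on_add[OF bet_cadlag gamdot_cadlag]
        cadlag_on_add[OF cadlag_on_mult[OF cadlag_on_const bet_cadlag] gamdot_cadlag]]) auto

lemma rho_eta: "rho t * eta t = thetadot t"
  by (simp add: rho_def eta_def thetadot_def power2_eq_square)

lemma thetadot_cadlag: "cadlag_on T thetadot"
  using cadlag_on_mult[OF rho_cadlag eta_cadlag] by (simp add: rho_eta)

lemmas rho_rcb = cadlag_on_rcb[OF rho_cadlag] and eta_rcb = cadlag_on_rcb[OF eta_cadlag]
  and thetadot_rcb = cadlag_on_rcb[OF thetadot_cadlag] and gamdot_rcb = cadlag_on_rcb[OF gamdot_cadlag]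

lemma thetadot_nonneg: "0 \<le> t \<Longrightarrow> t \<le> T \<Longrightarrow> 0 \<le> thetadot t"
  using lam_pos[of t] coercive_pos[of t] by (simp add: thetadot_def)

section \<open>Explicit solution of the state equation\<close>

definition Bint :: "real \<Rightarrow> real" where "Bint t = (LINT s:{0..t}|lborel. bet s)"

text \<open>Variation of constants for the state equation, after an integration by parts has removed \<open>dQ\<close>.\<close>

definition response :: "real \<Rightarrow> (real \<Rightarrow> real) \<Rightarrow> real \<Rightarrow> real" where
  "response y0 q t = exp (- Bint t) * (y0 - (LINT s:{0..t}|lborel. exp (Bint s) * (lam s * bet s + lamdot s) * q s))"

text \<open>The jumps of \<open>q\<close> enter only through \<open>lam t * q t\<close>; the
  remaining part \<open>response\<close> is continuous, which opens it to calculus with right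
  derivatives.\<close>

definition state_sol :: "real \<Rightarrow> (real \<Rightarrow> real) \<Rightarrow> real \<Rightarrow> real" where
  "state_sol y0 q t = lam t * q t + response y0 q t"

lemma Bint_cont: "continuous_on {0..T} Bint"
  unfolding Bint_def[abs_def] using T_ge0 by (intro rcb_integral_continuous bet_rcb) auto

lemma Bint_right_deriv: "0 \<le> t \<Longrightarrow> t < T \<Longrightarrow> (Bint has_real_derivative bet t) (at_right t)"
  unfolding Bint_def[abs_def] by (rule rcb_integral_right_deriv[OF bet_rcb])

lemma Bint_0: "Bint 0 = 0" using set_integral_Icc_self[of 0 bet] by (simp add: Bint_def)

lemma Bint_mono: "0 \<le> s \<Longrightarrow> s \<le> t \<Longrightarrow> t \<le> T \<Longrightarrow> Bint s \<le> Bint t"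
proof -
  assume st: "0 \<le> s" "s \<le> t" "t \<le> T"
  have i: "set_integrable lborel {0..t} bet" using rcb_integrable[OF bet_rcb T_ge0] st by auto
  have "0 \<le> (LINT r:{s<..t}|lborel. bet r)"
    unfolding set_lebesgue_integral_def using st bet_pos
    by (intro integral_nonneg_AE AE_I2) (auto simp: indicator_def intro: less_imp_le)
  then show ?thesis using set_integral_Icc_split[OF i st(1,2)] by (simp add: Bint_def)
qed

definition kern :: "real \<Rightarrow> real" where "kern s = exp (Bint s) * (lam s * bet s + lamdot s)"

lemma kern_rcb: "rcb T kern"
  unfolding kern_def[abs_def]
  by (intro rcb_mult rcb_add lam_rcb bet_rcb lamdot_rcb rcb_continuous[OF continuous_on_exp[OF Bint_cont]])

lemma response_cont: assumes "rcb T q" shows "continuous_on {0..T} (response y0 q)"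
  unfolding response_def[abs_def] kern_def[symmetric]
  using T_ge0 by (intro continuous_intros Bint_cont rcb_integral_continuous rcb_mult kern_rcb assms) auto

lemma response_right_deriv:
  assumes q: "rcb T q" and t: "0 \<le> t" "t < T"
  shows "(response y0 q has_real_derivative - (bet t * state_sol y0 q t + lamdot t * q t)) (at_right t)"
proof -
  have 1: "((\<lambda>t. LINT s:{0..t}|lborel. kern s * q s) has_real_derivative kern t * q t) (at_right t)"
    by (rule rcb_integral_right_deriv[OF rcb_mult[OF kern_rcb q] t])
  have "((\<lambda>t. exp (- Bint t) * (y0 - (LINT s:{0..t}|lborel. kern s * q s))) has_real_derivative
    - bet t * exp (- Bint t) * (y0 - (LINT s:{0..t}|lborel. kern s * q s)) + exp (- Bint t) * (- (kern t * q t))) (at_right t)"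
    by (rule derivative_eq_intros 1 Bint_right_deriv[OF t] refl | simp add: algebra_simps)+
  moreover have "- bet t * exp (- Bint t) * (y0 - (LINT s:{0..t}|lborel. kern s * q s)) + exp (- Bint t) * (- (kern t * q t))
    = - (bet t * state_sol y0 q t + lamdot t * q t)"
  proof -
    have "exp (- Bint t) * (kern t * q t) = (lam t * bet t + lamdot t) * q t"
      by (simp add: kern_def mult.assoc[symmetric] exp_minus)
    then show ?thesis by (simp add: state_sol_def response_def kern_def algebra_simps)
  qed
  ultimately show ?thesis by (simp add: response_def[abs_def] kern_def)
qed

lemma state_sol_rcb: "rcb T q \<Longrightarrow> rcb T (state_sol y0 q)"
  unfolding state_sol_def[abs_def] by (intro rcb_add rcb_mult lam_rcb rcb_continuous[OF response_cont])

lemma response_0: "response y0 q 0 = y0"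
  using set_integral_Icc_self[of 0 "\<lambda>s. exp (Bint s) * (lam s * bet s + lamdot s) * q s"] by (simp add: response_def Bint_0)

lemma state_sol_solves:
  assumes q: "rcb T q" and t: "0 \<le> t" "t \<le> T"
  shows "state_sol y0 q t = y0 - (LINT s:{0..t}|lborel. bet s * state_sol y0 q s) + lam t * q t - (LINT s:{0..t}|lborel. lamdot s * q s)"
proof -
  have r: "rcb T (\<lambda>s. bet s * state_sol y0 q s)" "rcb T (\<lambda>s. lamdot s * q s)"
    by (intro rcb_mult bet_rcb state_sol_rcb lamdot_rcb q)+
  have "response y0 q t = response y0 q 0 + (LINT s:{0..t}|lborel. - (bet s * state_sol y0 q s + lamdot s * q s))"
    by (rule right_deriv_FTC[OF response_cont[OF q] rcb_minus[OF rcb_add[OF r]] response_right_deriv[OF q] t])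
  also have "\<dots> = y0 - ((LINT s:{0..t}|lborel. bet s * state_sol y0 q s) + (LINT s:{0..t}|lborel. lamdot s * q s))"
    using rcb_integrable[OF r(1) T_ge0] rcb_integrable[OF r(2) T_ge0] t
    by (subst set_integral_add(2)[symmetric]) (auto simp: response_0 set_integral_uminus simp del: minus_add_distrib)
  finally show ?thesis by (simp add: state_sol_def)
qed

lemma state_sol_unique:
  assumes q: "rcb T q" and z: "rcb T z"
    and eq: "\<And>t. 0 \<le> t \<Longrightarrow> t \<le> T \<Longrightarrow>
      z t = y0 - (LINT s:{0..t}|lborel. bet s * z s) + lam t * q t - (LINT s:{0..t}|lborel. lamdot s * q s)"
    and t: "0 \<le> t" "t \<le> T"
  shows "z t = state_sol y0 q t"
proof -
  have "z t - state_sol y0 q t = 0"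
  proof (rule Volterra_zero[OF bet_rcb rcb_diff[OF z state_sol_rcb[OF q]] _ t])
    fix r assume r: "0 \<le> r" "r \<le> T"
    have "set_integrable lborel {0..r} (\<lambda>s. bet s * z s)" "set_integrable lborel {0..r} (\<lambda>s. bet s * state_sol y0 q s)"
      using r by (auto intro!: rcb_integrable[OF _ T_ge0] rcb_mult bet_rcb z state_sol_rcb q)
    then have "(LINT s:{0..r}|lborel. bet s * (z s - state_sol y0 q s)) =
      (LINT s:{0..r}|lborel. bet s * z s) - (LINT s:{0..r}|lborel. bet s * state_sol y0 q s)"
      by (subst set_integral_diff(2)[symmetric]) (auto simp: algebra_simps)
    then show "z r - state_sol y0 q r = - (LINT s:{0..r}|lborel. bet s * (z s - state_sol y0 q s))"
      using eq[OF r] state_sol_solves[OF q r, of y0] by simp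
  qed
  then show ?thesis by simp
qed

text \<open>The terms in \<open>q\<close> cancel when \<open>response / lam\<close> is
  differentiated, so the inventory can be recovered from the state alone. At \<open>T\<close>, with
  zero terminal inventory, this is the constraint that enters the first-order condition.\<close>

lemma state_sol_inverse:
  assumes q: "rcb T q" and t: "0 \<le> t" "t \<le> T"
  shows "q t = state_sol y0 q t / lam t - y0 / lam 0 + (LINT s:{0..t}|lborel. rho s * state_sol y0 q s)"
proof -
  have "response y0 q t / lam t = response y0 q 0 / lam 0 + (LINT s:{0..t}|lborel. - (rho s * state_sol y0 q s))"
  proof (rule right_deriv_FTC[where F="\<lambda>t. response y0 q t / lam t", OF _ _ _ t])
    show "continuous_on {0..T} (\<lambda>t. response y0 q t / lam t)"
      using lam_pos by (intro continuous_on_divide response_cont q lam_cont) (auto simp: less_imp_neq[THEN not_sym])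
    show "rcb T (\<lambda>s. - (rho s * state_sol y0 q s))" by (intro rcb_minus rcb_mult rho_rcb state_sol_rcb q)
    fix s assume s: "0 \<le> s" "s < T"
    then have l: "lam s \<noteq> 0" using lam_pos[of s] by auto
    have "- (bet s * state_sol y0 q s + lamdot s * q s) * lam s - response y0 q s * lamdot s = - (bet s * lam s + lamdot s) * state_sol y0 q s"
      by (simp add: state_sol_def algebra_simps)
    then have e: "(- (bet s * state_sol y0 q s + lamdot s * q s) * lam s - response y0 q s * lamdot s) / (lam s * lam s) = - (rho s * state_sol y0 q s)"
      using l by (simp add: rho_def gamdot_def field_simps)
    show "((\<lambda>t. response y0 q t / lam t) has_real_derivative - (rho s * state_sol y0 q s)) (at_right s)"
      unfolding e[symmetric] by (rule DERIV_divide[OF response_right_deriv[OF q s] lam_right_deriv[OF s] l])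
  qed
  then have "response y0 q t / lam t = y0 / lam 0 - (LINT s:{0..t}|lborel. rho s * state_sol y0 q s)"
    unfolding set_integral_uminus by (simp add: response_0)
  moreover have "state_sol y0 q t / lam t = q t + response y0 q t / lam t"
    using lam_pos[OF t] by (simp add: state_sol_def field_simps)
  ultimately show ?thesis by simp
qed

text \<open>Converse of the inversion: a guessed state \<open>z\<close> that reproduces
  \<open>q\<close> is the state, because the scaled difference \<open>w\<close> solves a homogeneous
  Volterra equation. The state of the optimizer is found by guessing in this way.\<close>

lemma state_sol_forward:
  assumes z: "rcb T z" and q: "rcb T q"
    and eq: "\<And>t. 0 \<le> t \<Longrightarrow> t \<le> T \<Longrightarrow> q t = z t / lam t - y0 / lam 0 + (LINT s:{0..t}|lborel. rho s * z s)"
    and t: "0 \<le> t" "t \<le> T"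
  shows "state_sol y0 q t = z t"
proof -
  obtain c where c: "0 < c" "\<And>t. 0 \<le> t \<Longrightarrow> t \<le> T \<Longrightarrow> c \<le> lam t" using lam_lower by blast
  define w where "w t = (z t - state_sol y0 q t) / lam t" for t
  have w: "rcb T w" unfolding w_def[abs_def] by (rule rcb_divide[OF rcb_diff[OF z state_sol_rcb[OF q]] lam_rcb c])
  have "w t = 0"
  proof (rule Volterra_zero[OF rcb_mult[OF rho_rcb lam_rcb] w _ t])
    fix r assume r: "0 \<le> r" "r \<le> T"
    have "set_integrable lborel {0..r} (\<lambda>s. rho s * z s)" "set_integrable lborel {0..r} (\<lambda>s. rho s * state_sol y0 q s)"
      using r by (auto intro!: rcb_integrable[OF _ T_ge0] rcb_mult rho_rcb z state_sol_rcb q)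
    then have "(LINT s:{0..r}|lborel. rho s * (z s - state_sol y0 q s)) =
      (LINT s:{0..r}|lborel. rho s * z s) - (LINT s:{0..r}|lborel. rho s * state_sol y0 q s)"
      by (subst set_integral_diff(2)[symmetric]) (auto simp: algebra_simps)
    moreover have "(LINT s:{0..r}|lborel. rho s * (z s - state_sol y0 q s)) = (LINT s:{0..r}|lborel. rho s * lam s * w s)"
    proof (rule set_lebesgue_integral_cong)
      show "\<forall>s. s \<in> {0..r} \<longrightarrow> rho s * (z s - state_sol y0 q s) = rho s * lam s * w s"
        using lam_pos r by (auto simp: w_def less_imp_neq[THEN not_sym])
    qed simp
    ultimately show "w r = - (LINT s:{0..r}|lborel. rho s * lam s * w s)"
      using eq[OF r] state_sol_inverse[OF q r, of y0] by (simp add: w_def diff_divide_distrib)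
  qed
  then show ?thesis using lam_pos[OF t] by (simp add: w_def)
qed

lemma state_sol_diff:
  assumes "rcb T p" "rcb T q" "0 \<le> t" "t \<le> T"
  shows "state_sol a p t - state_sol b q t = state_sol (a - b) (\<lambda>s. p s - q s) t"
proof -
  have "set_integrable lborel {0..t} (\<lambda>s. kern s * p s)" "set_integrable lborel {0..t} (\<lambda>s. kern s * q s)"
    using assms by (auto intro!: rcb_integrable[OF _ T_ge0] rcb_mult kern_rcb)
  then have "(LINT s:{0..t}|lborel. kern s * (p s - q s)) = (LINT s:{0..t}|lborel. kern s * p s) - (LINT s:{0..t}|lborel. kern s * q s)"
    by (subst set_integral_diff(2)[symmetric]) (auto simp: algebra_simps)
  then show ?thesis unfolding state_sol_def response_def kern_def[symmetric]
    by (simp add: left_diff_distrib right_diff_distrib)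
qed

lemma state_sol_cadlag_adapted:
  assumes Q: "cadlag_adapted Q"
  shows "cadlag_adapted (\<lambda>t \<omega>. state_sol y0 (\<lambda>s. Q s \<omega>) t)"
  unfolding cadlag_adapted_def
proof (intro conjI ballI)
  fix t assume t: "t \<in> {0..T}"
  have [measurable]: "Q t \<in> borel_measurable (F t)"
    "(\<lambda>\<omega>. LINT s:{0..t}|lborel. kern s * Q s \<omega>) \<in> borel_measurable (F t)"
    using t cadlag_adaptedD(1)[OF Q, of t]
    by (auto intro!: weighted_integral_measurable cadlag_adaptedD[OF Q] kern_rcb)
  show "(\<lambda>\<omega>. state_sol y0 (\<lambda>s. Q s \<omega>) t) \<in> borel_measurable (F t)"
    unfolding state_sol_def response_def kern_def[symmetric] by measurable
next
  fix \<omega> assume \<omega>: "\<omega> \<in> space M"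
  show "cadlag_on T (\<lambda>t. state_sol y0 (\<lambda>s. Q s \<omega>) t)"
    unfolding state_sol_def by (intro cadlag_on_add cadlag_on_mult lam_cadlag cadlag_adaptedD(3)[OF Q \<omega>]
        cadlag_on_continuous response_cont cadlag_adaptedD(4)[OF Q \<omega>])
qed

text \<open>The explicit solution is a state, so \<open>SOME\<close> returns one, and every state
  solves the same linear equation on almost every path. The summand \<open>lam 0 * Q 0\<close> in
  \<open>is_state\<close> cancels the boundary term at zero from integration by parts.\<close>

lemma state_eq_state_sol:
  assumes Q: "cadlag_adapted Q"
  shows "cadlag_adapted (state Q)"
    and "AE \<omega> in M. \<forall>t\<in>{0..T}. state Q t \<omega> = state_sol y (\<lambda>s. Q s \<omega>) t"
proof -
  have si: "AE \<omega> in M. \<forall>t\<in>{0..T}. stoch_int lam Q t \<omega> = ibp lam lamdot Q t \<omega>"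
    by (rule stoch_int_eq(2)[OF Q lamdot_rcb lam_FTC])
  have "is_state Q (\<lambda>t \<omega>. state_sol y (\<lambda>s. Q s \<omega>) t)"
    unfolding is_state_def
  proof (intro conjI state_sol_cadlag_adapted Q)
    show "AE \<omega> in M. \<forall>t\<in>{0..T}. state_sol y (\<lambda>s. Q s \<omega>) t =
        y - (LINT s:{0..t}|lborel. bet s * state_sol y (\<lambda>s. Q s \<omega>) s) + lam 0 * Q 0 \<omega> + stoch_int lam Q t \<omega>"
      using si AE_space
    proof eventually_elim
      case (elim \<omega>)
      show ?case
      proof
        fix t assume t: "t \<in> {0..T}"
        show "state_sol y (\<lambda>s. Q s \<omega>) t = y - (LINT s:{0..t}|lborel. bet s * state_sol y (\<lambda>s. Q s \<omega>) s) + lam 0 * Q 0 \<omega> + stoch_int lam Q t \<omega>"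
          using t elim(1) state_sol_solves[OF cadlag_adaptedD(4)[OF Q elim(2)], of t y] by (simp add: ibp_def)
      qed
    qed
  qed
  then have st: "is_state Q (state Q)" unfolding state_def by (rule someI[of "is_state Q"])
  then show cad: "cadlag_adapted (state Q)" by (simp add: is_state_def)
  have "AE \<omega> in M. \<forall>t\<in>{0..T}.
        state Q t \<omega> = y - (LINT s:{0..t}|lborel. bet s * state Q s \<omega>) + lam 0 * Q 0 \<omega> + stoch_int lam Q t \<omega>"
    using st by (simp add: is_state_def)
  then show "AE \<omega> in M. \<forall>t\<in>{0..T}. state Q t \<omega> = state_sol y (\<lambda>s. Q s \<omega>) t" using si AE_space
  proof eventually_elim
    case (elim \<omega>)
    show ?case
    proof
      fix t assume t: "t \<in> {0..T}"
      show "state Q t \<omega> = state_sol y (\<lambda>s. Q s \<omega>) t"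
      proof (rule state_sol_unique[OF cadlag_adaptedD(4)[OF Q elim(3)] cadlag_adaptedD(4)[OF cad elim(3)]])
        fix r assume r: "0 \<le> r" "r \<le> T"
        then have "r \<in> {0..T}" by simp
        then show "state Q r \<omega> = y - (LINT s:{0..r}|lborel. bet s * state Q s \<omega>) + lam r * Q r \<omega> - (LINT s:{0..r}|lborel. lamdot s * Q s \<omega>)"
          using elim(1,2) by (auto simp: ibp_def)
      qed (use t in auto)
    qed
  qed
qed

subsection \<open>The candidate optimizer\<close>

text \<open>Solution of the Riccati equation \<open>g' = thetadot * g\<^sup>2\<close> with terminal
  value \<open>lam T\<close>. It is the integrand against \<open>\<Xi>\<close> that produces the
  martingale of the optimizer.\<close>

definition opt_weight :: "real \<Rightarrow> real" where "opt_weight s = lam T / (1 + lam T * (theta T - theta s))"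

definition opt_weight_dot :: "real \<Rightarrow> real" where "opt_weight_dot s = thetadot s * (opt_weight s)\<^sup>2"

lemma theta_cont: "continuous_on {0..T} theta"
  unfolding theta_def[abs_def] using T_ge0 by (intro rcb_integral_continuous thetadot_rcb) auto

lemma theta_right_deriv: "0 \<le> t \<Longrightarrow> t < T \<Longrightarrow> (theta has_real_derivative thetadot t) (at_right t)"
  unfolding theta_def[abs_def] by (rule rcb_integral_right_deriv[OF thetadot_rcb])

lemma theta_0: "theta 0 = 0" using set_integral_Icc_self[of 0 thetadot] by (simp add: theta_def)

lemma theta_le: "0 \<le> s \<Longrightarrow> s \<le> T \<Longrightarrow> theta s \<le> theta T"
proof -
  assume st: "0 \<le> s" "s \<le> T"
  have i: "set_integrable lborel {0..T} thetadot" using rcb_integrable[OF thetadot_rcb T_ge0] by auto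
  have "0 \<le> (LINT r:{s<..T}|lborel. thetadot r)"
    unfolding set_lebesgue_integral_def using st thetadot_nonneg
    by (intro integral_nonneg_AE AE_I2) (auto simp: indicator_def)
  then show ?thesis using set_integral_Icc_split[OF i st] by (simp add: theta_def)
qed

lemma opt_weight_denom: "0 \<le> s \<Longrightarrow> s \<le> T \<Longrightarrow> 1 \<le> 1 + lam T * (theta T - theta s)"
  using theta_le[of s] lam_pos[of T] T_ge0 by simp

lemma opt_weight_pos: "0 \<le> s \<Longrightarrow> s \<le> T \<Longrightarrow> 0 < opt_weight s"
  using opt_weight_denom[of s] lam_pos[of T] T_ge0 by (simp add: opt_weight_def)

lemma opt_weight_cont: "continuous_on {0..T} opt_weight"
  unfolding opt_weight_def[abs_def] using opt_weight_denom by (intro continuous_intros theta_cont) fastforce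

lemma opt_weight_right_deriv:
  assumes t: "0 \<le> t" "t < T" shows "(opt_weight has_real_derivative opt_weight_dot t) (at_right t)"
proof -
  have d: "1 + lam T * (theta T - theta t) \<noteq> 0" using opt_weight_denom[of t] t by auto
  show ?thesis unfolding opt_weight_def[abs_def]
    apply (rule derivative_eq_intros theta_right_deriv[OF t] refl d)+
    using d by (simp add: opt_weight_dot_def opt_weight_def power2_eq_square field_simps)
qed

lemma opt_weight_dot_rcb: "rcb T opt_weight_dot"
  unfolding opt_weight_dot_def[abs_def] by (intro rcb_mult rcb_power thetadot_rcb rcb_continuous[OF opt_weight_cont])

lemma opt_weight_FTC: "0 \<le> t \<Longrightarrow> t \<le> T \<Longrightarrow> opt_weight t = opt_weight 0 + (LINT r:{0..t}|lborel. opt_weight_dot r)"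
  by (rule right_deriv_FTC[OF opt_weight_cont opt_weight_dot_rcb opt_weight_right_deriv])

lemma opt_weight_T: "opt_weight T = lam T" by (simp add: opt_weight_def)

text \<open>Here \<open>m = opt_weight * x + H\<close> with \<open>H\<close> continuous, and by the
  Riccati equation the right derivative of \<open>H / opt_weight\<close> is
  \<open>- thetadot * m\<close>. At \<open>t = T\<close>, where \<open>opt_weight T = lam T\<close>,
  the identity says that the inventory belonging to the terminal state \<open>m T\<close> is
  \<open>x T\<close>.\<close>

lemma optimal_path_identity:
  assumes x: "rcb T x" and m: "rcb T m" and t: "0 \<le> t" "t \<le> T"
    and eq: "\<And>t. 0 \<le> t \<Longrightarrow> t \<le> T \<Longrightarrow> m t = opt_weight t * x t + opt_weight 0 * (y / lam 0) - (LINT s:{0..t}|lborel. opt_weight_dot s * x s)"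
  shows "m t / opt_weight t + (LINT s:{0..t}|lborel. thetadot s * m s) = x t + y / lam 0"
proof -
  define H where "H t = opt_weight 0 * (y / lam 0) - (LINT s:{0..t}|lborel. opt_weight_dot s * x s)" for t
  have gx: "rcb T (\<lambda>s. opt_weight_dot s * x s)" by (rule rcb_mult[OF opt_weight_dot_rcb x])
  have "H t / opt_weight t = H 0 / opt_weight 0 + (LINT s:{0..t}|lborel. - (thetadot s * m s))"
  proof (rule right_deriv_FTC[where F="\<lambda>t. H t / opt_weight t", OF _ _ _ t])
    show "continuous_on {0..T} (\<lambda>t. H t / opt_weight t)"
      unfolding H_def using opt_weight_pos T_ge0
      by (intro continuous_intros opt_weight_cont rcb_integral_continuous gx) (auto simp: less_imp_neq[THEN not_sym])
    show "rcb T (\<lambda>s. - (thetadot s * m s))" by (intro rcb_minus rcb_mult thetadot_rcb m)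
    fix s assume s: "0 \<le> s" "s < T"
    have g: "opt_weight s \<noteq> 0" using opt_weight_pos[of s] s by auto
    have H': "(H has_real_derivative - (opt_weight_dot s * x s)) (at_right s)"
      unfolding H_def[abs_def] using DERIV_diff[OF DERIV_const rcb_integral_right_deriv[OF gx s]] by simp
    have ms: "m s = opt_weight s * x s + H s" using eq[of s] s by (simp add: H_def)
    have e: "(- (opt_weight_dot s * x s) * opt_weight s - H s * opt_weight_dot s) / (opt_weight s * opt_weight s) = - (thetadot s * m s)"
      using g by (simp add: ms opt_weight_dot_def power2_eq_square field_simps)
    show "((\<lambda>t. H t / opt_weight t) has_real_derivative - (thetadot s * m s)) (at_right s)"
      unfolding e[symmetric] by (rule DERIV_divide[OF H' opt_weight_right_deriv[OF s] g])
  qed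
  moreover have "H 0 / opt_weight 0 = y / lam 0"
    using set_integral_Icc_self[of 0 "\<lambda>s. opt_weight_dot s * x s"] opt_weight_pos[of 0] T_ge0 by (simp add: H_def)
  moreover have "m t / opt_weight t = x t + H t / opt_weight t"
    using eq[OF t] opt_weight_pos[OF t] by (simp add: H_def field_simps)
  ultimately show ?thesis by (simp add: set_lebesgue_integral_def)
qed

lemma opt_mart_cadlag_adapted: "cadlag_adapted opt_mart"
proof -
  have S: "cadlag_adapted (stoch_int opt_weight \<Xi>)" by (rule stoch_int_eq(1)[OF Xi_cadlag_adapted opt_weight_dot_rcb opt_weight_FTC])
  have X0: "\<Xi> 0 \<in> borel_measurable (F t)" if "0 \<le> t" "t \<le> T" for t
    using measurable_F_mono[OF cadlag_adaptedD(1)[OF Xi_cadlag_adapted, of 0], of t] that by auto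
  show ?thesis
    unfolding cadlag_adapted_def opt_mart_def[abs_def] opt_weight_def[abs_def, symmetric]
    using cadlag_adaptedD[OF S] X0 by (auto intro!: cadlag_on_add cadlag_on_const)
qed

lemma opt_mart_eq:
  "AE \<omega> in M. \<forall>t\<in>{0..T}. opt_mart t \<omega> = opt_weight t * \<Xi> t \<omega> + opt_weight 0 * (y / lam 0) - (LINT s:{0..t}|lborel. opt_weight_dot s * \<Xi> s \<omega>)"
proof -
  have "AE \<omega> in M. \<forall>t\<in>{0..T}. stoch_int opt_weight \<Xi> t \<omega> = ibp opt_weight opt_weight_dot \<Xi> t \<omega>"
    by (rule stoch_int_eq(2)[OF Xi_cadlag_adapted opt_weight_dot_rcb opt_weight_FTC])
  moreover have "opt_mart t \<omega> = opt_weight 0 * (\<Xi> 0 \<omega> + y / lam 0) + stoch_int opt_weight \<Xi> t \<omega>" for t \<omega>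
    by (simp add: opt_mart_def opt_weight_def[abs_def] theta_0)
  ultimately show ?thesis
    by (auto simp: ibp_def ring_distribs elim!: eventually_mono)
qed

lemma Qopt_cadlag_adapted: "cadlag_adapted Qopt"
  unfolding cadlag_adapted_def
proof (intro conjI ballI)
  fix t assume t: "t \<in> {0..T}"
  have [measurable]: "opt_mart t \<in> borel_measurable (F t)" "\<Xi> t \<in> borel_measurable (F t)"
    "(\<lambda>\<omega>. LINT s:{0..t}|lborel. thetadot s * opt_mart s \<omega>) \<in> borel_measurable (F t)"
    using t cadlag_adaptedD(1)[OF opt_mart_cadlag_adapted, of t] cadlag_adaptedD(1)[OF Xi_cadlag_adapted, of t]
    by (auto intro!: weighted_integral_measurable cadlag_adaptedD[OF opt_mart_cadlag_adapted] thetadot_rcb)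
  show "Qopt t \<in> borel_measurable (F t)"
    unfolding Qopt_def[abs_def] using t cadlag_adaptedD(1)[OF Xi_cadlag_adapted T_ge0]
    by (cases "t < T") auto
next
  fix \<omega> assume \<omega>: "\<omega> \<in> space M"
  have "cadlag_on T (\<lambda>t. eta t / lam t * opt_mart t \<omega> - y / lam 0 + (LINT s:{0..t}|lborel. thetadot s * opt_mart s \<omega>))"
    by (rule lam_lower) (intro cadlag_on_add cadlag_on_diff cadlag_on_mult cadlag_on_divide[OF eta_cadlag lam_cadlag] cadlag_on_const
        cadlag_adaptedD(3)[OF opt_mart_cadlag_adapted \<omega>] cadlag_on_continuous
        rcb_integral_continuous[OF rcb_mult[OF thetadot_rcb cadlag_adaptedD(4)[OF opt_mart_cadlag_adapted \<omega>]] T_ge0])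
  then show "cadlag_on T (\<lambda>t. Qopt t \<omega>)"
    by (rule cadlag_on_eq_before) (simp add: Qopt_def)
qed

definition Yopt :: "real \<Rightarrow> 'a \<Rightarrow> real" where
  "Yopt t \<omega> = (if t < T then eta t * opt_mart t \<omega> else opt_mart t \<omega>)"

lemma Yopt_rcb: "\<omega> \<in> space M \<Longrightarrow> rcb T (\<lambda>t. Yopt t \<omega>)"
  by (intro cadlag_on_rcb cadlag_on_eq_before[where g="\<lambda>t. Yopt t \<omega>", OF cadlag_on_mult[OF eta_cadlag cadlag_adaptedD(3)[OF opt_mart_cadlag_adapted]]])
    (auto simp: Yopt_def)

text \<open>Since \<open>rho * eta = thetadot\<close>, the formula of the optimizer before
  \<open>T\<close> is the inversion formula of \<open>Yopt\<close>; at \<open>T\<close> the path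
  identity supplies it. The jump of \<open>Yopt\<close> at \<open>T\<close> is invisible to the
  integral.\<close>

lemma state_sol_Qopt: "AE \<omega> in M. \<forall>t\<in>{0..T}. state_sol y (\<lambda>s. Qopt s \<omega>) t = Yopt t \<omega>"
  using opt_mart_eq AE_space
proof eventually_elim
  case (elim \<omega>)
  have m: "rcb T (\<lambda>t. opt_mart t \<omega>)" by (rule cadlag_adaptedD(4)[OF opt_mart_cadlag_adapted elim(2)])
  have int: "(LINT s:{0..t}|lborel. rho s * Yopt s \<omega>) = (LINT s:{0..t}|lborel. thetadot s * opt_mart s \<omega>)" if "t \<le> T" for t
  proof -
    have "AE s in lborel. indicat_real {0..t} s *\<^sub>R (rho s * Yopt s \<omega>) = indicat_real {0..t} s *\<^sub>R (thetadot s * opt_mart s \<omega>)"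
      using AE_lborel_singleton[of T]
      by eventually_elim (use that in \<open>auto simp: Yopt_def indicator_def rho_eta[symmetric]\<close>)
    moreover have "rcb T (\<lambda>s. rho s * Yopt s \<omega>)" "rcb T (\<lambda>s. thetadot s * opt_mart s \<omega>)"
      by (intro rcb_mult rho_rcb Yopt_rcb elim thetadot_rcb m)+
    then have "set_borel_measurable lborel {0..t} (\<lambda>s. rho s * Yopt s \<omega>)"
      "set_borel_measurable lborel {0..t} (\<lambda>s. thetadot s * opt_mart s \<omega>)"
      using rcb_set_measurable[OF _ T_ge0 that, of _ 0] by auto
    ultimately show ?thesis unfolding set_lebesgue_integral_def set_borel_measurable_def
      by (intro integral_cong_AE)
  qed
  show ?case
  proof
    fix t assume t: "t \<in> {0..T}"
    show "state_sol y (\<lambda>s. Qopt s \<omega>) t = Yopt t \<omega>"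
    proof (rule state_sol_forward[OF Yopt_rcb[OF elim(2)] cadlag_adaptedD(4)[OF Qopt_cadlag_adapted elim(2)]])
      fix r assume r: "0 \<le> r" "r \<le> T"
      show "Qopt r \<omega> = Yopt r \<omega> / lam r - y / lam 0 + (LINT s:{0..r}|lborel. rho s * Yopt s \<omega>)"
      proof (cases "r < T")
        case True then show ?thesis using int[of r] by (simp add: Qopt_def Yopt_def)
      next
        case False
        then have "r = T" using r by simp
        then show ?thesis using int[of T] optimal_path_identity[OF cadlag_adaptedD(4)[OF Xi_cadlag_adapted elim(2)] m, of T] elim(1) T_ge0
          by (simp add: Qopt_def Yopt_def opt_weight_T)
      qed
    qed (use t in auto)
  qed
qed

subsection \<open>Stability of the state\<close>

text \<open>Origin of \<open>L_Y\<close>: squaring the sum of \<open>lam * D\<close> and the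
  response costs a factor \<open>2\<close>, which gives \<open>2 * L\<^sup>2\<close>. Cauchy-Schwarz
  bounds the squared response by \<open>L\<^sup>2 * K\<^sup>2 * t\<close> times the energy of
  \<open>D\<close>; doubled and integrated over time, this gives the term with
  \<open>T\<^sup>2\<close>. As \<open>D T = 0\<close>, the terminal state is the response alone and
  adds a term with \<open>T\<close>, for which \<open>L_Y\<close> allows
  \<open>2 * T\<close>.\<close>

lemma state_sol_energy_bound:
  assumes D: "rcb T D" and DT: "D T = 0"
  shows "(LINT t:{0..T}|lborel. (state_sol 0 D t)\<^sup>2) + (state_sol 0 D T)\<^sup>2 \<le> L_Y\<^sup>2 * (LINT t:{0..T}|lborel. (D t)\<^sup>2)"
proof -
  define L where "L = Linf_norm T lam"
  define K where "K = Linf_norm T (\<lambda>t. bet t + gamdot t)"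
  define I where "I = (LINT t:{0..T}|lborel. (D t)\<^sup>2)"
  have L: "lam t \<le> L" if "0 \<le> t" "t < T" for t
    using rcb_le_Linf_norm[OF lam_rcb that] by (simp add: L_def)
  have K: "\<bar>bet t + gamdot t\<bar> \<le> K" if "0 \<le> t" "t < T" for t
    using rcb_le_Linf_norm[OF rcb_add[OF bet_rcb gamdot_rcb] that] by (simp add: K_def)
  have L0: "0 \<le> L" using L[of 0] lam_pos[of 0] T_pos by simp
  have K0: "0 \<le> K" using K[of 0] T_pos by simp
  have I0: "0 \<le> I" unfolding I_def set_lebesgue_integral_def by simp
  have D2: "rcb T (\<lambda>t. (D t)\<^sup>2)" by (rule rcb_power[OF D])
  have int2: "set_integrable lborel {0..t} (\<lambda>t. (D t)\<^sup>2)" if "t \<le> T" for t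
    using rcb_integrable[OF D2 T_ge0 that] by simp
  have absD: "rcb T (\<lambda>t. \<bar>D t\<bar>)" using D rcb_bound[OF D] unfolding rcb_def by (auto intro: tendsto_rabs)
  define a where "a t = (LINT s:{0..t}|lborel. \<bar>D s\<bar>)" for t
  have a0: "0 \<le> a t" for t unfolding a_def set_lebesgue_integral_def by simp
  have a_sq: "(a t)\<^sup>2 \<le> t * I" if t: "0 \<le> t" "t \<le> T" for t
  proof -
    have "(a t)\<^sup>2 \<le> (t - 0) * (LINT s:{0..t}|lborel. (D s)\<^sup>2)"
      unfolding a_def by (intro set_integral_abs_square_le rcb_set_measurable[OF D T_ge0] int2) (use t in auto)
    also have "\<dots> \<le> t * I"
      using t unfolding I_def set_lebesgue_integral_def diff_0_right
      by (intro mult_left_mono integral_mono int2[unfolded set_integrable_def]) (auto simp: indicator_def)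
    finally show ?thesis .
  qed
  have r_bound: "\<bar>response 0 D t\<bar> \<le> L * K * a t" if t: "0 \<le> t" "t \<le> T" for t
  proof -
    have ki: "set_integrable lborel {0..t} (\<lambda>s. kern s * D s)"
      using rcb_integrable[OF rcb_mult[OF kern_rcb D] T_ge0 t(2)] by simp
    have ai: "set_integrable lborel {0..t} (\<lambda>s. \<bar>D s\<bar>)" using rcb_integrable[OF absD T_ge0 t(2)] by simp
    have "\<bar>response 0 D t\<bar> = \<bar>LINT s:{0..t}|lborel. exp (- Bint t) * (kern s * D s)\<bar>"
      by (simp add: response_def kern_def)
    also have "\<dots> \<le> (LINT s:{0..t}|lborel. \<bar>exp (- Bint t) * (kern s * D s)\<bar>)"
      using set_integral_norm_bound[OF set_integrable_mult_right[of "exp (- Bint t)", OF ki]] by simp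
    also have "\<dots> \<le> (LINT s:{0..t}|lborel. L * K * \<bar>D s\<bar>)"
      unfolding set_lebesgue_integral_def
    proof (rule integral_mono_AE)
      show "integrable lborel (\<lambda>s. indicat_real {0..t} s *\<^sub>R \<bar>exp (- Bint t) * (kern s * D s)\<bar>)"
        using set_integrable_abs[OF set_integrable_mult_right[of "exp (- Bint t)", OF ki]] by (simp add: set_integrable_def)
      show "integrable lborel (\<lambda>s. indicat_real {0..t} s *\<^sub>R (L * K * \<bar>D s\<bar>))"
        using set_integrable_mult_right[of "L * K", OF ai] by (simp add: set_integrable_def)
      show "AE s in lborel. indicat_real {0..t} s *\<^sub>R \<bar>exp (- Bint t) * (kern s * D s)\<bar> \<le> indicat_real {0..t} s *\<^sub>R (L * K * \<bar>D s\<bar>)"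
        using AE_lborel_singleton[of T]
      proof eventually_elim
        case (elim s)
        show ?case
        proof (cases "s \<in> {0..t}")
          case True
          then have s: "0 \<le> s" "s < T" "s \<le> t" using elim t by auto
          \<comment> \<open>Resilience only damps the effect of past trades, because
            \<open>bet\<close> is positive.\<close>
          have "exp (- Bint t) * exp (Bint s) \<le> 1" using Bint_mono[of s t] s t by (simp flip: exp_add)
          moreover have "\<bar>lam s * bet s + lamdot s\<bar> \<le> L * K"
          proof -
            have "lam s * bet s + lamdot s = lam s * (bet s + gamdot s)"
              using lam_pos[of s] s by (simp add: gamdot_def field_simps)
            then show ?thesis using L[OF s(1,2)] K[OF s(1,2)] lam_pos[of s] s L0 by (auto simp: abs_mult intro!: mult_mono)
          qed
          ultimately have "exp (- Bint t) * exp (Bint s) * \<bar>lam s * bet s + lamdot s\<bar> \<le> 1 * (L * K)"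
            by (intro mult_mono) auto
          from mult_right_mono[OF this, of "\<bar>D s\<bar>"] show ?thesis using True
            by (simp add: kern_def abs_mult mult.assoc)
        qed simp
      qed
    qed
    also have "\<dots> = L * K * a t" by (simp add: a_def)
    finally show ?thesis .
  qed
  have pt: "(state_sol 0 D t)\<^sup>2 \<le> 2 * L\<^sup>2 * (D t)\<^sup>2 + 2 * L\<^sup>2 * K\<^sup>2 * I * t" if t: "0 \<le> t" "t < T" for t
  proof -
    have "(state_sol 0 D t)\<^sup>2 \<le> 2 * (lam t * D t)\<^sup>2 + 2 * (response 0 D t)\<^sup>2"
      using sum_squares_bound[of "lam t * D t" "response 0 D t"] by (simp add: state_sol_def power2_sum)
    also have "(lam t * D t)\<^sup>2 \<le> L\<^sup>2 * (D t)\<^sup>2"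
      using L[OF t] lam_pos[of t] t by (auto simp: power_mult_distrib intro!: mult_right_mono power_mono)
    also have "(response 0 D t)\<^sup>2 \<le> (L * K * a t)\<^sup>2"
      using r_bound[of t] t by (intro abs_le_square_iff[THEN iffD1]) (auto intro: order_trans[OF _ abs_ge_self])
    also have "\<dots> \<le> L\<^sup>2 * K\<^sup>2 * (t * I)"
      using a_sq[of t] t by (auto simp: power_mult_distrib intro!: mult_left_mono)
    finally show ?thesis by (simp add: algebra_simps)
  qed
  have T2: "(LINT t:{0..T}|lborel. t) = T\<^sup>2 / 2"
    using T_ge0 integral_power[of 0 T 1] by (simp add: set_lebesgue_integral_def numeral_2_eq_2 mult.commute)
  have it: "set_integrable lborel {0..T} (\<lambda>t. t)"
    using rcb_integrable[OF rcb_continuous[OF continuous_on_id] T_ge0 order_refl order_refl] by simp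
  have "(LINT t:{0..T}|lborel. (state_sol 0 D t)\<^sup>2) \<le> (LINT t:{0..T}|lborel. 2 * L\<^sup>2 * (D t)\<^sup>2 + 2 * L\<^sup>2 * K\<^sup>2 * I * t)"
    unfolding set_lebesgue_integral_def
  proof (rule integral_mono_AE)
    show "integrable lborel (\<lambda>t. indicat_real {0..T} t *\<^sub>R (state_sol 0 D t)\<^sup>2)"
      using rcb_integrable[OF rcb_power[OF state_sol_rcb[OF D]] T_ge0 order_refl order_refl] by (simp add: set_integrable_def)
    have "set_integrable lborel {0..T} (\<lambda>t. 2 * L\<^sup>2 * (D t)\<^sup>2 + 2 * L\<^sup>2 * K\<^sup>2 * I * t)"
      by (intro set_integral_add set_integrable_mult_right) (auto intro: int2 it)
    then show "integrable lborel (\<lambda>t. indicat_real {0..T} t *\<^sub>R (2 * L\<^sup>2 * (D t)\<^sup>2 + 2 * L\<^sup>2 * K\<^sup>2 * I * t))"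
      by (simp add: set_integrable_def)
    show "AE t in lborel. indicat_real {0..T} t *\<^sub>R (state_sol 0 D t)\<^sup>2 \<le> indicat_real {0..T} t *\<^sub>R (2 * L\<^sup>2 * (D t)\<^sup>2 + 2 * L\<^sup>2 * K\<^sup>2 * I * t)"
      using AE_lborel_singleton[of T] by eventually_elim (use pt in \<open>auto simp: indicator_def\<close>)
  qed
  also have "\<dots> = 2 * L\<^sup>2 * I + 2 * L\<^sup>2 * K\<^sup>2 * I * (T\<^sup>2 / 2)"
    using int2[of T] it by (subst set_integral_add(2)) (auto simp: T2 I_def)
  finally have 1: "(LINT t:{0..T}|lborel. (state_sol 0 D t)\<^sup>2) \<le> 2 * L\<^sup>2 * I + L\<^sup>2 * K\<^sup>2 * I * T\<^sup>2" by simp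
  have "(state_sol 0 D T)\<^sup>2 \<le> (L * K * a T)\<^sup>2"
    using r_bound[of T] T_ge0 by (intro abs_le_square_iff[THEN iffD1]) (auto simp: state_sol_def DT intro: order_trans[OF _ abs_ge_self])
  also have "\<dots> \<le> L\<^sup>2 * K\<^sup>2 * (T * I)"
    using a_sq[of T] T_ge0 by (auto simp: power_mult_distrib intro!: mult_left_mono)
  finally have 2: "(state_sol 0 D T)\<^sup>2 \<le> L\<^sup>2 * K\<^sup>2 * (T * I)" .
  have "L_Y\<^sup>2 = L\<^sup>2 * (2 + T * (T + 2) * K\<^sup>2)"
    unfolding L_Y_def L_def K_def using T_ge0 by (simp add: power_mult_distrib)
  then have "L_Y\<^sup>2 * I = 2 * L\<^sup>2 * I + L\<^sup>2 * K\<^sup>2 * I * T\<^sup>2 + 2 * (L\<^sup>2 * K\<^sup>2 * (T * I))"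
    by (simp add: algebra_simps power2_eq_square)
  moreover have "0 \<le> L\<^sup>2 * K\<^sup>2 * (T * I)" using T_ge0 I0 by simp
  ultimately show ?thesis using 1 2 unfolding I_def[symmetric] by linarith
qed

end

section \<open>Square-integrable processes\<close>

lemma power2_sum_le: "(a + b :: real)\<^sup>2 \<le> 2 * a\<^sup>2 + 2 * b\<^sup>2"
  using sum_squares_bound[of a b] by (simp add: power2_sum)

lemma integrable_leb: "integrable (leb t) f \<longleftrightarrow> set_integrable lborel {0..t} (f :: real \<Rightarrow> real)"
  by (simp add: integrable_restrict_space set_integrable_def)

lemma set_integrable_of_square:
  fixes f :: "real \<Rightarrow> real"
  assumes m: "f \<in> borel_measurable (leb T)" and sq: "set_integrable lborel {0..T} (\<lambda>t. (f t)\<^sup>2)"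
  shows "set_integrable lborel {0..T} f"
proof -
  interpret L: finite_measure "leb T" by (rule finite_measure_leb)
  have "integrable (leb T) (\<lambda>t. (f t)\<^sup>2)" using sq by (simp add: integrable_leb)
  then have "integrable (leb T) (\<lambda>t. f t * 1)" using m by (intro square_integrable_mult) auto
  then show ?thesis by (simp add: integrable_leb)
qed

lemma measurable_leb_pair:
  assumes "f \<in> borel_measurable (restrict_space borel {0..t} \<Otimes>\<^sub>M N)"
  shows "f \<in> borel_measurable (leb t \<Otimes>\<^sub>M N)"
  using assms by (simp cong: measurable_cong_sets add: sets_pair_measure_cong[OF sets_leb refl])

context filtered_prob_space
begin

lemma pair_leb: "pair_sigma_finite (leb t) M"
proof -
  interpret L: finite_measure "leb t" by (rule finite_measure_leb)
  show ?thesis ..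
qed

definition L2 :: "('a \<Rightarrow> real) \<Rightarrow> bool" where
  "L2 Z \<longleftrightarrow> Z \<in> borel_measurable M \<and> integrable M (\<lambda>\<omega>. (Z \<omega>)\<^sup>2)"

lemma L2_mult: "L2 X \<Longrightarrow> L2 Y \<Longrightarrow> integrable M (\<lambda>\<omega>. X \<omega> * Y \<omega>)"
  unfolding L2_def by (intro square_integrable_mult) auto

lemma L2_const: "L2 (\<lambda>_. c)" by (simp add: L2_def)

lemma L2_integrable: "L2 X \<Longrightarrow> integrable M X"
  using L2_mult[OF _ L2_const[of 1]] by simp

lemma L2_scale: "L2 X \<Longrightarrow> L2 (\<lambda>\<omega>. c * X \<omega>)"
  by (auto simp: L2_def power_mult_distrib)

lemma L2_bound:
  assumes "X \<in> borel_measurable M" "integrable M G" "AE \<omega> in M. (X \<omega>)\<^sup>2 \<le> G \<omega>"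
  shows "L2 X" and "expectation (\<lambda>\<omega>. (X \<omega>)\<^sup>2) \<le> expectation G"
proof -
  have "integrable M (\<lambda>\<omega>. (X \<omega>)\<^sup>2)"
    by (rule Bochner_Integration.integrable_bound[OF assms(2)])
      (use assms in \<open>auto elim!: eventually_mono intro: order_trans[OF _ abs_ge_self]\<close>)
  then show "L2 X" "expectation (\<lambda>\<omega>. (X \<omega>)\<^sup>2) \<le> expectation G"
    using assms by (auto simp: L2_def intro: integral_mono_AE)
qed

lemma L2_add:
  assumes "L2 X" "L2 Y"
  shows "L2 (\<lambda>\<omega>. X \<omega> + Y \<omega>)"
    and "expectation (\<lambda>\<omega>. (X \<omega> + Y \<omega>)\<^sup>2) \<le> 2 * expectation (\<lambda>\<omega>. (X \<omega>)\<^sup>2) + 2 * expectation (\<lambda>\<omega>. (Y \<omega>)\<^sup>2)"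
proof -
  have i: "integrable M (\<lambda>\<omega>. 2 * (X \<omega>)\<^sup>2 + 2 * (Y \<omega>)\<^sup>2)" using assms by (auto simp: L2_def)
  have m: "(\<lambda>\<omega>. X \<omega> + Y \<omega>) \<in> borel_measurable M" using assms by (auto simp: L2_def)
  show "L2 (\<lambda>\<omega>. X \<omega> + Y \<omega>)" by (rule L2_bound(1)[OF m i]) (simp add: power2_sum_le)
  have "expectation (\<lambda>\<omega>. (X \<omega> + Y \<omega>)\<^sup>2) \<le> expectation (\<lambda>\<omega>. 2 * (X \<omega>)\<^sup>2 + 2 * (Y \<omega>)\<^sup>2)"
    by (rule L2_bound(2)[OF m i]) (simp add: power2_sum_le)
  then show "expectation (\<lambda>\<omega>. (X \<omega> + Y \<omega>)\<^sup>2) \<le> 2 * expectation (\<lambda>\<omega>. (X \<omega>)\<^sup>2) + 2 * expectation (\<lambda>\<omega>. (Y \<omega>)\<^sup>2)"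
    using assms by (simp add: L2_def)
qed

lemma L2_diff: "L2 X \<Longrightarrow> L2 Y \<Longrightarrow> L2 (\<lambda>\<omega>. X \<omega> - Y \<omega>)"
  using L2_add(1)[of X "\<lambda>\<omega>. (-1) * Y \<omega>"] L2_scale[of Y "-1"] by simp

lemma L2_cong_AE:
  assumes "L2 X" "Y \<in> borel_measurable M" "AE \<omega> in M. Y \<omega> = X \<omega>"
  shows "L2 Y"
  using assms by (intro L2_bound(1)[of Y "\<lambda>\<omega>. (X \<omega>)\<^sup>2"]) (auto simp: L2_def)

definition L2P :: "(real \<Rightarrow> 'a \<Rightarrow> real) \<Rightarrow> bool" where
  "L2P X \<longleftrightarrow> (\<lambda>(t, \<omega>). X t \<omega>) \<in> borel_measurable (leb T \<Otimes>\<^sub>M M) \<and>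
     integrable (leb T \<Otimes>\<^sub>M M) (\<lambda>(t, \<omega>). (X t \<omega>)\<^sup>2)"

lemma L2P_mult:
  assumes "L2P X" "L2P Y"
  shows "integrable (leb T \<Otimes>\<^sub>M M) (\<lambda>(t, \<omega>). X t \<omega> * Y t \<omega>)"
  using square_integrable_mult[of "case_prod X" "leb T \<Otimes>\<^sub>M M" "case_prod Y"] assms
  by (simp add: L2P_def case_prod_beta')

lemma L2P_scale:
  assumes X: "L2P X" and f: "f \<in> borel_measurable (leb T)" and B: "\<And>t. 0 \<le> t \<Longrightarrow> t \<le> T \<Longrightarrow> \<bar>f t\<bar> \<le> B"
  shows "L2P (\<lambda>t \<omega>. f t * X t \<omega>)"
proof -
  have m: "(\<lambda>(t, \<omega>). f t * X t \<omega>) \<in> borel_measurable (leb T \<Otimes>\<^sub>M M)"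
    using X measurable_compose[OF measurable_fst f, of M]
    by (auto simp: L2P_def case_prod_beta' intro!: borel_measurable_times)
  have i: "integrable (leb T \<Otimes>\<^sub>M M) (\<lambda>z. B\<^sup>2 * (case_prod X z)\<^sup>2)"
    using X by (simp add: L2P_def case_prod_beta')
  have "integrable (leb T \<Otimes>\<^sub>M M) (\<lambda>(t, \<omega>). (f t * X t \<omega>)\<^sup>2)"
  proof (rule Bochner_Integration.integrable_bound[OF i])
    show "(\<lambda>(t, \<omega>). (f t * X t \<omega>)\<^sup>2) \<in> borel_measurable (leb T \<Otimes>\<^sub>M M)"
      using m by (simp add: case_prod_beta')
    show "AE z in leb T \<Otimes>\<^sub>M M. norm (case z of (t, \<omega>) \<Rightarrow> (f t * X t \<omega>)\<^sup>2) \<le> norm (B\<^sup>2 * (case_prod X z)\<^sup>2)"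
    proof (rule AE_I2)
      fix z assume z: "z \<in> space (leb T \<Otimes>\<^sub>M M)"
      have "\<bar>f (fst z)\<bar> \<le> B" using z by (intro B) (auto simp: space_pair_measure space_restrict_space)
      then have "(f (fst z))\<^sup>2 \<le> B\<^sup>2" by (intro abs_le_square_iff[THEN iffD1]) auto
      then show "norm (case z of (t, \<omega>) \<Rightarrow> (f t * X t \<omega>)\<^sup>2) \<le> norm (B\<^sup>2 * (case_prod X z)\<^sup>2)"
        by (auto simp: case_prod_beta' power_mult_distrib intro!: mult_right_mono)
    qed
  qed
  then show ?thesis using m by (simp add: L2P_def)
qed

lemma L2PI:
  assumes m: "(\<lambda>(t, \<omega>). X t \<omega>) \<in> borel_measurable (leb T \<Otimes>\<^sub>M M)"
    and X: "\<And>t. 0 \<le> t \<Longrightarrow> t \<le> T \<Longrightarrow> L2 (X t)"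
    and C: "\<And>t. 0 \<le> t \<Longrightarrow> t \<le> T \<Longrightarrow> expectation (\<lambda>\<omega>. (X t \<omega>)\<^sup>2) \<le> C"
  shows "L2P X"
proof -
  have m2: "(\<lambda>(t, \<omega>). (X t \<omega>)\<^sup>2) \<in> borel_measurable (leb T \<Otimes>\<^sub>M M)" using m by (simp add: case_prod_beta')
  have "(\<integral>\<^sup>+ z. ennreal (norm (case z of (t, \<omega>) \<Rightarrow> (X t \<omega>)\<^sup>2)) \<partial>(leb T \<Otimes>\<^sub>M M))
    = (\<integral>\<^sup>+ t. \<integral>\<^sup>+ \<omega>. ennreal ((X t \<omega>)\<^sup>2) \<partial>M \<partial>leb T)"
    using m2 by (subst nn_integral_fst[symmetric]) (auto simp: case_prod_beta')
  also have "\<dots> \<le> (\<integral>\<^sup>+ t. ennreal C \<partial>leb T)"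
  proof (rule nn_integral_mono)
    fix t assume "t \<in> space (leb T)"
    then have t: "0 \<le> t" "t \<le> T" by (auto simp: space_restrict_space)
    have "(\<integral>\<^sup>+ \<omega>. ennreal ((X t \<omega>)\<^sup>2) \<partial>M) = ennreal (expectation (\<lambda>\<omega>. (X t \<omega>)\<^sup>2))"
      using X[OF t] by (intro nn_integral_eq_integral) (auto simp: L2_def)
    then show "(\<integral>\<^sup>+ \<omega>. ennreal ((X t \<omega>)\<^sup>2) \<partial>M) \<le> ennreal C" using C[OF t] by (simp add: ennreal_leI)
  qed
  also have "\<dots> < \<infinity>"
    by (simp add: ennreal_mult_less_top emeasure_restrict_space emeasure_lborel_Icc_eq)
  finally have "integrable (leb T \<Otimes>\<^sub>M M) (\<lambda>(t, \<omega>). (X t \<omega>)\<^sup>2)"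
    using m2 by (intro integrableI_bounded) auto
  then show ?thesis using m by (simp add: L2P_def)
qed

lemma L2P_const: assumes Z: "L2 Z" shows "L2P (\<lambda>t. Z)"
proof (rule L2PI)
  have [measurable]: "Z \<in> borel_measurable M" using Z by (simp add: L2_def)
  show "(\<lambda>(t, \<omega>). Z \<omega>) \<in> borel_measurable (leb T \<Otimes>\<^sub>M M)" by measurable
qed (rule Z order_refl)+

lemma Fubini_leb:
  fixes f :: "real \<Rightarrow> 'a \<Rightarrow> real"
  assumes f: "integrable (leb T \<Otimes>\<^sub>M M) (\<lambda>(t, \<omega>). f t \<omega>)"
  shows "integrable M (\<lambda>\<omega>. LINT t:{0..T}|lborel. f t \<omega>)"
    and "AE \<omega> in M. set_integrable lborel {0..T} (\<lambda>t. f t \<omega>)"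
    and "set_integrable lborel {0..T} (\<lambda>t. expectation (f t))"
    and "expectation (\<lambda>\<omega>. LINT t:{0..T}|lborel. f t \<omega>) = (LINT t:{0..T}|lborel. expectation (f t))"
proof -
  interpret P: pair_sigma_finite "leb T" M by (rule pair_leb)
  show "integrable M (\<lambda>\<omega>. LINT t:{0..T}|lborel. f t \<omega>)"
    using P.integrable_snd[OF f] by (simp add: integral_leb)
  show "AE \<omega> in M. set_integrable lborel {0..T} (\<lambda>t. f t \<omega>)"
    using P.AE_integrable_snd[OF f] by (simp add: integrable_leb)
  show "set_integrable lborel {0..T} (\<lambda>t. expectation (f t))"
    using P.integrable_fst'[OF f] by (simp add: integrable_leb)
  show "expectation (\<lambda>\<omega>. LINT t:{0..T}|lborel. f t \<omega>) = (LINT t:{0..T}|lborel. expectation (f t))"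
    using P.integral_snd[OF f] P.integral_fst'[OF f] by (simp add: integral_leb)
qed

text \<open>Second moments bounded uniformly in time, weaker than an integrable supremum. The
  property is stable under the sums, weights and time integrals that form the state, and by Fubini
  it already gives joint square integrability on \<open>[0,T]\<close>.\<close>

definition supL2 :: "(real \<Rightarrow> 'a \<Rightarrow> real) \<Rightarrow> bool" where
  "supL2 X \<longleftrightarrow> (\<forall>t\<in>{0..T}. X t \<in> borel_measurable (F t)) \<and> (\<forall>\<omega>\<in>space M. rcb T (\<lambda>t. X t \<omega>)) \<and>
     (\<exists>C. \<forall>t\<in>{0..T}. L2 (X t) \<and> expectation (\<lambda>\<omega>. (X t \<omega>)\<^sup>2) \<le> C)"

lemma supL2D:
  assumes "supL2 X"
  shows "0 \<le> t \<Longrightarrow> t \<le> T \<Longrightarrow> X t \<in> borel_measurable (F t)"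
    and "0 \<le> t \<Longrightarrow> t \<le> T \<Longrightarrow> X t \<in> borel_measurable M"
    and "\<omega> \<in> space M \<Longrightarrow> rcb T (\<lambda>t. X t \<omega>)"
    and "0 \<le> t \<Longrightarrow> t \<le> T \<Longrightarrow> L2 (X t)"
  using assms measurable_F_M[of "X t" t] unfolding supL2_def by auto

lemma supL2_bound:
  assumes "supL2 X" obtains C where "0 \<le> C" "\<And>t. 0 \<le> t \<Longrightarrow> t \<le> T \<Longrightarrow> expectation (\<lambda>\<omega>. (X t \<omega>)\<^sup>2) \<le> C"
proof -
  obtain C where C: "\<forall>t\<in>{0..T}. expectation (\<lambda>\<omega>. (X t \<omega>)\<^sup>2) \<le> C" using assms by (auto simp: supL2_def)
  moreover have "0 \<le> expectation (\<lambda>\<omega>. (X 0 \<omega>)\<^sup>2)" by simp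
  ultimately have "0 \<le> C" using T_pos by (metis atLeastAtMost_iff less_eq_real_def order_trans order_refl)
  then show ?thesis using that[of C] C by auto
qed

lemma supL2_measurable_pair:
  assumes X: "supL2 X" shows "(\<lambda>(t, \<omega>). X t \<omega>) \<in> borel_measurable (leb T \<Otimes>\<^sub>M M)"
  using T_pos by (intro measurable_leb_pair rc_pair_measurable supL2D[OF X] rcb_tendsto[OF supL2D(3)[OF X]]) auto

lemma supL2_L2P:
  assumes X: "supL2 X" shows "L2P X"
proof -
  obtain C where "\<And>t. 0 \<le> t \<Longrightarrow> t \<le> T \<Longrightarrow> expectation (\<lambda>\<omega>. (X t \<omega>)\<^sup>2) \<le> C"
    using supL2_bound[OF X] by metis
  then show ?thesis by (intro L2PI supL2_measurable_pair supL2D(4)[OF X] X) auto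
qed

lemma supL2_const:
  assumes "Z \<in> borel_measurable (F 0)" "L2 Z" shows "supL2 (\<lambda>t. Z)"
  unfolding supL2_def using measurable_F_mono[OF assms(1)] assms(2) by (auto simp: rcb_const)

lemma supL2_add:
  assumes X: "supL2 X" and Y: "supL2 Y" shows "supL2 (\<lambda>t \<omega>. X t \<omega> + Y t \<omega>)"
proof -
  obtain C where C: "\<And>t. 0 \<le> t \<Longrightarrow> t \<le> T \<Longrightarrow> expectation (\<lambda>\<omega>. (X t \<omega>)\<^sup>2) \<le> C" using supL2_bound[OF X] by metis
  obtain D where D: "\<And>t. 0 \<le> t \<Longrightarrow> t \<le> T \<Longrightarrow> expectation (\<lambda>\<omega>. (Y t \<omega>)\<^sup>2) \<le> D" using supL2_bound[OF Y] by metis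
  have "expectation (\<lambda>\<omega>. (X t \<omega> + Y t \<omega>)\<^sup>2) \<le> 2 * C + 2 * D" if "0 \<le> t" "t \<le> T" for t
    using L2_add(2)[OF supL2D(4)[OF X that] supL2D(4)[OF Y that]] C[OF that] D[OF that] by linarith
  then show ?thesis
    unfolding supL2_def using supL2D[OF X] supL2D[OF Y] by (auto intro!: rcb_add L2_add(1) exI[of _ "2 * C + 2 * D"])
qed

lemma supL2_scale:
  assumes X: "supL2 X" and f: "rcb T f" shows "supL2 (\<lambda>t \<omega>. f t * X t \<omega>)"
proof -
  obtain C where C: "0 \<le> C" "\<And>t. 0 \<le> t \<Longrightarrow> t \<le> T \<Longrightarrow> expectation (\<lambda>\<omega>. (X t \<omega>)\<^sup>2) \<le> C" using supL2_bound[OF X] by metis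
  obtain B where B: "\<And>t. 0 \<le> t \<Longrightarrow> t \<le> T \<Longrightarrow> \<bar>f t\<bar> \<le> B" using rcb_bound[OF f] by metis
  have "expectation (\<lambda>\<omega>. (f t * X t \<omega>)\<^sup>2) \<le> B\<^sup>2 * C" if "0 \<le> t" "t \<le> T" for t
  proof -
    have "(f t)\<^sup>2 \<le> B\<^sup>2" using B[OF that] by (intro abs_le_square_iff[THEN iffD1]) auto
    then show ?thesis using C(2)[OF that] by (auto simp: power_mult_distrib intro!: mult_mono)
  qed
  then show ?thesis
    unfolding supL2_def using supL2D[OF X] by (auto intro!: rcb_mult f L2_scale exI[of _ "B\<^sup>2 * C"])
qed

lemma supL2_diff: "supL2 X \<Longrightarrow> supL2 Y \<Longrightarrow> supL2 (\<lambda>t \<omega>. X t \<omega> - Y t \<omega>)"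
  using supL2_add[of X "\<lambda>t \<omega>. (-1) * Y t \<omega>"] supL2_scale[of Y "\<lambda>_. -1"] by (simp add: rcb_const)

text \<open>By Cauchy-Schwarz one variable, \<open>T\<close> times the energy \<open>G\<close> over
  all of \<open>[0,T]\<close>, dominates the squared integral at every time.\<close>

lemma supL2_integral:
  assumes X: "supL2 X" and f: "rcb T f" shows "supL2 (\<lambda>t \<omega>. LINT s:{0..t}|lborel. f s * X s \<omega>)"
proof -
  let ?Y = "\<lambda>s \<omega>. f s * X s \<omega>"
  have Y: "supL2 ?Y" by (rule supL2_scale[OF X f])
  define G where "G \<omega> = (LINT s:{0..T}|lborel. (?Y s \<omega>)\<^sup>2)" for \<omega>
  have G: "integrable M G"
    unfolding G_def using Fubini_leb(1)[of "\<lambda>s \<omega>. (?Y s \<omega>)\<^sup>2"] supL2_L2P[OF Y] by (simp add: L2P_def)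
  have le: "(LINT s:{0..t}|lborel. ?Y s \<omega>)\<^sup>2 \<le> T * G \<omega>" if t: "0 \<le> t" "t \<le> T" and \<omega>: "\<omega> \<in> space M" for t \<omega>
  proof -
    have r: "rcb T (\<lambda>s. ?Y s \<omega>)" "rcb T (\<lambda>s. (?Y s \<omega>)\<^sup>2)" using supL2D(3)[OF Y \<omega>] by (auto intro: rcb_power)
    have T0: "0 \<le> T" using T_pos by simp
    have i: "set_integrable lborel {0..r} (\<lambda>s. ?Y s \<omega>)" "set_integrable lborel {0..r} (\<lambda>s. (?Y s \<omega>)\<^sup>2)" if "r \<le> T" for r
      using r that T0 by (auto intro: rcb_integrable)
    have "\<bar>LINT s:{0..t}|lborel. ?Y s \<omega>\<bar> \<le> (LINT s:{0..t}|lborel. \<bar>?Y s \<omega>\<bar>)"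
      using set_integral_norm_bound[OF i(1)[OF t(2)]] by simp
    then have "(LINT s:{0..t}|lborel. ?Y s \<omega>)\<^sup>2 \<le> (LINT s:{0..t}|lborel. \<bar>?Y s \<omega>\<bar>)\<^sup>2"
      by (intro abs_le_square_iff[THEN iffD1]) (auto intro: order_trans[OF _ abs_ge_self])
    also have "\<dots> \<le> (t - 0) * (LINT s:{0..t}|lborel. (?Y s \<omega>)\<^sup>2)"
      by (intro set_integral_abs_square_le rcb_set_measurable[OF r(1) T0] i t) auto
    also have "\<dots> \<le> T * G \<omega>"
      unfolding G_def using t T0 i[unfolded set_integrable_def] unfolding set_lebesgue_integral_def
      by (intro mult_mono integral_mono) (auto simp: indicator_def)
    finally show ?thesis .
  qed
  have meas: "(\<lambda>\<omega>. LINT s:{0..t}|lborel. ?Y s \<omega>) \<in> borel_measurable (F t)" if "0 \<le> t" "t \<le> T" for t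
    using that by (intro weighted_integral_measurable f supL2D[OF X]) auto
  have "L2 (\<lambda>\<omega>. LINT s:{0..t}|lborel. ?Y s \<omega>) \<and> expectation (\<lambda>\<omega>. (LINT s:{0..t}|lborel. ?Y s \<omega>)\<^sup>2) \<le> expectation (\<lambda>\<omega>. T * G \<omega>)"
    if "t \<in> {0..T}" for t
    using that meas measurable_F_M[OF meas] G le
    by (intro conjI L2_bound[of "\<lambda>\<omega>. LINT s:{0..t}|lborel. ?Y s \<omega>" "\<lambda>\<omega>. T * G \<omega>"]) auto
  moreover have "rcb T (\<lambda>t. LINT s:{0..t}|lborel. ?Y s \<omega>)" if "\<omega> \<in> space M" for \<omega>
    using T_pos by (intro rcb_integral supL2D(3)[OF Y that]) auto
  ultimately show ?thesis unfolding supL2_def using meas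
    by (auto intro!: exI[of _ "T * expectation G"])
qed

text \<open>Fubini with the cut-off at \<open>t\<close> absorbed into the weight, so that the result
  on the product with the whole of \<open>[0,T]\<close> applies.\<close>

lemma expectation_mult_integral:
  assumes X: "supL2 X" and f: "rcb T f" and Z: "L2 Z" and t: "0 \<le> t" "t \<le> T"
  shows "expectation (\<lambda>\<omega>. (LINT s:{0..t}|lborel. f s * X s \<omega>) * Z \<omega>) = (LINT s:{0..t}|lborel. f s * expectation (\<lambda>\<omega>. X s \<omega> * Z \<omega>))"
proof -
  obtain B where B: "\<And>t. 0 \<le> t \<Longrightarrow> t \<le> T \<Longrightarrow> \<bar>f t\<bar> \<le> B" "0 \<le> B" using rcb_bound[OF f] by metis
  define h where "h s = indicat_real {0..t} s * f s" for s
  have hm: "h \<in> borel_measurable (leb T)"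
    unfolding h_def using rcb_set_measurable[OF f _ t(2) order_refl] T_pos
    by (intro measurable_restrict_space1) (simp add: set_borel_measurable_def)
  have P: "L2P (\<lambda>s \<omega>. h s * X s \<omega>)"
    by (rule L2P_scale[OF supL2_L2P[OF X] hm, of B]) (use B in \<open>auto simp: h_def indicator_def\<close>)
  from Fubini_leb(4)[OF L2P_mult[OF P L2P_const[OF Z]]]
  have "expectation (\<lambda>\<omega>. LINT s:{0..T}|lborel. h s * X s \<omega> * Z \<omega>) = (LINT s:{0..T}|lborel. expectation (\<lambda>\<omega>. h s * X s \<omega> * Z \<omega>))" .
  moreover have "(LINT s:{0..T}|lborel. h s * X s \<omega> * Z \<omega>) = (LINT s:{0..t}|lborel. f s * X s \<omega>) * Z \<omega>" for \<omega>
    unfolding set_lebesgue_integral_def integral_mult_left_zero[symmetric] h_def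
    using t by (intro Bochner_Integration.integral_cong) (auto simp: indicator_def)
  moreover have "(LINT s:{0..T}|lborel. expectation (\<lambda>\<omega>. h s * X s \<omega> * Z \<omega>)) = (LINT s:{0..t}|lborel. f s * expectation (\<lambda>\<omega>. X s \<omega> * Z \<omega>))"
    unfolding set_lebesgue_integral_def h_def mult.assoc integral_mult_right_zero
    using t by (intro Bochner_Integration.integral_cong) (auto simp: indicator_def)
  ultimately show ?thesis by (simp only:)
qed

end

context execution_problem
begin

section \<open>The two martingales of the problem\<close>

lemma Xi_sq_L2: "L2 (\<Xi> T)"
  using Xi_L2 cadlag_adaptedD(2)[OF Xi_cadlag_adapted T_ge0] by (simp add: L2_def)

lemma sigma_finite_subalgebra_F: "t \<in> {0..T} \<Longrightarrow> sigma_finite_subalgebra M (F t)"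
proof -
  assume t: "t \<in> {0..T}"
  interpret finite_measure_subalgebra M "F t" by unfold_locales (rule subalgebra_F[OF t])
  show ?thesis ..
qed

text \<open>Conditional Jensen inequality for the square.\<close>

lemma Xi_L2_le:
  assumes t: "0 \<le> t" "t \<le> T"
  shows "L2 (\<Xi> t)" and "expectation (\<lambda>\<omega>. (\<Xi> t \<omega>)\<^sup>2) \<le> expectation (\<lambda>\<omega>. (\<Xi> T \<omega>)\<^sup>2)"
proof -
  interpret S: sigma_finite_subalgebra M "F t" using t by (intro sigma_finite_subalgebra_F) auto
  have i: "integrable M (\<Xi> T)" by (rule L2_integrable[OF Xi_sq_L2])
  have "AE \<omega> in M. (real_cond_exp M (F t) (\<Xi> T) \<omega>)\<^sup>2 \<le> real_cond_exp M (F t) (\<lambda>\<omega>. (\<Xi> T \<omega>)\<^sup>2) \<omega>"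
    by (rule S.real_cond_exp_jensens_inequality(2)[of "\<Xi> T" UNIV 0 0 "\<lambda>x. x\<^sup>2", OF i])
      (use Xi_L2 convex_power2 in auto)
  then have le: "AE \<omega> in M. (\<Xi> t \<omega>)\<^sup>2 \<le> real_cond_exp M (F t) (\<lambda>\<omega>. (\<Xi> T \<omega>)\<^sup>2) \<omega>"
    using Xi_cond_exp[of t] t by (auto elim: eventually_elim2)
  show "L2 (\<Xi> t)"
    by (rule L2_bound(1)[OF cadlag_adaptedD(2)[OF Xi_cadlag_adapted t] S.real_cond_exp_int(1)[OF Xi_L2] le])
  show "expectation (\<lambda>\<omega>. (\<Xi> t \<omega>)\<^sup>2) \<le> expectation (\<lambda>\<omega>. (\<Xi> T \<omega>)\<^sup>2)"
    using L2_bound(2)[OF cadlag_adaptedD(2)[OF Xi_cadlag_adapted t] S.real_cond_exp_int(1)[OF Xi_L2] le]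
    by (simp add: S.real_cond_exp_int(2)[OF Xi_L2])
qed

lemma Xi_supL2: "supL2 \<Xi>"
  unfolding supL2_def using Xi_L2_le cadlag_adaptedD[OF Xi_cadlag_adapted]
  by (auto intro!: exI[of _ "expectation (\<lambda>\<omega>. (\<Xi> T \<omega>)\<^sup>2)"])

text \<open>The martingale property in weak form. The orthogonality arguments below use only such
  pairings with square-integrable \<open>F s\<close>-measurable variables and no longer conditional
  expectations.\<close>

lemma Xi_martingale:
  assumes st: "0 \<le> s" "s \<le> t" "t \<le> T" and Z: "L2 Z" "Z \<in> borel_measurable (F s)"
  shows "expectation (\<lambda>\<omega>. \<Xi> t \<omega> * Z \<omega>) = expectation (\<lambda>\<omega>. \<Xi> s \<omega> * Z \<omega>)"
proof -
  have key: "expectation (\<lambda>\<omega>. \<Xi> r \<omega> * Z \<omega>) = expectation (\<lambda>\<omega>. \<Xi> T \<omega> * Z \<omega>)" if r: "s \<le> r" "r \<le> T" for r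
  proof -
    have r0: "0 \<le> r" using r st by simp
    interpret S: sigma_finite_subalgebra M "F r" using r r0 by (intro sigma_finite_subalgebra_F) auto
    have "(\<integral> \<omega>. Z \<omega> * real_cond_exp M (F r) (\<Xi> T) \<omega> \<partial>M) = (\<integral> \<omega>. Z \<omega> * \<Xi> T \<omega> \<partial>M)"
      using measurable_F_mono[OF Z(2) st(1) r] Xi_sq_L2
      by (intro S.real_cond_exp_intg(2) L2_mult Z) (auto simp: L2_def)
    moreover have "(\<integral> \<omega>. \<Xi> r \<omega> * Z \<omega> \<partial>M) = (\<integral> \<omega>. Z \<omega> * real_cond_exp M (F r) (\<Xi> T) \<omega> \<partial>M)"
    proof (rule integral_cong_AE)
      show "AE \<omega> in M. \<Xi> r \<omega> * Z \<omega> = Z \<omega> * real_cond_exp M (F r) (\<Xi> T) \<omega>"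
        using Xi_cond_exp[of r] r r0 by (auto elim!: eventually_mono)
    qed (use Z Xi_L2_le(1)[OF r0 r(2)] in \<open>auto simp: L2_def\<close>)
    ultimately show ?thesis by (simp add: mult.commute)
  qed
  show ?thesis using key[of t] key[of s] st by simp
qed

lemma opt_mart_explicit_supL2:
  "supL2 (\<lambda>t \<omega>. opt_weight t * \<Xi> t \<omega> + opt_weight 0 * (y / lam 0) - (LINT s:{0..t}|lborel. opt_weight_dot s * \<Xi> s \<omega>))"
  by (intro supL2_diff supL2_add supL2_scale supL2_integral Xi_supL2 opt_weight_dot_rcb rcb_continuous[OF opt_weight_cont]
      supL2_const L2_const) auto

lemma opt_mart_eq_at:
  assumes "0 \<le> t" "t \<le> T"
  shows "AE \<omega> in M. opt_mart t \<omega> = opt_weight t * \<Xi> t \<omega> + opt_weight 0 * (y / lam 0) - (LINT s:{0..t}|lborel. opt_weight_dot s * \<Xi> s \<omega>)"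
  using opt_mart_eq by eventually_elim (use assms in auto)

lemma opt_mart_supL2: "supL2 opt_mart"
proof -
  define X where "X t \<omega> = opt_weight t * \<Xi> t \<omega> + opt_weight 0 * (y / lam 0) - (LINT s:{0..t}|lborel. opt_weight_dot s * \<Xi> s \<omega>)" for t \<omega>
  have X: "supL2 X" unfolding X_def by (rule opt_mart_explicit_supL2)
  obtain C where C: "\<And>t. 0 \<le> t \<Longrightarrow> t \<le> T \<Longrightarrow> expectation (\<lambda>\<omega>. (X t \<omega>)\<^sup>2) \<le> C" using supL2_bound[OF X] by metis
  have "L2 (opt_mart t) \<and> expectation (\<lambda>\<omega>. (opt_mart t \<omega>)\<^sup>2) \<le> C" if t: "t \<in> {0..T}" for t
  proof -
    have t': "0 \<le> t" "t \<le> T" using t by auto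
    have m: "opt_mart t \<in> borel_measurable M" by (rule cadlag_adaptedD(2)[OF opt_mart_cadlag_adapted t'])
    have ae: "AE \<omega> in M. (opt_mart t \<omega>)\<^sup>2 \<le> (X t \<omega>)\<^sup>2"
      using opt_mart_eq_at[OF t'] unfolding X_def[symmetric] by eventually_elim simp
    have i: "integrable M (\<lambda>\<omega>. (X t \<omega>)\<^sup>2)" using supL2D(4)[OF X t'] by (simp add: L2_def)
    show ?thesis using L2_bound[OF m i ae] C[OF t'] by auto
  qed
  then show ?thesis unfolding supL2_def using cadlag_adaptedD[OF opt_mart_cadlag_adapted]
    by (auto intro!: exI[of _ C])
qed

text \<open>From time \<open>s\<close> on the pairing of \<open>\<Xi>\<close> with \<open>Z\<close>
  is constant, so the growth of \<open>opt_weight\<close> in the first term is cancelled by the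
  integral of \<open>opt_weight_dot\<close>.\<close>

lemma opt_mart_martingale:
  assumes st: "0 \<le> s" "s \<le> t" "t \<le> T" and Z: "L2 Z" "Z \<in> borel_measurable (F s)"
  shows "expectation (\<lambda>\<omega>. opt_mart t \<omega> * Z \<omega>) = expectation (\<lambda>\<omega>. opt_mart s \<omega> * Z \<omega>)"
proof -
  define x where "x = expectation (\<lambda>\<omega>. \<Xi> s \<omega> * Z \<omega>)"
  define e where "e r = expectation (\<lambda>\<omega>. \<Xi> r \<omega> * Z \<omega>)" for r
  have e: "e r = x" if "s \<le> r" "r \<le> T" for r
    unfolding e_def x_def using that st by (intro Xi_martingale Z) auto
  have E: "expectation (\<lambda>\<omega>. opt_mart r \<omega> * Z \<omega>) = opt_weight r * e r + opt_weight 0 * (y / lam 0) * expectation Z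
      - (LINT q:{0..r}|lborel. opt_weight_dot q * e q)" if r: "0 \<le> r" "r \<le> T" for r
  proof -
    have i: "integrable M (\<lambda>\<omega>. \<Xi> r \<omega> * Z \<omega>)" "integrable M (\<lambda>\<omega>. (LINT q:{0..r}|lborel. opt_weight_dot q * \<Xi> q \<omega>) * Z \<omega>)" "integrable M Z"
      using supL2D(4)[OF Xi_supL2 r] supL2D(4)[OF supL2_integral[OF Xi_supL2 opt_weight_dot_rcb] r] Z by (auto intro: L2_mult L2_integrable)
    have "expectation (\<lambda>\<omega>. opt_mart r \<omega> * Z \<omega>) = expectation (\<lambda>\<omega>. (opt_weight r * \<Xi> r \<omega> + opt_weight 0 * (y / lam 0) - (LINT q:{0..r}|lborel. opt_weight_dot q * \<Xi> q \<omega>)) * Z \<omega>)"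
    proof (rule integral_cong_AE)
      show "AE \<omega> in M. opt_mart r \<omega> * Z \<omega> = (opt_weight r * \<Xi> r \<omega> + opt_weight 0 * (y / lam 0) - (LINT q:{0..r}|lborel. opt_weight_dot q * \<Xi> q \<omega>)) * Z \<omega>"
        using opt_mart_eq_at[OF r] by eventually_elim simp
    qed (use Z supL2D(2)[OF opt_mart_supL2 r] supL2D(2)[OF opt_mart_explicit_supL2 r] in \<open>auto simp: L2_def\<close>)
    also have "\<dots> = expectation (\<lambda>\<omega>. opt_weight r * (\<Xi> r \<omega> * Z \<omega>) + opt_weight 0 * (y / lam 0) * Z \<omega> - (LINT q:{0..r}|lborel. opt_weight_dot q * \<Xi> q \<omega>) * Z \<omega>)"
      by (intro Bochner_Integration.integral_cong) (auto simp: algebra_simps)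
    also have "\<dots> = opt_weight r * e r + opt_weight 0 * (y / lam 0) * expectation Z - (LINT q:{0..r}|lborel. opt_weight_dot q * e q)"
      using i by (simp add: e_def expectation_mult_integral[OF Xi_supL2 opt_weight_dot_rcb Z(1) r])
    finally show ?thesis .
  qed
  have gi: "set_integrable lborel {0..t} (\<lambda>q. opt_weight_dot q * e q)"
  proof -
    have "set_integrable lborel {0..T} (\<lambda>q. expectation (\<lambda>\<omega>. (opt_weight_dot q * \<Xi> q \<omega>) * Z \<omega>))"
      by (rule Fubini_leb(3)[OF L2P_mult[OF supL2_L2P[OF supL2_scale[OF Xi_supL2 opt_weight_dot_rcb]] L2P_const[OF Z(1)]]])
    then have "set_integrable lborel {0..T} (\<lambda>q. opt_weight_dot q * e q)" by (simp add: e_def mult.assoc)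
    then show ?thesis by (rule set_integrable_subset) (use st in auto)
  qed
  have "(LINT q:{0..t}|lborel. opt_weight_dot q * e q) = (LINT q:{0..s}|lborel. opt_weight_dot q * e q) + (LINT q:{s<..t}|lborel. opt_weight_dot q * e q)"
    by (rule set_integral_Icc_split[OF gi st(1,2)])
  also have "(LINT q:{s<..t}|lborel. opt_weight_dot q * e q) = (LINT q:{s<..t}|lborel. opt_weight_dot q) * x"
    unfolding set_lebesgue_integral_def integral_mult_left_zero[symmetric] using e st
    by (intro Bochner_Integration.integral_cong) (auto simp: indicator_def)
  also have "(LINT q:{s<..t}|lborel. opt_weight_dot q) = opt_weight t - opt_weight s"
    using set_integral_Icc_split[OF rcb_integrable[OF opt_weight_dot_rcb T_ge0 st(3) order_refl] st(1,2)] opt_weight_FTC[of t] opt_weight_FTC[of s] st by simp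
  finally show ?thesis using E[of t] E[of s] e[of t] e[of s] st by (simp add: algebra_simps)
qed

end

section \<open>Optimality\<close>

context filtered_prob_space
begin

text \<open>\<open>T\<close> is treated apart because the optimizer and its state follow their first
  formula only before \<open>T\<close>.\<close>

lemma supL2_cong_AE:
  assumes X: "supL2 X" and Y: "\<And>t. 0 \<le> t \<Longrightarrow> t \<le> T \<Longrightarrow> Y t \<in> borel_measurable (F t)"
    "\<And>\<omega>. \<omega> \<in> space M \<Longrightarrow> rcb T (\<lambda>t. Y t \<omega>)"
    and eq: "\<And>t. 0 \<le> t \<Longrightarrow> t < T \<Longrightarrow> AE \<omega> in M. Y t \<omega> = X t \<omega>" and YT: "L2 (Y T)"
  shows "supL2 Y"
proof -
  obtain C where C: "\<And>t. 0 \<le> t \<Longrightarrow> t \<le> T \<Longrightarrow> expectation (\<lambda>\<omega>. (X t \<omega>)\<^sup>2) \<le> C" using supL2_bound[OF X] by metis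
  have "L2 (Y t) \<and> expectation (\<lambda>\<omega>. (Y t \<omega>)\<^sup>2) \<le> max C (expectation (\<lambda>\<omega>. (Y T \<omega>)\<^sup>2))" if t: "0 \<le> t" "t \<le> T" for t
  proof (cases "t < T")
    case True
    have m: "Y t \<in> borel_measurable M" using measurable_F_M[OF Y(1)] t by auto
    have ae: "AE \<omega> in M. (Y t \<omega>)\<^sup>2 \<le> (X t \<omega>)\<^sup>2" using eq[OF t(1) True] by eventually_elim simp
    have i: "integrable M (\<lambda>\<omega>. (X t \<omega>)\<^sup>2)" using supL2D(4)[OF X t] by (simp add: L2_def)
    show ?thesis using L2_bound[OF m i ae] C[OF t] by (auto simp: le_max_iff_disj)
  next
    case False
    then have "t = T" using t by simp
    then show ?thesis using YT by simp
  qed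
  then show ?thesis unfolding supL2_def using Y by (auto intro!: exI[of _ "max C (expectation (\<lambda>\<omega>. (Y T \<omega>)\<^sup>2))"])
qed

end

context execution_problem
begin

lemma strategiesD:
  assumes "Q \<in> strategies"
  shows "cadlag_adapted Q" "supL2 Q" "AE \<omega> in M. Q T \<omega> = \<Xi> T \<omega>"
proof -
  show cad: "cadlag_adapted Q" and "AE \<omega> in M. Q T \<omega> = \<Xi> T \<omega>"
    using assms by (auto simp: strategies_def semimartingale_def)
  define C where "C = (\<integral>\<^sup>+ \<omega>. (SUP t\<in>{0..T}. ennreal ((Q t \<omega>)\<^sup>2)) \<partial>M)"
  have C: "C < \<infinity>" using assms by (auto simp: strategies_def C_def)
  have "L2 (Q t) \<and> expectation (\<lambda>\<omega>. (Q t \<omega>)\<^sup>2) \<le> enn2real C" if t: "t \<in> {0..T}" for t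
  proof -
    have [measurable]: "Q t \<in> borel_measurable M" using t by (intro cadlag_adaptedD(2)[OF cad]) auto
    have le: "(\<integral>\<^sup>+ \<omega>. ennreal ((Q t \<omega>)\<^sup>2) \<partial>M) \<le> C"
      unfolding C_def using t by (intro nn_integral_mono SUP_upper)
    then have i: "integrable M (\<lambda>\<omega>. (Q t \<omega>)\<^sup>2)" using C by (intro integrableI_nonneg) auto
    have "ennreal (expectation (\<lambda>\<omega>. (Q t \<omega>)\<^sup>2)) \<le> C"
      using le nn_integral_eq_integral[OF i] by simp
    then have "expectation (\<lambda>\<omega>. (Q t \<omega>)\<^sup>2) \<le> enn2real C"
      using C enn2real_mono[of "ennreal (expectation (\<lambda>\<omega>. (Q t \<omega>)\<^sup>2))" C] by (simp add: enn2real_ennreal)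
    then show ?thesis using i by (simp add: L2_def)
  qed
  then show "supL2 Q" unfolding supL2_def using cadlag_adaptedD[OF cad]
    by (auto intro!: exI[of _ "enn2real C"])
qed

definition alpha :: "real \<Rightarrow> real" where "alpha t = eta t / lam t"

lemma alpha_cadlag: "cadlag_on T alpha"
  unfolding alpha_def[abs_def] by (rule lam_lower, rule cadlag_on_divide[OF eta_cadlag lam_cadlag]) auto

lemmas alpha_rcb = cadlag_on_rcb[OF alpha_cadlag]

lemma Qopt_before:
  "t < T \<Longrightarrow> Qopt t \<omega> = alpha t * opt_mart t \<omega> - y / lam 0 + (LINT s:{0..t}|lborel. thetadot s * opt_mart s \<omega>)"
  by (simp add: Qopt_def alpha_def)

lemma Qopt_supL2: "supL2 Qopt"
proof (rule supL2_cong_AE)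
  show "supL2 (\<lambda>t \<omega>. alpha t * opt_mart t \<omega> - y / lam 0 + (LINT s:{0..t}|lborel. thetadot s * opt_mart s \<omega>))"
    by (intro supL2_diff supL2_add supL2_scale supL2_integral opt_mart_supL2 thetadot_rcb alpha_rcb supL2_const L2_const) auto
  show "L2 (Qopt T)" using Xi_sq_L2 by (simp add: Qopt_def[abs_def])
qed (use cadlag_adaptedD[OF Qopt_cadlag_adapted] in \<open>auto simp: Qopt_before\<close>)

lemma state_sol_supL2:
  assumes Q: "supL2 Q" shows "supL2 (\<lambda>t \<omega>. state_sol y0 (\<lambda>s. Q s \<omega>) t)"
proof -
  have "(\<lambda>t \<omega>. state_sol y0 (\<lambda>s. Q s \<omega>) t) = (\<lambda>t \<omega>. lam t * Q t \<omega> + exp (- Bint t) * (y0 - (LINT s:{0..t}|lborel. kern s * Q s \<omega>)))"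
    by (simp add: state_sol_def response_def kern_def)
  moreover have "rcb T (\<lambda>t. exp (- Bint t))" by (intro rcb_continuous continuous_intros Bint_cont)
  ultimately show ?thesis
    by (auto intro!: supL2_add supL2_diff supL2_scale supL2_integral Q lam_rcb kern_rcb supL2_const L2_const)
qed

lemma Yopt_supL2: "supL2 Yopt"
proof (rule supL2_cong_AE)
  show "supL2 (\<lambda>t \<omega>. eta t * opt_mart t \<omega>)" by (intro supL2_scale opt_mart_supL2 eta_rcb)
  show "L2 (Yopt T)" using supL2D(4)[OF opt_mart_supL2 T_ge0] by (simp add: Yopt_def[abs_def])
  show "Yopt t \<in> borel_measurable (F t)" if t: "0 \<le> t" "t \<le> T" for t
    unfolding Yopt_def[abs_def] using supL2D(1)[OF opt_mart_supL2 t] by (cases "t < T") auto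
qed (auto simp: Yopt_def[abs_def] intro!: Yopt_rcb[unfolded Yopt_def])

section \<open>The cost as a quadratic form in the state\<close>

definition run_weight :: "real \<Rightarrow> real" where "run_weight t = (2 * bet t + gamdot t) / (2 * lam t)"

lemma run_weight_rcb: "rcb T run_weight"
proof -
  obtain c where c: "0 < c" "\<And>t. 0 \<le> t \<Longrightarrow> t \<le> T \<Longrightarrow> c \<le> lam t" using lam_lower by blast
  show ?thesis unfolding run_weight_def[abs_def]
    by (rule rcb_divide[of _ _ _ "2 * c"])
      (use c in \<open>auto intro!: rcb_add rcb_mult rcb_const bet_rcb gamdot_rcb lam_rcb\<close>)
qed

lemma run_weight_nonneg: "0 \<le> t \<Longrightarrow> t \<le> T \<Longrightarrow> 0 \<le> run_weight t"
  using lam_pos[of t] coercive_pos[of t] by (simp add: run_weight_def)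

definition path_form :: "(real \<Rightarrow> 'a \<Rightarrow> real) \<Rightarrow> (real \<Rightarrow> 'a \<Rightarrow> real) \<Rightarrow> 'a \<Rightarrow> real" where
  "path_form Y Z \<omega> = (LINT t:{0..T}|lborel. run_weight t * Y t \<omega> * Z t \<omega>) + 1 / (2 * lam T) * Y T \<omega> * Z T \<omega>"

lemma inner_H_path_form: "inner_H Y Z = expectation (path_form Y Z)"
  by (simp add: inner_H_def path_form_def[abs_def] run_weight_def)

lemma path_form_integrable:
  assumes Y: "supL2 Y" and Z: "supL2 Z" shows "integrable M (path_form Y Z)"
proof -
  have "integrable M (\<lambda>\<omega>. LINT t:{0..T}|lborel. run_weight t * Y t \<omega> * Z t \<omega>)"
    by (rule Fubini_leb(1)[OF L2P_mult[OF supL2_L2P[OF supL2_scale[OF Y run_weight_rcb]] supL2_L2P[OF Z]]])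
  moreover have "integrable M (\<lambda>\<omega>. 1 / (2 * lam T) * (Y T \<omega> * Z T \<omega>))"
    by (intro integrable_mult_right L2_mult supL2D(4) Y Z T_ge0 order_refl)
  ultimately show ?thesis unfolding path_form_def[abs_def] by (simp add: mult.assoc)
qed

lemma path_form_add_square:
  assumes Y: "rcb T (\<lambda>t. Y t \<omega>)" and Z: "rcb T (\<lambda>t. Z t \<omega>)"
  shows "path_form (\<lambda>t \<omega>. Y t \<omega> + Z t \<omega>) (\<lambda>t \<omega>. Y t \<omega> + Z t \<omega>) \<omega> = path_form Y Y \<omega> + 2 * path_form Y Z \<omega> + path_form Z Z \<omega>"
proof -
  have i: "set_integrable lborel {0..T} (\<lambda>t. run_weight t * Y t \<omega> * Y t \<omega>)" "set_integrable lborel {0..T} (\<lambda>t. run_weight t * Y t \<omega> * Z t \<omega>)"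
    "set_integrable lborel {0..T} (\<lambda>t. run_weight t * Z t \<omega> * Z t \<omega>)"
    by (intro rcb_integrable[OF _ T_ge0 order_refl order_refl] rcb_mult run_weight_rcb Y Z)+
  have "(LINT t:{0..T}|lborel. run_weight t * (Y t \<omega> + Z t \<omega>) * (Y t \<omega> + Z t \<omega>)) =
    (LINT t:{0..T}|lborel. run_weight t * Y t \<omega> * Y t \<omega> + 2 * (run_weight t * Y t \<omega> * Z t \<omega>) + run_weight t * Z t \<omega> * Z t \<omega>)"
    by (simp add: algebra_simps)
  also have "\<dots> = (LINT t:{0..T}|lborel. run_weight t * Y t \<omega> * Y t \<omega>) + 2 * (LINT t:{0..T}|lborel. run_weight t * Y t \<omega> * Z t \<omega>)
      + (LINT t:{0..T}|lborel. run_weight t * Z t \<omega> * Z t \<omega>)"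
    using i by (simp add: set_integral_add)
  moreover define q where "q = 1 / (2 * lam T)"
  ultimately show ?thesis unfolding path_form_def q_def[symmetric] by (simp add: algebra_simps)
qed

lemma path_form_cong:
  assumes "\<And>t. 0 \<le> t \<Longrightarrow> t \<le> T \<Longrightarrow> Y t \<omega> = Y' t \<omega>" "\<And>t. 0 \<le> t \<Longrightarrow> t \<le> T \<Longrightarrow> Z t \<omega> = Z' t \<omega>"
  shows "path_form Y Z \<omega> = path_form Y' Z' \<omega>"
proof -
  have "(LINT t:{0..T}|lborel. run_weight t * Y t \<omega> * Z t \<omega>) = (LINT t:{0..T}|lborel. run_weight t * Y' t \<omega> * Z' t \<omega>)"
    using assms by (intro set_lebesgue_integral_cong) auto
  then show ?thesis using assms T_ge0 by (simp add: path_form_def)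
qed

lemma path_form_square_nonneg: "0 \<le> path_form Z Z \<omega>"
proof -
  have "0 \<le> (LINT t:{0..T}|lborel. run_weight t * Z t \<omega> * Z t \<omega>)"
    unfolding set_lebesgue_integral_def using run_weight_nonneg
    by (intro integral_nonneg_AE AE_I2) (auto simp: indicator_def mult.assoc)
  then show ?thesis using lam_pos[of T] T_ge0 by (simp add: path_form_def mult.assoc)
qed

lemma C_H_sq_ge: "1 / (2 * lam T) \<le> C_H_sq" "0 \<le> t \<Longrightarrow> t < T \<Longrightarrow> run_weight t \<le> C_H_sq"
proof -
  show "1 / (2 * lam T) \<le> C_H_sq" by (simp add: C_H_sq_def)
  assume t: "0 \<le> t" "t < T"
  have "rcb T (\<lambda>t. 2 * run_weight t)" by (intro rcb_mult rcb_const run_weight_rcb)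
  moreover have e: "(\<lambda>t. 2 * run_weight t) = (\<lambda>t. (2 * bet t + gamdot t) / lam t)"
    unfolding run_weight_def times_divide_eq_right by (intro ext mult_divide_mult_cancel_left) simp
  ultimately have "2 * run_weight t \<le> Linf_norm T (\<lambda>t. (2 * bet t + gamdot t) / lam t)"
    using rcb_le_Linf_norm[of T "\<lambda>t. 2 * run_weight t" t] t by auto
  then show "run_weight t \<le> C_H_sq" by (simp add: C_H_sq_def le_max_iff_disj)
qed

lemma C_H_sq_nonneg: "0 \<le> C_H_sq"
  using C_H_sq_ge(1) lam_pos[of T] T_ge0 by (auto intro: order_trans[rotated])

lemma path_form_square_le:
  assumes Z: "rcb T (\<lambda>t. Z t \<omega>)"
  shows "path_form Z Z \<omega> \<le> C_H_sq * ((LINT t:{0..T}|lborel. (Z t \<omega>)\<^sup>2) + (Z T \<omega>)\<^sup>2)"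
proof -
  have "(LINT t:{0..T}|lborel. run_weight t * Z t \<omega> * Z t \<omega>) \<le> (LINT t:{0..T}|lborel. C_H_sq * (Z t \<omega>)\<^sup>2)"
    unfolding set_lebesgue_integral_def
  proof (rule integral_mono_AE)
    have "rcb T (\<lambda>t. run_weight t * Z t \<omega> * Z t \<omega>)" "rcb T (\<lambda>t. C_H_sq * (Z t \<omega>)\<^sup>2)"
      by (intro rcb_mult rcb_power rcb_const run_weight_rcb Z)+
    then show "integrable lborel (\<lambda>t. indicat_real {0..T} t *\<^sub>R (run_weight t * Z t \<omega> * Z t \<omega>))"
      "integrable lborel (\<lambda>t. indicat_real {0..T} t *\<^sub>R (C_H_sq * (Z t \<omega>)\<^sup>2))"
      using rcb_integrable[OF _ T_ge0 order_refl order_refl] unfolding set_integrable_def by blast+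
    show "AE t in lborel. indicat_real {0..T} t *\<^sub>R (run_weight t * Z t \<omega> * Z t \<omega>) \<le> indicat_real {0..T} t *\<^sub>R (C_H_sq * (Z t \<omega>)\<^sup>2)"
      using AE_lborel_singleton[of T]
      by eventually_elim (use C_H_sq_ge(2) in \<open>auto simp: indicator_def power2_eq_square mult.assoc intro!: mult_right_mono\<close>)
  qed
  moreover have "1 / (2 * lam T) * Z T \<omega> * Z T \<omega> \<le> C_H_sq * (Z T \<omega>)\<^sup>2"
    unfolding mult.assoc power2_eq_square by (intro mult_right_mono C_H_sq_ge(1)) auto
  ultimately show ?thesis by (simp add: path_form_def algebra_simps)
qed

text \<open>The value of \<open>eta\<close> is what makes \<open>run_weight * eta = rho / 2\<close>.
  On the other side, \<open>D T = 0\<close> and the inversion formula give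
  \<open>Z T / lam T\<close> as minus the integral of \<open>rho * Z\<close>. So the running part
  pairs \<open>rho * Z\<close> with the martingale at time \<open>t\<close> and the terminal part
  pairs it with the value at \<open>T\<close>; as \<open>Z t\<close> is
  \<open>F t\<close>-measurable, the two expectations agree.\<close>

lemma first_order_condition:
  assumes D: "supL2 D" and DT: "AE \<omega> in M. D T \<omega> = 0"
  shows "inner_H Yopt (\<lambda>t \<omega>. state_sol 0 (\<lambda>s. D s \<omega>) t) = 0"
proof -
  define Z where "Z t \<omega> = state_sol 0 (\<lambda>s. D s \<omega>) t" for t \<omega>
  have Z: "supL2 Z" unfolding Z_def[abs_def] by (rule state_sol_supL2[OF D])
  note m = opt_mart_supL2
  have ae: "AE \<omega> in M. path_form Yopt Z \<omega> = 1 / 2 * ((LINT t:{0..T}|lborel. rho t * Z t \<omega> * opt_mart t \<omega>)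
      - (LINT t:{0..T}|lborel. rho t * Z t \<omega>) * opt_mart T \<omega>)"
    using DT AE_space
  proof eventually_elim
    case (elim \<omega>)
    have "0 = Z T \<omega> / lam T + (LINT s:{0..T}|lborel. rho s * Z s \<omega>)"
      using state_sol_inverse[OF supL2D(3)[OF D elim(2)] T_ge0 order_refl, of 0] elim(1) by (simp add: Z_def)
    then have ZT: "1 / (2 * lam T) * opt_mart T \<omega> * Z T \<omega> = - (1 / 2) * (LINT s:{0..T}|lborel. rho s * Z s \<omega>) * opt_mart T \<omega>"
    proof -
      have "1 / (2 * lam T) * opt_mart T \<omega> * Z T \<omega> = 1 / 2 * (Z T \<omega> / lam T) * opt_mart T \<omega>" by simp
      also have "Z T \<omega> / lam T = - (LINT s:{0..T}|lborel. rho s * Z s \<omega>)"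
        using \<open>0 = Z T \<omega> / lam T + _\<close> by linarith
      finally show ?thesis by simp
    qed
    have "(LINT t:{0..T}|lborel. run_weight t * Yopt t \<omega> * Z t \<omega>) = (LINT t:{0..T}|lborel. 1 / 2 * (rho t * Z t \<omega> * opt_mart t \<omega>))"
      unfolding set_lebesgue_integral_def
    proof (rule integral_cong_AE)
      have "rcb T (\<lambda>t. run_weight t * Yopt t \<omega> * Z t \<omega>)" "rcb T (\<lambda>t. 1 / 2 * (rho t * Z t \<omega> * opt_mart t \<omega>))"
        by (intro rcb_mult rcb_const run_weight_rcb rho_rcb supL2D(3)[OF Z elim(2)] supL2D(3)[OF m elim(2)] Yopt_rcb elim(2))+
      then show "(\<lambda>t. indicat_real {0..T} t *\<^sub>R (run_weight t * Yopt t \<omega> * Z t \<omega>)) \<in> borel_measurable lborel"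
        "(\<lambda>t. indicat_real {0..T} t *\<^sub>R (1 / 2 * (rho t * Z t \<omega> * opt_mart t \<omega>))) \<in> borel_measurable lborel"
        using rcb_set_measurable[OF _ T_ge0 order_refl order_refl] unfolding set_borel_measurable_def by blast+
      show "AE t in lborel. indicat_real {0..T} t *\<^sub>R (run_weight t * Yopt t \<omega> * Z t \<omega>) = indicat_real {0..T} t *\<^sub>R (1 / 2 * (rho t * Z t \<omega> * opt_mart t \<omega>))"
        using AE_lborel_singleton[of T]
      proof eventually_elim
        case (elim t)
        show ?case
        proof (cases "t \<in> {0..T}")
          case True
          then have t: "0 \<le> t" "t < T" using elim by auto
          then have "run_weight t * eta t = 1 / 2 * rho t"
            using coercive_pos[of t] lam_pos[of t] by (simp add: run_weight_def eta_def rho_def)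
          then have "run_weight t * (eta t * opt_mart t \<omega>) = 1 / 2 * rho t * opt_mart t \<omega>" by (simp flip: mult.assoc)
          then show ?thesis using True t by (auto simp: Yopt_def)
        qed simp
      qed
    qed
    also have "\<dots> = 1 / 2 * (LINT t:{0..T}|lborel. rho t * Z t \<omega> * opt_mart t \<omega>)" by simp
    finally show ?case unfolding path_form_def using ZT by (simp add: Yopt_def algebra_simps)
  qed
  have rZ: "supL2 (\<lambda>t \<omega>. rho t * Z t \<omega>)" by (rule supL2_scale[OF Z rho_rcb])
  have i1: "integrable M (\<lambda>\<omega>. LINT t:{0..T}|lborel. rho t * Z t \<omega> * opt_mart t \<omega>)"
    by (rule Fubini_leb(1)[OF L2P_mult[OF supL2_L2P[OF rZ] supL2_L2P[OF m]]])
  have i2: "integrable M (\<lambda>\<omega>. (LINT t:{0..T}|lborel. rho t * Z t \<omega>) * opt_mart T \<omega>)"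
    by (intro L2_mult supL2D(4)[OF supL2_integral[OF Z rho_rcb]] supL2D(4)[OF m] T_ge0 order_refl)
  have "inner_H Yopt Z = expectation (\<lambda>\<omega>. 1 / 2 * ((LINT t:{0..T}|lborel. rho t * Z t \<omega> * opt_mart t \<omega>)
      - (LINT t:{0..T}|lborel. rho t * Z t \<omega>) * opt_mart T \<omega>))"
    unfolding inner_H_path_form using ae path_form_integrable[OF Yopt_supL2 Z] i1 i2 by (intro integral_cong_AE) auto
  also have "\<dots> = 1 / 2 * (expectation (\<lambda>\<omega>. LINT t:{0..T}|lborel. rho t * Z t \<omega> * opt_mart t \<omega>)
      - expectation (\<lambda>\<omega>. (LINT t:{0..T}|lborel. rho t * Z t \<omega>) * opt_mart T \<omega>))"
    using i1 i2 by simp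
  also have "expectation (\<lambda>\<omega>. LINT t:{0..T}|lborel. rho t * Z t \<omega> * opt_mart t \<omega>)
    = (LINT t:{0..T}|lborel. expectation (\<lambda>\<omega>. rho t * Z t \<omega> * opt_mart t \<omega>))"
    by (rule Fubini_leb(4)[OF L2P_mult[OF supL2_L2P[OF rZ] supL2_L2P[OF m]]])
  also have "expectation (\<lambda>\<omega>. (LINT t:{0..T}|lborel. rho t * Z t \<omega>) * opt_mart T \<omega>)
    = (LINT t:{0..T}|lborel. rho t * expectation (\<lambda>\<omega>. Z t \<omega> * opt_mart T \<omega>))"
    by (rule expectation_mult_integral[OF Z rho_rcb supL2D(4)[OF m T_ge0 order_refl] T_ge0 order_refl])
  also have "(LINT t:{0..T}|lborel. rho t * expectation (\<lambda>\<omega>. Z t \<omega> * opt_mart T \<omega>)) =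
    (LINT t:{0..T}|lborel. expectation (\<lambda>\<omega>. rho t * Z t \<omega> * opt_mart t \<omega>))"
  proof (rule set_lebesgue_integral_cong)
    show "\<forall>t. t \<in> {0..T} \<longrightarrow> rho t * expectation (\<lambda>\<omega>. Z t \<omega> * opt_mart T \<omega>) = expectation (\<lambda>\<omega>. rho t * Z t \<omega> * opt_mart t \<omega>)"
      using opt_mart_martingale[OF _ _ order_refl supL2D(4)[OF Z] supL2D(1)[OF Z]] by (simp add: mult.assoc mult.commute[of "Z _ _"])
  qed simp
  finally show ?thesis by (simp add: Z_def[abs_def])
qed

lemma J0_gap:
  assumes Q: "cadlag_adapted Q" "supL2 Q" "AE \<omega> in M. Q T \<omega> = \<Xi> T \<omega>"
  shows "0 \<le> J0 Q - J0 Qopt"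
    and "J0 Q - J0 Qopt \<le> C_J * expectation (\<lambda>\<omega>. LINT t:{0..T}|lborel. (Q t \<omega> - Qopt t \<omega>)\<^sup>2)"
proof -
  define D where "D t \<omega> = Q t \<omega> - Qopt t \<omega>" for t \<omega>
  have D: "supL2 D" unfolding D_def[abs_def] by (rule supL2_diff[OF Q(2) Qopt_supL2])
  have DT: "AE \<omega> in M. D T \<omega> = 0" using Q(3) by eventually_elim (simp add: D_def Qopt_def)
  define Z where "Z t \<omega> = state_sol 0 (\<lambda>s. D s \<omega>) t" for t \<omega>
  have Z: "supL2 Z" unfolding Z_def[abs_def] by (rule state_sol_supL2[OF D])
  have st: "supL2 (state P)" if P: "cadlag_adapted P" "supL2 P" for P
  proof (rule supL2_cong_AE[OF state_sol_supL2[OF P(2), of y]])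
    show ae: "AE \<omega> in M. state P t \<omega> = state_sol y (\<lambda>s. P s \<omega>) t" if "0 \<le> t" "t < T" for t
      using state_eq_state_sol(2)[OF P(1)] by eventually_elim (use that in auto)
    have "AE \<omega> in M. state P T \<omega> = state_sol y (\<lambda>s. P s \<omega>) T"
      using state_eq_state_sol(2)[OF P(1)] by eventually_elim (use T_ge0 in auto)
    then show "L2 (state P T)"
      by (rule L2_cong_AE[OF supL2D(4)[OF state_sol_supL2[OF P(2)] T_ge0 order_refl] cadlag_adaptedD(2)[OF state_eq_state_sol(1)[OF P(1)] T_ge0 order_refl]])
  qed (use cadlag_adaptedD[OF state_eq_state_sol(1)[OF P(1)]] in auto)
  have "AE \<omega> in M. path_form (state Q) (state Q) \<omega> = path_form Yopt Yopt \<omega> + 2 * path_form Yopt Z \<omega> + path_form Z Z \<omega>"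
    using state_eq_state_sol(2)[OF Q(1)] state_sol_Qopt AE_space
  proof eventually_elim
    case (elim \<omega>)
    \<comment> \<open>The common initial value \<open>y\<close> cancels by linearity, so the
      difference of the two states starts from zero.\<close>
    have "state Q t \<omega> = Yopt t \<omega> + Z t \<omega>" if "0 \<le> t" "t \<le> T" for t
      using elim(1,2) that state_sol_diff[OF supL2D(3)[OF Q(2) elim(3)] supL2D(3)[OF Qopt_supL2 elim(3)] that, of y y]
      by (simp add: Z_def D_def algebra_simps)
    then have "path_form (state Q) (state Q) \<omega> = path_form (\<lambda>t \<omega>. Yopt t \<omega> + Z t \<omega>) (\<lambda>t \<omega>. Yopt t \<omega> + Z t \<omega>) \<omega>"
      by (intro path_form_cong) auto
    then show ?case using path_form_add_square[of Yopt \<omega> Z, OF Yopt_rcb[OF elim(3)] supL2D(3)[OF Z elim(3)]] by simp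
  qed
  then have "inner_H (state Q) (state Q) = expectation (\<lambda>\<omega>. path_form Yopt Yopt \<omega> + 2 * path_form Yopt Z \<omega> + path_form Z Z \<omega>)"
    unfolding inner_H_path_form using path_form_integrable[OF st st, OF Q(1,2) Q(1,2)] path_form_integrable[OF Yopt_supL2 Yopt_supL2]
      path_form_integrable[OF Yopt_supL2 Z] path_form_integrable[OF Z Z]
    by (intro integral_cong_AE) auto
  also have "\<dots> = inner_H Yopt Yopt + 2 * inner_H Yopt Z + inner_H Z Z"
    unfolding inner_H_path_form using path_form_integrable[OF Yopt_supL2 Yopt_supL2] path_form_integrable[OF Yopt_supL2 Z] path_form_integrable[OF Z Z]
    by simp
  also have "inner_H Yopt Z = 0" unfolding Z_def[abs_def] by (rule first_order_condition[OF D DT])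
  finally have 1: "inner_H (state Q) (state Q) = inner_H Yopt Yopt + inner_H Z Z" by simp
  have "AE \<omega> in M. path_form (state Qopt) (state Qopt) \<omega> = path_form Yopt Yopt \<omega>"
    using state_eq_state_sol(2)[OF Qopt_cadlag_adapted] state_sol_Qopt
    by eventually_elim (intro path_form_cong, auto)
  then have 2: "inner_H (state Qopt) (state Qopt) = inner_H Yopt Yopt"
    unfolding inner_H_path_form using path_form_integrable[OF st st, OF Qopt_cadlag_adapted Qopt_supL2 Qopt_cadlag_adapted Qopt_supL2]
      path_form_integrable[OF Yopt_supL2 Yopt_supL2]
    by (intro integral_cong_AE) auto
  have gap: "J0 Q - J0 Qopt = inner_H Z Z" using 1 2 by (simp add: J0_def)
  show "0 \<le> J0 Q - J0 Qopt"
    unfolding gap inner_H_path_form by (intro integral_nonneg_AE AE_I2 path_form_square_nonneg)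
  have iD: "integrable M (\<lambda>\<omega>. LINT t:{0..T}|lborel. (D t \<omega>)\<^sup>2)"
    using Fubini_leb(1)[of "\<lambda>t \<omega>. (D t \<omega>)\<^sup>2"] supL2_L2P[OF D] by (simp add: L2P_def)
  have "inner_H Z Z \<le> expectation (\<lambda>\<omega>. C_J * (LINT t:{0..T}|lborel. (D t \<omega>)\<^sup>2))"
    unfolding inner_H_path_form
  proof (rule integral_mono_AE)
    show "AE \<omega> in M. path_form Z Z \<omega> \<le> C_J * (LINT t:{0..T}|lborel. (D t \<omega>)\<^sup>2)"
      using DT AE_space
    proof eventually_elim
      case (elim \<omega>)
      have "path_form Z Z \<omega> \<le> C_H_sq * ((LINT t:{0..T}|lborel. (Z t \<omega>)\<^sup>2) + (Z T \<omega>)\<^sup>2)"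
        by (rule path_form_square_le[of Z \<omega>, OF supL2D(3)[OF Z elim(2)]])
      also have "\<dots> \<le> C_H_sq * (L_Y\<^sup>2 * (LINT t:{0..T}|lborel. (D t \<omega>)\<^sup>2))"
        unfolding Z_def by (intro mult_left_mono C_H_sq_nonneg state_sol_energy_bound supL2D(3)[OF D elim(2)] elim(1))
      finally show ?case by (simp add: C_J_def mult.assoc)
    qed
  qed (use iD path_form_integrable[OF Z Z] in auto)
  then show "J0 Q - J0 Qopt \<le> C_J * expectation (\<lambda>\<omega>. LINT t:{0..T}|lborel. (Q t \<omega> - Qopt t \<omega>)\<^sup>2)"
    unfolding gap D_def by simp
qed

lemma C_J_nonneg: "0 \<le> C_J"
  using C_H_sq_nonneg by (simp add: C_J_def)

end

section \<open>Second moments and translation regularity\<close>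

text \<open>Domination by the increments of one function \<open>V\<close>, which is thereby
  nondecreasing, passes more easily than partition sums through products and reciprocals, and it
  bounds single increments directly.\<close>

definition variation_dominated :: "real \<Rightarrow> (real \<Rightarrow> real) \<Rightarrow> bool" where
  "variation_dominated T f \<longleftrightarrow> (\<exists>V. \<forall>s t. 0 \<le> s \<and> s \<le> t \<and> t \<le> T \<longrightarrow> \<bar>f t - f s\<bar> \<le> V t - V s)"

lemma variation_dominatedI:
  "(\<And>s t. 0 \<le> s \<Longrightarrow> s \<le> t \<Longrightarrow> t \<le> T \<Longrightarrow> \<bar>f t - f s\<bar> \<le> V t - V s) \<Longrightarrow> variation_dominated T f"
  unfolding variation_dominated_def by blast

lemma variation_dominatedE:
  assumes "variation_dominated T f"
  obtains V where "\<And>s t. 0 \<le> s \<Longrightarrow> s \<le> t \<Longrightarrow> t \<le> T \<Longrightarrow> \<bar>f t - f s\<bar> \<le> V t - V s"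
  using assms unfolding variation_dominated_def by blast

lemma variation_dominated_finite_variation: "finite_variation_on T f \<Longrightarrow> variation_dominated T f"
  by (erule finite_variation_on_dominated) (rule variation_dominatedI)

lemma variation_dominated_add:
  assumes "variation_dominated T f" "variation_dominated T g" shows "variation_dominated T (\<lambda>t. f t + g t)"
proof -
  obtain V where V: "\<And>s t. 0 \<le> s \<Longrightarrow> s \<le> t \<Longrightarrow> t \<le> T \<Longrightarrow> \<bar>f t - f s\<bar> \<le> V t - V s" using variation_dominatedE[OF assms(1)] by blast
  obtain W where W: "\<And>s t. 0 \<le> s \<Longrightarrow> s \<le> t \<Longrightarrow> t \<le> T \<Longrightarrow> \<bar>g t - g s\<bar> \<le> W t - W s" using variation_dominatedE[OF assms(2)] by blast
  show ?thesis by (rule variation_dominatedI[of _ _ "\<lambda>t. V t + W t"]) (use V W in fastforce)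
qed

lemma variation_dominated_mult:
  assumes "variation_dominated T f" "variation_dominated T g" "rcb T f" "rcb T g"
  shows "variation_dominated T (\<lambda>t. f t * g t)"
proof -
  obtain V where V: "\<And>s t. 0 \<le> s \<Longrightarrow> s \<le> t \<Longrightarrow> t \<le> T \<Longrightarrow> \<bar>f t - f s\<bar> \<le> V t - V s" using variation_dominatedE[OF assms(1)] by blast
  obtain W where W: "\<And>s t. 0 \<le> s \<Longrightarrow> s \<le> t \<Longrightarrow> t \<le> T \<Longrightarrow> \<bar>g t - g s\<bar> \<le> W t - W s" using variation_dominatedE[OF assms(2)] by blast
  obtain A where A: "0 \<le> A" "\<And>t. 0 \<le> t \<Longrightarrow> t \<le> T \<Longrightarrow> \<bar>f t\<bar> \<le> A" using rcb_bound[OF assms(3)] by metis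
  obtain B where B: "0 \<le> B" "\<And>t. 0 \<le> t \<Longrightarrow> t \<le> T \<Longrightarrow> \<bar>g t\<bar> \<le> B" using rcb_bound[OF assms(4)] by metis
  show ?thesis
  proof (rule variation_dominatedI[of _ _ "\<lambda>t. A * W t + B * V t"])
    fix s t assume st: "0 \<le> s" "s \<le> t" "t \<le> T"
    have "\<bar>f t * g t - f s * g s\<bar> = \<bar>f t * (g t - g s) + g s * (f t - f s)\<bar>" by (simp add: algebra_simps)
    also have "\<dots> \<le> \<bar>f t\<bar> * \<bar>g t - g s\<bar> + \<bar>g s\<bar> * \<bar>f t - f s\<bar>" by (metis abs_mult abs_triangle_ineq)
    also have "\<dots> \<le> A * (W t - W s) + B * (V t - V s)"
      using st A B V[OF st] W[OF st] by (intro add_mono mult_mono) auto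
    finally show "\<bar>f t * g t - f s * g s\<bar> \<le> A * W t + B * V t - (A * W s + B * V s)" by (simp add: algebra_simps)
  qed
qed

lemma variation_dominated_inverse:
  assumes "variation_dominated T g" "0 < c" "\<And>t. 0 \<le> t \<Longrightarrow> t \<le> T \<Longrightarrow> c \<le> g t"
  shows "variation_dominated T (\<lambda>t. 1 / g t)"
proof -
  obtain W where W: "\<And>s t. 0 \<le> s \<Longrightarrow> s \<le> t \<Longrightarrow> t \<le> T \<Longrightarrow> \<bar>g t - g s\<bar> \<le> W t - W s" using variation_dominatedE[OF assms(1)] by blast
  show ?thesis
  proof (rule variation_dominatedI[of _ _ "\<lambda>t. W t / c\<^sup>2"])
    fix s t assume st: "0 \<le> s" "s \<le> t" "t \<le> T"
    have g: "c \<le> g t" "c \<le> g s" using assms(3) st by auto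
    then have opt_weight: "c\<^sup>2 \<le> g t * g s" "0 < g t" "0 < g s" using assms(2) by (auto simp: power2_eq_square intro!: mult_mono)
    have "\<bar>1 / g t - 1 / g s\<bar> = \<bar>g t - g s\<bar> / (g t * g s)"
      using opt_weight by (simp add: diff_frac_eq abs_divide abs_mult abs_minus_commute)
    also have "\<dots> \<le> (W t - W s) / c\<^sup>2" using W[OF st] opt_weight assms(2) by (intro frac_le) auto
    finally show "\<bar>1 / g t - 1 / g s\<bar> \<le> W t / c\<^sup>2 - W s / c\<^sup>2" by (simp add: diff_divide_distrib)
  qed
qed

context filtered_prob_space
begin

text \<open>Weak form of a square-integrable martingale; what is extracted from it is the
  orthogonality of increments to the past.\<close>

definition L2mart :: "(real \<Rightarrow> 'a \<Rightarrow> real) \<Rightarrow> bool" where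
  "L2mart X \<longleftrightarrow> supL2 X \<and> (\<forall>s t Z. 0 \<le> s \<and> s \<le> t \<and> t \<le> T \<and> L2 Z \<and> Z \<in> borel_measurable (F s) \<longrightarrow>
     expectation (\<lambda>\<omega>. X t \<omega> * Z \<omega>) = expectation (\<lambda>\<omega>. X s \<omega> * Z \<omega>))"

lemma L2mart_product:
  assumes X: "L2mart X" and st: "0 \<le> s" "s \<le> t" "t \<le> T"
  shows "expectation (\<lambda>\<omega>. X t \<omega> * X s \<omega>) = expectation (\<lambda>\<omega>. (X s \<omega>)\<^sup>2)"
proof -
  have S: "supL2 X" using X by (simp add: L2mart_def)
  have "expectation (\<lambda>\<omega>. X t \<omega> * X s \<omega>) = expectation (\<lambda>\<omega>. X s \<omega> * X s \<omega>)"
    using X st supL2D(1)[OF S, of s] supL2D(4)[OF S, of s] unfolding L2mart_def by auto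
  then show ?thesis by (simp add: power2_eq_square)
qed

lemma L2mart_increment:
  assumes X: "L2mart X" and st: "0 \<le> s" "s \<le> t" "t \<le> T"
  shows "expectation (\<lambda>\<omega>. (X t \<omega> - X s \<omega>)\<^sup>2) = expectation (\<lambda>\<omega>. (X t \<omega>)\<^sup>2) - expectation (\<lambda>\<omega>. (X s \<omega>)\<^sup>2)"
proof -
  have S: "supL2 X" using X by (simp add: L2mart_def)
  have L: "L2 (X t)" "L2 (X s)" using supL2D(4)[OF S] st by auto
  have "expectation (\<lambda>\<omega>. (X t \<omega> - X s \<omega>)\<^sup>2) = expectation (\<lambda>\<omega>. (X t \<omega>)\<^sup>2 - 2 * (X t \<omega> * X s \<omega>) + (X s \<omega>)\<^sup>2)"
    by (simp add: power2_diff algebra_simps)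
  also have "\<dots> = expectation (\<lambda>\<omega>. (X t \<omega>)\<^sup>2) - 2 * expectation (\<lambda>\<omega>. X t \<omega> * X s \<omega>) + expectation (\<lambda>\<omega>. (X s \<omega>)\<^sup>2)"
    using L L2_mult[OF L] by (simp add: L2_def)
  finally show ?thesis using L2mart_product[OF X st] by simp
qed

lemma L2mart_mono:
  assumes X: "L2mart X" and st: "0 \<le> s" "s \<le> t" "t \<le> T"
  shows "expectation (\<lambda>\<omega>. (X s \<omega>)\<^sup>2) \<le> expectation (\<lambda>\<omega>. (X t \<omega>)\<^sup>2)"
proof -
  have "0 \<le> expectation (\<lambda>\<omega>. (X t \<omega> - X s \<omega>)\<^sup>2)" by simp
  then show ?thesis unfolding L2mart_increment[OF assms] by simp
qed

text \<open>Only pointwise convergence is at hand, so second moments pass to the limit in one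
  direction. This suffices both for right-continuity of the second moment and for the left limit at
  \<open>T\<close>.\<close>

lemma Fatou_L2_limit:
  assumes X: "\<And>k. L2 (X k)" and Y: "Y \<in> borel_measurable M"
    and lim: "\<And>\<omega>. \<omega> \<in> space M \<Longrightarrow> (\<lambda>k. X k \<omega>) \<longlonglongrightarrow> Y \<omega>"
    and le: "\<And>k. expectation (\<lambda>\<omega>. (X k \<omega>)\<^sup>2) \<le> c k" and c: "eventually (\<lambda>k. c k \<le> C) sequentially"
  shows "(\<integral>\<^sup>+ \<omega>. ennreal ((Y \<omega>)\<^sup>2) \<partial>M) \<le> ennreal C"
proof -
  have [measurable]: "X k \<in> borel_measurable M" for k using X by (simp add: L2_def)
  have "(\<integral>\<^sup>+ \<omega>. ennreal ((Y \<omega>)\<^sup>2) \<partial>M) = (\<integral>\<^sup>+ \<omega>. liminf (\<lambda>k. ennreal ((X k \<omega>)\<^sup>2)) \<partial>M)"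
  proof (rule nn_integral_cong)
    fix \<omega> assume "\<omega> \<in> space M"
    then have "(\<lambda>k. ennreal ((X k \<omega>)\<^sup>2)) \<longlonglongrightarrow> ennreal ((Y \<omega>)\<^sup>2)"
      by (intro tendsto_ennrealI tendsto_power lim)
    then show "ennreal ((Y \<omega>)\<^sup>2) = liminf (\<lambda>k. ennreal ((X k \<omega>)\<^sup>2))" by (rule lim_imp_Liminf[OF sequentially_bot, symmetric])
  qed
  also have "\<dots> \<le> liminf (\<lambda>k. \<integral>\<^sup>+ \<omega>. ennreal ((X k \<omega>)\<^sup>2) \<partial>M)"
    by (rule nn_integral_liminf) measurable
  also have "\<dots> \<le> limsup (\<lambda>k. \<integral>\<^sup>+ \<omega>. ennreal ((X k \<omega>)\<^sup>2) \<partial>M)" by (rule Liminf_le_Limsup) simp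
  also have "\<dots> \<le> ennreal C"
  proof (rule Limsup_bounded, use c in eventually_elim)
    case (elim k)
    have "(\<integral>\<^sup>+ \<omega>. ennreal ((X k \<omega>)\<^sup>2) \<partial>M) = ennreal (expectation (\<lambda>\<omega>. (X k \<omega>)\<^sup>2))"
      using X[of k] by (intro nn_integral_eq_integral) (auto simp: L2_def)
    also have "\<dots> \<le> ennreal C" using le[of k] elim by (intro ennreal_leI) auto
    finally show ?case .
  qed
  finally show ?thesis .
qed

end

context execution_problem
begin

section \<open>Regularity of the second moment and finiteness of the constants\<close>

lemma Xi_L2mart: "L2mart \<Xi>"
  unfolding L2mart_def using Xi_supL2 Xi_martingale by auto

lemma opt_mart_L2mart: "L2mart opt_mart"
  unfolding L2mart_def using opt_mart_supL2 opt_mart_martingale by auto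

lemma Xi_second_moment_eq: "0 \<le> t \<Longrightarrow> t \<le> T \<Longrightarrow> expectation (\<lambda>\<omega>. (\<Xi> t \<omega>)\<^sup>2) = Xi_second_moment t"
  by (simp add: Xi_second_moment_def)

lemma Xi_second_moment_mono: "s \<le> t \<Longrightarrow> Xi_second_moment s \<le> Xi_second_moment t"
  unfolding Xi_second_moment_def using T_ge0 by (intro L2mart_mono[OF Xi_L2mart]) auto

lemma Xi_increment:
  "0 \<le> s \<Longrightarrow> s \<le> t \<Longrightarrow> t \<le> T \<Longrightarrow> expectation (\<lambda>\<omega>. (\<Xi> t \<omega> - \<Xi> s \<omega>)\<^sup>2) = Xi_second_moment t - Xi_second_moment s"
  using L2mart_increment[OF Xi_L2mart] by (simp add: Xi_second_moment_eq)

lemma Xi_L2: "0 \<le> t \<Longrightarrow> t \<le> T \<Longrightarrow> L2 (\<Xi> t)"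
  by (rule supL2D(4)[OF Xi_supL2])

text \<open>Right-continuity of paths does not pass to second moments by itself. Write
  \<open>m\<close> for the second moment and \<open>L\<close> for its limit along \<open>s n\<close>
  decreasing to \<open>t\<close>. Fatou bounds the second moment of
  \<open>\<Xi> (s n) - \<Xi> t\<close>, which is \<open>m (s n) - m t\<close>, by
  \<open>m (s n) - L\<close>; hence \<open>L \<le> m t\<close>. With this
  \<open>interval_measure\<close> gives half-open intervals the expected mass.\<close>

lemma Xi_second_moment_right_cont: "continuous (at_right t) Xi_second_moment"
proof -
  let ?m = Xi_second_moment
  consider "t < 0" | "T \<le> t" | "0 \<le> t" "t < T" by linarith
  then have "(?m \<longlongrightarrow> ?m t) (at_right t)"
  proof cases
    case 1
    have "eventually (\<lambda>s. ?m s = ?m t) (at_right t)"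
      unfolding eventually_at_right_field using 1 T_pos by (intro exI[of _ 0]) (auto simp: Xi_second_moment_def)
    then show ?thesis by (rule tendsto_eventually)
  next
    case 2
    have "eventually (\<lambda>s. ?m s = ?m t) (at_right t)"
      unfolding eventually_at_right_field using 2 T_pos by (intro exI[of _ "t + 1"]) (auto simp: Xi_second_moment_def)
    then show ?thesis by (rule tendsto_eventually)
  next
    case 3
    define s where "s n = t + (T - t) / real (Suc n)" for n
    have s: "t < s n" "s n \<le> T" "0 \<le> s n" for n
    proof -
      have "(T - t) / real (Suc n) \<le> (T - t) / 1" using 3 by (intro divide_left_mono) auto
      then show "t < s n" "s n \<le> T" "0 \<le> s n" using 3 by (auto simp: s_def)
    qed
    have s_dec: "s k \<le> s n" if "n \<le> k" for n k
      unfolding s_def using that 3 by (intro add_left_mono divide_left_mono) auto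
    have "(\<lambda>n. t + (T - t) * (1 / real (Suc n))) \<longlonglongrightarrow> t + (T - t) * 0"
      using LIMSEQ_inverse_real_of_nat by (intro tendsto_intros) (simp add: inverse_eq_divide)
    then have s_lim: "s \<longlonglongrightarrow> t" by (simp add: s_def[abs_def])
    have s_right: "filterlim s (at_right t) sequentially"
      unfolding filterlim_at using s s_lim by (auto simp: less_imp_neq[THEN not_sym])
    define L where "L = (INF n. ?m (s n))"
    have bdd: "bdd_below (range (\<lambda>n. ?m (s n)))"
      using Xi_second_moment_mono s by (intro bdd_belowI[of _ "?m t"]) (auto intro: less_imp_le)
    have L_le: "L \<le> ?m (s n)" for n unfolding L_def by (intro cINF_lower bdd) auto
    have diff: "?m (s n) - ?m t \<le> ?m (s n) - L" for n
    proof -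
      have "(\<integral>\<^sup>+ \<omega>. ennreal ((\<Xi> (s n) \<omega> - \<Xi> t \<omega>)\<^sup>2) \<partial>M) \<le> ennreal (?m (s n) - L)"
      proof (rule Fatou_L2_limit[where X = "\<lambda>k \<omega>. \<Xi> (s n) \<omega> - \<Xi> (s (n + k)) \<omega>" and c = "\<lambda>k. ?m (s n) - ?m (s (n + k))"])
        show "L2 (\<lambda>\<omega>. \<Xi> (s n) \<omega> - \<Xi> (s (n + k)) \<omega>)" for k using s by (intro L2_diff Xi_L2)
        show "(\<lambda>\<omega>. \<Xi> (s n) \<omega> - \<Xi> t \<omega>) \<in> borel_measurable M"
          using L2_diff[OF Xi_L2[of "s n"] Xi_L2[of t]] s 3 by (auto simp: L2_def)
        show "(\<lambda>k. \<Xi> (s n) \<omega> - \<Xi> (s (n + k)) \<omega>) \<longlonglongrightarrow> \<Xi> (s n) \<omega> - \<Xi> t \<omega>" if "\<omega> \<in> space M" for \<omega>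
        proof -
          have "(\<lambda>k. \<Xi> (s k) \<omega>) \<longlonglongrightarrow> \<Xi> t \<omega>"
            by (rule filterlim_compose[OF rcb_tendsto[OF supL2D(3)[OF Xi_supL2 that] 3] s_right])
          from LIMSEQ_ignore_initial_segment[OF this, of n] show ?thesis
            by (intro tendsto_diff tendsto_const) (simp add: add.commute)
        qed
        show "expectation (\<lambda>\<omega>. (\<Xi> (s n) \<omega> - \<Xi> (s (n + k)) \<omega>)\<^sup>2) \<le> ?m (s n) - ?m (s (n + k))" for k
          using s s_dec[of n "n + k"] by (subst Xi_increment) auto
        show "eventually (\<lambda>k. ?m (s n) - ?m (s (n + k)) \<le> ?m (s n) - L) sequentially"
          using L_le by (intro always_eventually) auto
      qed
      moreover have "(\<integral>\<^sup>+ \<omega>. ennreal ((\<Xi> (s n) \<omega> - \<Xi> t \<omega>)\<^sup>2) \<partial>M) = ennreal (?m (s n) - ?m t)"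
        using L2_diff[OF Xi_L2[of "s n"] Xi_L2[of t]] s 3 Xi_increment[of t "s n"]
        by (subst nn_integral_eq_integral) (auto simp: L2_def less_imp_le)
      ultimately show ?thesis using L_le[of n] by (simp add: ennreal_le_iff)
    qed
    then have "L \<le> ?m t" by (simp add: diff[of 0, simplified])
    show ?thesis
    proof (rule tendstoI)
      fix e :: real assume e: "e > 0"
      have "L < ?m t + e" using \<open>L \<le> ?m t\<close> e by simp
      then obtain n where n: "?m (s n) < ?m t + e" unfolding L_def using bdd by (subst (asm) cINF_less_iff) auto
      show "eventually (\<lambda>r. dist (?m r) (?m t) < e) (at_right t)"
        unfolding eventually_at_right_field
      proof (intro exI[of _ "s n"] conjI allI impI)
        fix r assume "t < r" "r < s n"
        then show "dist (?m r) (?m t) < e"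
          using Xi_second_moment_mono[of t r] Xi_second_moment_mono[of r "s n"] n by (auto simp: dist_real_def)
      qed (rule s)
    qed
  qed
  then show ?thesis by (simp add: continuous_within)
qed

abbreviation mu :: "real measure" where "mu \<equiv> interval_measure Xi_second_moment"

lemma emeasure_mu_Ioc: "s \<le> t \<Longrightarrow> emeasure mu {s<..t} = ennreal (Xi_second_moment t - Xi_second_moment s)"
  by (rule emeasure_interval_measure_Ioc[OF _ Xi_second_moment_mono Xi_second_moment_right_cont])

text \<open>An atom of \<open>mu\<close> at \<open>T\<close> would carry infinite weight in
  \<open>Lambda_Xi\<close>. Without it the second moments converge as time tends to
  \<open>T\<close>, and Fatou makes the expected squared gap between the left limit and
  \<open>\<Xi> T\<close> vanish.\<close>

lemma Xi_left_limit:
  assumes fin: "Lambda_Xi < \<infinity>"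
  shows "AE \<omega> in M. ((\<lambda>t. \<Xi> t \<omega>) \<longlongrightarrow> \<Xi> T \<omega>) (at_left T)"
proof -
  let ?m = Xi_second_moment
  have atom: "emeasure mu {T} = 0"
  proof (rule ccontr)
    assume pos: "emeasure mu {T} \<noteq> 0"
    have "(\<integral>\<^sup>+ t. \<infinity> * indicator {T} t \<partial>mu) \<le> Lambda_Xi"
      unfolding Lambda_Xi_def using T_ge0 by (intro nn_integral_mono) (auto simp: indicator_def)
    moreover have "(\<integral>\<^sup>+ t. \<infinity> * indicator {T} t \<partial>mu) = \<infinity> * emeasure mu {T}" by (rule nn_integral_cmult_indicator) simp
    ultimately show False using fin pos by (simp add: ennreal_top_mult)
  qed
  define b where "b n = T - T / real (Suc n)" for n
  have b: "0 \<le> b n" "b n < T" for n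
  proof -
    have "T / real (Suc n) \<le> T / 1" using T_pos by (intro divide_left_mono) auto
    then show "0 \<le> b n" "b n < T" using T_pos by (auto simp: b_def)
  qed
  have "(\<lambda>n. T - T * (1 / real (Suc n))) \<longlonglongrightarrow> T - T * 0"
    using LIMSEQ_inverse_real_of_nat by (intro tendsto_intros) (simp add: inverse_eq_divide)
  then have b_lim: "b \<longlonglongrightarrow> T" by (simp add: b_def[abs_def])
  have b_left: "filterlim b (at_left T) sequentially"
    unfolding filterlim_at using b b_lim by (auto simp: less_imp_neq)
  have "(\<lambda>n. emeasure mu {b n<..T}) \<longlonglongrightarrow> emeasure mu (\<Inter>n. {b n<..T})"
  proof (rule Lim_emeasure_decseq)
    show "decseq (\<lambda>n. {b n<..T})"
    proof (rule decseq_SucI)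
      fix n
      have "T / real (Suc (Suc n)) \<le> T / real (Suc n)" using T_pos by (intro divide_left_mono) auto
      then show "{b (Suc n)<..T} \<subseteq> {b n<..T}" by (auto simp: b_def)
    qed
    show "emeasure mu {b n<..T} \<noteq> \<infinity>" for n using b[of n] by (subst emeasure_mu_Ioc) auto
  qed auto
  also have "(\<Inter>n. {b n<..T}) = {T}"
  proof (intro equalityI subsetI)
    fix x assume x: "x \<in> (\<Inter>n. {b n<..T})"
    then have "b n \<le> x" for n by (auto intro: less_imp_le)
    then have "T \<le> x" by (intro LIMSEQ_le_const2[OF b_lim]) auto
    moreover have "x \<le> T" using x by auto
    ultimately show "x \<in> {T}" by simp
  qed (use b in auto)
  finally have "(\<lambda>n. ennreal (?m T - ?m (b n))) \<longlonglongrightarrow> ennreal 0"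
    using b by (simp add: atom emeasure_mu_Ioc less_imp_le)
  then have gap0: "(\<lambda>n. ?m T - ?m (b n)) \<longlonglongrightarrow> 0"
    using Xi_second_moment_mono[OF less_imp_le[OF b(2)]]
    by (subst (asm) tendsto_ennreal_iff) (auto intro!: always_eventually)
  \<comment> \<open>The left limit is taken along a fixed sequence, which makes it measurable in
    \<open>\<omega>\<close>.\<close>
  define xl where "xl \<omega> = lim (\<lambda>n. \<Xi> (b n) \<omega>)" for \<omega>
  have [measurable]: "\<Xi> (b n) \<in> borel_measurable M" "\<Xi> T \<in> borel_measurable M" for n
    using supL2D(2)[OF Xi_supL2] b[of n] T_ge0 by auto
  have [measurable]: "xl \<in> borel_measurable M" unfolding xl_def by measurable
  have left: "((\<lambda>t. \<Xi> t \<omega>) \<longlongrightarrow> xl \<omega>) (at_left T)" if \<omega>: "\<omega> \<in> space M" for \<omega>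
  proof -
    obtain l where l: "((\<lambda>t. \<Xi> t \<omega>) \<longlongrightarrow> l) (at_left T)"
      using cadlag_adaptedD(3)[OF Xi_cadlag_adapted \<omega>] T_pos unfolding cadlag_on_def
      by (metis greaterThanAtMost_iff order_refl)
    then have "(\<lambda>n. \<Xi> (b n) \<omega>) \<longlonglongrightarrow> l" by (rule filterlim_compose[OF _ b_left])
    then have "xl \<omega> = l" unfolding xl_def by (rule limI)
    then show ?thesis using l by simp
  qed
  have le_e: "(\<integral>\<^sup>+ \<omega>. ennreal ((xl \<omega> - \<Xi> T \<omega>)\<^sup>2) \<partial>M) \<le> ennreal e" if e: "e > 0" for e
  proof (rule Fatou_L2_limit[where X = "\<lambda>n \<omega>. \<Xi> (b n) \<omega> - \<Xi> T \<omega>" and c = "\<lambda>n. ?m T - ?m (b n)"])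
    show "L2 (\<lambda>\<omega>. \<Xi> (b k) \<omega> - \<Xi> T \<omega>)" for k using b[of k] T_ge0 by (intro L2_diff Xi_L2) auto
    show "(\<lambda>k. \<Xi> (b k) \<omega> - \<Xi> T \<omega>) \<longlonglongrightarrow> xl \<omega> - \<Xi> T \<omega>" if "\<omega> \<in> space M" for \<omega>
      by (intro tendsto_diff tendsto_const filterlim_compose[OF left[OF that] b_left])
    show "expectation (\<lambda>\<omega>. (\<Xi> (b k) \<omega> - \<Xi> T \<omega>)\<^sup>2) \<le> ?m T - ?m (b k)" for k
      using Xi_increment[of "b k" T] b[of k] by (simp add: power2_commute less_imp_le)
    show "eventually (\<lambda>k. ?m T - ?m (b k) \<le> e) sequentially"
      using order_tendstoD(2)[OF gap0 e] by eventually_elim simp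
  qed simp
  have "(\<integral>\<^sup>+ \<omega>. ennreal ((xl \<omega> - \<Xi> T \<omega>)\<^sup>2) \<partial>M) \<le> 0"
  proof (rule ennreal_le_epsilon)
    fix e :: real assume "0 < e"
    then show "(\<integral>\<^sup>+ \<omega>. ennreal ((xl \<omega> - \<Xi> T \<omega>)\<^sup>2) \<partial>M) \<le> 0 + ennreal e" using le_e by simp
  qed
  then have "(\<integral>\<^sup>+ \<omega>. ennreal ((xl \<omega> - \<Xi> T \<omega>)\<^sup>2) \<partial>M) = 0" by simp
  then have "AE \<omega> in M. ennreal ((xl \<omega> - \<Xi> T \<omega>)\<^sup>2) = 0" by (subst (asm) nn_integral_0_iff_AE) auto
  then show ?thesis using AE_space
  proof eventually_elim
    case (elim \<omega>)
    then have "(xl \<omega> - \<Xi> T \<omega>)\<^sup>2 \<le> 0" by (simp only: ennreal_eq_0_iff)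
    then have "xl \<omega> = \<Xi> T \<omega>" by simp
    then show ?case using left[OF elim(2)] by simp
  qed
qed

lemma nn_integral_square_eq: "L2 X \<Longrightarrow> (\<integral>\<^sup>+ \<omega>. ennreal ((X \<omega>)\<^sup>2) \<partial>M) = ennreal (expectation (\<lambda>\<omega>. (X \<omega>)\<^sup>2))"
  by (intro nn_integral_eq_integral) (auto simp: L2_def)

lemma Qopt_L2: "0 \<le> t \<Longrightarrow> t \<le> T \<Longrightarrow> L2 (Qopt t)"
  by (rule supL2D(4)[OF Qopt_supL2])

lemma K_0_finite: "K_0 < \<infinity>"
proof -
  have S: "supL2 (\<lambda>t \<omega>. Qopt t \<omega> - \<Xi> t \<omega>)" by (rule supL2_diff[OF Qopt_supL2 Xi_supL2])
  obtain C where C: "\<And>t. 0 \<le> t \<Longrightarrow> t \<le> T \<Longrightarrow> expectation (\<lambda>\<omega>. (Qopt t \<omega> - \<Xi> t \<omega>)\<^sup>2) \<le> C" using supL2_bound[OF S] by metis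
  have "K_0 \<le> ennreal C"
    unfolding K_0_def
  proof (rule SUP_least)
    fix t assume "t \<in> {0..<T}"
    then show "(\<integral>\<^sup>+ \<omega>. ennreal ((Qopt t \<omega> - \<Xi> t \<omega>)\<^sup>2) \<partial>M) \<le> ennreal C"
      using C[of t] supL2D(4)[OF S, of t] by (subst nn_integral_square_eq) (auto intro: ennreal_leI)
  qed
  then show ?thesis by (rule le_less_trans) simp
qed

lemma Qopt_Xi_le_K_0:
  assumes "0 \<le> t" "t < T"
  shows "expectation (\<lambda>\<omega>. (Qopt t \<omega> - \<Xi> t \<omega>)\<^sup>2) \<le> enn2real K_0"
proof -
  have L: "L2 (\<lambda>\<omega>. Qopt t \<omega> - \<Xi> t \<omega>)" using assms by (intro L2_diff Qopt_L2 Xi_L2) auto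
  have "ennreal (expectation (\<lambda>\<omega>. (Qopt t \<omega> - \<Xi> t \<omega>)\<^sup>2)) \<le> K_0"
    unfolding nn_integral_square_eq[OF L, symmetric] K_0_def using assms by (intro SUP_upper) auto
  from enn2real_mono[OF this] K_0_finite show ?thesis by (simp add: enn2real_ennreal)
qed

text \<open>\<open>lam\<close> is Lipschitz because its derivative is bounded, and
  \<open>alpha\<close> arises from \<open>bet\<close>, \<open>lamdot\<close> and \<open>lam\<close>
  by sums, products and reciprocals of functions bounded away from zero.\<close>

lemma alpha_variation: "variation_dominated T alpha"
proof -
  obtain c where c: "0 < c" "\<And>t. 0 \<le> t \<Longrightarrow> t \<le> T \<Longrightarrow> c \<le> lam t" using lam_lower by blast
  obtain e where e: "0 < e" "\<And>t. 0 \<le> t \<Longrightarrow> t \<le> T \<Longrightarrow> e \<le> 2 * bet t + gamdot t" using coercive' by blast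
  obtain B where B: "\<And>t. 0 \<le> t \<Longrightarrow> t \<le> T \<Longrightarrow> \<bar>lamdot t\<bar> \<le> B" using rcb_bound[OF lamdot_rcb] by metis
  have vlam: "variation_dominated T lam"
  proof (rule variation_dominatedI[of _ _ "\<lambda>t. B * t"])
    fix s t assume st: "0 \<le> s" "s \<le> t" "t \<le> T"
    have "lam t - lam s = (LINT r:{0..t}|lborel. lamdot r) - (LINT r:{0..s}|lborel. lamdot r)"
      using lam_FTC[of s] lam_FTC[of t] st by linarith
    then show "\<bar>lam t - lam s\<bar> \<le> B * t - B * s"
      using rcb_integral_diff_bound[OF lamdot_rcb T_ge0 B st] by (simp add: algebra_simps)
  qed
  have vil: "variation_dominated T (\<lambda>t. 1 / lam t)" and ril: "rcb T (\<lambda>t. 1 / lam t)"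
    using vlam c by (auto intro: variation_dominated_inverse rcb_divide[OF rcb_const lam_rcb])
  have vg: "variation_dominated T gamdot"
    using variation_dominated_mult[OF variation_dominated_finite_variation[OF lamdot_fv] vil lamdot_rcb ril]
    by (simp add: gamdot_def[abs_def])
  have vb: "variation_dominated T bet" by (rule variation_dominated_finite_variation[OF bet_fv])
  have vn: "variation_dominated T (\<lambda>t. bet t + gamdot t)" by (rule variation_dominated_add[OF vb vg])
  have rn: "rcb T (\<lambda>t. bet t + gamdot t)" by (rule rcb_add[OF bet_rcb gamdot_rcb])
  have "variation_dominated T (\<lambda>t. bet t + (bet t + gamdot t))" by (rule variation_dominated_add[OF vb vn])
  then have vd: "variation_dominated T (\<lambda>t. 2 * bet t + gamdot t)" by (simp add: algebra_simps)
  have rd: "rcb T (\<lambda>t. 2 * bet t + gamdot t)" by (intro rcb_add rcb_mult rcb_const bet_rcb gamdot_rcb)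
  have vid: "variation_dominated T (\<lambda>t. 1 / (2 * bet t + gamdot t))" and rid: "rcb T (\<lambda>t. 1 / (2 * bet t + gamdot t))"
    using vd e by (auto intro: variation_dominated_inverse rcb_divide[OF rcb_const rd])
  have "variation_dominated T (\<lambda>t. ((bet t + gamdot t) * (1 / (2 * bet t + gamdot t))) * (1 / lam t))"
    by (intro variation_dominated_mult vn vid vil rn rid ril rcb_mult)
  then show ?thesis by (simp add: alpha_def[abs_def] eta_def)
qed

text \<open>Three sources of movement: the martingale with \<open>alpha\<close> frozen, whose
  expected squared increments are increments of its second moment; the variation of
  \<open>alpha\<close>; the drift, handled by Cauchy-Schwarz. Each is controlled by increments of a
  nondecreasing function. The bound stops before \<open>T\<close>, where the optimizer may
  jump.\<close>

lemma Qopt_increment: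
  obtains W where "\<And>s t. 0 \<le> s \<Longrightarrow> s \<le> t \<Longrightarrow> t \<le> T \<Longrightarrow> W s \<le> W t"
    and "\<And>s t. 0 \<le> s \<Longrightarrow> s \<le> t \<Longrightarrow> t < T \<Longrightarrow> expectation (\<lambda>\<omega>. (Qopt t \<omega> - Qopt s \<omega>)\<^sup>2) \<le> W t - W s"
proof -
  obtain V where V: "\<And>s t. 0 \<le> s \<Longrightarrow> s \<le> t \<Longrightarrow> t \<le> T \<Longrightarrow> \<bar>alpha t - alpha s\<bar> \<le> V t - V s"
    using variation_dominatedE[OF alpha_variation] by blast
  obtain A where A: "0 \<le> A" "\<And>t. 0 \<le> t \<Longrightarrow> t \<le> T \<Longrightarrow> \<bar>alpha t\<bar> \<le> A" using rcb_bound[OF alpha_rcb] by metis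
  define n where "n t = expectation (\<lambda>\<omega>. (opt_mart t \<omega>)\<^sup>2)" for t
  have n_mono: "n s \<le> n t" if "0 \<le> s" "s \<le> t" "t \<le> T" for s t unfolding n_def by (rule L2mart_mono[OF opt_mart_L2mart that])
  have n0: "0 \<le> n t" for t by (simp add: n_def)
  define R where "R t \<omega> = thetadot t * opt_mart t \<omega>" for t \<omega>
  have R: "supL2 R" unfolding R_def[abs_def] by (rule supL2_scale[OF opt_mart_supL2 thetadot_rcb])
  define G where "G \<omega> = (LINT r:{0..T}|lborel. (R r \<omega>)\<^sup>2)" for \<omega>
  have G: "integrable M G" unfolding G_def using Fubini_leb(1)[of "\<lambda>t \<omega>. (R t \<omega>)\<^sup>2"] supL2_L2P[OF R] by (simp add: L2P_def)
  have G0: "0 \<le> G \<omega>" for \<omega> by (simp add: G_def set_lebesgue_integral_def)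
  define I where "I t \<omega> = (LINT r:{0..t}|lborel. R r \<omega>)" for t \<omega>
  have I: "supL2 I" unfolding I_def R_def[abs_def] by (rule supL2_integral[OF opt_mart_supL2 thetadot_rcb])
  have I_le: "(I t \<omega> - I s \<omega>)\<^sup>2 \<le> (t - s) * G \<omega>" if st: "0 \<le> s" "s \<le> t" "t \<le> T" and \<omega>: "\<omega> \<in> space M" for s t \<omega>
  proof -
    have r: "rcb T (\<lambda>r. R r \<omega>)" "rcb T (\<lambda>r. (R r \<omega>)\<^sup>2)" using supL2D(3)[OF R \<omega>] by (auto intro: rcb_power)
    have i: "set_integrable lborel {q..r} (\<lambda>s. R s \<omega>)" "set_integrable lborel {q..r} (\<lambda>s. (R s \<omega>)\<^sup>2)" if "0 \<le> q" "r \<le> T" for q r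
      using r that T_ge0 by (auto intro: rcb_integrable)
    have "I t \<omega> - I s \<omega> = (LINT r:{s<..t}|lborel. R r \<omega>)"
      unfolding I_def using set_integral_Icc_split[OF i(1)[OF order_refl st(3)] st(1,2)] by simp
    moreover have sub: "set_integrable lborel {s<..t} (\<lambda>r. R r \<omega>)"
      by (rule set_integrable_subset[OF i(1)[OF st(1,3)]]) auto
    ultimately have "\<bar>I t \<omega> - I s \<omega>\<bar> \<le> (LINT r:{s<..t}|lborel. \<bar>R r \<omega>\<bar>)"
      using set_integral_norm_bound[OF sub] by simp
    also have "\<dots> \<le> (LINT r:{s..t}|lborel. \<bar>R r \<omega>\<bar>)"
      using set_integrable_abs[OF i(1)[OF st(1,3)]] set_integrable_abs[OF sub]
      unfolding set_lebesgue_integral_def set_integrable_def by (intro integral_mono) (auto simp: indicator_def)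
    finally have "(I t \<omega> - I s \<omega>)\<^sup>2 \<le> (LINT r:{s..t}|lborel. \<bar>R r \<omega>\<bar>)\<^sup>2"
      by (intro abs_le_square_iff[THEN iffD1]) (auto intro: order_trans[OF _ abs_ge_self])
    also have "\<dots> \<le> (t - s) * (LINT r:{s..t}|lborel. (R r \<omega>)\<^sup>2)"
      by (intro set_integral_abs_square_le rcb_set_measurable[OF r(1) T_ge0] i st)
    also have "\<dots> \<le> (t - s) * G \<omega>"
      unfolding G_def set_lebesgue_integral_def using st i[unfolded set_integrable_def]
      by (intro mult_left_mono integral_mono) (auto simp: indicator_def)
    finally show ?thesis .
  qed
  \<comment> \<open>Splitting off \<open>a\<close> and then separating \<open>b\<close> from
    \<open>c\<close> costs a factor \<open>2\<close> each time: hence \<open>2\<close> for the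
    martingale term and \<open>4\<close> for the other two, with a further \<open>2 * A\<close> from
    the squared increment of \<open>alpha\<close>.\<close>
  define W where "W t = 2 * A\<^sup>2 * n t + 8 * A * n T * V t + 4 * expectation G * t" for t
  have EG: "0 \<le> expectation G" using G0 by simp
  show ?thesis
  proof (rule that[of W])
    show "W s \<le> W t" if st: "0 \<le> s" "s \<le> t" "t \<le> T" for s t
      unfolding W_def using n_mono[OF st] V[OF st] A EG n0[of T] st
      by (intro add_mono mult_left_mono mult_nonneg_nonneg) auto
    fix s t assume st: "0 \<le> s" "s \<le> t" "t < T"
    define a b c where "a \<omega> = alpha t * (opt_mart t \<omega> - opt_mart s \<omega>)" and "b \<omega> = (alpha t - alpha s) * opt_mart s \<omega>"
      and "c \<omega> = I t \<omega> - I s \<omega>" for \<omega>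
    have L: "L2 a" "L2 b" "L2 c" unfolding a_def b_def c_def
      using st by (auto intro!: L2_scale L2_diff supL2D(4)[OF opt_mart_supL2] supL2D(4)[OF I])
    have Q: "Qopt t \<omega> - Qopt s \<omega> = a \<omega> + (b \<omega> + c \<omega>)" for \<omega>
      using st by (simp add: Qopt_before a_def b_def c_def I_def R_def algebra_simps)
    have "expectation (\<lambda>\<omega>. (Qopt t \<omega> - Qopt s \<omega>)\<^sup>2) \<le> 2 * expectation (\<lambda>\<omega>. (a \<omega>)\<^sup>2) + 2 * expectation (\<lambda>\<omega>. (b \<omega> + c \<omega>)\<^sup>2)"
      unfolding Q by (rule L2_add(2)[OF L(1) L2_add(1)[OF L(2,3)]])
    also have "expectation (\<lambda>\<omega>. (b \<omega> + c \<omega>)\<^sup>2) \<le> 2 * expectation (\<lambda>\<omega>. (b \<omega>)\<^sup>2) + 2 * expectation (\<lambda>\<omega>. (c \<omega>)\<^sup>2)"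
      by (rule L2_add(2)[OF L(2,3)])
    also have "expectation (\<lambda>\<omega>. (a \<omega>)\<^sup>2) \<le> A\<^sup>2 * (n t - n s)"
    proof -
      have "expectation (\<lambda>\<omega>. (a \<omega>)\<^sup>2) = (alpha t)\<^sup>2 * (n t - n s)"
        using L2mart_increment[OF opt_mart_L2mart, of s t] st by (simp add: a_def power_mult_distrib n_def)
      moreover have "(alpha t)\<^sup>2 \<le> A\<^sup>2" using A(2)[of t] st by (intro abs_le_square_iff[THEN iffD1]) auto
      ultimately show ?thesis using n_mono[of s t] st by (auto intro: mult_right_mono)
    qed
    also have "expectation (\<lambda>\<omega>. (b \<omega>)\<^sup>2) \<le> 2 * A * (V t - V s) * n T"
    proof -
      \<comment> \<open>One factor is bounded by \<open>2 * A\<close>, so the square becomes linear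
        in the increment of \<open>V\<close>.\<close>
      have "(alpha t - alpha s)\<^sup>2 = \<bar>alpha t - alpha s\<bar> * \<bar>alpha t - alpha s\<bar>" by (simp add: power2_eq_square)
      also have "\<dots> \<le> (2 * A) * (V t - V s)"
        using A(2)[of s] A(2)[of t] V[of s t] st by (intro mult_mono) auto
      finally have "(alpha t - alpha s)\<^sup>2 * n s \<le> (2 * A * (V t - V s)) * n T"
        using n_mono[of s T] n0[of s] V[of s t] A(1) st by (intro mult_mono) auto
      then show ?thesis by (simp add: b_def power_mult_distrib n_def)
    qed
    also have "expectation (\<lambda>\<omega>. (c \<omega>)\<^sup>2) \<le> expectation (\<lambda>\<omega>. (t - s) * G \<omega>)"
      using L(3) G I_le[OF st(1,2) less_imp_le[OF st(3)]] unfolding c_def[symmetric]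
      by (intro L2_bound(2)) (auto simp: L2_def)
    also have "\<dots> = (t - s) * expectation G" by simp
    finally show "expectation (\<lambda>\<omega>. (Qopt t \<omega> - Qopt s \<omega>)\<^sup>2) \<le> W t - W s"
      unfolding W_def by (simp add: algebra_simps)
  qed
qed

text \<open>The delay \<open>h\<close> is included among the variables because delays are later
  integrated against the exponential law.\<close>

lemma Qopt_shift_measurable:
  "(\<lambda>(h, t, \<omega>). Qopt (max (t - h) 0) \<omega>) \<in> borel_measurable (restrict_space borel {0..} \<Otimes>\<^sub>M (leb T \<Otimes>\<^sub>M M))"
proof -
  have 0: "(\<lambda>z. z) \<in> borel_measurable (restrict_space borel ({0..}::real set))" "(\<lambda>z. z) \<in> borel_measurable (leb T)"
    by (auto intro: measurable_restrict_space1)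
  have "(\<lambda>z. (max (fst (snd z) - fst z) 0, snd (snd z))) \<in> measurable (restrict_space borel {0..} \<Otimes>\<^sub>M (leb T \<Otimes>\<^sub>M M)) (leb T \<Otimes>\<^sub>M M)"
  proof (rule measurable_Pair)
    show "(\<lambda>z. max (fst (snd z) - fst z) 0) \<in> measurable (restrict_space borel {0..} \<Otimes>\<^sub>M (leb T \<Otimes>\<^sub>M M)) (leb T)"
    proof (rule measurable_restrict_space2)
      show "(\<lambda>z. max (fst (snd z) - fst z) 0) \<in> space (restrict_space borel {0..} \<Otimes>\<^sub>M (leb T \<Otimes>\<^sub>M M)) \<rightarrow> {0..T}"
        using T_ge0 by (auto simp: space_pair_measure space_restrict_space)
      have a: "(\<lambda>z. fst (snd z)) \<in> borel_measurable (restrict_space borel {0..} \<Otimes>\<^sub>M (leb T \<Otimes>\<^sub>M M))"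
        by (rule measurable_compose[OF measurable_compose[OF measurable_snd measurable_fst] 0(2)])
      have b: "fst \<in> borel_measurable (restrict_space borel ({0..}::real set) \<Otimes>\<^sub>M (leb T \<Otimes>\<^sub>M M))"
        by (rule measurable_compose[OF measurable_fst 0(1)])
      have "(\<lambda>z. max (fst (snd z) - fst z) 0) \<in> borel_measurable (restrict_space borel {0..} \<Otimes>\<^sub>M (leb T \<Otimes>\<^sub>M M))"
        by (intro borel_measurable_max borel_measurable_diff borel_measurable_const a b)
      then show "(\<lambda>z. max (fst (snd z) - fst z) 0) \<in> measurable (restrict_space borel {0..} \<Otimes>\<^sub>M (leb T \<Otimes>\<^sub>M M)) lborel"
        by (simp add: measurable_lborel1)
    qed
  qed (rule measurable_compose[OF measurable_snd measurable_snd])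
  from measurable_compose[OF this supL2_measurable_pair[OF Qopt_supL2]]
  show ?thesis by (simp add: case_prod_beta')
qed

text \<open>The increments of \<open>W\<close> integrate to at most \<open>h * (W T - W 0)\<close>,
  uniformly in the lag. The optimizer thus has half a derivative in mean square, which is the source
  of the order \<open>sqrt \<epsilon>\<close>.\<close>

lemma Qopt_tr_sq_finite: "Qopt_tr_sq < \<infinity>"
proof -
  interpret P: pair_sigma_finite "leb T" M by (rule pair_leb)
  obtain W where W: "\<And>s t. 0 \<le> s \<Longrightarrow> s \<le> t \<Longrightarrow> t \<le> T \<Longrightarrow> W s \<le> W t"
    "\<And>s t. 0 \<le> s \<Longrightarrow> s \<le> t \<Longrightarrow> t < T \<Longrightarrow> expectation (\<lambda>\<omega>. (Qopt t \<omega> - Qopt s \<omega>)\<^sup>2) \<le> W t - W s"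
    using Qopt_increment by blast
  have "Qopt_tr_sq \<le> ennreal (W T - W 0)"
    unfolding Qopt_tr_sq_def
  proof (rule SUP_least)
    fix h :: real assume "h \<in> {0<..}"
    then have h: "0 < h" by simp
    have hh: "h \<in> space (restrict_space borel {0..})" using h by (simp add: space_restrict_space)
    have m: "(\<lambda>(t, \<omega>). Qopt (max (t - h) 0) \<omega>) \<in> borel_measurable (leb T \<Otimes>\<^sub>M M)"
      using measurable_compose[OF measurable_Pair1'[OF hh] Qopt_shift_measurable] by simp
    have m2: "(\<lambda>(t, \<omega>). ennreal ((Qopt t \<omega> - Qopt (max (t - h) 0) \<omega>)\<^sup>2)) \<in> borel_measurable (leb T \<Otimes>\<^sub>M M)"
      using m supL2_measurable_pair[OF Qopt_supL2] by (simp add: case_prod_beta')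
    have "(\<integral>\<^sup>+ \<omega>. (\<integral>\<^sup>+ t\<in>{0..T}. ennreal ((Qopt t \<omega> - Qopt (max (t - h) 0) \<omega>)\<^sup>2) \<partial>lborel) \<partial>M)
      = (\<integral>\<^sup>+ \<omega>. (\<integral>\<^sup>+ t. ennreal ((Qopt t \<omega> - Qopt (max (t - h) 0) \<omega>)\<^sup>2) \<partial>leb T) \<partial>M)"
      by (simp add: nn_integral_restrict_space)
    also have "\<dots> = (\<integral>\<^sup>+ t. (\<integral>\<^sup>+ \<omega>. ennreal ((Qopt t \<omega> - Qopt (max (t - h) 0) \<omega>)\<^sup>2) \<partial>M) \<partial>leb T)"
      by (rule P.Fubini'[OF m2])
    also have "\<dots> = (\<integral>\<^sup>+ t\<in>{0..T}. (\<integral>\<^sup>+ \<omega>. ennreal ((Qopt t \<omega> - Qopt (max (t - h) 0) \<omega>)\<^sup>2) \<partial>M) \<partial>lborel)"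
      by (simp add: nn_integral_restrict_space)
    also have "\<dots> \<le> (\<integral>\<^sup>+ t\<in>{0..T}. ennreal (W t - W (max (t - h) 0)) \<partial>lborel)"
    proof (rule nn_integral_mono_AE)
      show "AE t in lborel. (\<integral>\<^sup>+ \<omega>. ennreal ((Qopt t \<omega> - Qopt (max (t - h) 0) \<omega>)\<^sup>2) \<partial>M) * indicator {0..T} t
        \<le> ennreal (W t - W (max (t - h) 0)) * indicator {0..T} t"
        using AE_lborel_singleton[of T]
      proof eventually_elim
        case (elim t)
        show ?case
        proof (cases "t \<in> {0..T}")
          case True
          then have t: "0 \<le> t" "t < T" "0 \<le> max (t - h) 0" "max (t - h) 0 \<le> t" using elim h by auto
          have "L2 (\<lambda>\<omega>. Qopt t \<omega> - Qopt (max (t - h) 0) \<omega>)" using t by (intro L2_diff Qopt_L2) auto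
          from nn_integral_square_eq[OF this] show ?thesis using True W(2)[OF t(3,4,2)] by (simp add: ennreal_leI)
        qed simp
      qed
    qed
    also have "\<dots> \<le> ennreal (h * (W T - W 0))" by (rule nn_integral_increment_shift[OF W(1) T_ge0 h])
    finally have "(\<integral>\<^sup>+ \<omega>. (\<integral>\<^sup>+ t\<in>{0..T}. ennreal ((Qopt t \<omega> - Qopt (max (t - h) 0) \<omega>)\<^sup>2) \<partial>lborel) \<partial>M) / ennreal h
      \<le> ennreal (h * (W T - W 0)) / ennreal h" by (rule divide_right_mono_ennreal)
    also have "\<dots> = ennreal (W T - W 0)" using h W(1)[of 0 T] T_ge0 by (subst divide_ennreal) auto
    finally show "(\<integral>\<^sup>+ \<omega>. (\<integral>\<^sup>+ t\<in>{0..T}. ennreal ((Qopt t \<omega> - Qopt (max (t - h) 0) \<omega>)\<^sup>2) \<partial>lborel) \<partial>M) / ennreal h \<le> ennreal (W T - W 0)" .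
  qed
  then show ?thesis by (rule le_less_trans) simp
qed

text \<open>\<open>C_0\<close> bounds the initial block trade; its martingale part is estimated by
  the terminal moment \<open>m2\<close>, since second moments of a martingale increase.\<close>

lemma Qopt_0_le_C_0: "expectation (\<lambda>\<omega>. (Qopt 0 \<omega>)\<^sup>2) \<le> C_0"
proof -
  have m0: "L2 (opt_mart 0)" by (rule supL2D(4)[OF opt_mart_supL2 order_refl T_ge0])
  have eq: "Qopt 0 \<omega> = alpha 0 * opt_mart 0 \<omega> + - (y / lam 0)" for \<omega>
    using T_pos set_integral_Icc_self[of 0] by (simp add: Qopt_before)
  have "expectation (\<lambda>\<omega>. (Qopt 0 \<omega>)\<^sup>2) \<le> 2 * expectation (\<lambda>\<omega>. (alpha 0 * opt_mart 0 \<omega>)\<^sup>2) + 2 * expectation (\<lambda>\<omega>. (- (y / lam 0))\<^sup>2)"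
    unfolding eq by (rule L2_add(2)[OF L2_scale[OF m0] L2_const])
  also have "\<dots> = 2 * ((alpha 0)\<^sup>2 * expectation (\<lambda>\<omega>. (opt_mart 0 \<omega>)\<^sup>2)) + 2 * y\<^sup>2 / (lam 0)\<^sup>2"
    by (simp add: power_mult_distrib power_divide prob_space)
  also have "(alpha 0)\<^sup>2 * expectation (\<lambda>\<omega>. (opt_mart 0 \<omega>)\<^sup>2) \<le> A_alpha\<^sup>2 * m2"
  proof (rule mult_mono)
    have "\<bar>alpha 0\<bar> \<le> A_alpha"
      using rcb_le_Linf_norm[OF alpha_rcb order_refl T_pos] by (simp add: A_alpha_def alpha_def[abs_def])
    then show "(alpha 0)\<^sup>2 \<le> A_alpha\<^sup>2" by (intro abs_le_square_iff[THEN iffD1]) auto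
    show "expectation (\<lambda>\<omega>. (opt_mart 0 \<omega>)\<^sup>2) \<le> m2"
      unfolding m2_def by (rule L2mart_mono[OF opt_mart_L2mart order_refl T_ge0 order_refl])
  qed auto
  finally show ?thesis by (simp add: C_0_def)
qed

end

section \<open>The regularized strategy\<close>

lemma rcb_If:
  assumes f: "rcb T f" and g: "rcb T g"
  shows "rcb T (\<lambda>t. if t < a then f t else g t)"
proof -
  obtain A B where "\<And>t. 0 \<le> t \<Longrightarrow> t \<le> T \<Longrightarrow> \<bar>f t\<bar> \<le> A" "\<And>t. 0 \<le> t \<Longrightarrow> t \<le> T \<Longrightarrow> \<bar>g t\<bar> \<le> B"
    using f g by (metis rcb_bound)
  then have "\<forall>t\<in>{0..T}. \<bar>if t < a then f t else g t\<bar> \<le> max A B" by (auto simp: le_max_iff_disj)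
  moreover have "((\<lambda>t. if t < a then f t else g t) \<longlongrightarrow> (if t < a then f t else g t)) (at_right t)" if t: "t \<in> {0..<T}" for t
  proof (cases "t < a")
    case True
    have "eventually (\<lambda>s. f s = (if s < a then f s else g s)) (at_right t)"
      unfolding eventually_at_right_field using True by (intro exI[of _ a]) auto
    then have "((\<lambda>t. if t < a then f t else g t) \<longlongrightarrow> f t) (at_right t)"
      by (rule Lim_transform_eventually[OF rcb_tendsto[OF f], rotated 2]) (use t in auto)
    then show ?thesis using True by simp
  next
    case False
    have "eventually (\<lambda>s. g s = (if s < a then f s else g s)) (at_right t)"
      unfolding eventually_at_right_field using False by (intro exI[of _ "t + 1"]) auto
    then have "((\<lambda>t. if t < a then f t else g t) \<longlongrightarrow> g t) (at_right t)"
      by (rule Lim_transform_eventually[OF rcb_tendsto[OF g], rotated 2]) (use t in auto)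
    then show ?thesis using False by simp
  qed
  ultimately show ?thesis unfolding rcb_def by blast
qed

locale smoothing = execution_problem +
  fixes \<epsilon> :: real
  assumes eps_pos: "0 < \<epsilon>" and eps_le: "\<epsilon> \<le> T\<^sup>2 / 4" and Lambda_finite: "Lambda_Xi < \<infinity>"
begin

definition d :: real where "d = sqrt \<epsilon>"

definition a :: real where "a = T - d"

lemma d_pos: "0 < d" using eps_pos by (simp add: d_def)

lemma d_sq: "d * d = \<epsilon>" "d\<^sup>2 = \<epsilon>" using eps_pos by (auto simp: d_def)

lemma d_le: "d \<le> T / 2"
proof -
  have "d \<le> sqrt ((T / 2)\<^sup>2)" unfolding d_def using eps_le by (intro real_sqrt_le_mono) (simp add: power_divide)
  then show ?thesis using T_pos by simp
qed

lemma a_bounds: "0 < a" "a < T" "0 \<le> a" "a \<le> T" using d_pos d_le T_pos by (auto simp: a_def)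

lemma T_minus_a: "T - a = d" by (simp add: a_def)

subsection \<open>Paths\<close>

lemma exp_rcb: "rcb T (\<lambda>r. exp (r / d))"
  using d_pos by (intro rcb_continuous continuous_intros) auto

lemma Qbar_eq: "Qbar \<epsilon> t \<omega> = exp (- t / d) / d * (LINT r:{0..t}|lborel. exp (r / d) * Qopt r \<omega>)"
proof -
  have e: "exp (- (t - r) / d) * Qopt r \<omega> = exp (- t / d) * (exp (r / d) * Qopt r \<omega>)" for r
    by (simp add: exp_add[symmetric] mult.assoc[symmetric] diff_divide_distrib)
  show ?thesis unfolding Qbar_def d_def[symmetric] e by simp
qed

lemma Qbar_supL2: "supL2 (Qbar \<epsilon>)"
proof -
  have "rcb T (\<lambda>t. exp (- t / d) / d)" using d_pos by (intro rcb_continuous continuous_intros) auto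
  from supL2_scale[OF supL2_integral[OF Qopt_supL2 exp_rcb] this] show ?thesis by (simp add: Qbar_eq[abs_def])
qed

lemma Qopt_rcb: "\<omega> \<in> space M \<Longrightarrow> rcb T (\<lambda>t. Qopt t \<omega>)" and Xi_rcb: "\<omega> \<in> space M \<Longrightarrow> rcb T (\<lambda>t. \<Xi> t \<omega>)"
  by (rule supL2D(3)[OF Qopt_supL2], assumption) (rule supL2D(3)[OF Xi_supL2])

lemma Qbar_cont: "\<omega> \<in> space M \<Longrightarrow> continuous_on {0..T} (\<lambda>t. Qbar \<epsilon> t \<omega>)"
  unfolding Qbar_eq using d_pos T_ge0
  by (intro continuous_intros rcb_integral_continuous rcb_mult exp_rcb Qopt_rcb) auto

lemma Qbar_0: "Qbar \<epsilon> 0 \<omega> = 0"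
  using set_integral_Icc_self[of 0 "\<lambda>r. exp (r / d) * Qopt r \<omega>"] by (simp add: Qbar_eq)

lemma Qbar_right_deriv:
  assumes \<omega>: "\<omega> \<in> space M" and t: "0 \<le> t" "t < T"
  shows "((\<lambda>t. Qbar \<epsilon> t \<omega>) has_real_derivative (Qopt t \<omega> - Qbar \<epsilon> t \<omega>) / d) (at_right t)"
proof -
  have I: "((\<lambda>t. LINT r:{0..t}|lborel. exp (r / d) * Qopt r \<omega>) has_real_derivative exp (t / d) * Qopt t \<omega>) (at_right t)"
    by (rule rcb_integral_right_deriv[OF rcb_mult[OF exp_rcb Qopt_rcb[OF \<omega>]] t])
  have E: "((\<lambda>t. exp (- t / d) / d) has_real_derivative - (exp (- t / d) / d) / d) (at_right t)"
    using d_pos by (auto intro!: derivative_eq_intros)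
  have "exp (- t / d) / d * (exp (t / d) * Qopt t \<omega>) = (exp (- t / d) * exp (t / d)) * Qopt t \<omega> / d" by simp
  also have "exp (- t / d) * exp (t / d) = 1" by (simp flip: exp_add)
  finally have "- (exp (- t / d) / d) / d * (LINT r:{0..t}|lborel. exp (r / d) * Qopt r \<omega>)
    + exp (t / d) * Qopt t \<omega> * (exp (- t / d) / d) = (Qopt t \<omega> - Qbar \<epsilon> t \<omega>) / d"
    using d_pos by (simp add: Qbar_eq diff_divide_distrib mult.commute)
  with DERIV_mult[OF E I] show ?thesis unfolding Qbar_eq by simp
qed

definition H :: "real \<Rightarrow> 'a \<Rightarrow> real" where "H t \<omega> = (LINT r:{0..t}|lborel. 1 / (T - r)\<^sup>2 * \<Xi> r \<omega>)"

text \<open>The formula of the last phase, taken at all times before \<open>T\<close>, so that its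
  right derivative is available without a case distinction at \<open>a\<close>.\<close>

definition W :: "real \<Rightarrow> 'a \<Rightarrow> real" where
  "W t \<omega> = (T - t) / d * Qbar \<epsilon> a \<omega> + (T - t) * (H t \<omega> - H a \<omega>)"

lemma weight_rcb: "b < T \<Longrightarrow> rcb b (\<lambda>r. 1 / (T - r)\<^sup>2)"
  by (intro rcb_continuous continuous_intros) auto

lemma weight_Xi_rcb: "\<omega> \<in> space M \<Longrightarrow> b < T \<Longrightarrow> rcb b (\<lambda>r. 1 / (T - r)\<^sup>2 * \<Xi> r \<omega>)"
  by (intro rcb_mult weight_rcb rcb_mono[OF Xi_rcb]) auto

lemma Qeps_le_a: "t \<le> a \<Longrightarrow> Qeps \<epsilon> t \<omega> = Qbar \<epsilon> t \<omega>"
  by (simp add: Qeps_def a_def d_def)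

lemma Qeps_ge_a:
  assumes \<omega>: "\<omega> \<in> space M" and t: "a \<le> t" "t < T"
  shows "Qeps \<epsilon> t \<omega> = W t \<omega>"
proof (cases "t = a")
  case True
  then show ?thesis using d_pos by (simp add: Qeps_le_a W_def T_minus_a)
next
  case False
  have "set_integrable lborel {0..t} (\<lambda>r. 1 / (T - r)\<^sup>2 * \<Xi> r \<omega>)"
    using weight_Xi_rcb[OF \<omega> t(2)] a_bounds t by (intro rcb_integrable[where T=t]) auto
  from set_integral_Icc_diff[OF this a_bounds(3) t(1)]
  have "(LINT r:{a..t}|lborel. \<Xi> r \<omega> / (T - r)\<^sup>2) = H t \<omega> - H a \<omega>" by (simp add: H_def)
  moreover have "Qeps \<epsilon> t \<omega> = (T - t) / d * Qbar \<epsilon> a \<omega> + (T - t) * (LINT r:{a..t}|lborel. \<Xi> r \<omega> / (T - r)\<^sup>2)"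
    using False t by (simp add: Qeps_def a_def d_def)
  ultimately show ?thesis by (simp add: W_def)
qed

lemma H_cont: "\<omega> \<in> space M \<Longrightarrow> 0 \<le> b \<Longrightarrow> b < T \<Longrightarrow> continuous_on {0..b} (\<lambda>t. H t \<omega>)"
  unfolding H_def by (intro rcb_integral_continuous weight_Xi_rcb)

lemma W_right_deriv:
  assumes \<omega>: "\<omega> \<in> space M" and t: "0 \<le> t" "t < T"
  shows "((\<lambda>t. W t \<omega>) has_real_derivative (\<Xi> t \<omega> - W t \<omega>) / (T - t)) (at_right t)"
proof -
  have b: "(t + T) / 2 < T" "t < (t + T) / 2" using t by auto
  have H': "((\<lambda>t. H t \<omega>) has_real_derivative 1 / (T - t)\<^sup>2 * \<Xi> t \<omega>) (at_right t)"
    unfolding H_def by (rule rcb_integral_right_deriv[OF weight_Xi_rcb[OF \<omega> b(1)] t(1) b(2)])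
  have "((\<lambda>t. (T - t) / d * Qbar \<epsilon> a \<omega> + (T - t) * (H t \<omega> - H a \<omega>)) has_real_derivative
    (- 1 / d * Qbar \<epsilon> a \<omega> + (- 1 * (H t \<omega> - H a \<omega>) + (T - t) * (1 / (T - t)\<^sup>2 * \<Xi> t \<omega>)))) (at_right t)"
    using d_pos by (auto intro!: derivative_eq_intros H')
  moreover have "- 1 / d * Qbar \<epsilon> a \<omega> + (- 1 * (H t \<omega> - H a \<omega>) + (T - t) * (1 / (T - t)\<^sup>2 * \<Xi> t \<omega>)) = (\<Xi> t \<omega> - W t \<omega>) / (T - t)"
  proof -
    have nz: "T - t \<noteq> 0" using t by simp
    have "(T - t) * (1 / (T - t)\<^sup>2 * \<Xi> t \<omega>) = \<Xi> t \<omega> / (T - t)" using nz by (simp add: power2_eq_square)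
    moreover have "W t \<omega> / (T - t) = Qbar \<epsilon> a \<omega> / d + (H t \<omega> - H a \<omega>)"
      using nz by (simp add: W_def add_divide_distrib)
    ultimately show ?thesis by (simp add: diff_divide_distrib)
  qed
  ultimately show ?thesis unfolding W_def by simp
qed

text \<open>Right derivative of the strategy before \<open>T\<close>. The value at \<open>T\<close>
  is set to zero, so that \<open>{0..<T}\<close> and \<open>{0..T}\<close> give the same
  integrand.\<close>

definition u :: "real \<Rightarrow> 'a \<Rightarrow> real" where
  "u t \<omega> = (if t < a then (Qopt t \<omega> - Qbar \<epsilon> t \<omega>) / d
     else if t < T then (\<Xi> t \<omega> - Qeps \<epsilon> t \<omega>) / (T - t) else 0)"

lemma W_cont: "\<omega> \<in> space M \<Longrightarrow> 0 \<le> b \<Longrightarrow> b < T \<Longrightarrow> continuous_on {0..b} (\<lambda>t. W t \<omega>)"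
  unfolding W_def using d_pos by (intro continuous_intros H_cont) auto

lemma Qeps_cont:
  assumes \<omega>: "\<omega> \<in> space M" and b: "0 \<le> b" "b < T"
  shows "continuous_on {0..b} (\<lambda>t. Qeps \<epsilon> t \<omega>)"
proof -
  have "continuous_on {0..b} (\<lambda>t. if t \<le> a then Qbar \<epsilon> t \<omega> else W t \<omega>)"
  proof (rule continuous_on_cases_le)
    show "continuous_on {t \<in> {0..b}. t \<le> a} (\<lambda>t. Qbar \<epsilon> t \<omega>)"
      by (rule continuous_on_subset[OF Qbar_cont[OF \<omega>]]) (use b in auto)
    show "continuous_on {t \<in> {0..b}. a \<le> t} (\<lambda>t. W t \<omega>)"
      by (rule continuous_on_subset[OF W_cont[OF \<omega> b]]) auto
    show "Qbar \<epsilon> t \<omega> = W t \<omega>" if "t \<in> {0..b}" "t = a" for t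
      using that Qeps_ge_a[OF \<omega> order_refl a_bounds(2)] by (simp add: Qeps_le_a)
  qed (intro continuous_intros)
  then show ?thesis
    by (rule continuous_on_eq) (use b Qeps_ge_a[OF \<omega>] in \<open>auto simp: Qeps_le_a\<close>)
qed

lemma u_rcb:
  assumes \<omega>: "\<omega> \<in> space M" and b: "0 \<le> b" "b < T"
  shows "rcb b (\<lambda>t. u t \<omega>)"
proof -
  have 1: "rcb b (\<lambda>t. (Qopt t \<omega> - Qbar \<epsilon> t \<omega>) / d)"
    using rcb_mult[OF rcb_const rcb_mono[OF rcb_diff[OF Qopt_rcb[OF \<omega>] rcb_continuous[OF Qbar_cont[OF \<omega>]]], of b], of "1 / d"] b
    by simp
  have 2: "rcb b (\<lambda>t. (\<Xi> t \<omega> - Qeps \<epsilon> t \<omega>) / (T - t))"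
  proof (rule rcb_divide[of _ _ _ "T - b"])
    show "rcb b (\<lambda>t. \<Xi> t \<omega> - Qeps \<epsilon> t \<omega>)"
      using b by (intro rcb_diff rcb_mono[OF Xi_rcb[OF \<omega>]] rcb_continuous Qeps_cont[OF \<omega>]) auto
    show "rcb b (\<lambda>t. T - t)" by (intro rcb_continuous continuous_intros)
  qed (use b in auto)
  have "rcb b (\<lambda>t. if t < a then (Qopt t \<omega> - Qbar \<epsilon> t \<omega>) / d else (\<Xi> t \<omega> - Qeps \<epsilon> t \<omega>) / (T - t))"
    by (rule rcb_If[OF 1 2])
  moreover have "u t \<omega> = (if t < a then (Qopt t \<omega> - Qbar \<epsilon> t \<omega>) / d else (\<Xi> t \<omega> - Qeps \<epsilon> t \<omega>) / (T - t))" if "t \<le> b" for t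
    using that b by (simp add: u_def)
  ultimately show ?thesis
    unfolding rcb_def
  proof (elim conjE, intro conjI ballI)
    fix t assume "\<forall>t\<in>{0..<b}. ((\<lambda>t. if t < a then (Qopt t \<omega> - Qbar \<epsilon> t \<omega>) / d else (\<Xi> t \<omega> - Qeps \<epsilon> t \<omega>) / (T - t)) \<longlongrightarrow>
      (if t < a then (Qopt t \<omega> - Qbar \<epsilon> t \<omega>) / d else (\<Xi> t \<omega> - Qeps \<epsilon> t \<omega>) / (T - t))) (at_right t)"
      and t: "t \<in> {0..<b}"
      and eq: "\<And>t. t \<le> b \<Longrightarrow> u t \<omega> = (if t < a then (Qopt t \<omega> - Qbar \<epsilon> t \<omega>) / d else (\<Xi> t \<omega> - Qeps \<epsilon> t \<omega>) / (T - t))"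
    then have "((\<lambda>t. if t < a then (Qopt t \<omega> - Qbar \<epsilon> t \<omega>) / d else (\<Xi> t \<omega> - Qeps \<epsilon> t \<omega>) / (T - t)) \<longlongrightarrow> u t \<omega>) (at_right t)"
      by simp
    moreover have "eventually (\<lambda>s. (if s < a then (Qopt s \<omega> - Qbar \<epsilon> s \<omega>) / d else (\<Xi> s \<omega> - Qeps \<epsilon> s \<omega>) / (T - s)) = u s \<omega>) (at_right t)"
      unfolding eventually_at_right_field using t eq by (intro exI[of _ b]) auto
    ultimately show "((\<lambda>t. u t \<omega>) \<longlongrightarrow> u t \<omega>) (at_right t)" by (rule Lim_transform_eventually)
  qed auto
qed

lemma Qeps_eq_integral:
  assumes \<omega>: "\<omega> \<in> space M" and t: "0 \<le> t" "t < T"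
  shows "Qeps \<epsilon> t \<omega> = (LINT s:{0..t}|lborel. u s \<omega>)"
proof -
  \<comment> \<open>On \<open>[0,b]\<close> with \<open>b < T\<close> the rate is bounded and
    right-continuous; at \<open>T\<close> it may blow up.\<close>
  define b where "b = (t + T) / 2"
  have b: "0 \<le> b" "t \<le> b" "b < T" using t by (auto simp: b_def)
  have "Qeps \<epsilon> t \<omega> = Qeps \<epsilon> 0 \<omega> + (LINT s:{0..t}|lborel. u s \<omega>)"
  proof (rule right_deriv_FTC[OF Qeps_cont[OF \<omega> b(1,3)] u_rcb[OF \<omega> b(1,3)] _ t(1) b(2)])
    fix s assume s: "0 \<le> s" "s < b"
    show "((\<lambda>t. Qeps \<epsilon> t \<omega>) has_real_derivative u s \<omega>) (at_right s)"
    proof (cases "s < a")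
      case True
      have "((\<lambda>t. Qbar \<epsilon> t \<omega>) has_real_derivative u s \<omega>) (at_right s)"
        using Qbar_right_deriv[OF \<omega>, of s] True s b by (simp add: u_def)
      then show ?thesis by (rule has_real_derivative_at_right_cong[OF _ True]) (simp add: Qeps_le_a)
    next
      case False
      then have "a \<le> s" "s < T" using s b by auto
      then have "((\<lambda>t. W t \<omega>) has_real_derivative u s \<omega>) (at_right s)"
        using W_right_deriv[OF \<omega>, of s] s Qeps_ge_a[OF \<omega>, of s] by (simp add: u_def)
      then show ?thesis
        by (rule has_real_derivative_at_right_cong[OF _ \<open>s < T\<close>]) (use Qeps_ge_a[OF \<omega>] \<open>a \<le> s\<close> in auto)
    qed
  qed
  then show ?thesis using a_bounds by (simp add: Qeps_le_a Qbar_0)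
qed

lemma H_measurable:
  assumes t: "0 \<le> t" "t < T" shows "H t \<in> borel_measurable (F t)"
  unfolding H_def[abs_def]
proof (rule integral_process_measurable)
  show "(\<lambda>\<omega>. 1 / (T - s)\<^sup>2 * \<Xi> s \<omega>) \<in> borel_measurable (F t)" if "0 \<le> s" "s \<le> t" for s
    using measurable_F_mono[OF supL2D(1)[OF Xi_supL2, of s]] that t by (intro borel_measurable_times borel_measurable_const) auto
  show "((\<lambda>s. 1 / (T - s)\<^sup>2 * \<Xi> s \<omega>) \<longlongrightarrow> 1 / (T - s)\<^sup>2 * \<Xi> s \<omega>) (at_right s)" if "0 \<le> s" "s < t" "\<omega> \<in> space (F t)" for s \<omega>
    using that t space_F[of t] by (intro rcb_tendsto[OF weight_Xi_rcb[of \<omega> t]]) auto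
qed (rule t)

lemma Qeps_measurable:
  assumes t: "0 \<le> t" "t \<le> T" shows "Qeps \<epsilon> t \<in> borel_measurable (F t)"
proof -
  consider "t \<le> a" | "a < t" "t < T" | "t = T" using t by linarith
  then show ?thesis
  proof cases
    case 1
    then have "Qeps \<epsilon> t = Qbar \<epsilon> t" by (auto simp: Qeps_le_a)
    then show ?thesis using supL2D(1)[OF Qbar_supL2 t] by simp
  next
    case 2
    have [measurable]: "H t \<in> borel_measurable (F t)" "H a \<in> borel_measurable (F t)" "Qbar \<epsilon> a \<in> borel_measurable (F t)"
      using H_measurable[of t] measurable_F_mono[OF H_measurable[of a], of t] measurable_F_mono[OF supL2D(1)[OF Qbar_supL2, of a], of t]
        a_bounds 2 by auto
    have "W t \<in> borel_measurable (F t)" unfolding W_def[abs_def] by measurable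
    then show ?thesis
      by (rule measurable_cong[THEN iffD2, rotated]) (use 2 t space_F[of t] Qeps_ge_a in auto)
  next
    case 3
    then have "Qeps \<epsilon> t = \<Xi> t" using d_pos by (auto simp: Qeps_def d_def[symmetric])
    then show ?thesis using supL2D(1)[OF Xi_supL2 t] by simp
  qed
qed

lemma u_measurable:
  assumes t: "0 \<le> t" "t \<le> T" shows "u t \<in> borel_measurable (F t)"
proof -
  have [measurable]: "Qeps \<epsilon> t \<in> borel_measurable (F t)" "Qbar \<epsilon> t \<in> borel_measurable (F t)"
    "Qopt t \<in> borel_measurable (F t)" "\<Xi> t \<in> borel_measurable (F t)"
    using Qeps_measurable supL2D(1)[OF Qbar_supL2] supL2D(1)[OF Qopt_supL2] supL2D(1)[OF Xi_supL2] t by auto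
  show ?thesis unfolding u_def[abs_def] by measurable
qed

lemma u_right_cont: "\<omega> \<in> space M \<Longrightarrow> 0 \<le> s \<Longrightarrow> s < T \<Longrightarrow> ((\<lambda>s. u s \<omega>) \<longlongrightarrow> u s \<omega>) (at_right s)"
  by (rule rcb_tendsto[OF u_rcb[of \<omega> "(s + T) / 2"]]) auto

lemma u_progressive: "progressive u"
  unfolding progressive_def
proof
  fix t assume t: "t \<in> {0..T}"
  show "(\<lambda>(s, \<omega>). u s \<omega>) \<in> borel_measurable (restrict_space borel {0..t} \<Otimes>\<^sub>M F t)"
  proof (rule rc_pair_measurable)
    show "u s \<in> borel_measurable (F t)" if "0 \<le> s" "s \<le> t" for s
      using measurable_F_mono[OF u_measurable] that t by auto
    show "((\<lambda>s. u s \<omega>) \<longlongrightarrow> u s \<omega>) (at_right s)" if "0 \<le> s" "s < t" "\<omega> \<in> space (F t)" for s \<omega>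
      using that t space_F[OF t] by (intro u_right_cont) auto
  qed (use t in auto)
qed

lemma u_pair_measurable: "(\<lambda>(s, \<omega>). u s \<omega>) \<in> borel_measurable (leb T \<Otimes>\<^sub>M M)"
  using T_ge0 measurable_F_M[OF u_measurable] u_right_cont
  by (intro measurable_leb_pair rc_pair_measurable) auto

text \<open>In the last phase the strategy is a weighted mean of past values of \<open>\<Xi>\<close>
  whose weight \<open>(T - t) / (T - r)\<^sup>2\<close> concentrates at \<open>T\<close>. With the
  mean restarted at an \<open>s\<close> close to \<open>T\<close>, everything before
  \<open>s\<close> contributes a multiple of \<open>T - t\<close>, and after \<open>s\<close> the
  values of \<open>\<Xi>\<close> are already near \<open>l\<close>.\<close>

lemma Hardy_left_limit:
  assumes \<omega>: "\<omega> \<in> space M" and l: "((\<lambda>t. \<Xi> t \<omega>) \<longlongrightarrow> l) (at_left T)"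
  shows "((\<lambda>t. Qeps \<epsilon> t \<omega>) \<longlongrightarrow> l) (at_left T)"
proof -
  have "((\<lambda>t. W t \<omega>) \<longlongrightarrow> l) (at_left T)"
  proof (rule tendstoI)
    fix e :: real assume e: "e > 0"
    have "eventually (\<lambda>t. dist (\<Xi> t \<omega>) l < e / 2) (at_left T)" using e by (intro tendstoD[OF l]) auto
    then obtain s0 where s0: "s0 < T" "\<And>t. s0 < t \<Longrightarrow> t < T \<Longrightarrow> dist (\<Xi> t \<omega>) l < e / 2"
      by (auto simp: eventually_at_left_field)
    define s where "s = (max s0 a + T) / 2"
    have s: "0 \<le> s" "s < T" "a \<le> s" "s0 < s" using s0(1) a_bounds by (auto simp: s_def max_def)
    \<comment> \<open>Deviation from \<open>l\<close> after removal of the decaying contribution of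
      the past before \<open>s\<close>.\<close>
    define D where "D t = W t \<omega> - l - (T - t) / (T - s) * (W s \<omega> - l)" for t
    have bound: "\<bar>D t\<bar> \<le> e / 2" if t: "s \<le> t" "t < T" for t
    proof -
      have Wdiff: "W t \<omega> / (T - t) - W s \<omega> / (T - s) = H t \<omega> - H s \<omega>"
        using t s by (simp add: W_def add_divide_distrib)
      have i: "set_integrable lborel {0..t} (\<lambda>r. 1 / (T - r)\<^sup>2 * \<Xi> r \<omega>)" "set_integrable lborel {0..t} (\<lambda>r. 1 / (T - r)\<^sup>2)"
        using weight_Xi_rcb[OF \<omega> t(2)] weight_rcb[OF t(2)] s t by (auto intro!: rcb_integrable[where T=t])
      have i': "set_integrable lborel {s..t} (\<lambda>r. 1 / (T - r)\<^sup>2 * \<Xi> r \<omega>)" "set_integrable lborel {s..t} (\<lambda>r. 1 / (T - r)\<^sup>2)"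
        by (rule set_integrable_subset[OF i(1)] set_integrable_subset[OF i(2)]; use s in auto)+
      have w: "(LINT r:{s..t}|lborel. 1 / (T - r)\<^sup>2) = 1 / (T - t) - 1 / (T - s)"
      proof -
        have "1 / (T - t') = 1 / (T - 0) + (LINT r:{0..t'}|lborel. 1 / (T - r)\<^sup>2)" if t': "0 \<le> t'" "t' \<le> t" for t'
        proof (rule right_deriv_FTC[where T=t and F="\<lambda>t. 1 / (T - t)"])
          show "continuous_on {0..t} (\<lambda>t. 1 / (T - t))" using t by (intro continuous_intros) auto
          show "rcb t (\<lambda>r. 1 / (T - r)\<^sup>2)" by (rule weight_rcb[OF t(2)])
          show "((\<lambda>t. 1 / (T - t)) has_real_derivative 1 / (T - r)\<^sup>2) (at_right r)" if "0 \<le> r" "r < t" for r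
            using that t by (auto intro!: derivative_eq_intros simp: power2_eq_square)
        qed (use t' in auto)
        from this[of t] this[of s] show ?thesis
          using set_integral_Icc_diff[OF i(2) s(1) t(1)] s t by simp
      qed
      have gen: "x - l - p / q * (z - l) = p * ((x / p - z / q) - l * (1 / p - 1 / q))" if "p \<noteq> 0" "q \<noteq> 0" for x p q z :: real
        using that by (simp add: field_simps)
      have "D t = (T - t) * ((H t \<omega> - H s \<omega>) - l * (1 / (T - t) - 1 / (T - s)))"
        unfolding D_def Wdiff[symmetric] by (rule gen) (use t s in auto)
      also have "H t \<omega> - H s \<omega> = (LINT r:{s..t}|lborel. 1 / (T - r)\<^sup>2 * \<Xi> r \<omega>)"
        using set_integral_Icc_diff[OF i(1) s(1) t(1)] by (simp add: H_def)
      also have "(LINT r:{s..t}|lborel. 1 / (T - r)\<^sup>2 * \<Xi> r \<omega>) - l * (1 / (T - t) - 1 / (T - s))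
        = (LINT r:{s..t}|lborel. 1 / (T - r)\<^sup>2 * \<Xi> r \<omega> - l * (1 / (T - r)\<^sup>2))"
        unfolding w[symmetric] set_integral_mult_right[symmetric]
        by (rule set_integral_diff(2)[OF i'(1) set_integrable_mult_right[OF i'(2)], symmetric])
      finally have Deq: "D t = (T - t) * (LINT r:{s..t}|lborel. 1 / (T - r)\<^sup>2 * \<Xi> r \<omega> - l * (1 / (T - r)\<^sup>2))" .
      have id: "set_integrable lborel {s..t} (\<lambda>r. 1 / (T - r)\<^sup>2 * \<Xi> r \<omega> - l * (1 / (T - r)\<^sup>2))"
        using set_integral_diff(1)[OF i'(1) set_integrable_mult_right[of l, OF i'(2)]] by simp
      have "\<bar>LINT r:{s..t}|lborel. 1 / (T - r)\<^sup>2 * \<Xi> r \<omega> - l * (1 / (T - r)\<^sup>2)\<bar>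
        \<le> (LINT r:{s..t}|lborel. \<bar>1 / (T - r)\<^sup>2 * \<Xi> r \<omega> - l * (1 / (T - r)\<^sup>2)\<bar>)"
        using set_integral_norm_bound[OF id] by simp
      also have "\<dots> \<le> (LINT r:{s..t}|lborel. e / 2 * (1 / (T - r)\<^sup>2))"
      proof (rule set_integral_mono)
        show "set_integrable lborel {s..t} (\<lambda>r. \<bar>1 / (T - r)\<^sup>2 * \<Xi> r \<omega> - l * (1 / (T - r)\<^sup>2)\<bar>)" by (rule set_integrable_abs[OF id])
        show "set_integrable lborel {s..t} (\<lambda>r. e / 2 * (1 / (T - r)\<^sup>2))" by (intro set_integrable_mult_right i'(2))
        fix r assume r: "r \<in> {s..t}"
        have "\<bar>1 / (T - r)\<^sup>2 * \<Xi> r \<omega> - l * (1 / (T - r)\<^sup>2)\<bar> = \<bar>\<Xi> r \<omega> - l\<bar> * (1 / (T - r)\<^sup>2)"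
          by (simp add: abs_divide diff_divide_distrib[symmetric])
        also have "\<dots> \<le> e / 2 * (1 / (T - r)\<^sup>2)"
          using s0(2)[of r] r s t by (intro mult_right_mono) (auto simp: dist_real_def)
        finally show "\<bar>1 / (T - r)\<^sup>2 * \<Xi> r \<omega> - l * (1 / (T - r)\<^sup>2)\<bar> \<le> e / 2 * (1 / (T - r)\<^sup>2)" .
      qed
      also have "\<dots> = e / 2 * (1 / (T - t) - 1 / (T - s))" unfolding set_integral_mult_right w ..
      also have "\<dots> \<le> e / 2 * (1 / (T - t))" using e s by (intro mult_left_mono) auto
      finally have "(T - t) * \<bar>LINT r:{s..t}|lborel. 1 / (T - r)\<^sup>2 * \<Xi> r \<omega> - l * (1 / (T - r)\<^sup>2)\<bar> \<le> (T - t) * (e / 2 * (1 / (T - t)))"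
        using t by (intro mult_left_mono) auto
      moreover have gen2: "p * (c * (1 / p)) = c" if "p \<noteq> 0" for p c :: real using that by simp
      have "(T - t) * (e / 2 * (1 / (T - t))) = e / 2" by (rule gen2) (use t in auto)
      moreover have "\<bar>T - t\<bar> = T - t" using t by auto
      ultimately show ?thesis unfolding Deq abs_mult by (simp only:)
    qed
    define R where "R t = (T - t) / (T - s) * (W s \<omega> - l)" for t
    have "(R \<longlongrightarrow> (T - T) / (T - s) * (W s \<omega> - l)) (at_left T)"
      unfolding R_def[abs_def] using s by (intro tendsto_intros) auto
    then have "(R \<longlongrightarrow> 0) (at_left T)" by simp
    then have "eventually (\<lambda>t. dist (R t) 0 < e / 2) (at_left T)" by (rule tendstoD) (use e in simp)
    moreover have "eventually (\<lambda>t. s < t \<and> t < T) (at_left T)"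
      unfolding eventually_at_left_field using s by (intro exI[of _ s]) auto
    ultimately show "eventually (\<lambda>t. dist (W t \<omega>) l < e) (at_left T)"
    proof eventually_elim
      case (elim t)
      then have "\<bar>D t\<bar> \<le> e / 2" by (intro bound) auto
      then show ?case using elim unfolding D_def R_def[symmetric] dist_real_def by linarith
    qed
  qed
  moreover have "eventually (\<lambda>t. W t \<omega> = Qeps \<epsilon> t \<omega>) (at_left T)"
    unfolding eventually_at_left_field using a_bounds Qeps_ge_a[OF \<omega>] by (intro exI[of _ a]) auto
  ultimately show ?thesis by (rule Lim_transform_eventually)
qed

lemma Qeps_cadlag_adapted: "cadlag_adapted (Qeps \<epsilon>)"
  unfolding cadlag_adapted_def
proof (intro conjI ballI)
  show "Qeps \<epsilon> t \<in> borel_measurable (F t)" if "t \<in> {0..T}" for t using that by (intro Qeps_measurable) auto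
  fix \<omega> assume \<omega>: "\<omega> \<in> space M"
  show "cadlag_on T (\<lambda>t. Qeps \<epsilon> t \<omega>)"
    unfolding cadlag_on_def
  proof (intro conjI ballI)
    fix t assume t: "t \<in> {0..<T}"
    show "((\<lambda>t. Qeps \<epsilon> t \<omega>) \<longlongrightarrow> Qeps \<epsilon> t \<omega>) (at_right t)"
      by (rule continuous_on_Icc_at_right[OF Qeps_cont[OF \<omega>, of "(t + T) / 2"]]) (use t in auto)
  next
    fix t assume t: "t \<in> {0<..T}"
    show "\<exists>l. ((\<lambda>t. Qeps \<epsilon> t \<omega>) \<longlongrightarrow> l) (at_left t)"
    proof (cases "t < T")
      case True
      then show ?thesis using cadlag_on_continuous[OF Qeps_cont[OF \<omega>, of t]] t unfolding cadlag_on_def by auto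
    next
      case False
      then have "t = T" using t by simp
      moreover obtain l where "((\<lambda>t. \<Xi> t \<omega>) \<longlongrightarrow> l) (at_left T)"
        using cadlag_adaptedD(3)[OF Xi_cadlag_adapted \<omega>] T_pos unfolding cadlag_on_def
        by (metis greaterThanAtMost_iff order_refl)
      ultimately show ?thesis using Hardy_left_limit[OF \<omega>] by blast
    qed
  qed
qed

subsection \<open>Exponential averaging\<close>

text \<open>Law of the delay: exponential with mean \<open>d\<close>, matching the kernel of
  \<open>Qbar\<close>.\<close>

definition nu :: "real measure" where "nu = density lborel (exponential_density (1 / d))"

lemma prob_nu: "prob_space nu"
  unfolding nu_def using d_pos by (intro prob_space_exponential_density) auto

lemma sets_nu [measurable_cong, simp]: "sets nu = sets borel" and space_nu [simp]: "space nu = UNIV"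
  by (simp_all add: nu_def)

lemma AE_nu_nonneg: "AE h in nu. 0 \<le> h"
  unfolding nu_def by (subst AE_density) (auto simp: exponential_density_def)

lemma nu_moment: "(\<integral>\<^sup>+ h. ennreal (max h 0) \<partial>nu) = ennreal d"
proof -
  have "(\<integral>\<^sup>+ h. ennreal (max h 0) \<partial>nu) = (\<integral>\<^sup>+ h. ennreal (exponential_density (1 / d) h) * ennreal (max h 0) \<partial>lborel)"
    unfolding nu_def by (subst nn_integral_density) auto
  also have "\<dots> = (\<integral>\<^sup>+ h. ennreal (exponential_density (1 / d) h * h ^ 1) \<partial>lborel)"
    by (intro nn_integral_cong) (use d_pos in \<open>auto simp: exponential_density_def max_def ennreal_mult'\<close>)
  also have "\<dots> = ennreal d"
    using nn_integral_erlang_ith_moment[of "1 / d" 0 1] d_pos by simp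
  finally show ?thesis .
qed

text \<open>\<open>Qbar\<close> is the mean of the optimizer delayed by a
  \<open>nu\<close>-distributed time and extended by zero to negative times, in accordance with the
  value of strategies before their initial jump. Cauchy-Schwarz against the constant one moves the
  square inside. The free constant \<open>c\<close> serves both for \<open>Qopt t\<close> and for
  \<open>\<Xi> a\<close>.\<close>

lemma Jensen_Qbar:
  assumes \<omega>: "\<omega> \<in> space M" and t: "0 \<le> t" "t \<le> T"
  shows "ennreal ((c - Qbar \<epsilon> t \<omega>)\<^sup>2) \<le> (\<integral>\<^sup>+ h. ennreal ((c - indicat_real {0..t} (t - h) * Qopt (t - h) \<omega>)\<^sup>2) \<partial>nu)"
proof -
  interpret N: prob_space nu by (rule prob_nu)
  have N1: "measure nu UNIV = 1" using N.prob_space by simp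
  define g where "g r = indicat_real {0..t} r * Qopt r \<omega>" for r
  have g[measurable]: "g \<in> borel_measurable borel"
    using rcb_set_measurable[OF Qopt_rcb[OF \<omega>] T_ge0 t(2) order_refl] by (simp add: g_def[abs_def] set_borel_measurable_def)
  obtain B where B: "\<And>t. 0 \<le> t \<Longrightarrow> t \<le> T \<Longrightarrow> \<bar>Qopt t \<omega>\<bar> \<le> B" "0 \<le> B" using rcb_bound[OF Qopt_rcb[OF \<omega>]] by metis
  have gB: "\<bar>g r\<bar> \<le> B" for r using B t by (auto simp: g_def indicator_def)
  have gm: "(\<lambda>h. g (t - h)) \<in> borel_measurable nu" by (simp add: measurable_cong_sets[OF sets_nu refl])
  have i: "integrable nu (\<lambda>h. g (t - h))"
    by (rule N.integrable_const_bound[where B=B]) (use gm gB in auto)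
  have bnd: "(c - x)\<^sup>2 \<le> (\<bar>c\<bar> + B)\<^sup>2" if "\<bar>x\<bar> \<le> B" for x
    using that by (intro abs_le_square_iff[THEN iffD1]) auto
  have i2: "integrable nu (\<lambda>h. (c - g (t - h))\<^sup>2)"
    by (rule N.integrable_const_bound[where B="(\<bar>c\<bar> + B)\<^sup>2"]) (use gm bnd[OF gB] in auto)
  have "(LINT h|nu. g (t - h)) = (LINT h|lborel. exponential_density (1 / d) h * g (t - h))"
    unfolding nu_def using d_pos by (subst integral_density) (auto intro!: AE_I2 exponential_density_nonneg)
  also have "\<dots> = (LINT r|lborel. exponential_density (1 / d) (t - r) * g r)"
    by (subst lborel_integral_real_affine[of "-1" _ t]) auto
  also have "\<dots> = (LINT r|lborel. 1 / d * (indicat_real {0..t} r *\<^sub>R (exp (- (t - r) / d) * Qopt r \<omega>)))"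
    by (intro Bochner_Integration.integral_cong) (auto simp: g_def exponential_density_def indicator_def)
  also have "\<dots> = Qbar \<epsilon> t \<omega>"
    by (simp add: Qbar_def d_def set_lebesgue_integral_def)
  finally have mean: "(LINT h|nu. g (t - h)) = Qbar \<epsilon> t \<omega>" .
  have "c - Qbar \<epsilon> t \<omega> = (LINT h|nu. (c - g (t - h)) * 1)"
    using i mean by (simp add: N1)
  then have "(c - Qbar \<epsilon> t \<omega>)\<^sup>2 \<le> (LINT h|nu. (c - g (t - h))\<^sup>2)"
    using Cauchy_Schwarz_integral[of "\<lambda>h. c - g (t - h)" nu "\<lambda>_. 1"] i2 gm by (simp add: N1)
  then have "ennreal ((c - Qbar \<epsilon> t \<omega>)\<^sup>2) \<le> ennreal (LINT h|nu. (c - g (t - h))\<^sup>2)" by (rule ennreal_leI)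
  also have "\<dots> = (\<integral>\<^sup>+ h. ennreal ((c - g (t - h))\<^sup>2) \<partial>nu)"
    by (rule nn_integral_eq_integral[symmetric, OF i2]) auto
  finally show ?thesis by (simp add: g_def)
qed

lemma nu_pair: "pair_sigma_finite nu (leb T \<Otimes>\<^sub>M M)" "pair_sigma_finite nu M"
proof -
  interpret N: prob_space nu by (rule prob_nu)
  interpret P: pair_sigma_finite "leb T" M by (rule pair_leb)
  have "sigma_finite_measure (leb T \<Otimes>\<^sub>M M)" by unfold_locales
  then show "pair_sigma_finite nu (leb T \<Otimes>\<^sub>M M)" using N.sigma_finite_measure_axioms by (intro pair_sigma_finite.intro)
  show "pair_sigma_finite nu M" by unfold_locales
qed

text \<open>The positive part \<open>max h 0\<close> makes the estimate total in \<open>h\<close>;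
  for nonpositive delays the left side vanishes.\<close>

lemma Qopt_shift_bound:
  "(\<integral>\<^sup>+ z. ennreal ((Qopt (fst z) (snd z) - Qopt (max (fst z - max h 0) 0) (snd z))\<^sup>2) \<partial>(leb T \<Otimes>\<^sub>M M)) \<le> Qopt_tr_sq * ennreal (max h 0)"
proof (cases "0 < h")
  case True
  interpret P: pair_sigma_finite "leb T" M by (rule pair_leb)
  have hh: "h \<in> space (restrict_space borel {0..})" using True by (simp add: space_restrict_space)
  have m: "(\<lambda>(t, \<omega>). Qopt (max (t - h) 0) \<omega>) \<in> borel_measurable (leb T \<Otimes>\<^sub>M M)"
    using measurable_compose[OF measurable_Pair1'[OF hh] Qopt_shift_measurable] by simp
  have m2: "(\<lambda>(t, \<omega>). ennreal ((Qopt t \<omega> - Qopt (max (t - h) 0) \<omega>)\<^sup>2)) \<in> borel_measurable (leb T \<Otimes>\<^sub>M M)"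
    using m supL2_measurable_pair[OF Qopt_supL2] by (simp add: case_prod_beta')
  define I where "I = (\<integral>\<^sup>+ \<omega>. (\<integral>\<^sup>+ t\<in>{0..T}. ennreal ((Qopt t \<omega> - Qopt (max (t - h) 0) \<omega>)\<^sup>2) \<partial>lborel) \<partial>M)"
  have "(\<integral>\<^sup>+ z. ennreal ((Qopt (fst z) (snd z) - Qopt (max (fst z - max h 0) 0) (snd z))\<^sup>2) \<partial>(leb T \<Otimes>\<^sub>M M))
    = (\<integral>\<^sup>+ t. (\<integral>\<^sup>+ \<omega>. ennreal ((Qopt t \<omega> - Qopt (max (t - h) 0) \<omega>)\<^sup>2) \<partial>M) \<partial>leb T)"
    using m2 True by (subst nn_integral_fst[symmetric]) (auto simp: case_prod_beta' max_absorb1)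
  also have "\<dots> = I"
    unfolding I_def by (subst P.Fubini'[OF m2, symmetric]) (simp add: nn_integral_restrict_space)
  also have "I = I / ennreal h * ennreal h"
    using True by (simp add: ennreal_divide_times[symmetric] ennreal_mult_divide_eq ennreal_times_divide mult.commute)
  also have "\<dots> \<le> Qopt_tr_sq * ennreal h"
    unfolding I_def Qopt_tr_sq_def using True by (intro mult_right_mono SUP_upper) auto
  finally show ?thesis using True by (simp add: max_absorb1)
next
  case False
  have "(\<integral>\<^sup>+ z. ennreal ((Qopt (fst z) (snd z) - Qopt (max (fst z - max h 0) 0) (snd z))\<^sup>2) \<partial>(leb T \<Otimes>\<^sub>M M)) = (\<integral>\<^sup>+ z. 0 \<partial>(leb T \<Otimes>\<^sub>M M))"
    using False by (intro nn_integral_cong) (auto simp: space_pair_measure space_restrict_space max_def)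
  then show ?thesis by simp
qed

abbreviation (input) tau :: real where "tau \<equiv> enn2real Qopt_tr_sq"

abbreviation (input) x2 :: real where "x2 \<equiv> expectation (\<lambda>\<omega>. (\<Xi> T \<omega>)\<^sup>2)"

lemma C_0_nonneg: "0 \<le> C_0" by (simp add: C_0_def m2_def)

text \<open>For delays beyond \<open>t\<close> the zero extension is compared with the initial
  value, so that the difference splits into a translation increment \<open>A\<close> and, where the
  delay exceeds \<open>t\<close>, the initial jump \<open>D\<close>. Both cost at most a multiple of
  the delay: \<open>A\<close> by the seminorm, \<open>D\<close> because the times
  \<open>t < h\<close> have measure at most \<open>h\<close>. Averaging over the delay gives its
  mean \<open>d\<close>.\<close>

lemma Qbar_error:
  "(\<integral>\<^sup>+ z. ennreal ((Qopt (fst z) (snd z) - Qbar \<epsilon> (fst z) (snd z))\<^sup>2) \<partial>(leb T \<Otimes>\<^sub>M M)) \<le> ennreal ((2 * C_0 + 2 * tau) * d)"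
proof -
  interpret N: prob_space nu by (rule prob_nu)
  interpret P: pair_sigma_finite "leb T" M by (rule pair_leb)
  interpret NP: pair_sigma_finite nu "leb T \<Otimes>\<^sub>M M" by (rule nu_pair)
  define A where "A h z = ennreal ((Qopt (fst z) (snd z) - Qopt (max (fst z - max h 0) 0) (snd z))\<^sup>2)" for h z
  define D where "D h z = (indicator {fst z<..} h :: ennreal) * ennreal ((Qopt 0 (snd z))\<^sup>2)" for h :: real and z :: "real \<times> 'a"
  have Am: "(\<lambda>(h, z). A h z) \<in> borel_measurable (nu \<Otimes>\<^sub>M (leb T \<Otimes>\<^sub>M M))"
  proof -
    have mh: "(\<lambda>h::real. max h 0) \<in> measurable nu (restrict_space borel {0..})"
      by (rule measurable_restrict_space2) auto
    have "(\<lambda>w. (max (fst w) 0, snd w)) \<in> measurable (nu \<Otimes>\<^sub>M (leb T \<Otimes>\<^sub>M M)) (restrict_space borel {0..} \<Otimes>\<^sub>M (leb T \<Otimes>\<^sub>M M))"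
      by (rule measurable_Pair[OF measurable_compose[OF measurable_fst mh] measurable_snd])
    from measurable_compose[OF this Qopt_shift_measurable]
    have [measurable]: "(\<lambda>w. Qopt (max (fst (snd w) - max (fst w) 0) 0) (snd (snd w))) \<in> borel_measurable (nu \<Otimes>\<^sub>M (leb T \<Otimes>\<^sub>M M))"
      by (simp add: case_prod_beta')
    have [measurable]: "(\<lambda>w. Qopt (fst (snd w)) (snd (snd w))) \<in> borel_measurable (nu \<Otimes>\<^sub>M (leb T \<Otimes>\<^sub>M M))"
      using measurable_compose[OF measurable_snd supL2_measurable_pair[OF Qopt_supL2]] by (simp add: case_prod_beta')
    show ?thesis unfolding A_def case_prod_beta' by measurable
  qed
  have Q0m: "Qopt 0 \<in> borel_measurable M" using supL2D(2)[OF Qopt_supL2 order_refl T_ge0] .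
  have Dm: "(\<lambda>(h, z). D h z) \<in> borel_measurable (nu \<Otimes>\<^sub>M (leb T \<Otimes>\<^sub>M M))"
  proof -
    have l: "(\<lambda>t. t) \<in> borel_measurable (leb T)" by (rule measurable_restrict_space1) simp
    have [measurable]: "(\<lambda>w. fst (snd w)) \<in> borel_measurable (nu \<Otimes>\<^sub>M (leb T \<Otimes>\<^sub>M M))"
      by (rule measurable_compose[OF measurable_compose[OF measurable_snd measurable_fst] l])
    have [measurable]: "(\<lambda>w. Qopt 0 (snd (snd w))) \<in> borel_measurable (nu \<Otimes>\<^sub>M (leb T \<Otimes>\<^sub>M M))"
      by (rule measurable_compose[OF measurable_compose[OF measurable_snd measurable_snd] Q0m])
    have "(\<lambda>w. (if fst (snd w) < fst w then 1 else 0) * ennreal ((Qopt 0 (snd (snd w)))\<^sup>2)) \<in> borel_measurable (nu \<Otimes>\<^sub>M (leb T \<Otimes>\<^sub>M M))"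
      by measurable
    then show ?thesis unfolding D_def case_prod_beta' by (simp add: indicator_def)
  qed
  have "(\<integral>\<^sup>+ z. ennreal ((Qopt (fst z) (snd z) - Qbar \<epsilon> (fst z) (snd z))\<^sup>2) \<partial>(leb T \<Otimes>\<^sub>M M))
    \<le> (\<integral>\<^sup>+ z. (\<integral>\<^sup>+ h. 2 * A h z + 2 * D h z \<partial>nu) \<partial>(leb T \<Otimes>\<^sub>M M))"
  proof (rule nn_integral_mono)
    fix z assume "z \<in> space (leb T \<Otimes>\<^sub>M M)"
    then obtain t \<omega> where z: "z = (t, \<omega>)" "0 \<le> t" "t \<le> T" "\<omega> \<in> space M"
      by (cases z) (auto simp: space_pair_measure space_restrict_space)
    have "ennreal ((Qopt t \<omega> - Qbar \<epsilon> t \<omega>)\<^sup>2) \<le> (\<integral>\<^sup>+ h. ennreal ((Qopt t \<omega> - indicat_real {0..t} (t - h) * Qopt (t - h) \<omega>)\<^sup>2) \<partial>nu)"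
      by (rule Jensen_Qbar[OF z(4,2,3)])
    also have "\<dots> \<le> (\<integral>\<^sup>+ h. 2 * A h z + 2 * D h z \<partial>nu)"
    proof (rule nn_integral_mono_AE)
      show "AE h in nu. ennreal ((Qopt t \<omega> - indicat_real {0..t} (t - h) * Qopt (t - h) \<omega>)\<^sup>2) \<le> 2 * A h z + 2 * D h z"
        using AE_nu_nonneg
      proof eventually_elim
        case (elim h)
        define p q where "p = Qopt t \<omega> - Qopt (max (t - max h 0) 0) \<omega>" and "q = indicat_real {t<..} h * Qopt 0 \<omega>"
        have "Qopt t \<omega> - indicat_real {0..t} (t - h) * Qopt (t - h) \<omega> = p + q"
          using elim z by (auto simp: p_def q_def indicator_def max_def)
        then have "ennreal ((Qopt t \<omega> - indicat_real {0..t} (t - h) * Qopt (t - h) \<omega>)\<^sup>2) \<le> ennreal (2 * p\<^sup>2 + 2 * q\<^sup>2)"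
          by (simp add: power2_sum_le ennreal_leI del: ennreal_plus)
        also have "\<dots> = 2 * ennreal (p\<^sup>2) + 2 * ennreal (q\<^sup>2)" by (simp add: ennreal_mult)
        also have "ennreal (p\<^sup>2) = A h z" by (simp add: A_def p_def z)
        also have "ennreal (q\<^sup>2) = D h z" by (auto simp: D_def q_def z indicator_def)
        finally show ?case .
      qed
    qed
    finally show "ennreal ((Qopt (fst z) (snd z) - Qbar \<epsilon> (fst z) (snd z))\<^sup>2) \<le> (\<integral>\<^sup>+ h. 2 * A h z + 2 * D h z \<partial>nu)" by (simp add: z)
  qed
  also have "\<dots> = (\<integral>\<^sup>+ h. (\<integral>\<^sup>+ z. 2 * A h z + 2 * D h z \<partial>(leb T \<Otimes>\<^sub>M M)) \<partial>nu)"
    by (rule NP.Fubini') (use Am Dm in \<open>simp add: case_prod_beta'\<close>)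
  also have "\<dots> \<le> (\<integral>\<^sup>+ h. (2 * Qopt_tr_sq + 2 * ennreal C_0) * ennreal (max h 0) \<partial>nu)"
  proof (rule nn_integral_mono)
    fix h :: real
    have Ah: "A h \<in> borel_measurable (leb T \<Otimes>\<^sub>M M)" "D h \<in> borel_measurable (leb T \<Otimes>\<^sub>M M)"
      using measurable_compose[OF measurable_Pair1' Am, of h] measurable_compose[OF measurable_Pair1' Dm, of h] by auto
    have "(\<integral>\<^sup>+ z. 2 * A h z + 2 * D h z \<partial>(leb T \<Otimes>\<^sub>M M)) = 2 * (\<integral>\<^sup>+ z. A h z \<partial>(leb T \<Otimes>\<^sub>M M)) + 2 * (\<integral>\<^sup>+ z. D h z \<partial>(leb T \<Otimes>\<^sub>M M))"
      using Ah by (simp add: nn_integral_add nn_integral_cmult)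
    also have "(\<integral>\<^sup>+ z. A h z \<partial>(leb T \<Otimes>\<^sub>M M)) \<le> Qopt_tr_sq * ennreal (max h 0)"
      unfolding A_def by (rule Qopt_shift_bound)
    also have "(\<integral>\<^sup>+ z. D h z \<partial>(leb T \<Otimes>\<^sub>M M)) = (\<integral>\<^sup>+ t. (\<integral>\<^sup>+ \<omega>. indicator {t<..} h * ennreal ((Qopt 0 \<omega>)\<^sup>2) \<partial>M) \<partial>leb T)"
      using Ah(2) by (subst nn_integral_fst[symmetric]) (auto simp: D_def)
    also have "\<dots> = (\<integral>\<^sup>+ t. indicator {t<..} h * ennreal (expectation (\<lambda>\<omega>. (Qopt 0 \<omega>)\<^sup>2)) \<partial>leb T)"
      using Q0m nn_integral_square_eq[OF Qopt_L2[OF order_refl T_ge0]] by (intro nn_integral_cong) (simp add: nn_integral_cmult)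
    also have "\<dots> \<le> (\<integral>\<^sup>+ t. ennreal C_0 * indicator {0..max h 0} t \<partial>leb T)"
      using Qopt_0_le_C_0 by (intro nn_integral_mono) (auto simp: indicator_def space_restrict_space intro: ennreal_leI)
    also have "\<dots> \<le> (\<integral>\<^sup>+ t. ennreal C_0 * indicator {0..max h 0} t \<partial>lborel)"
      by (subst nn_integral_restrict_space) (auto intro!: nn_integral_mono simp: indicator_def)
    also have "\<dots> = ennreal C_0 * ennreal (max h 0)" by (subst nn_integral_cmult_indicator) auto
    finally show "(\<integral>\<^sup>+ z. 2 * A h z + 2 * D h z \<partial>(leb T \<Otimes>\<^sub>M M)) \<le> (2 * Qopt_tr_sq + 2 * ennreal C_0) * ennreal (max h 0)"
      by (simp add: distrib_right mult.assoc add_mono mult_left_mono)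
  qed
  also have "\<dots> = (2 * Qopt_tr_sq + 2 * ennreal C_0) * ennreal d"
    by (subst nn_integral_cmult) (use nu_moment in auto)
  also have "Qopt_tr_sq = ennreal tau" using Qopt_tr_sq_finite by simp
  also have "(2 * ennreal tau + 2 * ennreal C_0) * ennreal d = ennreal ((2 * C_0 + 2 * tau) * d)"
    using C_0_nonneg d_pos by (simp add: ennreal_mult add.commute)
  finally show ?thesis .
qed

lemma Xi_sq_le: "0 \<le> t \<Longrightarrow> t \<le> T \<Longrightarrow> expectation (\<lambda>\<omega>. (\<Xi> t \<omega>)\<^sup>2) \<le> x2"
  by (rule Xi_L2_le(2))

text \<open>Jensen with \<open>c = \<Xi> a\<close>. For a delay within \<open>[0,a]\<close> the gap
  splits at the delayed time \<open>r\<close> into \<open>\<Xi> r - Qopt r\<close>, bounded by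
  \<open>K_0\<close>, and a martingale increment; for a longer delay only \<open>\<Xi> a\<close> is
  left. This bound does not shrink with \<open>\<epsilon>\<close>: it is the gap that the last phase
  must close within time \<open>d\<close>.\<close>

lemma Xi_Qbar_error: "expectation (\<lambda>\<omega>. (\<Xi> a \<omega> - Qbar \<epsilon> a \<omega>)\<^sup>2) \<le> 2 * enn2real K_0 + 2 * x2"
proof -
  interpret N: prob_space nu by (rule prob_nu)
  interpret NM: pair_sigma_finite nu M by (rule nu_pair)
  define q where "q h \<omega> = \<Xi> a \<omega> - indicat_real {0..a} (a - h) * Qopt (a - h) \<omega>" for h \<omega>
  have La: "L2 (\<Xi> a)" "L2 (Qbar \<epsilon> a)" using a_bounds by (auto intro: Xi_L2 supL2D(4)[OF Qbar_supL2])
  have qm: "(\<lambda>(h, \<omega>). ennreal ((q h \<omega>)\<^sup>2)) \<in> borel_measurable (nu \<Otimes>\<^sub>M M)"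
  proof -
    have "(\<lambda>h::real. max 0 (min a (a - h))) \<in> measurable nu (leb T)"
      by (rule measurable_restrict_space2) (use a_bounds in auto)
    then have "(\<lambda>w. (max 0 (min a (a - fst w)), snd w)) \<in> measurable (nu \<Otimes>\<^sub>M M) (leb T \<Otimes>\<^sub>M M)"
      by (intro measurable_Pair measurable_compose[OF measurable_fst] measurable_snd)
    from measurable_compose[OF this supL2_measurable_pair[OF Qopt_supL2]]
    have [measurable]: "(\<lambda>w. Qopt (max 0 (min a (a - fst w))) (snd w)) \<in> borel_measurable (nu \<Otimes>\<^sub>M M)" by (simp add: case_prod_beta')
    have [measurable]: "\<Xi> a \<in> borel_measurable M" using La by (simp add: L2_def)
    have "(\<lambda>w. ennreal ((\<Xi> a (snd w) - indicat_real {0..a} (a - fst w) * Qopt (max 0 (min a (a - fst w))) (snd w))\<^sup>2)) \<in> borel_measurable (nu \<Otimes>\<^sub>M M)"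
      by measurable
    also have "(\<lambda>w. ennreal ((\<Xi> a (snd w) - indicat_real {0..a} (a - fst w) * Qopt (max 0 (min a (a - fst w))) (snd w))\<^sup>2)) = (\<lambda>(h, \<omega>). ennreal ((q h \<omega>)\<^sup>2))"
      by (auto simp: q_def fun_eq_iff indicator_def)
    finally show ?thesis .
  qed
  have "ennreal (expectation (\<lambda>\<omega>. (\<Xi> a \<omega> - Qbar \<epsilon> a \<omega>)\<^sup>2)) = (\<integral>\<^sup>+ \<omega>. ennreal ((\<Xi> a \<omega> - Qbar \<epsilon> a \<omega>)\<^sup>2) \<partial>M)"
    by (rule nn_integral_square_eq[OF L2_diff[OF La], symmetric])
  also have "\<dots> \<le> (\<integral>\<^sup>+ \<omega>. (\<integral>\<^sup>+ h. ennreal ((q h \<omega>)\<^sup>2) \<partial>nu) \<partial>M)"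
    unfolding q_def using a_bounds by (intro nn_integral_mono Jensen_Qbar) auto
  also have "\<dots> = (\<integral>\<^sup>+ h. (\<integral>\<^sup>+ \<omega>. ennreal ((q h \<omega>)\<^sup>2) \<partial>M) \<partial>nu)"
    by (rule NM.Fubini'[OF qm])
  also have "\<dots> \<le> (\<integral>\<^sup>+ h. ennreal (2 * enn2real K_0 + 2 * x2) \<partial>nu)"
  proof (rule nn_integral_mono)
    fix h :: real
    show "(\<integral>\<^sup>+ \<omega>. ennreal ((q h \<omega>)\<^sup>2) \<partial>M) \<le> ennreal (2 * enn2real K_0 + 2 * x2)"
    proof (cases "a - h \<in> {0..a}")
      case True
      define r where "r = a - h"
      have r: "0 \<le> r" "r \<le> a" "r < T" using True a_bounds by (auto simp: r_def)
      have L: "L2 (\<lambda>\<omega>. \<Xi> r \<omega> - Qopt r \<omega>)" "L2 (\<lambda>\<omega>. \<Xi> a \<omega> - \<Xi> r \<omega>)" using r a_bounds by (auto intro!: L2_diff Xi_L2 Qopt_L2)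
      have eq: "q h \<omega> = (\<Xi> r \<omega> - Qopt r \<omega>) + (\<Xi> a \<omega> - \<Xi> r \<omega>)" for \<omega> using True by (simp add: q_def r_def)
      have "expectation (\<lambda>\<omega>. (q h \<omega>)\<^sup>2) \<le> 2 * expectation (\<lambda>\<omega>. (\<Xi> r \<omega> - Qopt r \<omega>)\<^sup>2) + 2 * expectation (\<lambda>\<omega>. (\<Xi> a \<omega> - \<Xi> r \<omega>)\<^sup>2)"
        unfolding eq by (rule L2_add(2)[OF L])
      also have "expectation (\<lambda>\<omega>. (\<Xi> r \<omega> - Qopt r \<omega>)\<^sup>2) \<le> enn2real K_0"
        using Qopt_Xi_le_K_0[of r] r by (simp add: power2_commute)
      also have "expectation (\<lambda>\<omega>. (\<Xi> a \<omega> - \<Xi> r \<omega>)\<^sup>2) \<le> x2"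
      proof -
        have "expectation (\<lambda>\<omega>. (\<Xi> a \<omega> - \<Xi> r \<omega>)\<^sup>2) = expectation (\<lambda>\<omega>. (\<Xi> a \<omega>)\<^sup>2) - expectation (\<lambda>\<omega>. (\<Xi> r \<omega>)\<^sup>2)"
          using r a_bounds by (intro L2mart_increment[OF Xi_L2mart]) auto
        moreover have "0 \<le> expectation (\<lambda>\<omega>. (\<Xi> r \<omega>)\<^sup>2)" by simp
        ultimately show ?thesis using Xi_sq_le[of a] a_bounds by linarith
      qed
      finally have le: "expectation (\<lambda>\<omega>. (q h \<omega>)\<^sup>2) \<le> 2 * enn2real K_0 + 2 * x2" by simp
      have "L2 (q h)" using L2_add(1)[OF L] by (simp add: eq[abs_def])
      from nn_integral_square_eq[OF this] le show ?thesis by (simp add: ennreal_leI del: ennreal_plus)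
    next
      case False
      then have "q h = \<Xi> a" by (auto simp: q_def)
      moreover have "expectation (\<lambda>\<omega>. (\<Xi> a \<omega>)\<^sup>2) \<le> 2 * enn2real K_0 + 2 * x2"
      proof -
        have "0 \<le> x2" by simp
        then show ?thesis using Xi_sq_le[of a] a_bounds enn2real_nonneg[of K_0] by linarith
      qed
      ultimately show ?thesis using nn_integral_square_eq[OF La(1)] by (simp add: ennreal_leI del: ennreal_plus)
    qed
  qed
  also have "\<dots> = ennreal (2 * enn2real K_0 + 2 * x2)" using N.emeasure_space_1 by simp
  finally show ?thesis by (subst (asm) ennreal_le_iff) auto
qed

subsection \<open>The martingale part of the rate\<close>

text \<open>The integral of \<open>1 / (T - r)\<close> against \<open>\<Xi>\<close> over
  \<open>(a,t]\<close>, integrated by parts so that only Lebesgue integrals occur.\<close>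

definition X :: "real \<Rightarrow> 'a \<Rightarrow> real" where "X t \<omega> = \<Xi> t \<omega> / (T - t) - \<Xi> a \<omega> / d - (H t \<omega> - H a \<omega>)"

lemma u_eq_X:
  assumes "\<omega> \<in> space M" "a \<le> t" "t < T"
  shows "u t \<omega> = (\<Xi> a \<omega> - Qbar \<epsilon> a \<omega>) / d + X t \<omega>"
proof -
  have nz: "T - t \<noteq> 0" using assms by simp
  have "W t \<omega> / (T - t) = Qbar \<epsilon> a \<omega> / d + (H t \<omega> - H a \<omega>)"
    using nz by (simp add: W_def add_divide_distrib)
  then show ?thesis using assms by (simp add: u_def Qeps_ge_a X_def diff_divide_distrib)
qed

text \<open>The cut-off makes the weight bounded on the whole of \<open>[0,T]\<close> without changing it on \<open>[0,b]\<close>.\<close>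

definition cut :: "real \<Rightarrow> real \<Rightarrow> real" where "cut b r = 1 / (T - min r b)\<^sup>2"

lemma cut_rcb: "b < T \<Longrightarrow> rcb T (cut b)"
  unfolding cut_def[abs_def] by (intro rcb_continuous continuous_intros) auto

lemma H_cut: "t \<le> b \<Longrightarrow> H t \<omega> = (LINT r:{0..t}|lborel. cut b r * \<Xi> r \<omega>)"
  unfolding H_def by (rule set_lebesgue_integral_cong) (auto simp: cut_def min_def)

lemma H_L2: "0 \<le> t \<Longrightarrow> t < T \<Longrightarrow> L2 (H t)"
  using supL2D(4)[OF supL2_integral[OF Xi_supL2 cut_rcb[of t]], of t] by (simp add: H_cut[OF order_refl, abs_def])

lemma X_L2: "a \<le> t \<Longrightarrow> t < T \<Longrightarrow> L2 (X t)"
  unfolding X_def[abs_def] using a_bounds L2_scale[OF Xi_L2, of t "1 / (T - t)"] L2_scale[OF Xi_L2, of a "1 / d"]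
  by (intro L2_diff H_L2) auto

section \<open>Moments of the martingale part and the role of \<open>Lambda_Xi\<close>\<close>

lemma expectation_H:
  assumes Z: "L2 Z" and t: "0 \<le> t" "t < T"
  shows "expectation (\<lambda>\<omega>. H t \<omega> * Z \<omega>) = (LINT r:{0..t}|lborel. 1 / (T - r)\<^sup>2 * expectation (\<lambda>\<omega>. \<Xi> r \<omega> * Z \<omega>))"
    and "set_integrable lborel {0..t} (\<lambda>r. 1 / (T - r)\<^sup>2 * expectation (\<lambda>\<omega>. \<Xi> r \<omega> * Z \<omega>))"
proof -
  have "expectation (\<lambda>\<omega>. H t \<omega> * Z \<omega>) = (LINT r:{0..t}|lborel. cut t r * expectation (\<lambda>\<omega>. \<Xi> r \<omega> * Z \<omega>))"
    unfolding H_cut[OF order_refl] by (rule expectation_mult_integral[OF Xi_supL2 cut_rcb[OF t(2)] Z]) (use t in auto)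
  also have "\<dots> = (LINT r:{0..t}|lborel. 1 / (T - r)\<^sup>2 * expectation (\<lambda>\<omega>. \<Xi> r \<omega> * Z \<omega>))"
    by (rule set_lebesgue_integral_cong) (auto simp: cut_def min_def)
  finally show "expectation (\<lambda>\<omega>. H t \<omega> * Z \<omega>) = (LINT r:{0..t}|lborel. 1 / (T - r)\<^sup>2 * expectation (\<lambda>\<omega>. \<Xi> r \<omega> * Z \<omega>))" .
  have "set_integrable lborel {0..T} (\<lambda>r. expectation (\<lambda>\<omega>. (cut t r * \<Xi> r \<omega>) * Z \<omega>))"
    by (rule Fubini_leb(3)[OF L2P_mult[OF supL2_L2P[OF supL2_scale[OF Xi_supL2 cut_rcb[OF t(2)]]] L2P_const[OF Z]]])
  then have "set_integrable lborel {0..t} (\<lambda>r. expectation (\<lambda>\<omega>. (cut t r * \<Xi> r \<omega>) * Z \<omega>))"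
    by (rule set_integrable_subset) (use t in auto)
  then show "set_integrable lborel {0..t} (\<lambda>r. 1 / (T - r)\<^sup>2 * expectation (\<lambda>\<omega>. \<Xi> r \<omega> * Z \<omega>))"
    by (rule set_integrable_cong[THEN iffD1, OF refl refl, rotated]) (auto simp: cut_def min_def mult.assoc)
qed

lemma weight_integral:
  assumes "0 \<le> s" "s \<le> t" "t < T"
  shows "(LINT r:{s<..t}|lborel. 1 / (T - r)\<^sup>2) = 1 / (T - t) - 1 / (T - s)"
proof -
  have "1 / (T - t') = 1 / (T - 0) + (LINT r:{0..t'}|lborel. 1 / (T - r)\<^sup>2)" if t': "0 \<le> t'" "t' \<le> t" for t'
  proof (rule right_deriv_FTC[where T=t and F="\<lambda>t. 1 / (T - t)"])
    show "continuous_on {0..t} (\<lambda>t. 1 / (T - t))" using assms by (intro continuous_intros) auto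
    show "rcb t (\<lambda>r. 1 / (T - r)\<^sup>2)" by (rule weight_rcb[OF assms(3)])
    show "((\<lambda>t. 1 / (T - t)) has_real_derivative 1 / (T - r)\<^sup>2) (at_right r)" if "0 \<le> r" "r < t" for r
      using that assms by (auto intro!: derivative_eq_intros simp: power2_eq_square)
  qed (use t' in auto)
  from this[of t] this[of s] show ?thesis
    using set_integral_Icc_split[OF rcb_integrable[OF weight_rcb[OF assms(3)] _ order_refl order_refl] assms(1,2)] assms by simp
qed

abbreviation (input) mm :: "real \<Rightarrow> real" where "mm \<equiv> Xi_second_moment"

lemma mm_rcb: "rcb b mm"
proof -
  have "\<bar>mm t\<bar> \<le> mm T" for t
    using Xi_second_moment_mono[of t "max t T"] T_pos by (auto simp: Xi_second_moment_def max_def min_def split: if_splits)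
  moreover have "(mm \<longlongrightarrow> mm t) (at_right t)" for t
    using Xi_second_moment_right_cont by (simp add: continuous_within)
  ultimately show ?thesis unfolding rcb_def by blast
qed

lemma expectation_Xi_Xi:
  assumes "0 \<le> r" "r \<le> T" "0 \<le> s" "s \<le> T"
  shows "expectation (\<lambda>\<omega>. \<Xi> r \<omega> * \<Xi> s \<omega>) = mm (min r s)"
proof (cases "s \<le> r")
  case True
  then show ?thesis using L2mart_product[OF Xi_L2mart, of s r] assms by (simp add: Xi_second_moment_eq min_absorb2)
next
  case False
  then show ?thesis using L2mart_product[OF Xi_L2mart, of r s] assms by (simp add: Xi_second_moment_eq min_absorb1 mult.commute)
qed

definition hh :: "real \<Rightarrow> real" where "hh t = (LINT r:{0..t}|lborel. 1 / (T - r)\<^sup>2 * mm r)"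

text \<open>With \<open>f(r) = 1 / (T - r)\<close> and the second moment \<open>m\<close> of \<open>\<Xi>\<close>, integration by parts shows that
  \<open>\<phi>\<close> and \<open>\<psi>\<close> are the integrals of \<open>f\<close> and of \<open>f\<^sup>2\<close> over \<open>(a,s]\<close> with respect to \<open>dm\<close>.\<close>

definition \<phi> :: "real \<Rightarrow> real" where "\<phi> s = mm s / (T - s) - mm a / d - (hh s - hh a)"

lemma weight_mm_rcb: "b < T \<Longrightarrow> rcb b (\<lambda>r. 1 / (T - r)\<^sup>2 * mm r)"
  by (intro rcb_mult weight_rcb mm_rcb)

lemma expectation_X_Xi:
  assumes "a \<le> s" "s \<le> t" "t < T"
  shows "expectation (\<lambda>\<omega>. \<Xi> s \<omega> * X t \<omega>) = \<phi> s"
proof -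
  have s: "0 \<le> s" "s < T" "0 \<le> t" using assms a_bounds by auto
  have Hs: "expectation (\<lambda>\<omega>. H r \<omega> * \<Xi> s \<omega>) = (LINT q:{0..r}|lborel. 1 / (T - q)\<^sup>2 * mm (min q s))"
    "set_integrable lborel {0..r} (\<lambda>q. 1 / (T - q)\<^sup>2 * mm (min q s))" if r: "0 \<le> r" "r \<le> t" for r
  proof -
    have Z: "L2 (\<Xi> s)" using s by (intro Xi_L2) auto
    have e: "q \<in> {0..r} \<longrightarrow> expectation (\<lambda>\<omega>. \<Xi> q \<omega> * \<Xi> s \<omega>) = mm (min q s)" for q
      using r s assms by (auto intro!: expectation_Xi_Xi)
    show "expectation (\<lambda>\<omega>. H r \<omega> * \<Xi> s \<omega>) = (LINT q:{0..r}|lborel. 1 / (T - q)\<^sup>2 * mm (min q s))"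
      using r assms e by (subst expectation_H(1)[OF Z]) (auto intro!: set_lebesgue_integral_cong)
    have "set_integrable lborel {0..r} (\<lambda>q. 1 / (T - q)\<^sup>2 * expectation (\<lambda>\<omega>. \<Xi> q \<omega> * \<Xi> s \<omega>))"
      using r assms by (intro expectation_H(2)[OF Z]) auto
    then show "set_integrable lborel {0..r} (\<lambda>q. 1 / (T - q)\<^sup>2 * mm (min q s))"
      by (rule set_integrable_cong[THEN iffD1, OF refl refl, rotated]) (use e in auto)
  qed
  have Ht: "expectation (\<lambda>\<omega>. H t \<omega> * \<Xi> s \<omega>) = hh s + (1 / (T - t) - 1 / (T - s)) * mm s"
  proof -
    have "(LINT q:{0..t}|lborel. 1 / (T - q)\<^sup>2 * mm (min q s)) =
      (LINT q:{0..s}|lborel. 1 / (T - q)\<^sup>2 * mm (min q s)) + (LINT q:{s<..t}|lborel. 1 / (T - q)\<^sup>2 * mm (min q s))"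
      by (rule set_integral_Icc_split[OF Hs(2)]) (use s assms in auto)
    also have "(LINT q:{0..s}|lborel. 1 / (T - q)\<^sup>2 * mm (min q s)) = hh s"
      unfolding hh_def by (rule set_lebesgue_integral_cong) auto
    also have "(LINT q:{s<..t}|lborel. 1 / (T - q)\<^sup>2 * mm (min q s)) = (LINT q:{s<..t}|lborel. 1 / (T - q)\<^sup>2 * mm s)"
      by (rule set_lebesgue_integral_cong) auto
    also have "\<dots> = (1 / (T - t) - 1 / (T - s)) * mm s"
      unfolding set_integral_mult_left weight_integral[OF s(1) assms(2,3)] ..
    finally show ?thesis using Hs(1)[of t] s by simp
  qed
  have Ha: "expectation (\<lambda>\<omega>. H a \<omega> * \<Xi> s \<omega>) = hh a"
    unfolding hh_def using Hs(1)[of a] assms a_bounds by (auto intro!: set_lebesgue_integral_cong)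
  have i: "integrable M (\<lambda>\<omega>. \<Xi> t \<omega> * \<Xi> s \<omega>)" "integrable M (\<lambda>\<omega>. \<Xi> a \<omega> * \<Xi> s \<omega>)"
    "integrable M (\<lambda>\<omega>. H t \<omega> * \<Xi> s \<omega>)" "integrable M (\<lambda>\<omega>. H a \<omega> * \<Xi> s \<omega>)"
    using s assms a_bounds by (auto intro!: L2_mult Xi_L2 H_L2)
  have "expectation (\<lambda>\<omega>. \<Xi> s \<omega> * X t \<omega>) = expectation (\<lambda>\<omega>. 1 / (T - t) * (\<Xi> t \<omega> * \<Xi> s \<omega>) - 1 / d * (\<Xi> a \<omega> * \<Xi> s \<omega>) - (H t \<omega> * \<Xi> s \<omega> - H a \<omega> * \<Xi> s \<omega>))"
    by (intro Bochner_Integration.integral_cong) (auto simp: X_def algebra_simps)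
  also have "\<dots> = 1 / (T - t) * expectation (\<lambda>\<omega>. \<Xi> t \<omega> * \<Xi> s \<omega>) - 1 / d * expectation (\<lambda>\<omega>. \<Xi> a \<omega> * \<Xi> s \<omega>)
      - (expectation (\<lambda>\<omega>. H t \<omega> * \<Xi> s \<omega>) - expectation (\<lambda>\<omega>. H a \<omega> * \<Xi> s \<omega>))"
    using i by simp
  also have "expectation (\<lambda>\<omega>. \<Xi> t \<omega> * \<Xi> s \<omega>) = mm s"
    using expectation_Xi_Xi[of t s] s assms by (simp add: min_absorb2)
  also have "expectation (\<lambda>\<omega>. \<Xi> a \<omega> * \<Xi> s \<omega>) = mm a"
    using expectation_Xi_Xi[of a s] s assms a_bounds by (simp add: min_absorb1)
  finally show ?thesis unfolding Ht Ha \<phi>_def by (simp add: algebra_simps)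
qed

definition \<Phi> :: "real \<Rightarrow> real" where "\<Phi> t = (LINT r:{0..t}|lborel. 1 / (T - r)\<^sup>2 * \<phi> r)"

definition \<psi> :: "real \<Rightarrow> real" where "\<psi> t = \<phi> t / (T - t) - (\<Phi> t - \<Phi> a)"

lemma over_rcb: "rcb b f \<Longrightarrow> b < T \<Longrightarrow> rcb b (\<lambda>t. f t / (T - t))"
  by (rule rcb_divide[of _ _ _ "T - b"]) (auto intro!: rcb_continuous continuous_intros)

lemma \<phi>_rcb: "0 \<le> b \<Longrightarrow> b < T \<Longrightarrow> rcb b \<phi>"
  unfolding \<phi>_def[abs_def] hh_def[abs_def]
  by (intro rcb_diff rcb_const over_rcb mm_rcb rcb_integral weight_mm_rcb) auto

lemma \<psi>_rcb: "0 \<le> b \<Longrightarrow> b < T \<Longrightarrow> rcb b \<psi>"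
  unfolding \<psi>_def[abs_def] \<Phi>_def[abs_def]
  by (intro rcb_diff rcb_const over_rcb \<phi>_rcb rcb_integral rcb_mult weight_rcb) auto

lemma \<phi>_a: "\<phi> a = 0"
  using T_minus_a by (simp add: \<phi>_def)

text \<open>Only one factor of the square is expanded; each resulting term pairs \<open>X t\<close>
  with \<open>\<Xi>\<close> at a time in \<open>[a,t]\<close>, where the mixed moment is
  known.\<close>

lemma expectation_X_sq:
  assumes t: "a \<le> t" "t < T"
  shows "expectation (\<lambda>\<omega>. (X t \<omega>)\<^sup>2) = \<psi> t"
proof -
  have t0: "0 \<le> t" using t a_bounds by simp
  have Z: "L2 (X t)" by (rule X_L2[OF t])
  have i: "integrable M (\<lambda>\<omega>. \<Xi> t \<omega> * X t \<omega>)" "integrable M (\<lambda>\<omega>. \<Xi> a \<omega> * X t \<omega>)"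
    "integrable M (\<lambda>\<omega>. H t \<omega> * X t \<omega>)" "integrable M (\<lambda>\<omega>. H a \<omega> * X t \<omega>)"
    using t t0 a_bounds by (auto intro!: L2_mult Xi_L2 H_L2 Z)
  have "expectation (\<lambda>\<omega>. (X t \<omega>)\<^sup>2) = expectation (\<lambda>\<omega>. 1 / (T - t) * (\<Xi> t \<omega> * X t \<omega>) - 1 / d * (\<Xi> a \<omega> * X t \<omega>) - (H t \<omega> * X t \<omega> - H a \<omega> * X t \<omega>))"
  proof (intro Bochner_Integration.integral_cong refl)
    fix \<omega>
    have "(X t \<omega>)\<^sup>2 = (\<Xi> t \<omega> / (T - t) - \<Xi> a \<omega> / d - (H t \<omega> - H a \<omega>)) * X t \<omega>"
      by (simp add: power2_eq_square X_def)
    then show "(X t \<omega>)\<^sup>2 = 1 / (T - t) * (\<Xi> t \<omega> * X t \<omega>) - 1 / d * (\<Xi> a \<omega> * X t \<omega>) - (H t \<omega> * X t \<omega> - H a \<omega> * X t \<omega>)"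
      by (simp add: left_diff_distrib)
  qed
  also have "\<dots> = 1 / (T - t) * expectation (\<lambda>\<omega>. \<Xi> t \<omega> * X t \<omega>) - 1 / d * expectation (\<lambda>\<omega>. \<Xi> a \<omega> * X t \<omega>)
      - (expectation (\<lambda>\<omega>. H t \<omega> * X t \<omega>) - expectation (\<lambda>\<omega>. H a \<omega> * X t \<omega>))"
    using i by simp
  also have "expectation (\<lambda>\<omega>. \<Xi> t \<omega> * X t \<omega>) = \<phi> t" by (rule expectation_X_Xi[OF t(1) order_refl t(2)])
  also have "expectation (\<lambda>\<omega>. \<Xi> a \<omega> * X t \<omega>) = 0" using expectation_X_Xi[OF order_refl t] \<phi>_a by simp
  also have "expectation (\<lambda>\<omega>. H t \<omega> * X t \<omega>) - expectation (\<lambda>\<omega>. H a \<omega> * X t \<omega>)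
    = (LINT r:{a<..t}|lborel. 1 / (T - r)\<^sup>2 * expectation (\<lambda>\<omega>. \<Xi> r \<omega> * X t \<omega>))"
    using set_integral_Icc_split[OF expectation_H(2)[OF Z t0 t(2)] a_bounds(3) t(1)]
      expectation_H(1)[OF Z t0 t(2)] expectation_H(1)[OF Z a_bounds(3,2)] by simp
  also have "\<dots> = (LINT r:{a<..t}|lborel. 1 / (T - r)\<^sup>2 * \<phi> r)"
    using expectation_X_Xi[of _ t] t by (intro set_lebesgue_integral_cong) auto
  also have "\<dots> = \<Phi> t - \<Phi> a"
    using set_integral_Icc_split[OF rcb_integrable[OF rcb_mult[OF weight_rcb[OF t(2)] \<phi>_rcb[OF t0 t(2)]] t0 order_refl order_refl] a_bounds(3) t(1)]
    by (simp add: \<Phi>_def)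
  finally show ?thesis by (simp add: \<psi>_def)
qed

lemma integral_\<psi>_le:
  assumes t: "a \<le> t" "t < T"
  shows "(LINT r:{a..t}|lborel. \<psi> r) \<le> \<phi> t"
proof -
  have t0: "0 \<le> t" using t a_bounds by simp
  \<comment> \<open>An antiderivative of \<open>\<psi>\<close>: the factor \<open>T - s\<close>
    compensates one power of the singular weight.\<close>
  define K where "K s = (T - s) * (\<Phi> s - \<Phi> a)" for s
  have wp: "rcb t (\<lambda>r. 1 / (T - r)\<^sup>2 * \<phi> r)" by (intro rcb_mult weight_rcb \<phi>_rcb t t0)
  have FTC: "K s = K 0 + (LINT r:{0..s}|lborel. \<psi> r)" if s: "0 \<le> s" "s \<le> t" for s
  proof (rule right_deriv_FTC[OF _ \<psi>_rcb[OF t0 t(2)] _ s])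
    show "continuous_on {0..t} K"
      unfolding K_def \<Phi>_def by (intro continuous_intros rcb_integral_continuous wp t0)
    fix r assume r: "0 \<le> r" "r < t"
    have P: "(\<Phi> has_real_derivative 1 / (T - r)\<^sup>2 * \<phi> r) (at_right r)"
      unfolding \<Phi>_def[abs_def] by (rule rcb_integral_right_deriv[OF wp r])
    have "(K has_real_derivative (- 1 * (\<Phi> r - \<Phi> a) + (T - r) * (1 / (T - r)\<^sup>2 * \<phi> r))) (at_right r)"
      unfolding K_def[abs_def] by (auto intro!: derivative_eq_intros P)
    moreover have "(T - r) * (1 / (T - r)\<^sup>2 * \<phi> r) = \<phi> r / (T - r)" using r t by (simp add: power2_eq_square)
    then have "- 1 * (\<Phi> r - \<Phi> a) + (T - r) * (1 / (T - r)\<^sup>2 * \<phi> r) = \<psi> r" by (simp only: \<psi>_def) simp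
    ultimately show "(K has_real_derivative \<psi> r) (at_right r)" by (simp only:)
  qed
  have "(LINT r:{a..t}|lborel. \<psi> r) = K t - K a"
    using set_integral_Icc_diff[OF rcb_integrable[OF \<psi>_rcb[OF t0 t(2)] t0 order_refl order_refl] a_bounds(3) t(1)]
      FTC[of t] FTC[of a] t t0 a_bounds by simp
  also have "\<dots> = \<phi> t - (T - t) * \<psi> t"
  proof -
    have "(T - t) * (\<phi> t / (T - t)) = \<phi> t" using t by simp
    then show ?thesis by (simp add: K_def \<psi>_def right_diff_distrib)
  qed
  also have "\<dots> \<le> \<phi> t"
  proof -
    have "0 \<le> \<psi> t" using expectation_X_sq[OF t] by (metis integral_nonneg_AE AE_I2 zero_le_power2)
    then show ?thesis using t by simp
  qed
  finally show ?thesis .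
qed

text \<open>By Fubini \<open>R\<close> is the \<open>mu\<close>-integral of
  \<open>1 / (T - b) - 1 / (T - s)\<close> over \<open>(a,b]\<close>, so adding the integral
  \<open>P\<close> of \<open>1 / (T - s)\<close> leaves a constant integrand. This integration by
  parts for \<open>mu\<close> identifies \<open>\<phi> b\<close> with \<open>P\<close>, which is a
  portion of \<open>Lambda_Xi\<close>.\<close>

lemma \<phi>_le_Lambda:
  assumes b: "a \<le> b" "b < T"
  shows "\<phi> b \<le> enn2real Lambda_Xi"
proof -
  have b0: "0 \<le> b" using b a_bounds by simp
  interpret I: sigma_finite_measure mu
    by (rule sigma_finite_interval_measure[OF Xi_second_moment_mono Xi_second_moment_right_cont])
  interpret LI: pair_sigma_finite lborel mu ..
  define w where "w r = 1 / (T - r)\<^sup>2" for r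
  define P where "P = (\<integral>\<^sup>+ s. ennreal (1 / (T - s)) * indicator {a<..b} s \<partial>mu)"
  \<comment> \<open>The condition \<open>s \<le> r \<le> b\<close> couples the variables:
    integrating out \<open>r\<close> gives the difference of the weights, integrating out
    \<open>s\<close> gives the increments of \<open>mm\<close>.\<close>
  define g where "g r s = ennreal (w r) * indicator {a<..b} s * indicator {s..b} r" for r s :: real
  have [measurable]: "w \<in> borel_measurable borel" unfolding w_def by measurable
  have gm: "(\<lambda>(r, s). g r s) \<in> borel_measurable (lborel \<Otimes>\<^sub>M mu)"
  proof -
    have "(\<lambda>z. ennreal (w (fst z)) * indicator {a<..b} (snd z) * (if snd z \<le> fst z \<and> fst z \<le> b then 1 else 0)) \<in> borel_measurable (lborel \<Otimes>\<^sub>M mu)"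
      by measurable
    then show ?thesis unfolding g_def case_prod_beta' by (simp add: indicator_def)
  qed
  have inner: "(\<integral>\<^sup>+ r. g r s \<partial>lborel) = ennreal (1 / (T - b) - 1 / (T - s)) * indicator {a<..b} s" for s
  proof (cases "s \<in> {a<..b}")
    case True
    have "(\<integral>\<^sup>+ r. g r s \<partial>lborel) = (\<integral>\<^sup>+ r. ennreal (w r) * indicator {s..b} r \<partial>lborel)" using True by (simp add: g_def)
    also have "\<dots> = ennreal (1 / (T - b) - 1 / (T - s))"
    proof (rule nn_integral_FTC_Icc)
      show "((\<lambda>t. 1 / (T - t)) has_real_derivative w r) (at r)" if "r \<in> {s..b}" for r
        using that b by (auto intro!: derivative_eq_intros simp: power2_eq_square w_def)
    qed (use True in \<open>auto simp: w_def\<close>)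
    finally show ?thesis using True by simp
  qed (simp add: g_def)
  have iw: "set_integrable lborel {a..b} (\<lambda>r. w r * (mm r - mm a))"
    using rcb_integrable[OF rcb_mult[OF weight_rcb[OF b(2)] rcb_diff[OF mm_rcb rcb_const]] b0 order_refl a_bounds(3)]
    by (simp add: w_def)
  define R where "R = (LINT r:{a..b}|lborel. w r * (mm r - mm a))"
  have second: "(\<integral>\<^sup>+ s. (\<integral>\<^sup>+ r. g r s \<partial>lborel) \<partial>mu) = ennreal R"
  proof -
    have "(\<integral>\<^sup>+ s. (\<integral>\<^sup>+ r. g r s \<partial>lborel) \<partial>mu) = (\<integral>\<^sup>+ r. (\<integral>\<^sup>+ s. g r s \<partial>mu) \<partial>lborel)"
      by (rule LI.Fubini'[OF gm])
    also have "\<dots> = (\<integral>\<^sup>+ r. ennreal (indicat_real {a..b} r *\<^sub>R (w r * (mm r - mm a))) \<partial>lborel)"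
    proof (rule nn_integral_cong)
      fix r :: real
      show "(\<integral>\<^sup>+ s. g r s \<partial>mu) = ennreal (indicat_real {a..b} r *\<^sub>R (w r * (mm r - mm a)))"
      proof (cases "r \<in> {a..b}")
        case True
        have "(\<integral>\<^sup>+ s. g r s \<partial>mu) = (\<integral>\<^sup>+ s. ennreal (w r) * indicator {a<..r} s \<partial>mu)"
          using True by (intro nn_integral_cong) (auto simp: g_def indicator_def)
        also have "\<dots> = ennreal (w r) * ennreal (mm r - mm a)"
          using True by (subst nn_integral_cmult_indicator) (auto simp: emeasure_mu_Ioc)
        finally show ?thesis using True Xi_second_moment_mono[of a r] by (simp add: ennreal_mult[symmetric] w_def)
      next
        case False
        then have "g r s = 0" for s by (auto simp: g_def indicator_def)
        then show ?thesis using False by simp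
      qed
    qed
    also have "\<dots> = ennreal R"
      unfolding R_def set_lebesgue_integral_def
    proof (rule nn_integral_eq_integral)
      show "integrable lborel (\<lambda>r. indicat_real {a..b} r *\<^sub>R (w r * (mm r - mm a)))" using iw by (simp add: set_integrable_def)
      show "AE r in lborel. 0 \<le> indicat_real {a..b} r *\<^sub>R (w r * (mm r - mm a))"
        using Xi_second_moment_mono by (intro AE_I2) (auto simp: indicator_def w_def)
    qed
    finally show ?thesis .
  qed
  have "P + ennreal R = (\<integral>\<^sup>+ s. ennreal (1 / (T - s)) * indicator {a<..b} s + ennreal (1 / (T - b) - 1 / (T - s)) * indicator {a<..b} s \<partial>mu)"
    unfolding P_def second[symmetric] inner by (subst nn_integral_add) auto
  also have "\<dots> = (\<integral>\<^sup>+ s. ennreal (1 / (T - b)) * indicator {a<..b} s \<partial>mu)"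
  proof (rule nn_integral_cong)
    fix s :: real
    show "ennreal (1 / (T - s)) * indicator {a<..b} s + ennreal (1 / (T - b) - 1 / (T - s)) * indicator {a<..b} s = ennreal (1 / (T - b)) * indicator {a<..b} s"
    proof (cases "s \<in> {a<..b}")
      case True
      then have "1 / (T - s) \<le> 1 / (T - b)" "0 \<le> 1 / (T - s)" using b by (auto intro!: divide_left_mono)
      then show ?thesis using True by (simp add: ennreal_plus[symmetric] del: ennreal_plus)
    qed simp
  qed
  also have "\<dots> = ennreal (1 / (T - b)) * ennreal (mm b - mm a)"
    using b by (subst nn_integral_cmult_indicator) (auto simp: emeasure_mu_Ioc)
  also have "\<dots> = ennreal ((mm b - mm a) / (T - b))"
    using b Xi_second_moment_mono[of a b] by (simp add: ennreal_mult[symmetric])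
  finally have sum: "P + ennreal R = ennreal ((mm b - mm a) / (T - b))" .
  have R0: "0 \<le> R" unfolding R_def set_lebesgue_integral_def using Xi_second_moment_mono
    by (intro integral_nonneg_AE AE_I2) (auto simp: indicator_def w_def)
  have P_le: "P \<le> Lambda_Xi"
    unfolding P_def Lambda_Xi_def
  proof (rule nn_integral_mono)
    fix s :: real
    show "ennreal (1 / (T - s)) * indicator {a<..b} s \<le> inverse (ennreal (T - s)) * indicator {0..T} s"
      using b a_bounds by (auto simp: indicator_def inverse_ennreal inverse_eq_divide)
  qed
  have \<phi>_eq: "\<phi> b = (mm b - mm a) / (T - b) - R"
  proof -
    have i1: "set_integrable lborel {a<..b} (\<lambda>r. w r * mm r)" "set_integrable lborel {a<..b} (\<lambda>r. w r * mm a)"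
    proof -
      have r: "rcb b (\<lambda>r. w r * mm r)" "rcb b (\<lambda>r. w r * mm a)"
        unfolding w_def by (intro rcb_mult weight_rcb b mm_rcb rcb_const)+
      show "set_integrable lborel {a<..b} (\<lambda>r. w r * mm r)"
        by (rule set_integrable_subset[OF rcb_integrable[OF r(1) b0 order_refl a_bounds(3)]]) auto
      show "set_integrable lborel {a<..b} (\<lambda>r. w r * mm a)"
        by (rule set_integrable_subset[OF rcb_integrable[OF r(2) b0 order_refl a_bounds(3)]]) auto
    qed
    have "R = (LINT r:{a<..b}|lborel. w r * (mm r - mm a))"
    proof -
      have "rcb b (\<lambda>r. w r * (mm r - mm a))" unfolding w_def by (intro rcb_mult weight_rcb b rcb_diff mm_rcb rcb_const)
      from rcb_integrable[OF this b0 order_refl order_refl] show ?thesis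
        unfolding R_def using set_integral_Icc_diff[OF _ a_bounds(3) b(1)] set_integral_Icc_split[OF _ a_bounds(3) b(1)] by simp
    qed
    also have "\<dots> = (LINT r:{a<..b}|lborel. w r * mm r) - (LINT r:{a<..b}|lborel. w r * mm a)"
      using set_integral_diff(2)[OF i1] by (simp add: right_diff_distrib)
    also have "(LINT r:{a<..b}|lborel. w r * mm a) = (1 / (T - b) - 1 / d) * mm a"
      unfolding set_integral_mult_left w_def weight_integral[OF a_bounds(3) b] T_minus_a ..
    also have "(LINT r:{a<..b}|lborel. w r * mm r) = hh b - hh a"
      using set_integral_Icc_split[OF rcb_integrable[OF weight_mm_rcb[OF b(2)] b0 order_refl order_refl] a_bounds(3) b(1)]
      by (simp add: hh_def w_def)
    finally show ?thesis by (simp add: \<phi>_def diff_divide_distrib left_diff_distrib)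
  qed
  have "P = ennreal (enn2real P)" using P_le Lambda_finite by (simp add: le_less_trans less_top)
  then have "ennreal (enn2real P + R) = ennreal ((mm b - mm a) / (T - b))" using sum R0 by simp
  then have "enn2real P + R = (mm b - mm a) / (T - b)"
    using R0 b Xi_second_moment_mono[of a b] by (subst (asm) ennreal_inj) auto
  moreover have "enn2real P \<le> enn2real Lambda_Xi" using P_le Lambda_finite by (intro enn2real_mono) auto
  ultimately show ?thesis using \<phi>_eq by simp
qed

lemma nn_integral_X_sq_le:
  assumes b: "a \<le> b" "b < T"
  shows "(\<integral>\<^sup>+ t. ennreal (\<psi> t) * indicator {a..b} t \<partial>lborel) \<le> ennreal (enn2real Lambda_Xi)"
proof -
  have b0: "0 \<le> b" using b a_bounds by simp
  have pos: "0 \<le> \<psi> t" if "a \<le> t" "t < T" for t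
    using expectation_X_sq[OF that] by (metis integral_nonneg_AE AE_I2 zero_le_power2)
  have "(\<integral>\<^sup>+ t. ennreal (\<psi> t) * indicator {a..b} t \<partial>lborel) = (\<integral>\<^sup>+ t. ennreal (indicat_real {a..b} t *\<^sub>R \<psi> t) \<partial>lborel)"
    by (intro nn_integral_cong) (auto simp: indicator_def)
  also have "\<dots> = ennreal (LINT t:{a..b}|lborel. \<psi> t)"
    unfolding set_lebesgue_integral_def
  proof (rule nn_integral_eq_integral)
    show "integrable lborel (\<lambda>t. indicat_real {a..b} t *\<^sub>R \<psi> t)"
      using rcb_integrable[OF \<psi>_rcb[OF b0 b(2)] b0 order_refl a_bounds(3)] by (simp add: set_integrable_def)
  qed (use pos b in \<open>auto intro!: AE_I2 simp: indicator_def\<close>)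
  also have "\<dots> \<le> ennreal (enn2real Lambda_Xi)"
    using integral_\<psi>_le[OF b] \<phi>_le_Lambda[OF b] by (intro ennreal_leI) simp
  finally show ?thesis .
qed

end

section \<open>Conclusion\<close>

text \<open>The positive and the negative part of the difference are densities of two measures that
  agree on all half-lines, hence of the same measure, and densities are unique almost
  everywhere.\<close>

lemma AE_eq_if_integrals_eq:
  fixes f g :: "real \<Rightarrow> real"
  assumes f: "set_integrable lborel {0..T} f" and g: "set_integrable lborel {0..T} g" and T: "0 \<le> T"
    and eq: "\<And>t. 0 \<le> t \<Longrightarrow> t \<le> T \<Longrightarrow> (LINT s:{0..t}|lborel. f s) = (LINT s:{0..t}|lborel. g s)"
  shows "AE t in lborel. t \<in> {0..T} \<longrightarrow> f t = g t"
proof -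
  define h where "h t = indicat_real {0..T} t *\<^sub>R f t - indicat_real {0..T} t *\<^sub>R g t" for t
  have h: "integrable lborel h"
    using f g unfolding h_def set_integrable_def by (rule Bochner_Integration.integrable_diff)
  have [measurable]: "h \<in> borel_measurable borel" using h by auto
  have hx: "(LINT t|lborel. indicat_real {x<..} t *\<^sub>R h t) = 0" for x
  proof -
    have fg: "set_integrable lborel {0..T} (\<lambda>t. f t - g t)" using f g by (rule set_integral_diff)
    have z: "(LINT s:{0..t}|lborel. f s - g s) = 0" if "0 \<le> t" "t \<le> T" for t
    proof -
      have "set_integrable lborel {0..t} f" "set_integrable lborel {0..t} g"
        by (rule set_integrable_subset[OF f] set_integrable_subset[OF g]; use that in auto)+
      then show ?thesis using eq[OF that] by simp
    qed
    have "(LINT t|lborel. indicat_real {x<..} t *\<^sub>R h t) = (LINT s:{max x 0<..T}|lborel. f s - g s)" if "0 \<le> x"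
      unfolding set_lebesgue_integral_def using that
      by (intro Bochner_Integration.integral_cong) (auto simp: h_def indicator_def)
    moreover have "(LINT s:{max x 0<..T}|lborel. f s - g s) = 0" if "0 \<le> x"
    proof (cases "x \<le> T")
      case True
      then show ?thesis using set_integral_Icc_split[OF fg that True] z[OF that True] z[OF T order_refl] that by (simp add: max_absorb1)
    qed (use that in \<open>simp add: set_lebesgue_integral_def\<close>)
    moreover have "(LINT t|lborel. indicat_real {x<..} t *\<^sub>R h t) = (LINT s:{0..T}|lborel. f s - g s)" if "x < 0"
      unfolding set_lebesgue_integral_def using that
      by (intro Bochner_Integration.integral_cong) (auto simp: h_def indicator_def)
    ultimately show ?thesis using z[OF T order_refl] by (cases "0 \<le> x") auto
  qed
  define p where "p t = max 0 (h t)" for t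
  define n where "n t = max 0 (- h t)" for t
  have pn: "integrable lborel p" "integrable lborel n" unfolding p_def n_def using h by auto
  have [measurable]: "p \<in> borel_measurable borel" "n \<in> borel_measurable borel" unfolding p_def n_def by measurable
  have em: "emeasure (density lborel (\<lambda>t. ennreal (q t))) {x<..} = ennreal (LINT t|lborel. indicat_real {x<..} t *\<^sub>R q t)"
    if q: "integrable lborel q" "\<And>t. 0 \<le> q t" for q and x :: real
  proof -
    have [measurable]: "q \<in> borel_measurable borel" using q by auto
    have "emeasure (density lborel (\<lambda>t. ennreal (q t))) {x<..} = (\<integral>\<^sup>+ t. ennreal (indicat_real {x<..} t *\<^sub>R q t) \<partial>lborel)"
      by (subst emeasure_density) (auto intro!: nn_integral_cong simp: indicator_def)
    also have "\<dots> = ennreal (LINT t|lborel. indicat_real {x<..} t *\<^sub>R q t)"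
      using q by (intro nn_integral_eq_integral integrable_mult_indicator) auto
    finally show ?thesis .
  qed
  have "density lborel (\<lambda>t. ennreal (p t)) = density lborel (\<lambda>t. ennreal (n t))"
  proof (rule measure_eqI_lessThan)
    fix x :: real
    have p0: "0 \<le> p t" "0 \<le> n t" for t by (auto simp: p_def n_def)
    show "emeasure (density lborel (\<lambda>t. ennreal (p t))) {x<..} < \<infinity>" by (simp add: em[OF pn(1) p0(1)])
    have i: "integrable lborel (\<lambda>t. indicat_real {x<..} t *\<^sub>R p t)" "integrable lborel (\<lambda>t. indicat_real {x<..} t *\<^sub>R n t)"
      by (intro integrable_mult_indicator pn; simp)+
    have "0 = (LINT t|lborel. indicat_real {x<..} t *\<^sub>R p t - indicat_real {x<..} t *\<^sub>R n t)"
      unfolding hx[of x, symmetric] by (intro Bochner_Integration.integral_cong) (auto simp: p_def n_def indicator_def)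
    then have "(LINT t|lborel. indicat_real {x<..} t *\<^sub>R p t) = (LINT t|lborel. indicat_real {x<..} t *\<^sub>R n t)"
      using i by simp
    then show "emeasure (density lborel (\<lambda>t. ennreal (p t))) {x<..} = emeasure (density lborel (\<lambda>t. ennreal (n t))) {x<..}"
      using em[OF pn(1) p0(1)] em[OF pn(2) p0(2)] by simp
  qed auto
  then have "AE t in lborel. ennreal (p t) = ennreal (n t)"
    by (subst (asm) sigma_finite_measure.density_unique_iff[OF sigma_finite_lborel]) auto
  then show ?thesis
  proof eventually_elim
    case (elim t)
    then have "p t = n t" by (subst (asm) ennreal_inj) (auto simp: p_def n_def)
    then have "h t = 0" by (auto simp: p_def n_def max_def split: if_splits)
    then show ?case by (auto simp: h_def)
  qed
qed

context smoothing
begin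

text \<open>Measurability of \<open>\<psi>\<close> is at hand on compact pieces \<open>[a,b]\<close>
  with \<open>b < T\<close>. The supremum of its truncations to such pieces is measurable on the
  whole line, and monotone convergence bounds its total integral.\<close>

lemma \<psi>_envelope:
  obtains G where "G \<in> borel_measurable lborel" "(\<integral>\<^sup>+ t. G t \<partial>lborel) \<le> ennreal (enn2real Lambda_Xi)"
    "\<And>t. a \<le> t \<Longrightarrow> t < T \<Longrightarrow> ennreal (\<psi> t) \<le> G t"
proof -
  define b where "b n = T - d / real (Suc n)" for n
  have b: "a \<le> b n" "b n < T" for n
  proof -
    have "d / real (Suc n) \<le> d / 1" using d_pos by (intro divide_left_mono) auto
    then show "a \<le> b n" "b n < T" using d_pos by (auto simp: b_def a_def)
  qed
  have b0: "0 \<le> b n" for n using b(1)[of n] a_bounds by linarith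
  define f where "f n t = ennreal (\<psi> t) * indicator {a..b n} t" for n t
  have fm: "f n \<in> borel_measurable lborel" for n
  proof -
    have "(\<lambda>t. indicat_real {a..b n} t *\<^sub>R \<psi> t) \<in> borel_measurable lborel"
      using rcb_set_measurable[OF \<psi>_rcb[OF b0 b(2)] b0 order_refl a_bounds(3)] by (simp add: set_borel_measurable_def)
    then have "(\<lambda>t. ennreal (indicat_real {a..b n} t *\<^sub>R \<psi> t)) \<in> borel_measurable lborel" by simp
    also have "(\<lambda>t. ennreal (indicat_real {a..b n} t *\<^sub>R \<psi> t)) = f n" by (auto simp: f_def fun_eq_iff indicator_def)
    finally show ?thesis .
  qed
  have inc: "incseq f"
  proof (rule incseq_SucI)
    fix n
    have "d / real (Suc (Suc n)) \<le> d / real (Suc n)" using d_pos by (intro divide_left_mono) auto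
    then show "f n \<le> f (Suc n)" by (auto simp: f_def le_fun_def b_def indicator_def)
  qed
  show ?thesis
  proof (rule that[of "\<lambda>t. SUP n. f n t"])
    show "(\<lambda>t. SUP n. f n t) \<in> borel_measurable lborel" using fm by (intro borel_measurable_SUP) auto
    show "(\<integral>\<^sup>+ t. (SUP n. f n t) \<partial>lborel) \<le> ennreal (enn2real Lambda_Xi)"
    proof -
      have "(\<integral>\<^sup>+ t. (SUP n. f n t) \<partial>lborel) = (SUP n. \<integral>\<^sup>+ t. f n t \<partial>lborel)"
        by (rule nn_integral_monotone_convergence_SUP[OF inc fm])
      also have "\<dots> \<le> ennreal (enn2real Lambda_Xi)"
        unfolding f_def by (intro SUP_least nn_integral_X_sq_le b)
      finally show ?thesis .
    qed
    fix t assume t: "a \<le> t" "t < T"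
    have "(\<lambda>n. T - d * (1 / real (Suc n))) \<longlonglongrightarrow> T - d * 0"
      using LIMSEQ_inverse_real_of_nat by (intro tendsto_intros) (simp add: inverse_eq_divide)
    then have "b \<longlonglongrightarrow> T" by (simp add: b_def[abs_def])
    then have "eventually (\<lambda>n. t < b n) sequentially" using t by (intro order_tendstoD)
    then obtain n where "t < b n" by (auto simp: eventually_sequentially)
    then have "ennreal (\<psi> t) = f n t" using t by (simp add: f_def)
    then show "ennreal (\<psi> t) \<le> (SUP n. f n t)" by (metis SUP_upper UNIV_I)
  qed
qed

section \<open>Energy of the rate\<close>

abbreviation (input) PP :: real where "PP \<equiv> 2 * enn2real K_0 + 2 * x2"

abbreviation (input) \<Lambda> :: real where "\<Lambda> \<equiv> enn2real Lambda_Xi"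

lemma PP_nonneg: "0 \<le> PP" by simp

lemma \<psi>_nonneg: "a \<le> t \<Longrightarrow> t < T \<Longrightarrow> 0 \<le> \<psi> t"
  using expectation_X_sq by (metis integral_nonneg_AE AE_I2 zero_le_power2)

text \<open>The gap at \<open>a\<close> is divided by \<open>d\<close>, so its second moment by
  \<open>\<epsilon>\<close>; the factors \<open>2\<close> come from separating it from
  \<open>X\<close> inside the square.\<close>

lemma u_sq_late:
  assumes t: "a \<le> t" "t < T"
  shows "L2 (u t)" "expectation (\<lambda>\<omega>. (u t \<omega>)\<^sup>2) \<le> 2 * PP / \<epsilon> + 2 * \<psi> t"
proof -
  have m: "u t \<in> borel_measurable M" using measurable_F_M[OF u_measurable] t a_bounds by auto
  have a: "0 \<le> a" "a \<le> T" using a_bounds by auto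
  have L: "L2 (\<lambda>\<omega>. 1 / d * (\<Xi> a \<omega> - Qbar \<epsilon> a \<omega>))" "L2 (X t)"
    by (rule L2_scale[OF L2_diff[OF Xi_L2[OF a] supL2D(4)[OF Qbar_supL2 a]]]) (rule X_L2[OF t])
  have i: "integrable M (\<lambda>\<omega>. (1 / d * (\<Xi> a \<omega> - Qbar \<epsilon> a \<omega>) + X t \<omega>)\<^sup>2)" using L2_add(1)[OF L] by (simp add: L2_def)
  have ae: "AE \<omega> in M. (u t \<omega>)\<^sup>2 \<le> (1 / d * (\<Xi> a \<omega> - Qbar \<epsilon> a \<omega>) + X t \<omega>)\<^sup>2"
    using u_eq_X[OF _ t] by (intro AE_I2) simp
  show "L2 (u t)" by (rule L2_bound(1)[OF m i ae])
  have "expectation (\<lambda>\<omega>. (u t \<omega>)\<^sup>2) \<le> expectation (\<lambda>\<omega>. (1 / d * (\<Xi> a \<omega> - Qbar \<epsilon> a \<omega>) + X t \<omega>)\<^sup>2)"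
    by (rule L2_bound(2)[OF m i ae])
  also have "\<dots> \<le> 2 * expectation (\<lambda>\<omega>. (1 / d * (\<Xi> a \<omega> - Qbar \<epsilon> a \<omega>))\<^sup>2) + 2 * expectation (\<lambda>\<omega>. (X t \<omega>)\<^sup>2)"
    by (rule L2_add(2)[OF L])
  also have "expectation (\<lambda>\<omega>. (1 / d * (\<Xi> a \<omega> - Qbar \<epsilon> a \<omega>))\<^sup>2) = expectation (\<lambda>\<omega>. (\<Xi> a \<omega> - Qbar \<epsilon> a \<omega>)\<^sup>2) / \<epsilon>"
    unfolding power_mult_distrib by (simp add: power_divide d_sq)
  also have "\<dots> \<le> PP / \<epsilon>" using Xi_Qbar_error eps_pos by (intro divide_right_mono) auto
  finally show "expectation (\<lambda>\<omega>. (u t \<omega>)\<^sup>2) \<le> 2 * PP / \<epsilon> + 2 * \<psi> t" by (simp add: expectation_X_sq[OF t])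
qed

lemma Qbar_error_measurable:
  "(\<lambda>z. ennreal ((Qopt (fst z) (snd z) - Qbar \<epsilon> (fst z) (snd z))\<^sup>2)) \<in> borel_measurable (leb T \<Otimes>\<^sub>M M)"
  using supL2_measurable_pair[OF supL2_diff[OF Qopt_supL2 Qbar_supL2]] by (simp add: case_prod_beta')

text \<open>Used twice: for the rate, with \<open>c1 = 1 / \<epsilon>\<close>, and for the distance
  to the optimizer, with \<open>c1 = 1\<close> and with
  \<open>(T - t)\<^sup>2 \<le> \<epsilon>\<close> already absorbed into \<open>c2\<close> and
  \<open>c3\<close>. The constant \<open>c2\<close> is paid over a time of length \<open>d\<close>,
  while \<open>\<psi>\<close> contributes at most \<open>\<Lambda>\<close> in total.\<close>

lemma piecewise_nn_bound:
  fixes v :: "real \<Rightarrow> 'a \<Rightarrow> real"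
  assumes v: "(\<lambda>(t, \<omega>). v t \<omega>) \<in> borel_measurable (leb T \<Otimes>\<^sub>M M)"
    and c: "0 \<le> c1" "0 \<le> c2" "0 \<le> c3"
    and early: "\<And>t \<omega>. 0 \<le> t \<Longrightarrow> t < a \<Longrightarrow> \<omega> \<in> space M \<Longrightarrow> (v t \<omega>)\<^sup>2 \<le> c1 * (Qopt t \<omega> - Qbar \<epsilon> t \<omega>)\<^sup>2"
    and late: "\<And>t. a \<le> t \<Longrightarrow> t < T \<Longrightarrow> (\<integral>\<^sup>+ \<omega>. ennreal ((v t \<omega>)\<^sup>2) \<partial>M) \<le> ennreal (c2 + c3 * \<psi> t)"
  shows "(\<integral>\<^sup>+ z. ennreal ((v (fst z) (snd z))\<^sup>2) \<partial>(leb T \<Otimes>\<^sub>M M)) \<le> ennreal (c1 * ((2 * C_0 + 2 * tau) * d) + c2 * d + c3 * \<Lambda>)"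
proof -
  obtain G where G: "G \<in> borel_measurable lborel" "(\<integral>\<^sup>+ t. G t \<partial>lborel) \<le> ennreal \<Lambda>"
    "\<And>t. a \<le> t \<Longrightarrow> t < T \<Longrightarrow> ennreal (\<psi> t) \<le> G t" using \<psi>_envelope by blast
  define q where "q t = (\<integral>\<^sup>+ \<omega>. ennreal ((Qopt t \<omega> - Qbar \<epsilon> t \<omega>)\<^sup>2) \<partial>M)" for t
  have qm: "q \<in> borel_measurable (leb T)"
    unfolding q_def using borel_measurable_nn_integral_fst[OF Qbar_error_measurable] by simp
  have Gm: "G \<in> borel_measurable (leb T)" by (rule measurable_restrict_space1[OF G(1)])
  have im: "(\<lambda>t. ennreal c2 * indicator {a..T} t) \<in> borel_measurable (leb T)" by (rule measurable_restrict_space1) simp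
  have "(\<integral>\<^sup>+ z. ennreal ((v (fst z) (snd z))\<^sup>2) \<partial>(leb T \<Otimes>\<^sub>M M)) = (\<integral>\<^sup>+ t. (\<integral>\<^sup>+ \<omega>. ennreal ((v t \<omega>)\<^sup>2) \<partial>M) \<partial>leb T)"
    using v by (subst nn_integral_fst[symmetric]) (auto simp: case_prod_beta')
  also have "\<dots> \<le> (\<integral>\<^sup>+ t. ennreal c1 * q t + (ennreal c2 * indicator {a..T} t + ennreal c3 * G t) \<partial>leb T)"
  proof (rule nn_integral_mono_AE)
    have "AE t in leb T. t \<noteq> T" using AE_lborel_singleton[of T] by (subst AE_restrict_space_iff) auto
    then show "AE t in leb T. (\<integral>\<^sup>+ \<omega>. ennreal ((v t \<omega>)\<^sup>2) \<partial>M) \<le> ennreal c1 * q t + (ennreal c2 * indicator {a..T} t + ennreal c3 * G t)"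
      using AE_space
    proof eventually_elim
      case (elim t)
      then have t: "0 \<le> t" "t < T" by (auto simp: space_restrict_space)
      show ?case
      proof (cases "t < a")
        case True
        have "(\<integral>\<^sup>+ \<omega>. ennreal ((v t \<omega>)\<^sup>2) \<partial>M) \<le> (\<integral>\<^sup>+ \<omega>. ennreal c1 * ennreal ((Qopt t \<omega> - Qbar \<epsilon> t \<omega>)\<^sup>2) \<partial>M)"
          using early[OF t(1) True] c by (intro nn_integral_mono) (simp add: ennreal_mult[symmetric] ennreal_leI)
        also have "\<dots> = ennreal c1 * q t"
          unfolding q_def using L2_diff[OF supL2D(4)[OF Qopt_supL2] supL2D(4)[OF Qbar_supL2], of t t] t
          by (intro nn_integral_cmult) (auto simp: L2_def)
        finally show ?thesis by (rule order_trans) simp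
      next
        case False
        then have ta: "a \<le> t" by simp
        have "(\<integral>\<^sup>+ \<omega>. ennreal ((v t \<omega>)\<^sup>2) \<partial>M) \<le> ennreal (c2 + c3 * \<psi> t)" by (rule late[OF ta t(2)])
        also have "\<dots> = ennreal c2 + ennreal c3 * ennreal (\<psi> t)" using c \<psi>_nonneg[OF ta t(2)] by (simp add: ennreal_mult)
        also have "\<dots> \<le> ennreal c2 * indicator {a..T} t + ennreal c3 * G t"
          using G(3)[OF ta t(2)] ta t by (intro add_mono mult_left_mono) auto
        also have "\<dots> \<le> ennreal c1 * q t + (ennreal c2 * indicator {a..T} t + ennreal c3 * G t)" by simp
        finally show ?thesis .
      qed
    qed
  qed
  also have "\<dots> = ennreal c1 * (\<integral>\<^sup>+ t. q t \<partial>leb T) + ((\<integral>\<^sup>+ t. ennreal c2 * indicator {a..T} t \<partial>leb T) + ennreal c3 * (\<integral>\<^sup>+ t. G t \<partial>leb T))"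
    using qm Gm im by (simp add: nn_integral_add nn_integral_cmult)
  also have "\<dots> \<le> ennreal c1 * ennreal ((2 * C_0 + 2 * tau) * d) + (ennreal c2 * ennreal d + ennreal c3 * ennreal \<Lambda>)"
  proof (intro add_mono mult_left_mono)
    show "(\<integral>\<^sup>+ t. q t \<partial>leb T) \<le> ennreal ((2 * C_0 + 2 * tau) * d)"
      unfolding q_def using Qbar_error nn_integral_fst[OF Qbar_error_measurable] by simp
    have "(\<integral>\<^sup>+ t. ennreal c2 * indicator {a..T} t \<partial>leb T) = (\<integral>\<^sup>+ t. ennreal c2 * indicator {a..T} t \<partial>lborel)"
      using a_bounds by (subst nn_integral_restrict_space) (auto intro!: nn_integral_cong simp: indicator_def)
    also have "\<dots> = ennreal c2 * ennreal d"
      using a_bounds by (subst nn_integral_cmult_indicator) (auto simp: T_minus_a)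
    finally show "(\<integral>\<^sup>+ t. ennreal c2 * indicator {a..T} t \<partial>leb T) \<le> ennreal c2 * ennreal d" by simp
    have "(\<integral>\<^sup>+ t. G t \<partial>leb T) \<le> (\<integral>\<^sup>+ t. G t \<partial>lborel)"
      by (subst nn_integral_restrict_space) (auto intro!: nn_integral_mono simp: indicator_def)
    then show "(\<integral>\<^sup>+ t. G t \<partial>leb T) \<le> ennreal \<Lambda>" using G(2) by simp
  qed auto
  also have "\<dots> = ennreal (c1 * ((2 * C_0 + 2 * tau) * d) + c2 * d + c3 * \<Lambda>)"
    using c C_0_nonneg d_pos by (simp add: ennreal_mult[symmetric] ennreal_plus[symmetric] add.assoc del: ennreal_plus)
  finally show ?thesis .
qed

definition rate_bound :: real where "rate_bound = 1 / \<epsilon> * ((2 * C_0 + 2 * tau) * d) + 2 * PP / \<epsilon> * d + 2 * \<Lambda>"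

lemma u_energy: "(\<integral>\<^sup>+ z. ennreal ((u (fst z) (snd z))\<^sup>2) \<partial>(leb T \<Otimes>\<^sub>M M)) \<le> ennreal rate_bound"
  unfolding rate_bound_def
proof (rule piecewise_nn_bound[OF u_pair_measurable])
  show "(u t \<omega>)\<^sup>2 \<le> 1 / \<epsilon> * (Qopt t \<omega> - Qbar \<epsilon> t \<omega>)\<^sup>2" if "t < a" for t \<omega>
    using that by (simp add: u_def power_divide d_sq)
  show "(\<integral>\<^sup>+ \<omega>. ennreal ((u t \<omega>)\<^sup>2) \<partial>M) \<le> ennreal (2 * PP / \<epsilon> + 2 * \<psi> t)" if "a \<le> t" "t < T" for t
    unfolding nn_integral_square_eq[OF u_sq_late(1)[OF that]] by (rule ennreal_leI[OF u_sq_late(2)[OF that]])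
qed (use eps_pos PP_nonneg in auto)

lemma u_L2P: "L2P u"
proof -
  have "integrable (leb T \<Otimes>\<^sub>M M) (\<lambda>z. (u (fst z) (snd z))\<^sup>2)"
    using u_pair_measurable u_energy
    by (intro integrableI_nonneg) (auto simp: case_prod_beta' intro: le_less_trans)
  then show ?thesis using u_pair_measurable by (simp add: L2P_def case_prod_beta')
qed

lemma u_square_integral:
  shows "integrable M (\<lambda>\<omega>. LINT t:{0..T}|lborel. (u t \<omega>)\<^sup>2)"
    and "AE \<omega> in M. set_integrable lborel {0..T} (\<lambda>t. (u t \<omega>)\<^sup>2)"
    and "expectation (\<lambda>\<omega>. LINT t:{0..T}|lborel. (u t \<omega>)\<^sup>2) \<le> rate_bound"
proof -
  interpret P: pair_sigma_finite "leb T" M by (rule pair_leb)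
  have i: "integrable (leb T \<Otimes>\<^sub>M M) (\<lambda>(t, \<omega>). (u t \<omega>)\<^sup>2)" using u_L2P by (simp add: L2P_def)
  show "integrable M (\<lambda>\<omega>. LINT t:{0..T}|lborel. (u t \<omega>)\<^sup>2)" "AE \<omega> in M. set_integrable lborel {0..T} (\<lambda>t. (u t \<omega>)\<^sup>2)"
    using Fubini_leb(1,2)[OF i] by auto
  have "expectation (\<lambda>\<omega>. LINT t:{0..T}|lborel. (u t \<omega>)\<^sup>2) = integral\<^sup>L (leb T \<Otimes>\<^sub>M M) (\<lambda>(t, \<omega>). (u t \<omega>)\<^sup>2)"
    using P.integral_snd[OF i] by (simp add: integral_leb)
  moreover have "ennreal (integral\<^sup>L (leb T \<Otimes>\<^sub>M M) (\<lambda>(t, \<omega>). (u t \<omega>)\<^sup>2)) \<le> ennreal rate_bound"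
    using u_energy nn_integral_eq_integral[OF i] by (simp add: case_prod_beta')
  moreover have "0 \<le> rate_bound" unfolding rate_bound_def using C_0_nonneg d_pos eps_pos PP_nonneg by (intro add_nonneg_nonneg mult_nonneg_nonneg) auto
  ultimately show "expectation (\<lambda>\<omega>. LINT t:{0..T}|lborel. (u t \<omega>)\<^sup>2) \<le> rate_bound" by (simp add: ennreal_le_iff)
qed

lemma u_path_measurable: "\<omega> \<in> space M \<Longrightarrow> (\<lambda>t. u t \<omega>) \<in> borel_measurable (leb T)"
  using measurable_compose[OF measurable_Pair2' u_pair_measurable] by simp

text \<open>Before \<open>T\<close> the identity holds on every path. At \<open>T\<close> two left
  limits are compared: the integral converges because \<open>u\<close> is integrable, and the
  strategy converges to \<open>\<Xi> T\<close> because \<open>\<Xi>\<close> is left-continuous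
  there; both facts hold almost surely.\<close>

lemma Qeps_eq_integral_AE:
  "AE \<omega> in M. set_integrable lborel {0..T} (\<lambda>t. u t \<omega>) \<and> (\<forall>t\<in>{0..T}. Qeps \<epsilon> t \<omega> = (LINT s:{0..t}|lborel. u s \<omega>))"
  using u_square_integral(2) Xi_left_limit[OF Lambda_finite] AE_space
proof eventually_elim
  case (elim \<omega>)
  have i: "set_integrable lborel {0..T} (\<lambda>t. u t \<omega>)"
    by (rule set_integrable_of_square[OF u_path_measurable[OF elim(3)] elim(1)])
  have "set_integrable lborel {0..<T} (\<lambda>t. u t \<omega>)" by (rule set_integrable_subset[OF i]) auto
  then have "((\<lambda>t. LINT s:{0..t}|lborel. u s \<omega>) \<longlongrightarrow> (LINT s:{0..<T}|lborel. u s \<omega>)) (at_left T)"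
    using T_pos by (intro tendsto_set_lebesgue_integral_at_left) auto
  moreover have "eventually (\<lambda>t. (LINT s:{0..t}|lborel. u s \<omega>) = Qeps \<epsilon> t \<omega>) (at_left T)"
    unfolding eventually_at_left_field using T_pos Qeps_eq_integral[OF elim(3)] by (intro exI[of _ 0]) auto
  ultimately have "((\<lambda>t. Qeps \<epsilon> t \<omega>) \<longlongrightarrow> (LINT s:{0..<T}|lborel. u s \<omega>)) (at_left T)" by (rule Lim_transform_eventually)
  with Hardy_left_limit[OF elim(3,2)] have "\<Xi> T \<omega> = (LINT s:{0..<T}|lborel. u s \<omega>)"
    by (intro tendsto_unique[of "at_left T"]) auto
  also have "\<dots> = (LINT s:{0..T}|lborel. u s \<omega>)"
    unfolding set_lebesgue_integral_def using a_bounds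
    by (intro Bochner_Integration.integral_cong) (auto simp: indicator_def u_def)
  finally have "Qeps \<epsilon> T \<omega> = (LINT s:{0..T}|lborel. u s \<omega>)" using d_pos by (simp add: Qeps_def d_def[symmetric])
  then have "Qeps \<epsilon> t \<omega> = (LINT s:{0..t}|lborel. u s \<omega>)" if "t \<in> {0..T}" for t
    using Qeps_eq_integral[OF elim(3), of t] that by (cases "t < T") auto
  then show ?case using i by auto
qed

lemma is_rate_u: "is_rate (Qeps \<epsilon>) u"
  unfolding is_rate_def
proof (intro conjI u_progressive)
  interpret P: pair_sigma_finite "leb T" M by (rule pair_leb)
  have m: "(\<lambda>(t, \<omega>). ennreal ((u t \<omega>)\<^sup>2)) \<in> borel_measurable (leb T \<Otimes>\<^sub>M M)"
    using u_pair_measurable by (simp add: case_prod_beta')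
  have "(\<integral>\<^sup>+ \<omega>. (\<integral>\<^sup>+ t\<in>{0..T}. ennreal ((u t \<omega>)\<^sup>2) \<partial>lborel) \<partial>M) = (\<integral>\<^sup>+ t. (\<integral>\<^sup>+ \<omega>. ennreal ((u t \<omega>)\<^sup>2) \<partial>M) \<partial>leb T)"
    by (subst P.Fubini'[OF m, symmetric]) (simp add: nn_integral_restrict_space)
  also have "\<dots> = (\<integral>\<^sup>+ z. ennreal ((u (fst z) (snd z))\<^sup>2) \<partial>(leb T \<Otimes>\<^sub>M M))"
    using m by (subst nn_integral_fst[symmetric]) (auto simp: case_prod_beta')
  also have "\<dots> < \<infinity>" using u_energy by (rule le_less_trans) simp
  finally show "(\<integral>\<^sup>+ \<omega>. (\<integral>\<^sup>+ t\<in>{0..T}. ennreal ((u t \<omega>)\<^sup>2) \<partial>lborel) \<partial>M) < \<infinity>" .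
  show "AE \<omega> in M. \<forall>t\<in>{0..T}. Qeps \<epsilon> t \<omega> = (LINT s:{0..t}|lborel. u s \<omega>)"
    using Qeps_eq_integral_AE by eventually_elim auto
qed

text \<open>The rate in the cost is an arbitrarily chosen density, so it has to be compared with \<open>u\<close>.\<close>

lemma rate_energy: "expectation (\<lambda>\<omega>. LINT t:{0..T}|lborel. (rate (Qeps \<epsilon>) t \<omega>)\<^sup>2) \<le> rate_bound"
proof -
  define v where "v = rate (Qeps \<epsilon>)"
  have v: "is_rate (Qeps \<epsilon>) v" unfolding v_def rate_def by (rule someI[of "is_rate (Qeps \<epsilon>)", OF is_rate_u])
  \<comment> \<open>Progressive measurability at time \<open>T\<close> gives joint measurability
    over \<open>F T\<close>, which the identity map then transports to \<open>M\<close>.\<close>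
  have vT: "(\<lambda>(s, \<omega>). v s \<omega>) \<in> borel_measurable (restrict_space borel {0..T} \<Otimes>\<^sub>M F T)"
    using v T_ge0 by (simp add: is_rate_def progressive_def)
  have vp: "(\<lambda>(s, \<omega>). v s \<omega>) \<in> borel_measurable (leb T \<Otimes>\<^sub>M F T)" by (rule measurable_leb_pair[OF vT])
  have vm: "(\<lambda>t. v t \<omega>) \<in> borel_measurable (leb T)" if "\<omega> \<in> space M" for \<omega>
    using measurable_compose[OF measurable_Pair2' vp] that space_F[of T] T_ge0 by simp
  have idm: "(\<lambda>\<omega>. \<omega>) \<in> measurable M (F T)"
    using subalgebra_F[of T] T_ge0 by (intro measurableI) (auto simp: subalgebra_def)
  have "(\<lambda>z. (snd z, fst z)) \<in> measurable (M \<Otimes>\<^sub>M leb T) (leb T \<Otimes>\<^sub>M F T)"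
    by (intro measurable_Pair measurable_snd measurable_compose[OF measurable_fst idm])
  from measurable_compose[OF this vp] have vsw: "(\<lambda>(\<omega>, t). ennreal ((v t \<omega>)\<^sup>2)) \<in> borel_measurable (M \<Otimes>\<^sub>M leb T)"
    by (simp add: case_prod_beta')
  interpret L: finite_measure "leb T" by (rule finite_measure_leb)
  have nm: "(\<lambda>\<omega>. \<integral>\<^sup>+ t. ennreal ((v t \<omega>)\<^sup>2) \<partial>leb T) \<in> borel_measurable M"
    by (rule L.borel_measurable_nn_integral[OF vsw])
  have "(\<integral>\<^sup>+ \<omega>. (\<integral>\<^sup>+ t. ennreal ((v t \<omega>)\<^sup>2) \<partial>leb T) \<partial>M) \<noteq> \<infinity>"
    using v by (simp add: is_rate_def nn_integral_restrict_space less_top)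
  from nn_integral_PInf_AE[OF nm this]
  have fin: "AE \<omega> in M. (\<integral>\<^sup>+ t. ennreal ((v t \<omega>)\<^sup>2) \<partial>leb T) \<noteq> \<infinity>" .
  have vQ: "AE \<omega> in M. \<forall>t\<in>{0..T}. Qeps \<epsilon> t \<omega> = (LINT s:{0..t}|lborel. v s \<omega>)" using v by (simp add: is_rate_def)
  have ae: "AE \<omega> in M. (LINT t:{0..T}|lborel. (v t \<omega>)\<^sup>2) = (LINT t:{0..T}|lborel. (u t \<omega>)\<^sup>2)"
    using fin vQ Qeps_eq_integral_AE AE_space
  proof eventually_elim
    case (elim \<omega>)
    have "integrable (leb T) (\<lambda>t. (v t \<omega>)\<^sup>2)"
      using vm[OF elim(4)] elim(1) by (intro integrableI_nonneg) (auto simp: less_top)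
    then have iv: "set_integrable lborel {0..T} (\<lambda>t. v t \<omega>)"
      by (intro set_integrable_of_square[OF vm[OF elim(4)]]) (simp add: integrable_leb)
    have "AE t in lborel. t \<in> {0..T} \<longrightarrow> v t \<omega> = u t \<omega>"
      by (rule AE_eq_if_integrals_eq[OF iv _ T_ge0]) (use elim(2,3) in auto)
    then have "AE t in leb T. v t \<omega> = u t \<omega>" by (subst AE_restrict_space_iff) auto
    then have "(\<integral>t. (v t \<omega>)\<^sup>2 \<partial>leb T) = (\<integral>t. (u t \<omega>)\<^sup>2 \<partial>leb T)"
      using vm[OF elim(4)] u_path_measurable[OF elim(4)] by (intro integral_cong_AE) (auto elim: eventually_mono)
    then show ?case by (simp add: integral_leb)
  qed
  have Bu0: "0 \<le> rate_bound" unfolding rate_bound_def using C_0_nonneg d_pos eps_pos PP_nonneg by (intro add_nonneg_nonneg mult_nonneg_nonneg) auto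
  show ?thesis
  proof (cases "integrable M (\<lambda>\<omega>. LINT t:{0..T}|lborel. (v t \<omega>)\<^sup>2)")
    case True
    then have "expectation (\<lambda>\<omega>. LINT t:{0..T}|lborel. (v t \<omega>)\<^sup>2) = expectation (\<lambda>\<omega>. LINT t:{0..T}|lborel. (u t \<omega>)\<^sup>2)"
      using u_square_integral(1) ae by (intro integral_cong_AE) auto
    then show ?thesis using u_square_integral(3) by (simp add: v_def)
  next
    \<comment> \<open>A nonintegrable function has integral zero by convention, so nonnegativity of
      \<open>rate_bound\<close> is enough.\<close>
    case False
    then show ?thesis using Bu0 by (simp add: v_def not_integrable_integral_eq)
  qed
qed

section \<open>Admissibility of the regularized strategy\<close>

lemma cadlag_adapted_indicator:
  assumes Q: "cadlag_adapted Q" and N: "N \<in> sets (F 0)"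
  shows "cadlag_adapted (\<lambda>t \<omega>. indicat_real N \<omega> * Q t \<omega>)"
  unfolding cadlag_adapted_def
proof (intro conjI ballI)
  fix t assume t: "t \<in> {0..T}"
  have "N \<in> sets (F t)" using N F_mono[of 0 t] t by auto
  then show "(\<lambda>\<omega>. indicat_real N \<omega> * Q t \<omega>) \<in> borel_measurable (F t)"
    using cadlag_adaptedD(1)[OF Q, of t] t by auto
next
  fix \<omega> assume "\<omega> \<in> space M"
  then show "cadlag_on T (\<lambda>t. indicat_real N \<omega> * Q t \<omega>)"
    by (intro cadlag_on_mult cadlag_on_const cadlag_adaptedD(3)[OF Q])
qed

text \<open>Paths of the regularized strategy may have infinite variation on a null set. In a semimartingale
  decomposition this part goes into the local martingale.\<close>

lemma null_martingale:
  assumes Q: "cadlag_adapted Q" and N: "N \<in> null_sets M"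
  shows "local_martingale (\<lambda>t \<omega>. indicat_real N \<omega> * Q t \<omega>)"
proof -
  let ?X = "\<lambda>t \<omega>. indicat_real N \<omega> * Q t \<omega>"
  have X: "cadlag_adapted ?X" using N null_sets_F0 by (intro cadlag_adapted_indicator Q) auto
  let ?Y = "\<lambda>t \<omega>. ?X (min t T) \<omega> - ?X 0 \<omega>"
  have ym: "?Y t \<in> borel_measurable (F t)" if "0 \<le> t" "t \<le> T" for t
    using cadlag_adaptedD(1)[OF X that] measurable_F_mono[OF cadlag_adaptedD(1)[OF X, of 0], of t] that
    by (auto simp: min_absorb1)
  have y0: "AE \<omega> in M. ?Y t \<omega> = 0" for t using AE_not_in[OF N] by eventually_elim simp
  have yM: "?Y t \<in> borel_measurable M" if "0 \<le> t" "t \<le> T" for t using measurable_F_M[OF ym[OF that]] that by auto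
  have "martingale ?Y"
    unfolding martingale_def
  proof (intro conjI ballI allI impI)
    fix t assume t: "t \<in> {0..T}"
    show "?Y t \<in> borel_measurable (F t)" using ym t by auto
    have "integrable M (\<lambda>\<omega>. 0 :: real)" by simp
    then show "integrable M (?Y t)"
      by (rule integrable_cong_AE_imp) (use yM[of t] t y0[of t] in \<open>auto elim: eventually_mono\<close>)
  next
    fix s t assume st: "0 \<le> s \<and> s \<le> t \<and> t \<le> T"
    interpret S: sigma_finite_subalgebra M "F s" using st by (intro sigma_finite_subalgebra_F) auto
    have "AE \<omega> in M. real_cond_exp M (F s) (?Y t) \<omega> = real_cond_exp M (F s) (\<lambda>_. 0) \<omega>"
      using y0[of t] yM[of t] st by (intro S.real_cond_exp_cong) auto
    moreover have "AE \<omega> in M. real_cond_exp M (F s) (\<lambda>_. 0) \<omega> = 0" by (rule S.real_cond_exp_F_meas) auto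
    ultimately show "AE \<omega> in M. real_cond_exp M (F s) (?Y t) \<omega> = ?Y s \<omega>"
      using y0[of s] by eventually_elim simp
  qed
  then have Y: "martingale (\<lambda>t \<omega>. ?X (min t T) \<omega> - ?X 0 \<omega>)" .
  have S: "{\<omega> \<in> space M. T \<le> t} \<in> sets (F t)" if "t \<in> {0..T}" for t
  proof -
    have "space M \<in> sets (F t)" using sets.top[of "F t"] unfolding space_F[OF that] .
    then show ?thesis by (cases "T \<le> t") auto
  qed
  \<comment> \<open>The constant sequence \<open>T\<close> localizes a process that is already a
    martingale.\<close>
  show ?thesis
    unfolding local_martingale_def
  proof (rule conjI[OF X], rule exI[of _ "\<lambda>_ _. T"], intro conjI allI ballI)
    show "{\<omega> \<in> space M. T \<le> t} \<in> sets (F t)" if "t \<in> {0..T}" for t by (rule S[OF that])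
  qed (use T_ge0 Y in simp_all)
qed

lemma Qeps_semimartingale: "semimartingale (Qeps \<epsilon>)"
proof -
  have "AE \<omega> in M. finite_variation_on T (\<lambda>t. Qeps \<epsilon> t \<omega>)"
    using Qeps_eq_integral_AE by eventually_elim (rule integral_finite_variation, auto)
  then obtain N where N: "{\<omega> \<in> space M. \<not> finite_variation_on T (\<lambda>t. Qeps \<epsilon> t \<omega>)} \<subseteq> N" "N \<in> null_sets M"
    unfolding eventually_ae_filter by blast
  \<comment> \<open>Null sets belong to \<open>F 0\<close>, so cutting along \<open>N\<close> keeps
    both parts adapted.\<close>
  have N0: "N \<in> sets (F 0)" "space M - N \<in> sets (F 0)"
    using N(2) null_sets_F0 sets.compl_sets[of N "F 0"] space_F[of 0] T_ge0 by auto
  have "finite_variation_on T (\<lambda>t. indicat_real (space M - N) \<omega> * Qeps \<epsilon> t \<omega>)" if "\<omega> \<in> space M" for \<omega>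
  proof (cases "\<omega> \<in> N")
    case True
    then show ?thesis by (auto simp: finite_variation_on_def intro!: exI[of _ 0])
  next
    case False
    then show ?thesis using N(1) that by auto
  qed
  moreover have "Qeps \<epsilon> t \<omega> = indicat_real N \<omega> * Qeps \<epsilon> t \<omega> + indicat_real (space M - N) \<omega> * Qeps \<epsilon> t \<omega>" if "\<omega> \<in> space M" for t \<omega>
    using that by (auto simp: indicator_def)
  ultimately show ?thesis
    unfolding semimartingale_def
    using Qeps_cadlag_adapted null_martingale[OF Qeps_cadlag_adapted N(2)] cadlag_adapted_indicator[OF Qeps_cadlag_adapted N0(2)]
    by (intro conjI exI[of _ "\<lambda>t \<omega>. indicat_real N \<omega> * Qeps \<epsilon> t \<omega>"]
        exI[of _ "\<lambda>t \<omega>. indicat_real (space M - N) \<omega> * Qeps \<epsilon> t \<omega>"]) auto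
qed

text \<open>The squared supremum is integrable because Cauchy-Schwarz bounds every squared value on
  a path by \<open>T\<close> times the energy of \<open>u\<close> on that path.\<close>

lemma Qeps_ac_strategies: "Qeps \<epsilon> \<in> ac_strategies"
proof -
  define G where "G \<omega> = (LINT t:{0..T}|lborel. (u t \<omega>)\<^sup>2)" for \<omega>
  have le: "AE \<omega> in M. (SUP t\<in>{0..T}. ennreal ((Qeps \<epsilon> t \<omega>)\<^sup>2)) \<le> ennreal (T * G \<omega>)"
    using Qeps_eq_integral_AE u_square_integral(2) AE_space
  proof eventually_elim
    case (elim \<omega>)
    show ?case
    proof (rule SUP_least)
      fix t assume t: "t \<in> {0..T}"
      have i: "set_integrable lborel {0..t} (\<lambda>t. u t \<omega>)" "set_integrable lborel {0..t} (\<lambda>t. (u t \<omega>)\<^sup>2)"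
        using elim t by (auto intro: set_integrable_subset[of lborel "{0..T}"])
      have "\<bar>LINT s:{0..t}|lborel. u s \<omega>\<bar> \<le> (LINT s:{0..t}|lborel. \<bar>u s \<omega>\<bar>)" using set_integral_norm_bound[OF i(1)] by simp
      then have "(LINT s:{0..t}|lborel. u s \<omega>)\<^sup>2 \<le> (LINT s:{0..t}|lborel. \<bar>u s \<omega>\<bar>)\<^sup>2"
        by (intro abs_le_square_iff[THEN iffD1]) (auto intro: order_trans[OF _ abs_ge_self])
      also have "\<dots> \<le> (t - 0) * (LINT s:{0..t}|lborel. (u s \<omega>)\<^sup>2)"
        using t i by (intro set_integral_abs_square_le) (auto simp: set_borel_measurable_def set_integrable_def)
      also have "\<dots> \<le> T * G \<omega>"
        unfolding G_def using t T_ge0 i(2)[unfolded set_integrable_def] elim(2)[unfolded set_integrable_def]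
        unfolding set_lebesgue_integral_def by (intro mult_mono integral_mono) (auto simp: indicator_def)
      finally show "ennreal ((Qeps \<epsilon> t \<omega>)\<^sup>2) \<le> ennreal (T * G \<omega>)" using elim(1) t by (auto intro: ennreal_leI)
    qed
  qed
  have "integrable M (\<lambda>\<omega>. T * G \<omega>)" unfolding G_def using u_square_integral(1) by simp
  moreover have "AE \<omega> in M. 0 \<le> T * G \<omega>" using T_ge0 by (intro AE_I2) (simp add: G_def set_lebesgue_integral_def)
  ultimately have "(\<integral>\<^sup>+ \<omega>. ennreal (T * G \<omega>) \<partial>M) < \<infinity>" by (subst nn_integral_eq_integral) auto
  with nn_integral_mono_AE[OF le] have "(\<integral>\<^sup>+ \<omega>. (SUP t\<in>{0..T}. ennreal ((Qeps \<epsilon> t \<omega>)\<^sup>2)) \<partial>M) < \<infinity>" by (rule le_less_trans)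
  moreover have "Qeps \<epsilon> T \<omega> = \<Xi> T \<omega>" for \<omega> using d_pos by (simp add: Qeps_def d_def[symmetric])
  ultimately have "Qeps \<epsilon> \<in> strategies" unfolding strategies_def using Qeps_semimartingale by simp
  then show ?thesis unfolding ac_strategies_def using is_rate_u by blast
qed

text \<open>In the last phase \<open>Qeps - Qopt = (\<Xi> - Qopt) - (T - t) * u\<close>. The first
  part is bounded by \<open>K_0\<close> over a time of length \<open>d\<close>; in the second,
  \<open>(T - t)\<^sup>2 \<le> \<epsilon>\<close> reduces the distance to the estimate of the
  rate.\<close>

lemma Qeps_error:
  "expectation (\<lambda>\<omega>. LINT t:{0..T}|lborel. (Qeps \<epsilon> t \<omega> - Qopt t \<omega>)\<^sup>2)
    \<le> 1 * ((2 * C_0 + 2 * tau) * d) + (2 * enn2real K_0 + 4 * PP) * d + 4 * \<epsilon> * \<Lambda>" (is "_ \<le> ?B")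
proof -
  interpret P: pair_sigma_finite "leb T" M by (rule pair_leb)
  have Q: "supL2 (Qeps \<epsilon>)" using strategiesD(2)[of "Qeps \<epsilon>"] Qeps_ac_strategies by (simp add: ac_strategies_def)
  have D: "supL2 (\<lambda>t \<omega>. Qeps \<epsilon> t \<omega> - Qopt t \<omega>)" by (rule supL2_diff[OF Q Qopt_supL2])
  have i: "integrable (leb T \<Otimes>\<^sub>M M) (\<lambda>(t, \<omega>). (Qeps \<epsilon> t \<omega> - Qopt t \<omega>)\<^sup>2)" using supL2_L2P[OF D] by (simp add: L2P_def)
  have "(\<integral>\<^sup>+ z. ennreal ((Qeps \<epsilon> (fst z) (snd z) - Qopt (fst z) (snd z))\<^sup>2) \<partial>(leb T \<Otimes>\<^sub>M M)) \<le> ennreal ?B"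
  proof (rule piecewise_nn_bound[OF supL2_measurable_pair[OF D]])
    show "(Qeps \<epsilon> t \<omega> - Qopt t \<omega>)\<^sup>2 \<le> 1 * (Qopt t \<omega> - Qbar \<epsilon> t \<omega>)\<^sup>2" if "t < a" for t \<omega>
      using that by (simp add: Qeps_le_a power2_commute)
    fix t assume t: "a \<le> t" "t < T"
    have t0: "0 \<le> t" "t \<le> T" using t a_bounds by auto
    have L: "L2 (\<lambda>\<omega>. \<Xi> t \<omega> - Qopt t \<omega>)" "L2 (\<lambda>\<omega>. - (T - t) * u t \<omega>)"
      using t0 by (auto intro!: L2_diff Xi_L2 Qopt_L2 L2_scale[of "u t" "- (T - t)", simplified] u_sq_late(1)[OF t])
    have LD: "L2 (\<lambda>\<omega>. Qeps \<epsilon> t \<omega> - Qopt t \<omega>)" by (rule supL2D(4)[OF D t0])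
    have "expectation (\<lambda>\<omega>. (Qeps \<epsilon> t \<omega> - Qopt t \<omega>)\<^sup>2) = expectation (\<lambda>\<omega>. ((\<Xi> t \<omega> - Qopt t \<omega>) + - (T - t) * u t \<omega>)\<^sup>2)"
    proof (intro Bochner_Integration.integral_cong refl)
      fix \<omega>
      have "(T - t) * u t \<omega> = \<Xi> t \<omega> - Qeps \<epsilon> t \<omega>" using t by (simp add: u_def)
      then have "Qeps \<epsilon> t \<omega> - Qopt t \<omega> = (\<Xi> t \<omega> - Qopt t \<omega>) + - ((T - t) * u t \<omega>)" by linarith
      then show "(Qeps \<epsilon> t \<omega> - Qopt t \<omega>)\<^sup>2 = ((\<Xi> t \<omega> - Qopt t \<omega>) + - (T - t) * u t \<omega>)\<^sup>2"
        by (simp only: mult_minus_left)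
    qed
    also have "\<dots> \<le> 2 * expectation (\<lambda>\<omega>. (\<Xi> t \<omega> - Qopt t \<omega>)\<^sup>2) + 2 * expectation (\<lambda>\<omega>. (- (T - t) * u t \<omega>)\<^sup>2)"
      by (rule L2_add(2)[OF L])
    also have "expectation (\<lambda>\<omega>. (\<Xi> t \<omega> - Qopt t \<omega>)\<^sup>2) \<le> enn2real K_0"
      using Qopt_Xi_le_K_0[OF t0(1) t(2)] by (simp add: power2_commute)
    also have "expectation (\<lambda>\<omega>. (- (T - t) * u t \<omega>)\<^sup>2) \<le> \<epsilon> * (2 * PP / \<epsilon> + 2 * \<psi> t)"
    proof -
      have "expectation (\<lambda>\<omega>. (- (T - t) * u t \<omega>)\<^sup>2) = (T - t)\<^sup>2 * expectation (\<lambda>\<omega>. (u t \<omega>)\<^sup>2)"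
        unfolding power_mult_distrib power2_minus by (rule integral_mult_right_zero)
      also have "\<dots> \<le> \<epsilon> * (2 * PP / \<epsilon> + 2 * \<psi> t)"
      proof (rule mult_mono[OF _ u_sq_late(2)[OF t]])
        have "(T - t)\<^sup>2 \<le> d\<^sup>2" using t by (intro power_mono) (auto simp: a_def)
        then show "(T - t)\<^sup>2 \<le> \<epsilon>" by (simp only: d_sq)
      qed (use eps_pos in simp_all)
      finally show ?thesis .
    qed
    also have "\<epsilon> * (2 * PP / \<epsilon> + 2 * \<psi> t) = 2 * PP + 2 * \<epsilon> * \<psi> t"
      using eps_pos by (simp add: field_simps)
    finally have "expectation (\<lambda>\<omega>. (Qeps \<epsilon> t \<omega> - Qopt t \<omega>)\<^sup>2) \<le> (2 * enn2real K_0 + 4 * PP) + 4 * \<epsilon> * \<psi> t" by simp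
    then show "(\<integral>\<^sup>+ \<omega>. ennreal ((Qeps \<epsilon> t \<omega> - Qopt t \<omega>)\<^sup>2) \<partial>M) \<le> ennreal ((2 * enn2real K_0 + 4 * PP) + 4 * \<epsilon> * \<psi> t)"
      unfolding nn_integral_square_eq[OF LD] by (rule ennreal_leI)
  qed (use eps_pos PP_nonneg in auto)
  then have "ennreal (integral\<^sup>L (leb T \<Otimes>\<^sub>M M) (\<lambda>(t, \<omega>). (Qeps \<epsilon> t \<omega> - Qopt t \<omega>)\<^sup>2)) \<le> ennreal ?B"
    using nn_integral_eq_integral[OF i] by (simp add: case_prod_beta' del: ennreal_plus)
  moreover have "0 \<le> ?B" using C_0_nonneg d_pos eps_pos PP_nonneg by (intro add_nonneg_nonneg mult_nonneg_nonneg) auto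
  ultimately have "integral\<^sup>L (leb T \<Otimes>\<^sub>M M) (\<lambda>(t, \<omega>). (Qeps \<epsilon> t \<omega> - Qopt t \<omega>)\<^sup>2) \<le> ?B" by (simp only: ennreal_le_iff)
  moreover have "expectation (\<lambda>\<omega>. LINT t:{0..T}|lborel. (Qeps \<epsilon> t \<omega> - Qopt t \<omega>)\<^sup>2) = integral\<^sup>L (leb T \<Otimes>\<^sub>M M) (\<lambda>(t, \<omega>). (Qeps \<epsilon> t \<omega> - Qopt t \<omega>)\<^sup>2)"
    using P.integral_snd[OF i] by (simp add: integral_leb)
  ultimately show ?thesis by simp
qed

text \<open>Per unit of \<open>d\<close> the distance costs
  \<open>2 * C_0 + 2 * tau + 10 * K_0 + 8 * x2\<close> and the rate
  \<open>2 * C_0 + 2 * tau + 4 * K_0 + 4 * x2\<close>; in \<open>C_tr\<close> the respective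
  coefficients are \<open>2\<close>, \<open>4\<close>, \<open>16\<close> and \<open>20\<close>. The
  terms in \<open>\<Lambda> * \<epsilon>\<close> have the coefficients \<open>4\<close> and
  \<open>2\<close>.\<close>

lemma total_bounds:
  shows "1 * ((2 * C_0 + 2 * tau) * d) + (2 * enn2real K_0 + 4 * PP) * d + 4 * \<epsilon> * \<Lambda> \<le> C_tr * sqrt \<epsilon> + 4 * \<Lambda> * \<epsilon>"
    and "\<epsilon> * rate_bound \<le> C_tr * sqrt \<epsilon> + 4 * \<Lambda> * \<epsilon>"
proof -
  have nn: "0 \<le> tau * d" "0 \<le> enn2real K_0 * d" "0 \<le> x2 * d" "0 \<le> C_0 * d" "0 \<le> \<Lambda> * \<epsilon>"
    using d_pos C_0_nonneg eps_pos by auto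
  have C: "C_tr * sqrt \<epsilon> = 2 * (C_0 * d) + 4 * (tau * d) + 16 * (enn2real K_0 * d) + 20 * (x2 * d)"
    by (simp add: C_tr_def d_def algebra_simps)
  show "1 * ((2 * C_0 + 2 * tau) * d) + (2 * enn2real K_0 + 4 * PP) * d + 4 * \<epsilon> * \<Lambda> \<le> C_tr * sqrt \<epsilon> + 4 * \<Lambda> * \<epsilon>"
    unfolding C using nn by (simp add: algebra_simps)
  have "\<epsilon> * rate_bound = (2 * C_0 + 2 * tau) * d + 2 * PP * d + 2 * (\<Lambda> * \<epsilon>)"
    using eps_pos by (simp add: rate_bound_def distrib_left)
  then show "\<epsilon> * rate_bound \<le> C_tr * sqrt \<epsilon> + 4 * \<Lambda> * \<epsilon>"
    unfolding C using nn by (simp add: algebra_simps)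
qed

end

context execution_problem
begin

section \<open>Comparison of the value functions\<close>

lemma J0_lower: "- (y\<^sup>2 / (2 * lam 0)) \<le> J0 Q"
proof -
  have "0 \<le> inner_H (state Q) (state Q)"
    unfolding inner_H_path_form by (intro integral_nonneg_AE AE_I2 path_form_square_nonneg)
  then show ?thesis by (simp add: J0_def)
qed

lemma J0_le_J: "0 \<le> \<epsilon> \<Longrightarrow> J0 Q \<le> J \<epsilon> Q"
  unfolding J_def set_lebesgue_integral_def
  by (simp add: mult_nonneg_nonneg integral_nonneg_AE)

lemma main_bounds:
  assumes e: "0 < \<epsilon>" "\<epsilon> \<le> T\<^sup>2 / 4" and fin: "Lambda_Xi < \<infinity>"
  defines "B \<equiv> C_tr * sqrt \<epsilon> + 4 * enn2real Lambda_Xi * \<epsilon>"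
  shows "Qeps \<epsilon> \<in> ac_strategies" "0 \<le> J0 (Qeps \<epsilon>) - J0 Qopt" "J0 (Qeps \<epsilon>) - J0 Qopt \<le> C_J * B"
    "0 \<le> J \<epsilon> (Qeps \<epsilon>) - V0" "J \<epsilon> (Qeps \<epsilon>) - V0 \<le> (1 + C_J) * B"
    "0 \<le> V \<epsilon> - V0" "V \<epsilon> - V0 \<le> (1 + C_J) * B"
proof -
  interpret smoothing M F T bet lam lamdot y \<Xi> \<epsilon> by unfold_locales (rule e fin)+
  show Q: "Qeps \<epsilon> \<in> ac_strategies" by (rule Qeps_ac_strategies)
  then have Qs: "Qeps \<epsilon> \<in> strategies" by (simp add: ac_strategies_def)
  show "0 \<le> J0 (Qeps \<epsilon>) - J0 Qopt" by (rule J0_gap(1)[OF strategiesD[OF Qs]])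
  have "J0 (Qeps \<epsilon>) - J0 Qopt \<le> C_J * expectation (\<lambda>\<omega>. LINT t:{0..T}|lborel. (Qeps \<epsilon> t \<omega> - Qopt t \<omega>)\<^sup>2)"
    by (rule J0_gap(2)[OF strategiesD[OF Qs]])
  also have "\<dots> \<le> C_J * B"
    unfolding B_def by (intro mult_left_mono order_trans[OF Qeps_error total_bounds(1)] C_J_nonneg)
  finally show gap: "J0 (Qeps \<epsilon>) - J0 Qopt \<le> C_J * B" .
  \<comment> \<open>A real infimum lies below the members of the set only if the set is bounded
    below; nonnegativity of the quadratic form supplies this.\<close>
  have bdd0: "bdd_below (J0 ` strategies)" using J0_lower by (intro bdd_belowI2)
  have bdd: "bdd_below (J \<epsilon> ` ac_strategies)"
    using J0_lower J0_le_J e by (intro bdd_belowI2[of _ "- (y\<^sup>2 / (2 * lam 0))"]) (meson less_imp_le order_trans)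
  have V0_le: "V0 \<le> J \<epsilon> P" if "P \<in> ac_strategies" for P
  proof -
    have "V0 \<le> J0 P" unfolding V0_def using that by (intro cINF_lower bdd0) (simp add: ac_strategies_def)
    also have "\<dots> \<le> J \<epsilon> P" using e by (intro J0_le_J) simp
    finally show ?thesis .
  qed
  \<comment> \<open>No strategy is cheaper than \<open>Qopt\<close>, so the bound on the gap to
    \<open>Qopt\<close> also bounds the gap to \<open>V0\<close>.\<close>
  have opt: "J0 Qopt \<le> V0"
    unfolding V0_def
  proof (rule cINF_greatest)
    show "strategies \<noteq> {}" using Qs by blast
    show "J0 Qopt \<le> J0 P" if "P \<in> strategies" for P using J0_gap(1)[OF strategiesD[OF that]] by simp
  qed
  show "0 \<le> J \<epsilon> (Qeps \<epsilon>) - V0" using V0_le[OF Q] by simp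
  have "\<epsilon> * expectation (\<lambda>\<omega>. LINT t:{0..T}|lborel. (rate (Qeps \<epsilon>) t \<omega>)\<^sup>2) \<le> \<epsilon> * rate_bound"
    using rate_energy e by (intro mult_left_mono) auto
  also have "\<dots> \<le> B" unfolding B_def by (rule total_bounds(2))
  finally show J: "J \<epsilon> (Qeps \<epsilon>) - V0 \<le> (1 + C_J) * B" using gap opt by (simp add: J_def algebra_simps)
  show "0 \<le> V \<epsilon> - V0"
  proof -
    have "V0 \<le> V \<epsilon>" unfolding V_def using Q V0_le by (intro cINF_greatest) auto
    then show ?thesis by simp
  qed
  have "V \<epsilon> \<le> J \<epsilon> (Qeps \<epsilon>)" unfolding V_def by (rule cINF_lower[OF bdd Q])
  then show "V \<epsilon> - V0 \<le> (1 + C_J) * B" using J by simp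
qed

lemma value_gap_bigo:
  assumes fin: "Lambda_Xi < \<infinity>"
  shows "(\<lambda>\<epsilon>. V \<epsilon> - V0) \<in> O[at_right 0](sqrt)"
proof (rule bigoI)
  define L where "L = enn2real Lambda_Xi"
  have "eventually (\<lambda>\<epsilon>. 0 < \<epsilon> \<and> \<epsilon> \<le> T\<^sup>2 / 4) (at_right 0)"
    unfolding eventually_at_right_field using T_pos by (intro exI[of _ "T\<^sup>2 / 4"]) auto
  then show "eventually (\<lambda>\<epsilon>. norm (V \<epsilon> - V0) \<le> (1 + C_J) * (C_tr + 4 * L * (T / 2)) * norm (sqrt \<epsilon>)) (at_right 0)"
  proof eventually_elim
    case (elim \<epsilon>)
    have b: "0 \<le> V \<epsilon> - V0" "V \<epsilon> - V0 \<le> (1 + C_J) * (C_tr * sqrt \<epsilon> + 4 * L * \<epsilon>)"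
      using main_bounds(6,7)[OF _ _ fin] elim by (auto simp: L_def)
    \<comment> \<open>In this range \<open>\<epsilon>\<close> is at most \<open>T / 2\<close> times
      \<open>sqrt \<epsilon>\<close>, so the linear term is absorbed.\<close>
    have "sqrt \<epsilon> \<le> sqrt ((T / 2)\<^sup>2)" using elim by (intro real_sqrt_le_mono) (simp add: power_divide)
    then have "sqrt \<epsilon> \<le> T / 2" using T_pos by simp
    then have "sqrt \<epsilon> * sqrt \<epsilon> \<le> T / 2 * sqrt \<epsilon>" using elim by (intro mult_right_mono) auto
    then have "\<epsilon> \<le> T / 2 * sqrt \<epsilon>" using elim by simp
    then have "4 * L * \<epsilon> \<le> 4 * L * (T / 2 * sqrt \<epsilon>)" by (intro mult_left_mono) (auto simp: L_def)
    then have "C_tr * sqrt \<epsilon> + 4 * L * \<epsilon> \<le> (C_tr + 4 * L * (T / 2)) * sqrt \<epsilon>" by (simp add: algebra_simps)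
    then have "(1 + C_J) * (C_tr * sqrt \<epsilon> + 4 * L * \<epsilon>) \<le> (1 + C_J) * ((C_tr + 4 * L * (T / 2)) * sqrt \<epsilon>)"
      using C_J_nonneg by (intro mult_left_mono) auto
    then show ?case using b elim by (simp add: mult.assoc)
  qed
qed

end

theorem theorem5p7:
  fixes M :: "'a measure" and F :: "real \<Rightarrow> 'a measure" and T y :: real
    and bet lam lamdot :: "real \<Rightarrow> real" and \<Xi> :: "real \<Rightarrow> 'a \<Rightarrow> real"
  assumes setting: "execution_problem M F T bet lam lamdot \<Xi>"
    and Lambda_finite: "execution_problem.Lambda_Xi M T \<Xi> < \<infinity>"
  shows
    "let Qac = execution_problem.ac_strategies M F T \<Xi>;
         J0 = execution_problem.J0 M F T bet lam lamdot y;
         J = execution_problem.J M F T bet lam lamdot y;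
         V0 = execution_problem.V0 M F T bet lam lamdot y \<Xi>;
         V = execution_problem.V M F T bet lam lamdot y \<Xi>;
         Q0 = execution_problem.Qopt M F T bet lam lamdot y \<Xi>;
         Qeps = execution_problem.Qeps M F T bet lam lamdot y \<Xi>;
         C_J = execution_problem.C_J T bet lam lamdot;
         C_tr = execution_problem.C_tr M F T bet lam lamdot y \<Xi>;
         \<Lambda> = enn2real (execution_problem.Lambda_Xi M T \<Xi>)
     in (\<forall>\<epsilon>. 0 < \<epsilon> \<and> \<epsilon> \<le> T\<^sup>2 / 4 \<longrightarrow>
           Qeps \<epsilon> \<in> Qac \<and>
           0 \<le> J0 (Qeps \<epsilon>) - J0 Q0 \<and>
           J0 (Qeps \<epsilon>) - J0 Q0 \<le> C_J * (C_tr * sqrt \<epsilon> + 4 * \<Lambda> * \<epsilon>) \<and>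
           0 \<le> J \<epsilon> (Qeps \<epsilon>) - V0 \<and>
           J \<epsilon> (Qeps \<epsilon>) - V0 \<le> (1 + C_J) * (C_tr * sqrt \<epsilon> + 4 * \<Lambda> * \<epsilon>) \<and>
           0 \<le> V \<epsilon> - V0 \<and>
           V \<epsilon> - V0 \<le> (1 + C_J) * (C_tr * sqrt \<epsilon> + 4 * \<Lambda> * \<epsilon>)) \<and>
        (\<lambda>\<epsilon>. V \<epsilon> - V0) \<in> O[at_right 0](sqrt)"
proof -
  interpret execution_problem M F T bet lam lamdot y \<Xi> by (rule setting)
  show ?thesis
    unfolding Let_def using main_bounds[OF _ _ Lambda_finite] value_gap_bigo[OF Lambda_finite] by blast
qed

end
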